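(* Assume that $\mathbb{L}$ and $\mathbb{G}^\Omega$ satisfy (L1), (L2), (L3), (L4), (G1), (G2), (G3), and that $(q,\gamma)\in\mathbb{E}$. Then there exists a unique weak-dual solution $u_*$ of the problem $$\mathbb{L}u=\frac{1}{u^q}\ \text{ in }\Omega,\qquad u>0\ \text{ in }\Omega,\qquad u=0\ \text{ on }\partial\Omega\text{ or in }\Omega^c\text{ if applicable}.$$ That is, there is exactly one positive function $u_*$ with $u_*\in L^1_0(\Omega,\delta^\gamma)$, $u_*^{-q}\in L^1(\Omega,\delta^\gamma)$ and $$\int_\Omega u_*\,\xi\,dx=\int_\Omega \frac{1}{u_*^q}\,\mathbb{G}^\Omega[\xi]\,dx\qquad\text{for all }\xi\in\delta^\gamma L^\infty(\Omega).$$
   Context: Setting. $N\ge 2$; $\Omega\subset\mathbb{R}^N$ is a $C^2$ bounded domain; $\delta(x)=\operatorname{dist}(x,\mathbb{R}^N\setminus\Omega)$; $s,\gamma\in(0,1]$ with $N>2s$. $f\asymp g$ means that there is $C>0$ with $C^{-1}g\le f\le Cg$; $a\wedge b=\min\{a,b\}$. $L^1(\Omega,\delta^\gamma)$ is the space of Borel measurable $f:\Omega\to\mathbb{R}$ with $\int_\Omega|f|\delta^\gamma dx<\infty$; $L^1_0(\Omega,\delta^\gamma)$ consists of those $f\in L^1(\Omega,\delta^\gamma)$ set equal to $0$ on $\partial\Omega$ (or in $\Omega^c$ if applicable), i.e. functions on $\Omega$ regarded as extended by zero. $\delta^\gamma L^\infty(\Omega)=\{\delta^\gamma v: v\in L^\infty(\Omega)\}$.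 For $0<s<1$, $H^s_{00}(\Omega)=\{u\in H^s(\Omega):u/\delta^s\in L^2(\Omega)\}$, where $H^s(\Omega)$ is the usual fractional Sobolev space; for $s=1$ read $H^1_0(\Omega)$. Assumptions on the linear operator $\mathbb{L}$: (L1) $\mathbb{L}:C_c^\infty(\Omega)\subset L^2(\Omega)\to L^2(\Omega)$ is positive and symmetric. Its Friedrichs extension is still denoted $\mathbb{L}$; $\mathbb{H}(\Omega):=\operatorname{Dom}(\mathbb{L}^{1/2})$. (L2) There is $\Lambda_0>0$ with $\|u\|_{L^2(\Omega)}^2\le\Lambda_0\langle\mathbb{L}u,u\rangle_{L^2(\Omega)}$ for all $u\in C_c^\infty(\Omega)$. Then $\mathbb{H}(\Omega)$ is a Hilbert space with inner product $\langle u,v\rangle_{\mathbb{H}(\Omega)}:=\langle\mathbb{L}^{1/2}u,\mathbb{L}^{1/2}v\rangle_{L^2(\Omega)}$. (L3) $\mathbb{H}(\Omega)=H^s_{00}(\Omega)$. (L4) For all $u,v\in\mathbb{H}(\Omega)\cap L^\infty(\Omega)$ with $v\ge0$ and every convex $p\in C^{1,1}(\mathbb{R})$ with $p(0)=p'(0)=0$: $\langle p(u),v\rangle_{\mathbb{H}(\Omega)}\le\langle u,p'(u)v\rangle_{\mathbb{H}(\Omega)}$. Assumptions on the inverse: (G1) There is an operator $\mathbb{G}^\Omega$ such that for every $f\in C_c^\infty(\Omega)$, $\mathbb{G}^\Omega[f]\in\operatorname{Dom}(\mathbb{L})\subset\mathbb{H}(\Omega)$ and $\mathbb{L}[\mathbb{G}^\Omega[f]]=f$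 a.e. in $\Omega$. (G2) $\mathbb{G}^\Omega[f](x)=\int_\Omega G^\Omega(x,y)f(y)\,dy$, $x\in\Omega$, where $G^\Omega:\{(x,y)\in\Omega\times\Omega:x\ne y\}\to\mathbb{R}^+$ is Borel measurable, symmetric and $$G^\Omega(x,y)\asymp\frac{1}{|x-y|^{N-2s}}\Big(\frac{\delta(x)}{|x-y|}\wedge1\Big)^\gamma\Big(\frac{\delta(y)}{|x-y|}\wedge1\Big)^\gamma,\quad x\neq y.$$ (G3) If $x\in\Omega$, $(x_n)\subset\Omega$ and $x_n\to x$, then $G^\Omega(x_n,y)\to G^\Omega(x,y)$ for a.e. $y\in\Omega$, $y\ne x$. Exponents. $q^*_{s,\gamma}:=\frac{2s}{\gamma}-1$; $q^{**}_{s,\gamma}:=+\infty$ if $\gamma\ge2s-1$ and $q^{**}_{s,\gamma}:=\frac{\gamma+1}{2s-\gamma-1}$ if $\gamma<2s-1$. $(q,\gamma)\in\mathbb{E}$ means: $q>0$, $0<\gamma<2s$, and either ($0<q<q^*_{s,\gamma}$ and $\gamma\ge s-\frac12$) or ($q\in[q^*_{s,\gamma},q^{**}_{s,\gamma})$ and $\gamma>s-\frac12$). *)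

theory Defs
  imports "HOL-Analysis.Analysis"
begin

primrec C_k :: "nat \<Rightarrow> ('a::euclidean_space \<Rightarrow> real) \<Rightarrow> bool" where
  "C_k 0 f \<longleftrightarrow> continuous_on UNIV f"
| "C_k (Suc k) f \<longleftrightarrow> (\<forall>x. f differentiable at x) \<and> (\<forall>v. C_k k (\<lambda>x. frechet_derivative f (at x) v))"

definition test_functions :: "'a::euclidean_space set \<Rightarrow> ('a \<Rightarrow> real) set" where
  "test_functions \<Omega> = {f. (\<forall>k. C_k k f) \<and> compact (closure {x. f x \<noteq> 0}) \<and> closure {x. f x \<noteq> 0} \<subseteq> \<Omega>}"

text \<open>Near each boundary point, after a rotation of the axes taking the last coordinate direction
  to \<open>e\<close>, the domain is the strict epigraph of a \<open>C\<^sup>2\<close> function \<open>\<phi>\<close> of the remaining coordinates;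
  \<open>\<phi>\<close> is only evaluated on the hyperplane orthogonal to \<open>e\<close>.\<close>

definition C2_bounded_domain :: "'a::euclidean_space set \<Rightarrow> bool" where
  "C2_bounded_domain \<Omega> \<longleftrightarrow> open \<Omega> \<and> connected \<Omega> \<and> bounded \<Omega> \<and> \<Omega> \<noteq> {} \<and>
     (\<forall>z\<in>frontier \<Omega>. \<exists>r>0. \<exists>e \<phi>. norm e = 1 \<and> C_k 2 \<phi> \<and>
        \<Omega> \<inter> ball z r = {x \<in> ball z r. x \<bullet> e > \<phi> (x - (x \<bullet> e) *\<^sub>R e)})"

definition bdist :: "'a::euclidean_space set \<Rightarrow> 'a \<Rightarrow> real" where
  "bdist \<Omega> x = infdist x (- \<Omega>)"

text \<open>Elements of function spaces are Borel representatives, defined on the whole space; spaces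
  over \<open>\<Omega>\<close> do not depend on the values outside \<open>\<Omega>\<close>, except where stated.\<close>

abbreviation borel_on :: "'a::euclidean_space set \<Rightarrow> 'a measure" where
  "borel_on \<Omega> \<equiv> restrict_space lborel \<Omega>"

definition L2 :: "'a measure \<Rightarrow> ('a \<Rightarrow> real) set" where
  "L2 M = {f \<in> borel_measurable M. integrable M (\<lambda>x. (f x)\<^sup>2)}"

definition l2_inner :: "'a measure \<Rightarrow> ('a \<Rightarrow> real) \<Rightarrow> ('a \<Rightarrow> real) \<Rightarrow> real" where
  "l2_inner M f g = (\<integral>x. f x * g x \<partial>M)"

definition l2_norm :: "'a measure \<Rightarrow> ('a \<Rightarrow> real) \<Rightarrow> real" where
  "l2_norm M f = sqrt (l2_inner M f f)"

definition L_infinity :: "'a measure \<Rightarrow> ('a \<Rightarrow> real) set" where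
  "L_infinity M = {f \<in> borel_measurable M. \<exists>C. AE x in M. \<bar>f x\<bar> \<le> C}"

definition L1_weighted :: "'a::euclidean_space set \<Rightarrow> real \<Rightarrow> ('a \<Rightarrow> real) set" where
  "L1_weighted \<Omega> \<gamma> = {f \<in> borel_measurable (borel_on \<Omega>).
     integrable (borel_on \<Omega>) (\<lambda>x. \<bar>f x\<bar> * bdist \<Omega> x powr \<gamma>)}"

definition L1_weighted_0 :: "'a::euclidean_space set \<Rightarrow> real \<Rightarrow> ('a \<Rightarrow> real) set" where
  "L1_weighted_0 \<Omega> \<gamma> = {f \<in> L1_weighted \<Omega> \<gamma>. \<forall>x. x \<notin> \<Omega> \<longrightarrow> f x = 0}"

definition weighted_L_infinity :: "'a::euclidean_space set \<Rightarrow> real \<Rightarrow> ('a \<Rightarrow> real) set" where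
  "weighted_L_infinity \<Omega> \<gamma> =
     {\<xi>. \<exists>v\<in>L_infinity (borel_on \<Omega>). \<forall>x\<in>\<Omega>. \<xi> x = bdist \<Omega> x powr \<gamma> * v x}"

definition frac_Sobolev :: "'a::euclidean_space set \<Rightarrow> real \<Rightarrow> ('a \<Rightarrow> real) set" where
  "frac_Sobolev \<Omega> s = {u \<in> L2 (borel_on \<Omega>).
     integrable (borel_on \<Omega> \<Otimes>\<^sub>M borel_on \<Omega>)
       (\<lambda>(x, y). (u x - u y)\<^sup>2 / norm (x - y) powr (real DIM('a) + 2 * s))}"

definition weak_partial ::
  "'a::euclidean_space set \<Rightarrow> 'a \<Rightarrow> ('a \<Rightarrow> real) \<Rightarrow> ('a \<Rightarrow> real) \<Rightarrow> bool" where
  "weak_partial \<Omega> i u g \<longleftrightarrow> (\<forall>\<phi>\<in>test_functions \<Omega>.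
     (\<integral>x. u x * frechet_derivative \<phi> (at x) i \<partial>borel_on \<Omega>) = - (\<integral>x. g x * \<phi> x \<partial>borel_on \<Omega>))"

definition Sobolev_H1 :: "'a::euclidean_space set \<Rightarrow> ('a \<Rightarrow> real) set" where
  "Sobolev_H1 \<Omega> = {u \<in> L2 (borel_on \<Omega>). \<forall>i\<in>Basis. \<exists>g\<in>L2 (borel_on \<Omega>). weak_partial \<Omega> i u g}"

text \<open>The closure of the test functions in the \<open>H\<^sup>1\<close> norm.\<close>

definition Sobolev_H10 :: "'a::euclidean_space set \<Rightarrow> ('a \<Rightarrow> real) set" where
  "Sobolev_H10 \<Omega> = {u \<in> Sobolev_H1 \<Omega>. \<exists>us. (\<forall>n. us n \<in> test_functions \<Omega>) \<and>
     (\<lambda>n. l2_norm (borel_on \<Omega>) (\<lambda>x. us n x - u x)) \<longlonglongrightarrow> 0 \<and>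
     (\<forall>i\<in>Basis. \<forall>g\<in>L2 (borel_on \<Omega>). weak_partial \<Omega> i u g \<longrightarrow>
        (\<lambda>n. l2_norm (borel_on \<Omega>) (\<lambda>x. frechet_derivative (us n) (at x) i - g x)) \<longlonglongrightarrow> 0)}"

definition H00 :: "'a::euclidean_space set \<Rightarrow> real \<Rightarrow> ('a \<Rightarrow> real) set" where
  "H00 \<Omega> s = (if s < 1
     then {u \<in> frac_Sobolev \<Omega> s. (\<lambda>x. u x / bdist \<Omega> x powr s) \<in> L2 (borel_on \<Omega>)}
     else Sobolev_H10 \<Omega>)"

definition positive_symmetric ::
  "'a measure \<Rightarrow> ('a \<Rightarrow> real) set \<Rightarrow> (('a \<Rightarrow> real) \<Rightarrow> ('a \<Rightarrow> real)) \<Rightarrow> bool" where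
  "positive_symmetric M D L \<longleftrightarrow>
     (\<forall>u\<in>D. L u \<in> L2 M) \<and>
     (\<forall>u\<in>D. \<forall>v\<in>D. \<forall>a b. AE x in M. L (\<lambda>x. a * u x + b * v x) x = a * L u x + b * L v x) \<and>
     (\<forall>u\<in>D. l2_inner M (L u) u \<ge> 0) \<and>
     (\<forall>u\<in>D. \<forall>v\<in>D. l2_inner M (L u) v = l2_inner M u (L v))"

text \<open>The Friedrichs extension: close the quadratic form \<open>(u, v) \<mapsto> \<langle>L u, v\<rangle>\<close> on \<open>D\<close>, then take the
  operator associated with the closed form. The sequences \<open>us\<close> in \<open>form_approx\<close> converge to \<open>u\<close> in
  \<open>L\<^sup>2\<close> and are Cauchy in the form norm.\<close>

definition form_approx :: "'a measure \<Rightarrow> ('a \<Rightarrow> real) set \<Rightarrow> (('a \<Rightarrow> real) \<Rightarrow> ('a \<Rightarrow> real)) \<Rightarrow>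
    ('a \<Rightarrow> real) \<Rightarrow> (nat \<Rightarrow> 'a \<Rightarrow> real) \<Rightarrow> bool" where
  "form_approx M D L u us \<longleftrightarrow> (\<forall>n. us n \<in> D) \<and>
     (\<lambda>n. l2_norm M (\<lambda>x. us n x - u x)) \<longlonglongrightarrow> 0 \<and>
     (\<forall>e>0. \<exists>N. \<forall>m\<ge>N. \<forall>n\<ge>N.
        l2_inner M (L (\<lambda>x. us m x - us n x)) (\<lambda>x. us m x - us n x) < e)"

definition form_domain ::
  "'a measure \<Rightarrow> ('a \<Rightarrow> real) set \<Rightarrow> (('a \<Rightarrow> real) \<Rightarrow> ('a \<Rightarrow> real)) \<Rightarrow> ('a \<Rightarrow> real) set" where
  "form_domain M D L = {u \<in> L2 M. \<exists>us. form_approx M D L u us}"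

definition closed_form :: "'a measure \<Rightarrow> ('a \<Rightarrow> real) set \<Rightarrow> (('a \<Rightarrow> real) \<Rightarrow> ('a \<Rightarrow> real)) \<Rightarrow>
    ('a \<Rightarrow> real) \<Rightarrow> ('a \<Rightarrow> real) \<Rightarrow> real" where
  "closed_form M D L u v = (THE c. \<forall>us vs. form_approx M D L u us \<and> form_approx M D L v vs \<longrightarrow>
     (\<lambda>n. l2_inner M (L (us n)) (vs n)) \<longlonglongrightarrow> c)"

text \<open>From here on an operator is represented by its graph, which is closed under modification of
  either component on null sets; thus \<open>(u, f) \<in> A\<close> says that \<open>u\<close> lies in the domain of \<open>A\<close> and
  that \<open>A u = f\<close> almost everywhere.\<close>

definition friedrichs_extension :: "'a measure \<Rightarrow> ('a \<Rightarrow> real) set \<Rightarrow>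
    (('a \<Rightarrow> real) \<Rightarrow> ('a \<Rightarrow> real)) \<Rightarrow> (('a \<Rightarrow> real) \<times> ('a \<Rightarrow> real)) set" where
  "friedrichs_extension M D L = {(u, f). u \<in> form_domain M D L \<and> f \<in> L2 M \<and>
     (\<forall>v\<in>form_domain M D L. closed_form M D L u v = l2_inner M f v)}"

definition adjoint_graph ::
  "'a measure \<Rightarrow> (('a \<Rightarrow> real) \<times> ('a \<Rightarrow> real)) set \<Rightarrow> (('a \<Rightarrow> real) \<times> ('a \<Rightarrow> real)) set" where
  "adjoint_graph M T = {(v, g). v \<in> L2 M \<and> g \<in> L2 M \<and>
     (\<forall>(u, f)\<in>T. l2_inner M f v = l2_inner M u g)}"

definition self_adjoint :: "'a measure \<Rightarrow> (('a \<Rightarrow> real) \<times> ('a \<Rightarrow> real)) set \<Rightarrow> bool" where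
  "self_adjoint M T \<longleftrightarrow>
     (\<forall>f\<in>L2 M. \<forall>e>0. \<exists>u\<in>Domain T. l2_norm M (\<lambda>x. f x - u x) < e) \<and> adjoint_graph M T = T"

text \<open>The positive self-adjoint square root of a positive self-adjoint operator; it exists and is
  unique, so \<open>T\<close> is determined by \<open>A\<close>.\<close>

definition is_sqrt_op :: "'a measure \<Rightarrow> (('a \<Rightarrow> real) \<times> ('a \<Rightarrow> real)) set \<Rightarrow>
    (('a \<Rightarrow> real) \<times> ('a \<Rightarrow> real)) set \<Rightarrow> bool" where
  "is_sqrt_op M T A \<longleftrightarrow>
     self_adjoint M T \<and> (\<forall>(u, f)\<in>T. l2_inner M f u \<ge> 0) \<and> T O T = A"

definition op_apply :: "(('a \<Rightarrow> real) \<times> ('a \<Rightarrow> real)) set \<Rightarrow> ('a \<Rightarrow> real) \<Rightarrow> ('a \<Rightarrow> real)" where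
  "op_apply T u = (SOME f. (u, f) \<in> T)"

text \<open>The inner product of \<open>\<bbbH>(\<Omega>) = Domain T\<close>, where \<open>T\<close> is the square root of the operator.\<close>

definition energy_inner :: "'a measure \<Rightarrow> (('a \<Rightarrow> real) \<times> ('a \<Rightarrow> real)) set \<Rightarrow>
    ('a \<Rightarrow> real) \<Rightarrow> ('a \<Rightarrow> real) \<Rightarrow> real" where
  "energy_inner M T u v = l2_inner M (op_apply T u) (op_apply T v)"

definition green_op ::
  "'a::euclidean_space set \<Rightarrow> ('a \<Rightarrow> 'a \<Rightarrow> real) \<Rightarrow> ('a \<Rightarrow> real) \<Rightarrow> 'a \<Rightarrow> real" where
  "green_op \<Omega> G f x = (\<integral>y. G x y * f y \<partial>borel_on \<Omega>)"

definition green_profile :: "'a::euclidean_space set \<Rightarrow> real \<Rightarrow> real \<Rightarrow> 'a \<Rightarrow> 'a \<Rightarrow> real" where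
  "green_profile \<Omega> s \<gamma> x y = 1 / norm (x - y) powr (real DIM('a) - 2 * s) *
     (min (bdist \<Omega> x / norm (x - y)) 1) powr \<gamma> *
     (min (bdist \<Omega> y / norm (x - y)) 1) powr \<gamma>"

definition q_star :: "real \<Rightarrow> real \<Rightarrow> real" where
  "q_star s \<gamma> = 2 * s / \<gamma> - 1"

definition q_star_star :: "real \<Rightarrow> real \<Rightarrow> ereal" where
  "q_star_star s \<gamma> = (if \<gamma> \<ge> 2 * s - 1 then \<infinity> else ereal ((\<gamma> + 1) / (2 * s - \<gamma> - 1)))"

definition admissible_exponents :: "real \<Rightarrow> real \<Rightarrow> real \<Rightarrow> bool" where
  "admissible_exponents s q \<gamma> \<longleftrightarrow> q > 0 \<and> 0 < \<gamma> \<and> \<gamma> < 2 * s \<and>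
     ((0 < q \<and> q < q_star s \<gamma> \<and> \<gamma> \<ge> s - 1 / 2) \<or>
      (q_star s \<gamma> \<le> q \<and> ereal q < q_star_star s \<gamma> \<and> \<gamma> > s - 1 / 2))"

definition weak_dual_solution ::
  "'a::euclidean_space set \<Rightarrow> real \<Rightarrow> ('a \<Rightarrow> 'a \<Rightarrow> real) \<Rightarrow> real \<Rightarrow> ('a \<Rightarrow> real) \<Rightarrow> bool" where
  "weak_dual_solution \<Omega> \<gamma> G q u \<longleftrightarrow>
     u \<in> L1_weighted_0 \<Omega> \<gamma> \<and> (\<forall>x\<in>\<Omega>. u x > 0) \<and>
     (\<lambda>x. 1 / u x powr q) \<in> L1_weighted \<Omega> \<gamma> \<and>
     (\<forall>\<xi>\<in>weighted_L_infinity \<Omega> \<gamma>.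
        (\<integral>x. u x * \<xi> x \<partial>borel_on \<Omega>) = (\<integral>x. 1 / u x powr q * green_op \<Omega> G \<xi> x \<partial>borel_on \<Omega>))"

end

(* Write G for the Green operator and d for the distance to the boundary. By duality, u is a weak-dual
   solution iff u = G[u^-q] almost everywhere. Everything rests on the Kato inequality
   |G f| <= G[f sgn (G f)] for f in L^1(d^gamma). It follows from (L4) with p(t) = ln (cosh (k t)) / k
   for test functions f, then by density, and then as k tends to infinity. It gives a comparison
   principle: if f <= 0 wherever G f >= 0, then G f <= 0. Uniqueness is immediate from it.

   For existence, u = G[(u + eps)^-q] is solved by the method of continuity: the Kato inequality makes
   the solution of u = G[r + t g(u)] Lipschitz in r, uniformly in t, when g is decreasing, so that t can
   be increased in steps of fixed length by the contraction principle. The solutions increase as eps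
   decreases, and it remains to dominate (u + eps)^-q in L^1(d^gamma). For q <= q* this is done by
   u >= c d^gamma. For q > q* put a = 2s/(q+1); then small multiples of G[(d^a + eps)^-q] are
   subsolutions, because G[d^(-aq)] <= C d^a, and hence u + eps >= c d^a. *)
theory Submission
  imports Defs
begin

section \<open>Smooth functions and density of test functions\<close>


text \<open>Assumption (L4) compares energies, the Kato inequality compares functions. They meet
  because the energy product with G[xi] is integration against xi: (L4) with v = G[xi] becomes an
  inequality of integrals once p(u) and p'(u) v lie in the form domain. That stability is delicate
  for s = 1, where the domain is a closure of test functions. The choice ln (cosh (k t)) / k suits
  it: it vanishes to second order at 0, its derivative tanh (k t) is bounded and Lipschitz, and all
  later derivatives are polynomials in tanh (k t), so test functions go to test functions. G acts on
  L^1(d^gamma) because its kernel is symmetric and G[d^gamma] <= C d^gamma; C and the Lipschitz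
  constant of g fix the step length. The exponent a solves 2s - a q = a: G raises the power -a q of
  d by 2s and so returns d^a. This requires 2s - gamma < a q, which says that q exceeds q_star, and
  a q < gamma + 1, which also makes d^(-a q) integrable against d^gamma. Up to q_star the majorant
  is a power -gamma q of d; its integrability, gamma - gamma q > -1, is where gamma is compared with
  s - 1/2.\<close>

definition smooth :: "('a::euclidean_space \<Rightarrow> real) \<Rightarrow> bool" where
  "smooth f \<longleftrightarrow> (\<forall>k. C_k k f)"

lemma C_k_SucD: "C_k (Suc k) f \<Longrightarrow> C_k k f"
proof (induction k arbitrary: f)
  case 0
  then show ?case
    by (auto intro!: continuous_at_imp_continuous_on differentiable_imp_continuous_within)
next
  case (Suc k)
  then show ?case by simp
qed

lemma frechet_derivative_eqI:
  "(f has_derivative f') (at x) \<Longrightarrow> frechet_derivative f (at x) = f'"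
  using frechet_derivative_at by metis

lemma C_k_const: "C_k k (\<lambda>x. c)"
  by (induction k arbitrary: c) auto

lemma C_k_add: "C_k k f \<Longrightarrow> C_k k g \<Longrightarrow> C_k k (\<lambda>x. f x + g x)"
proof (induction k arbitrary: f g)
  case (Suc k)
  have d: "((\<lambda>x. f x + g x) has_derivative
      (\<lambda>v. frechet_derivative f (at x) v + frechet_derivative g (at x) v)) (at x)" for x
    using Suc.prems by (intro has_derivative_add) (auto simp: frechet_derivative_works[symmetric])
  show ?case
    using Suc by (auto simp: frechet_derivative_eqI[OF d] intro: differentiable_add)
qed (auto intro: continuous_on_add)

lemma C_k_mult: "C_k k f \<Longrightarrow> C_k k g \<Longrightarrow> C_k k (\<lambda>x. f x * g x)"
proof (induction k arbitrary: f g)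
  case (Suc k)
  have d: "((\<lambda>x. f x * g x) has_derivative
      (\<lambda>v. f x * frechet_derivative g (at x) v + frechet_derivative f (at x) v * g x)) (at x)" for x
    using Suc.prems by (intro has_derivative_mult) (auto simp: frechet_derivative_works[symmetric])
  show ?case
    using Suc C_k_SucD[OF Suc.prems(1)] C_k_SucD[OF Suc.prems(2)]
    by (auto simp: frechet_derivative_eqI[OF d] intro!: C_k_add intro: differentiable_mult)
qed (auto intro: continuous_on_mult)

text \<open>The outer function comes with the whole sequence \<open>h\<close> of its iterated
  derivatives. The chain rule turns a derivative of \<open>h n (f x)\<close> into a product
  containing \<open>h (Suc n) (f x)\<close>, so the induction on \<open>k\<close> has to run for all
  \<open>n\<close> at once.\<close>

lemma C_k_compose:
  fixes h :: "nat \<Rightarrow> real \<Rightarrow> real"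
  assumes h: "\<And>n t. (h n has_real_derivative h (Suc n) t) (at t)"
  shows "C_k k f \<Longrightarrow> C_k k (\<lambda>x. h n (f x))"
proof (induction k arbitrary: f n)
  case 0
  have "continuous_on UNIV (h n)"
    using h by (meson DERIV_isCont continuous_at_imp_continuous_on)
  then show ?case using 0 by (auto intro: continuous_on_compose2)
next
  case (Suc k)
  have d: "((\<lambda>x. h n (f x)) has_derivative
      (\<lambda>v. frechet_derivative f (at x) v * h (Suc n) (f x))) (at x)" for x
  proof -
    have "(f has_derivative frechet_derivative f (at x)) (at x)"
      using Suc.prems by (simp add: frechet_derivative_works)
    from has_derivative_compose[OF this h[of n "f x", unfolded has_field_derivative_def]]
    show ?thesis by (simp add: mult.commute)
  qed
  show ?case
    using Suc d C_k_SucD[OF Suc.prems]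
    by (auto simp: frechet_derivative_eqI[OF d] differentiable_def intro!: C_k_mult)
qed

lemma smooth_const: "smooth (\<lambda>x. c)"
  by (simp add: smooth_def C_k_const)

lemma smooth_add: "smooth f \<Longrightarrow> smooth g \<Longrightarrow> smooth (\<lambda>x. f x + g x)"
  by (simp add: smooth_def C_k_add)

lemma smooth_mult: "smooth f \<Longrightarrow> smooth g \<Longrightarrow> smooth (\<lambda>x. f x * g x)"
  by (simp add: smooth_def C_k_mult)

lemma smooth_diff: "smooth f \<Longrightarrow> smooth g \<Longrightarrow> smooth (\<lambda>x. f x - g x)"
  using smooth_add[of f "\<lambda>x. - 1 * g x"] smooth_mult[OF smooth_const[of "-1"], of g] by simp

lemma smooth_sum: "(\<And>i. i \<in> I \<Longrightarrow> smooth (f i)) \<Longrightarrow> smooth (\<lambda>x. \<Sum>i\<in>I. f i x)"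
  by (induction I rule: infinite_finite_induct) (auto intro: smooth_const smooth_add)

lemma smooth_compose:
  fixes h :: "nat \<Rightarrow> real \<Rightarrow> real"
  assumes "\<And>n t. (h n has_real_derivative h (Suc n) t) (at t)" and "smooth f"
  shows "smooth (\<lambda>x. h n (f x))"
  unfolding smooth_def
proof
  show "C_k k (\<lambda>x. h n (f x))" for k
    by (rule C_k_compose[of h, OF assms(1)]) (use assms(2) in \<open>auto simp: smooth_def\<close>)
qed

lemma smooth_imp_differentiable: "smooth f \<Longrightarrow> f differentiable at x"
  unfolding smooth_def by (metis C_k.simps(2))

lemma smooth_imp_continuous_on: "smooth f \<Longrightarrow> continuous_on S f"
  unfolding smooth_def by (metis C_k.simps(1) continuous_on_subset subset_UNIV)

lemma smooth_frechet_derivative: "smooth f \<Longrightarrow> smooth (\<lambda>x. frechet_derivative f (at x) v)"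
  unfolding smooth_def by (metis C_k.simps(2))

lemma smooth_inner_left: "smooth (\<lambda>x. (x - c) \<bullet> v)"
proof -
  have d: "((\<lambda>x. (x - c) \<bullet> v) has_derivative (\<lambda>u. u \<bullet> v)) (at x)" for x
    by (auto intro!: derivative_eq_intros)
  have "C_k k (\<lambda>x. (x - c) \<bullet> v)" for k
    by (cases k) (auto simp: frechet_derivative_eqI[OF d] C_k_const differentiable_def
        intro!: exI d continuous_intros)
  then show ?thesis by (simp add: smooth_def)
qed

lemma smooth_norm_square: "smooth (\<lambda>x. (norm (x - c))\<^sup>2)"
proof -
  have "smooth (\<lambda>x. \<Sum>b\<in>Basis. ((x - c) \<bullet> b) * ((x - c) \<bullet> b))"
    by (intro smooth_sum smooth_mult smooth_inner_left)
  then show ?thesis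
    by (simp add: power2_norm_eq_inner euclidean_inner[of "_ - c" "_ - c"])
qed

section \<open>Explicit derivatives of tanh, ln cosh and exp (- 1 / t)\<close>

primrec tanh_deriv_poly :: "nat \<Rightarrow> real poly" where
  "tanh_deriv_poly 0 = [:0, 1:]"
| "tanh_deriv_poly (Suc n) = pderiv (tanh_deriv_poly n) * [:1, 0, -1:]"

text \<open>Because tanh' = 1 - tanh^2, every derivative of tanh is a polynomial in tanh; the
  recursion differentiates the polynomial and multiplies by 1 - X^2. The derivatives thus form a
  sequence to which \<open>smooth_compose\<close> applies.\<close>

lemma DERIV_tanh_deriv_poly:
  "((\<lambda>t. poly (tanh_deriv_poly n) (tanh t)) has_real_derivative
     poly (tanh_deriv_poly (Suc n)) (tanh t)) (at t)"
proof -
  have "(tanh has_real_derivative (1 - (tanh t)\<^sup>2)) (at t)"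
    by (auto intro!: derivative_eq_intros)
  from DERIV_chain2[OF poly_DERIV this, of "tanh_deriv_poly n"] show ?thesis
    by (simp add: power2_eq_square algebra_simps)
qed

lemma smooth_tanh: "smooth f \<Longrightarrow> smooth (\<lambda>x. tanh (f x))"
  using smooth_compose[of "\<lambda>n t. poly (tanh_deriv_poly n) (tanh t)", OF DERIV_tanh_deriv_poly, of f 0] by simp

lemma DERIV_ln_cosh: "((\<lambda>t. ln (cosh t)) has_real_derivative tanh t) (at t)" for t :: real
  by (auto intro!: derivative_eq_intros simp: tanh_def cosh_real_pos)

lemma smooth_ln_cosh:
  assumes "smooth f" shows "smooth (\<lambda>x. ln (cosh (f x)))"
proof -
  \<comment> \<open>The derivative of ln cosh is tanh, so its sequence of derivatives is that of
    tanh shifted by one place.\<close>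
  let ?h = "\<lambda>n t. case n of 0 \<Rightarrow> ln (cosh t) | Suc n \<Rightarrow> poly (tanh_deriv_poly n) (tanh t)"
  have "(?h n has_real_derivative ?h (Suc n) t) (at t)" for n t
    using DERIV_tanh_deriv_poly DERIV_ln_cosh by (cases n) auto
  from smooth_compose[of ?h, OF this assms, of 0] show ?thesis by simp
qed

text \<open>For t > 0 the \<open>n\<close>-th derivative of exp (- 1 / t) is this polynomial in 1 /
  t times exp (- 1 / t): differentiating p(1/t) exp (- 1 / t) gives (p - p')(1/t) / t^2 times the
  same exponential.\<close>

primrec flat_poly :: "nat \<Rightarrow> real poly" where
  "flat_poly 0 = 1"
| "flat_poly (Suc n) = (flat_poly n - pderiv (flat_poly n)) * [:0, 0, 1:]"

text \<open>With x = 1 / t this is the decay of every polynomial times exp (- x) at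
  infinity.\<close>

lemma flat_tendsto_0:
  fixes p :: "real poly"
  shows "((\<lambda>t. poly p (1 / t) * exp (- 1 / t)) \<longlongrightarrow> 0) (at_right 0)"
proof -
  have "((\<lambda>x. poly p x * exp (- x)) \<longlongrightarrow> 0) at_top"
  proof (induction p)
    case (pCons a p)
    have "((\<lambda>x::real. a * exp (- x) + (\<Sum>i\<le>degree p. coeff p i * (x ^ Suc i / exp x))) \<longlongrightarrow> 
        a * 0 + (\<Sum>i\<le>degree p. coeff p i * 0)) at_top"
      by (intro tendsto_intros tendsto_power_div_exp_0)
        (auto intro: filterlim_compose[OF exp_at_bot] filterlim_uminus_at_bot_at_top)
    also have "(\<lambda>x::real. a * exp (- x) + (\<Sum>i\<le>degree p. coeff p i * (x ^ Suc i / exp x)))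
        = (\<lambda>x. poly (pCons a p) x * exp (- x))"
      by (simp add: fun_eq_iff poly_altdef[of p] exp_minus field_simps sum_distrib_left sum_distrib_right)
    finally show ?case by simp
  qed simp
  from filterlim_compose[OF this filterlim_inverse_at_top_right]
  show ?thesis by (simp add: divide_inverse)
qed

lemma DERIV_flat:
  fixes n :: nat
  defines "h \<equiv> (\<lambda>n t. if t > 0 then poly (flat_poly n) (1 / t) * exp (- 1 / t) else (0::real))"
  shows "(h n has_real_derivative h (Suc n) t) (at t)"
proof (cases t "0::real" rule: linorder_cases)
  case less
  have "((\<lambda>_. 0) has_real_derivative 0) (at t)" by simp
  then have "(h n has_real_derivative 0) (at t)"
    by (rule has_field_derivative_transform_within_open[where S="{..<0}"]) (use less in \<open>auto simp: h_def\<close>)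
  then show ?thesis using less by (simp add: h_def)
next
  case greater
  have "((\<lambda>t. poly (flat_poly n) (1 / t) * exp (- 1 / t)) has_real_derivative 
      poly (flat_poly (Suc n)) (1 / t) * exp (- 1 / t)) (at t)"
    using greater
    by (auto intro!: derivative_eq_intros DERIV_chain2[OF poly_DERIV] simp: field_simps power2_eq_square)
  then have "(h n has_real_derivative poly (flat_poly (Suc n)) (1 / t) * exp (- 1 / t)) (at t)"
    by (rule has_field_derivative_transform_within_open[where S="{0<..}"]) (use greater in \<open>auto simp: h_def\<close>)
  then show ?thesis using greater by (simp add: h_def)
next
  case equal
  \<comment> \<open>At 0 the difference quotient from the right is again a polynomial in 1 / y times
    the exponential; the extra factor X of the polynomial accounts for the division by y.\<close>
  have "((\<lambda>y. h n y / y) \<longlongrightarrow> 0) (at_right 0)"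
  proof (rule Lim_transform_eventually[OF flat_tendsto_0[of "flat_poly n * [:0, 1:]"]])
    show "\<forall>\<^sub>F x in at_right 0. poly (flat_poly n * [:0, 1:]) (1 / x) * exp (- 1 / x) = h n x / x"
      using eventually_at_right_less[of 0] by eventually_elim (auto simp: h_def)
  qed
  moreover have "((\<lambda>y. h n y / y) \<longlongrightarrow> 0) (at_left 0)"
    by (rule tendsto_eventually) (auto simp: h_def eventually_at intro: exI[of _ 1])
  ultimately have "((\<lambda>y. h n y / y) \<longlongrightarrow> 0) (at 0)"
    by (simp add: filterlim_split_at)
  then show ?thesis using equal by (simp add: has_field_derivative_iff h_def)
qed

text \<open>The flat function is composed with r^2 - |x - c|^2, a polynomial in the coordinates.
  Squaring the norm avoids its singularity at the centre.\<close>

lemma smooth_bump: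
  "smooth (\<lambda>x. if norm (x - c) < r then exp (- 1 / (r\<^sup>2 - (norm (x - c))\<^sup>2)) else 0)" if "r > 0"
proof -
  have "smooth (\<lambda>x. r\<^sup>2 - (norm (x - c))\<^sup>2)"
    by (intro smooth_diff smooth_const smooth_norm_square)
  from smooth_compose[of "\<lambda>n t. if t > 0 then poly (flat_poly n) (1 / t) * exp (- 1 / t) else 0",
      OF DERIV_flat this, of 0]
  have "smooth (\<lambda>x. if (norm (x - c))\<^sup>2 < r\<^sup>2 then exp (- 1 / (r\<^sup>2 - (norm (x - c))\<^sup>2)) else 0)"
    by (simp cong: if_cong)
  moreover have "(norm (x - c))\<^sup>2 < r\<^sup>2 \<longleftrightarrow> norm (x - c) < r" for x
    using that by (meson less_imp_le norm_ge_zero power2_less_imp_less power_strict_mono pos2)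
  ultimately show ?thesis by simp
qed

section \<open>Test functions and cut-offs\<close>

lemma test_functions_iff:
  "\<phi> \<in> test_functions \<Omega> \<longleftrightarrow> smooth \<phi> \<and> (\<exists>K. compact K \<and> K \<subseteq> \<Omega> \<and> (\<forall>x. x \<notin> K \<longrightarrow> \<phi> x = 0))"
proof
  assume "\<phi> \<in> test_functions \<Omega>"
  then have "smooth \<phi>" "compact (closure {x. \<phi> x \<noteq> 0})" "closure {x. \<phi> x \<noteq> 0} \<subseteq> \<Omega>"
    unfolding test_functions_def smooth_def mem_Collect_eq by - (elim conjE, assumption)+
  moreover have "\<forall>x. x \<notin> closure {x. \<phi> x \<noteq> 0} \<longrightarrow> \<phi> x = 0"
    using closure_subset[of "{x. \<phi> x \<noteq> 0}"] by auto
  ultimately show "smooth \<phi> \<and> (\<exists>K. compact K \<and> K \<subseteq> \<Omega> \<and> (\<forall>x. x \<notin> K \<longrightarrow> \<phi> x = 0))"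
    by blast
next
  assume "smooth \<phi> \<and> (\<exists>K. compact K \<and> K \<subseteq> \<Omega> \<and> (\<forall>x. x \<notin> K \<longrightarrow> \<phi> x = 0))"
  then obtain K where K: "smooth \<phi>" "compact K" "K \<subseteq> \<Omega>" "\<And>x. x \<notin> K \<Longrightarrow> \<phi> x = 0"
    by blast
  have "closure {x. \<phi> x \<noteq> 0} \<subseteq> K"
    using K by (intro closure_minimal) (auto intro: compact_imp_closed)
  moreover from this have "compact (closure {x. \<phi> x \<noteq> 0})"
    using compact_Int_closed[OF K(2) closed_closure, of "{x. \<phi> x \<noteq> 0}"] by (simp add: Int_absorb1)
  ultimately show "\<phi> \<in> test_functions \<Omega>"
    using K(1,3) by (simp add: test_functions_def smooth_def)
qed

lemma test_functions_smooth: "\<phi> \<in> test_functions \<Omega> \<Longrightarrow> smooth \<phi>"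
  by (simp add: test_functions_iff)

lemma test_functions_outside: "\<phi> \<in> test_functions \<Omega> \<Longrightarrow> x \<notin> \<Omega> \<Longrightarrow> \<phi> x = 0"
  by (auto simp: test_functions_iff)

lemma test_functions_zero: "(\<lambda>x. 0) \<in> test_functions \<Omega>"
  by (auto simp: test_functions_iff smooth_const)

lemma test_functions_add:
  assumes "f \<in> test_functions \<Omega>" "g \<in> test_functions \<Omega>"
  shows "(\<lambda>x. f x + g x) \<in> test_functions \<Omega>"
proof -
  obtain K K' where "compact K" "K \<subseteq> \<Omega>" "\<forall>x. x \<notin> K \<longrightarrow> f x = 0"
    and "compact K'" "K' \<subseteq> \<Omega>" "\<forall>x. x \<notin> K' \<longrightarrow> g x = 0"
    using assms by (auto simp: test_functions_iff)
  then show ?thesis using assms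
    by (auto simp: test_functions_iff intro!: smooth_add exI[of _ "K \<union> K'"])
qed

lemma test_functions_supp:
  assumes "f \<in> test_functions \<Omega>" "smooth g" "\<And>x. f x = 0 \<Longrightarrow> g x = 0"
  shows "g \<in> test_functions \<Omega>"
  using assms by (auto simp: test_functions_iff)

lemma test_functions_mult_left:
  assumes "f \<in> test_functions \<Omega>" "smooth g"
  shows "(\<lambda>x. g x * f x) \<in> test_functions \<Omega>"
  by (rule test_functions_supp[OF assms(1)])
    (use assms in \<open>auto intro!: smooth_mult simp: test_functions_smooth\<close>)

lemma test_functions_tanh:
  "f \<in> test_functions \<Omega> \<Longrightarrow> (\<lambda>x. tanh (f x)) \<in> test_functions \<Omega>"
  using test_functions_supp[of f \<Omega> "\<lambda>x. tanh (f x)"] smooth_tanh[of f] test_functions_smooth[of f \<Omega>]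
  by simp

lemma test_functions_mono: "A \<subseteq> B \<Longrightarrow> test_functions A \<subseteq> test_functions B"
  by (auto simp: test_functions_def)

lemma test_functions_frechet_derivative:
  assumes "f \<in> test_functions \<Omega>"
  shows "(\<lambda>x. frechet_derivative f (at x) v) \<in> test_functions \<Omega>"
proof -
  obtain K where K: "compact K" "K \<subseteq> \<Omega>" "\<And>x. x \<notin> K \<Longrightarrow> f x = 0"
    using assms by (auto simp: test_functions_iff)
  have "frechet_derivative f (at x) v = 0" if "x \<notin> K" for x
  proof -
    have "((\<lambda>_. 0) has_derivative (\<lambda>_. 0)) (at x)" by simp
    then have "(f has_derivative (\<lambda>_. 0)) (at x)"
      by (rule has_derivative_transform_within_open[where s="- K"])
        (use that K in \<open>auto intro: compact_imp_closed\<close>)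
    from frechet_derivative_eqI[OF this] show ?thesis by simp
  qed
  then show ?thesis
    using assms K by (auto simp: test_functions_iff intro: smooth_frechet_derivative)
qed

text \<open>The quotient of \<open>\<phi>\<close> by the weight is continuous on a compact set
  outside which \<open>\<phi>\<close> vanishes, hence bounded. This puts every test function below a
  multiple of a power of the boundary distance, although that power vanishes at the
  boundary.\<close>

lemma test_functions_le_weight:
  assumes "\<phi> \<in> test_functions \<Omega>" "continuous_on \<Omega> w" "\<And>x. x \<in> \<Omega> \<Longrightarrow> w x > (0::real)"
  shows "\<exists>B>0. \<forall>x\<in>\<Omega>. \<bar>\<phi> x\<bar> \<le> B * w x"
proof -
  obtain K where K: "compact K" "K \<subseteq> \<Omega>" "\<And>x. x \<notin> K \<Longrightarrow> \<phi> x = 0"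
    using assms by (auto simp: test_functions_iff)
  have "continuous_on K (\<lambda>x. \<phi> x / w x)"
    using assms K
    by (intro continuous_on_divide smooth_imp_continuous_on[OF test_functions_smooth[OF assms(1)]])
      (auto intro: continuous_on_subset simp: less_imp_neq[symmetric])
  then have "bounded ((\<lambda>x. \<phi> x / w x) ` K)"
    using K by (intro compact_imp_bounded compact_continuous_image)
  then obtain B where B: "B > 0" "\<forall>x\<in>K. \<bar>\<phi> x / w x\<bar> \<le> B"
    by (auto simp: bounded_pos)
  have "\<bar>\<phi> x\<bar> \<le> B * w x" if "x \<in> \<Omega>" for x
    using B K assms(3)[OF that] by (cases "x \<in> K") (auto simp: field_simps)
  then show ?thesis using B by blast
qed

lemma test_functions_bounded:
  assumes "\<phi> \<in> test_functions \<Omega>" shows "\<exists>B>0. \<forall>x. \<bar>\<phi> x\<bar> \<le> B"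
proof -
  obtain B where "B > 0" "\<forall>x\<in>\<Omega>. \<bar>\<phi> x\<bar> \<le> B"
    using test_functions_le_weight[OF assms, of "\<lambda>_. 1"] by auto
  then show ?thesis using test_functions_outside[OF assms]
    by (metis abs_zero less_eq_real_def)
qed

lemma test_functions_measurable:
  "\<phi> \<in> test_functions \<Omega> \<Longrightarrow> \<phi> \<in> borel_measurable borel"
  by (intro borel_measurable_continuous_onI smooth_imp_continuous_on test_functions_smooth)

lemma test_functions_measurable_on:
  "\<phi> \<in> test_functions \<Omega> \<Longrightarrow> \<phi> \<in> borel_measurable (borel_on S)"
  by (intro measurable_restrict_space1) (simp add: test_functions_measurable)

text \<open>By Lindelof, \<open>U\<close> is a countable union of balls whose closures lie in
  \<open>U\<close>. The cut-off \<open>\<zeta> n\<close> is tanh of \<open>n\<close> times the sum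
  of the first \<open>n\<close> bumps: tanh keeps the values in [0, 1], finitely many balls keep the
  support compact, and the factor \<open>n\<close> drives the argument to infinity at every point of
  \<open>U\<close>.\<close>

lemma open_cutoff:
  fixes U :: "'a::euclidean_space set"
  assumes "open U"
  obtains \<zeta> :: "nat \<Rightarrow> 'a \<Rightarrow> real" where "\<And>n. \<zeta> n \<in> test_functions U"
    "\<And>n x. 0 \<le> \<zeta> n x \<and> \<zeta> n x \<le> 1" "\<And>x. (\<lambda>n. \<zeta> n x) \<longlonglongrightarrow> indicat_real U x"
proof (cases "U = {}")
  case True
  then show ?thesis by (intro that[of "\<lambda>n x. 0"]) (auto simp: test_functions_zero)
next
  case False
  define F where "F = {ball c r |c r. r > 0 \<and> cball c r \<subseteq> U}"
  have UF: "\<Union>F = U"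
  proof
    show "\<Union>F \<subseteq> U" using ball_subset_cball by (fastforce simp: F_def)
    show "U \<subseteq> \<Union>F"
    proof
      fix x assume "x \<in> U"
      with \<open>open U\<close> obtain e where "e > 0" "cball x e \<subseteq> U"
        by (meson open_contains_cball)
      then show "x \<in> \<Union>F" by (auto simp: F_def intro!: exI[of _ "ball x e"])
    qed
  qed
  have "\<And>S. S \<in> F \<Longrightarrow> open S" by (auto simp: F_def)
  then obtain F' where F': "F' \<subseteq> F" "countable F'" "\<Union>F' = U"
    using Lindelof[of F] UF by auto
  with False have "F' \<noteq> {}" by auto
  then have range: "range (from_nat_into F') = F'"
    using F' by (intro range_from_nat_into) auto
  then have "from_nat_into F' n \<in> F" for n
    using F'(1) by (metis rangeI subsetD)
  then have "\<forall>n. \<exists>c r. from_nat_into F' n = ball c r \<and> r > 0 \<and> cball c r \<subseteq> U"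
    unfolding F_def by blast
  then obtain c r where cr: "\<And>n. from_nat_into F' n = ball (c n) (r n)" "\<And>n. r n > 0"
      "\<And>n. cball (c n) (r n) \<subseteq> U"
    by metis
  define b where "b = (\<lambda>n x. if norm (x - c n) < r n
      then exp (- 1 / ((r n)\<^sup>2 - (norm (x - c n))\<^sup>2)) else 0)"
  have b_smooth: "smooth (b n)" for n
    unfolding b_def by (rule smooth_bump) (rule cr)
  have b_nonneg: "b n x \<ge> 0" for n x by (simp add: b_def)
  have b_zero: "b n x = 0" if "x \<notin> cball (c n) (r n)" for n x
    using that by (auto simp: b_def dist_norm norm_minus_commute)
  define S where "S = (\<lambda>n x. \<Sum>i<n. b i x)"
  define \<zeta> where "\<zeta> = (\<lambda>n x. tanh (real n * S n x))"
  have S_nonneg: "S n x \<ge> 0" for n x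
    unfolding S_def by (intro sum_nonneg b_nonneg)
  have "\<zeta> n \<in> test_functions U" for n
    unfolding test_functions_iff
  proof (intro conjI exI)
    show "smooth (\<zeta> n)"
      unfolding \<zeta>_def S_def by (intro smooth_tanh smooth_mult smooth_const smooth_sum b_smooth)
    show "compact (\<Union>i<n. cball (c i) (r i))"
      by (intro compact_UN) auto
    show "(\<Union>i<n. cball (c i) (r i)) \<subseteq> U" using cr(3) by blast
    show "\<forall>x. x \<notin> (\<Union>i<n. cball (c i) (r i)) \<longrightarrow> \<zeta> n x = 0"
      by (auto simp: \<zeta>_def S_def intro!: sum.neutral b_zero)
  qed
  moreover have "0 \<le> \<zeta> n x \<and> \<zeta> n x \<le> 1" for n x
    using S_nonneg[of n x] tanh_real_lt_1[of "real n * S n x"] by (simp add: \<zeta>_def)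
  moreover have "(\<lambda>n. \<zeta> n x) \<longlonglongrightarrow> indicat_real U x" for x
  proof (cases "x \<in> U")
    case True
    then obtain B where "B \<in> F'" "x \<in> B" using F' by auto
    then obtain i where "x \<in> ball (c i) (r i)" using range cr(1) by (metis rangeE)
    then have bi: "b i x > 0" by (simp add: b_def dist_norm norm_minus_commute)
    have "filterlim (\<lambda>n. real n * b i x) at_top sequentially"
      using bi by (intro filterlim_at_top_mult_tendsto_pos[OF tendsto_const] filterlim_real_sequentially)
    from filterlim_compose[OF tanh_real_at_top this]
    have "(\<lambda>n. tanh (real n * b i x)) \<longlonglongrightarrow> 1" .
    moreover have "\<forall>\<^sub>F n in sequentially. tanh (real n * b i x) \<le> \<zeta> n x"
      using eventually_gt_at_top[of i]
    proof eventually_elim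
      case (elim n)
      have "b i x \<le> S n x"
        unfolding S_def using elim by (intro member_le_sum) (auto simp: b_nonneg)
      then show ?case by (simp add: \<zeta>_def mult_left_mono)
    qed
    moreover have "\<forall>\<^sub>F n in sequentially. \<zeta> n x \<le> 1"
      by (simp add: \<zeta>_def less_imp_le tanh_real_lt_1)
    ultimately have "(\<lambda>n. \<zeta> n x) \<longlonglongrightarrow> 1"
      using tendsto_sandwich[of "\<lambda>n. tanh (real n * b i x)" "\<lambda>n. \<zeta> n x" sequentially "\<lambda>_. 1" 1]
      by simp
    then show ?thesis using True by simp
  next
    case False
    then have "\<And>n. x \<notin> cball (c n) (r n)" using cr(3) by blast
    then have "\<And>n. \<zeta> n x = 0" by (simp add: \<zeta>_def S_def b_zero)
    then show ?thesis using False by simp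
  qed
  ultimately show ?thesis by (rule that)
qed

section \<open>Density of test functions in L^1 of a finite measure\<close>

lemma test_functions_integrable:
  assumes "finite_measure \<mu>" "sets \<mu> = sets (borel_on \<Omega>)" "\<phi> \<in> test_functions \<Omega>"
  shows "integrable \<mu> \<phi>"
proof -
  interpret finite_measure \<mu> by fact
  obtain B where "\<forall>x. \<bar>\<phi> x\<bar> \<le> B" using test_functions_bounded[OF assms(3)] by blast
  moreover have "\<phi> \<in> borel_measurable \<mu>"
    using measurable_cong_sets[OF assms(2) refl] test_functions_measurable_on[OF assms(3)] by blast
  ultimately show ?thesis by (intro integrable_const_bound[of _ B]) auto
qed

text \<open>The measure is a parameter because approximation is required both for Lebesgue measure
  on the domain and for the measure whose density is the boundary weight.\<close>

definition test_approximable :: "'a::euclidean_space set \<Rightarrow> 'a measure \<Rightarrow> ('a \<Rightarrow> real) \<Rightarrow> bool" where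
  "test_approximable \<Omega> \<mu> f \<longleftrightarrow> integrable \<mu> f \<and>
     (\<forall>e>0. \<exists>\<phi>\<in>test_functions \<Omega>. (\<integral>x. \<bar>f x - \<phi> x\<bar> \<partial>\<mu>) < e)"

lemma test_approximable_lim:
  assumes "finite_measure \<mu>" "sets \<mu> = sets (borel_on \<Omega>)"
    and "\<And>n. test_approximable \<Omega> \<mu> (f n)" "integrable \<mu> g"
    and lim: "(\<lambda>n. \<integral>x. \<bar>f n x - g x\<bar> \<partial>\<mu>) \<longlonglongrightarrow> 0"
  shows "test_approximable \<Omega> \<mu> g"
  unfolding test_approximable_def
proof (intro conjI allI impI)
  fix e :: real assume "e > 0"
  then have "\<forall>\<^sub>F n in sequentially. (\<integral>x. \<bar>f n x - g x\<bar> \<partial>\<mu>) < e / 2"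
    using order_tendstoD(2)[OF lim, of "e / 2"] by simp
  then obtain n where n: "(\<integral>x. \<bar>f n x - g x\<bar> \<partial>\<mu>) < e / 2"
    by (auto simp: eventually_sequentially)
  obtain \<phi> where \<phi>: "\<phi> \<in> test_functions \<Omega>" "(\<integral>x. \<bar>f n x - \<phi> x\<bar> \<partial>\<mu>) < e / 2"
    using assms(3)[of n] \<open>e > 0\<close> by (auto simp: test_approximable_def dest!: spec[of _ "e / 2"])
  have [simp]: "integrable \<mu> (f n)" "integrable \<mu> \<phi>"
    using assms \<phi> test_functions_integrable by (auto simp: test_approximable_def)
  have "(\<integral>x. \<bar>g x - \<phi> x\<bar> \<partial>\<mu>) \<le> (\<integral>x. \<bar>f n x - g x\<bar> + \<bar>f n x - \<phi> x\<bar> \<partial>\<mu>)"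
    using assms by (intro integral_mono) auto
  also have "\<dots> = (\<integral>x. \<bar>f n x - g x\<bar> \<partial>\<mu>) + (\<integral>x. \<bar>f n x - \<phi> x\<bar> \<partial>\<mu>)"
    using assms by (intro Bochner_Integration.integral_add) auto
  finally show "\<exists>\<phi>\<in>test_functions \<Omega>. (\<integral>x. \<bar>g x - \<phi> x\<bar> \<partial>\<mu>) < e"
    using n \<phi> by (intro bexI[of _ \<phi>]) auto
qed fact

lemma test_approximable_lim_bounded:
  assumes "finite_measure \<mu>" "sets \<mu> = sets (borel_on \<Omega>)"
    and f: "\<And>n. test_approximable \<Omega> \<mu> (f n)" and g: "integrable \<mu> g"
    and lim: "\<And>x. x \<in> space \<mu> \<Longrightarrow> (\<lambda>n. f n x) \<longlonglongrightarrow> g x"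
    and h: "integrable \<mu> h" "\<And>n x. x \<in> space \<mu> \<Longrightarrow> \<bar>f n x\<bar> \<le> h x"
  shows "test_approximable \<Omega> \<mu> g"
proof (rule test_approximable_lim[OF assms(1,2) f g])
  have [measurable]: "f n \<in> borel_measurable \<mu>" "g \<in> borel_measurable \<mu>" for n
    using f g by (auto simp: test_approximable_def)
  have "(\<lambda>n. \<integral>x. \<bar>f n x - g x\<bar> \<partial>\<mu>) \<longlonglongrightarrow> (\<integral>x. 0 \<partial>\<mu>)"
  proof (rule integral_dominated_convergence)
    show "integrable \<mu> (\<lambda>x. h x + \<bar>g x\<bar>)" using h g by auto
    show "AE x in \<mu>. (\<lambda>n. \<bar>f n x - g x\<bar>) \<longlonglongrightarrow> 0"
      using lim by (intro AE_I2) (simp add: tendsto_rabs_zero LIM_zero)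
    show "AE x in \<mu>. norm \<bar>f n x - g x\<bar> \<le> h x + \<bar>g x\<bar>" for n
      using h(2)[of _ n] by (intro AE_I2) (fastforce intro: order_trans[OF abs_triangle_ineq4])
  qed auto
  then show "(\<lambda>n. \<integral>x. \<bar>f n x - g x\<bar> \<partial>\<mu>) \<longlonglongrightarrow> 0" by simp
qed

lemma test_approximable_test:
  assumes "finite_measure \<mu>" "sets \<mu> = sets (borel_on \<Omega>)" "\<phi> \<in> test_functions \<Omega>"
  shows "test_approximable \<Omega> \<mu> \<phi>"
  unfolding test_approximable_def using test_functions_integrable[OF assms] assms(3)
  by (auto intro!: bexI[of _ \<phi>])

lemma test_approximable_scale:
  assumes "test_approximable \<Omega> \<mu> f"
  shows "test_approximable \<Omega> \<mu> (\<lambda>x. c * f x)"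
proof (cases "c = 0")
  case True
  then show ?thesis by (auto simp: test_approximable_def intro!: bexI[OF _ test_functions_zero])
next
  case False
  show ?thesis
    unfolding test_approximable_def
  proof (intro conjI allI impI)
    fix e :: real assume "e > 0"
    then obtain \<phi> where \<phi>: "\<phi> \<in> test_functions \<Omega>" "(\<integral>x. \<bar>f x - \<phi> x\<bar> \<partial>\<mu>) < e / \<bar>c\<bar>"
      using assms False by (auto simp: test_approximable_def dest!: spec[of _ "e / \<bar>c\<bar>"])
    have "(\<integral>x. \<bar>c * f x - c * \<phi> x\<bar> \<partial>\<mu>) = \<bar>c\<bar> * (\<integral>x. \<bar>f x - \<phi> x\<bar> \<partial>\<mu>)"
      by (simp add: right_diff_distrib[symmetric] abs_mult)
    also have "\<dots> < e" using \<phi> False by (simp add: field_simps)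
    finally show "\<exists>\<phi>\<in>test_functions \<Omega>. (\<integral>x. \<bar>c * f x - \<phi> x\<bar> \<partial>\<mu>) < e"
      using \<phi> by (intro bexI[of _ "\<lambda>x. c * \<phi> x"]) (auto intro: test_functions_mult_left smooth_const)
  qed (use assms in \<open>auto simp: test_approximable_def\<close>)
qed

lemma test_approximable_add:
  assumes "finite_measure \<mu>" "sets \<mu> = sets (borel_on \<Omega>)"
    "test_approximable \<Omega> \<mu> f" "test_approximable \<Omega> \<mu> g"
  shows "test_approximable \<Omega> \<mu> (\<lambda>x. f x + g x)"
  unfolding test_approximable_def
proof (intro conjI allI impI)
  fix e :: real assume "e > 0"
  then obtain \<phi> \<psi> where \<phi>: "\<phi> \<in> test_functions \<Omega>" "(\<integral>x. \<bar>f x - \<phi> x\<bar> \<partial>\<mu>) < e / 2"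
    and \<psi>: "\<psi> \<in> test_functions \<Omega>" "(\<integral>x. \<bar>g x - \<psi> x\<bar> \<partial>\<mu>) < e / 2"
    using assms by (auto simp: test_approximable_def dest!: spec[of _ "e / 2"])
  have [simp]: "integrable \<mu> f" "integrable \<mu> g" "integrable \<mu> \<phi>" "integrable \<mu> \<psi>"
    using assms \<phi> \<psi> test_functions_integrable by (auto simp: test_approximable_def)
  have "(\<integral>x. \<bar>f x + g x - (\<phi> x + \<psi> x)\<bar> \<partial>\<mu>) \<le> (\<integral>x. \<bar>f x - \<phi> x\<bar> + \<bar>g x - \<psi> x\<bar> \<partial>\<mu>)"
    by (intro integral_mono) auto
  also have "\<dots> = (\<integral>x. \<bar>f x - \<phi> x\<bar> \<partial>\<mu>) + (\<integral>x. \<bar>g x - \<psi> x\<bar> \<partial>\<mu>)"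
    by (intro Bochner_Integration.integral_add) auto
  finally show "\<exists>\<phi>\<in>test_functions \<Omega>. (\<integral>x. \<bar>f x + g x - \<phi> x\<bar> \<partial>\<mu>) < e"
    using \<phi> \<psi> by (intro bexI[of _ "\<lambda>x. \<phi> x + \<psi> x"]) (auto intro: test_functions_add)
qed (use assms in \<open>auto simp: test_approximable_def\<close>)

text \<open>Cut-offs reach the open sets, linearity the complements, and dominated convergence the
  countable disjoint unions; since open sets are stable under intersection, these sets are all Borel
  sets. The set appears as \<open>A \<inter> \<Omega>\<close> so that the induction can run over
  Borel sets of the whole space.\<close>

lemma test_approximable_indicator:
  assumes fm: "finite_measure \<mu>" and sets: "sets \<mu> = sets (borel_on \<Omega>)" and "open \<Omega>"
    and A: "A \<in> sets borel"
  shows "test_approximable \<Omega> \<mu> (indicat_real (A \<inter> \<Omega>))"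
proof -
  interpret finite_measure \<mu> by fact
  have int: "integrable \<mu> (indicat_real (B \<inter> \<Omega>))" if "B \<in> sets borel" for B
    using that sets \<open>open \<Omega>\<close> by (intro integrable_real_indicator) (auto simp: sets_restrict_space emeasure_eq_measure)
  have opn: "test_approximable \<Omega> \<mu> (indicat_real (U \<inter> \<Omega>))" if opU: "open U" for U
  proof -
    obtain \<zeta> where \<zeta>: "\<And>n. \<zeta> n \<in> test_functions (U \<inter> \<Omega>)" "\<And>n x. 0 \<le> \<zeta> n x \<and> \<zeta> n x \<le> 1"
      "\<And>x. (\<lambda>n. \<zeta> n x) \<longlonglongrightarrow> indicat_real (U \<inter> \<Omega>) x"
      using open_cutoff[OF open_Int[OF opU \<open>open \<Omega>\<close>]] by blast
    have "\<zeta> n \<in> test_functions \<Omega>" for n using \<zeta>(1) test_functions_mono[of "U \<inter> \<Omega>" \<Omega>] by blast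
    then have "test_approximable \<Omega> \<mu> (\<zeta> n)" for n
      by (rule test_approximable_test[OF fm sets])
    moreover have "integrable \<mu> (indicat_real (U \<inter> \<Omega>))" using opU by (intro int) simp
    moreover have "\<bar>\<zeta> n x\<bar> \<le> 1" for n x using \<zeta>(2)[of n x] by simp
    ultimately show ?thesis
      using \<zeta>(3) test_approximable_lim_bounded[OF fm sets, of \<zeta> "indicat_real (U \<inter> \<Omega>)" "\<lambda>_. 1"]
      by simp
  qed
  have st: "Int_stable {S :: 'a set. open S}" "{S :: 'a set. open S} \<subseteq> Pow UNIV"
    by (auto simp: Int_stable_def)
  have "A \<in> sigma_sets UNIV {S. open S}" using A by (simp add: borel_def)
  with st show ?thesis
  proof (induction rule: sigma_sets_induct_disjoint)
    case (basic U) then show ?case by (auto intro: opn)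
  next
    case empty show ?case using test_approximable_test[OF fm sets test_functions_zero] by simp
  next
    case (compl B)
    have "test_approximable \<Omega> \<mu> (\<lambda>x. indicat_real (UNIV \<inter> \<Omega>) x + (- 1) * indicat_real (B \<inter> \<Omega>) x)"
      by (intro test_approximable_add[OF fm sets] test_approximable_scale opn compl) auto
    also have "(\<lambda>x. indicat_real (UNIV \<inter> \<Omega>) x + (- 1) * indicat_real (B \<inter> \<Omega>) x) =
        indicat_real ((UNIV - B) \<inter> \<Omega>)"
      by (auto simp: indicator_def fun_eq_iff)
    finally show ?case .
  next
    case (union B)
    have eq: "(\<Sum>i<n. indicat_real (B i \<inter> \<Omega>) x) = indicat_real ((\<Union>i<n. B i) \<inter> \<Omega>) x" for n x
    proof (induction n)
      case (Suc n)
      have "B n \<inter> B i = {}" if "i < n" for i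
        by (rule disjoint_family_onD[OF union(1)]) (use that in auto)
      then have "B n \<inter> (\<Union>i<n. B i) = {}" by blast
      then have "indicat_real ((\<Union>i<Suc n. B i) \<inter> \<Omega>) x =
          indicat_real ((\<Union>i<n. B i) \<inter> \<Omega>) x + indicat_real (B n \<inter> \<Omega>) x"
        unfolding indicator_def lessThan_Suc by auto
      then show ?case using Suc by simp
    qed simp
    show ?case
    proof (rule test_approximable_lim_bounded[OF fm sets, where f="\<lambda>n. indicat_real ((\<Union>i<n. B i) \<inter> \<Omega>)" and h="\<lambda>_. 1"])
      show "test_approximable \<Omega> \<mu> (indicat_real ((\<Union>i<n. B i) \<inter> \<Omega>))" for n
      proof -
        have "test_approximable \<Omega> \<mu> (\<lambda>x. \<Sum>i<n. indicat_real (B i \<inter> \<Omega>) x)"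
          by (induction n) (simp_all add: test_approximable_add[OF fm sets] union
              test_approximable_test[OF fm sets test_functions_zero])
        then show ?thesis by (simp add: eq)
      qed
      show "integrable \<mu> (indicat_real (\<Union> (range B) \<inter> \<Omega>))"
      proof (rule int)
        have "range B \<subseteq> sets borel" using union(2) by (simp add: borel_def)
        then show "\<Union> (range B) \<in> sets borel" by (intro sets.countable_UN) auto
      qed
      show "(\<lambda>n. indicat_real ((\<Union>i<n. B i) \<inter> \<Omega>) x) \<longlonglongrightarrow> indicat_real (\<Union> (range B) \<inter> \<Omega>) x" for x
      proof (rule tendsto_eventually)
        show "\<forall>\<^sub>F n in sequentially. indicat_real ((\<Union>i<n. B i) \<inter> \<Omega>) x = indicat_real (\<Union> (range B) \<inter> \<Omega>) x"
        proof (cases "\<exists>i. x \<in> B i")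
          case True
          then obtain i where "x \<in> B i" by blast
          then show ?thesis
            by (intro eventually_mono[OF eventually_gt_at_top[of i]]) (auto simp: indicator_def)
        qed (auto simp: indicator_def)
      qed
    qed (auto simp: indicator_def)
  qed
qed

text \<open>Linearity and closure under dominated limits carry the approximation from indicators
  over simple functions to all integrable ones.\<close>

lemma test_functions_dense_L1:
  assumes fm: "finite_measure \<mu>" and sets: "sets \<mu> = sets (borel_on \<Omega>)" and op: "open \<Omega>"
    and f: "integrable \<mu> f"
  shows "test_approximable \<Omega> \<mu> f"
  using f
proof (induction rule: integrable_induct)
  case (base A c)
  then have "A \<inter> \<Omega> = A" "A \<in> sets borel"
    using sets op by (auto simp: sets_restrict_space)
  then have "test_approximable \<Omega> \<mu> (indicat_real A)"
    using test_approximable_indicator[OF fm sets op, of A] by simp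
  from test_approximable_scale[OF this, of c] show ?case by (simp add: mult.commute)
next
  case (add f g)
  then show ?case by (intro test_approximable_add[OF fm sets])
next
  case (lim f s)
  show ?case
    by (rule test_approximable_lim_bounded[OF fm sets, where f=s and h="\<lambda>x. 2 * \<bar>f x\<bar>"])
      (use lim in auto)
qed

lemma test_functions_dense_seq:
  assumes "finite_measure \<mu>" "sets \<mu> = sets (borel_on \<Omega>)" "open \<Omega>" "integrable \<mu> f"
  shows "\<exists>\<phi>. (\<forall>n. \<phi> n \<in> test_functions \<Omega>) \<and> (\<lambda>n. \<integral>x. \<bar>\<phi> n x - f x\<bar> \<partial>\<mu>) \<longlonglongrightarrow> 0"
proof -
  have "\<forall>n::nat. \<exists>\<phi>\<in>test_functions \<Omega>. (\<integral>x. \<bar>f x - \<phi> x\<bar> \<partial>\<mu>) < 1 / (real n + 1)"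
    using test_functions_dense_L1[OF assms] by (auto simp: test_approximable_def)
  then obtain \<phi> where \<phi>: "\<And>n. \<phi> n \<in> test_functions \<Omega>"
      "\<And>n. (\<integral>x. \<bar>f x - \<phi> n x\<bar> \<partial>\<mu>) < 1 / (real n + 1)"
    by metis
  have "(\<lambda>n. \<integral>x. \<bar>f x - \<phi> n x\<bar> \<partial>\<mu>) \<longlonglongrightarrow> 0"
    by (rule tendsto_sandwich[OF _ _ tendsto_const LIMSEQ_inverse_real_of_nat])
      (use \<phi> in \<open>auto intro!: eventuallyI less_imp_le simp: inverse_eq_divide add.commute\<close>)
  then show ?thesis using \<phi> by (auto simp: abs_minus_commute intro!: exI[of _ \<phi>])
qed

lemma AE_tendsto_subseq:
  fixes f :: "nat \<Rightarrow> 'a \<Rightarrow> real"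
  assumes "\<And>n. integrable M (\<lambda>x. f n x - g x)" "(\<lambda>n. \<integral>x. \<bar>f n x - g x\<bar> \<partial>M) \<longlonglongrightarrow> 0"
  shows "\<exists>r::nat \<Rightarrow> nat. strict_mono r \<and> (AE x in M. (\<lambda>n. f (r n) x) \<longlonglongrightarrow> g x)"
proof -
  obtain r :: "nat \<Rightarrow> nat" where "strict_mono r" "AE x in M. (\<lambda>n. f (r n) x - g x) \<longlonglongrightarrow> 0"
    using tendsto_L1_AE_subseq[of M "\<lambda>n x. f n x - g x"] assms by (auto simp: strict_mono_def)
  then show ?thesis by (auto simp: LIM_zero_iff intro!: exI[of _ r])
qed

lemma finite_measure_borel_on:
  assumes "open \<Omega>" "bounded \<Omega>" shows "finite_measure (borel_on \<Omega>)"
  by (rule finite_measureI) (use assms in \<open>auto simp: emeasure_restrict_space space_restrict_space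
      dest: emeasure_bounded_finite\<close>)

text \<open>Test functions are turned into nonnegative bounded ones by applying \<open>tanh\<^sup>2\<close>, which maps
  approximations of an indicator function to approximations of a multiple of it.\<close>

lemma AE_nonneg_test_functions:
  fixes h :: "'a::euclidean_space \<Rightarrow> real"
  assumes op: "open \<Omega>" and bd: "bounded \<Omega>"
    and h [measurable]: "h \<in> borel_measurable (borel_on \<Omega>)"
    and int: "\<And>\<xi>. \<xi> \<in> test_functions \<Omega> \<Longrightarrow> integrable (borel_on \<Omega>) (\<lambda>x. h x * \<xi> x)"
    and nn: "\<And>\<xi>. \<xi> \<in> test_functions \<Omega> \<Longrightarrow> (\<And>x. \<xi> x \<ge> 0) \<Longrightarrow> (\<integral>x. h x * \<xi> x \<partial>borel_on \<Omega>) \<ge> 0"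
  shows "AE x in borel_on \<Omega>. h x \<ge> 0"
proof -
  have fm: "finite_measure (borel_on \<Omega>)"
    by (rule finite_measure_borel_on[OF op bd])
  interpret finite_measure "borel_on \<Omega>" by fact
  define B where "B = {x\<in>space (borel_on \<Omega>). h x < 0}"
  have [measurable]: "B \<in> sets (borel_on \<Omega>)" by (simp add: B_def)
  have "integrable (borel_on \<Omega>) (indicat_real B)"
    by (intro integrable_real_indicator) (auto simp: emeasure_eq_measure)
  then obtain \<phi> where \<phi>: "\<And>n. \<phi> n \<in> test_functions \<Omega>"
      "(\<lambda>n. \<integral>x. \<bar>\<phi> n x - indicat_real B x\<bar> \<partial>borel_on \<Omega>) \<longlonglongrightarrow> 0"
    using test_functions_dense_seq[OF fm refl op] by blast
  have "integrable (borel_on \<Omega>) (\<lambda>x. \<phi> n x - indicat_real B x)" for n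
    using \<open>integrable (borel_on \<Omega>) (indicat_real B)\<close> test_functions_integrable[OF fm refl \<phi>(1)] by auto
  from AE_tendsto_subseq[OF this \<phi>(2)] obtain r where
    r: "AE x in borel_on \<Omega>. (\<lambda>n. \<phi> (r n) x) \<longlonglongrightarrow> indicat_real B x" by blast
  \<comment> \<open>As \<open>h\<close> is integrable only against test functions, the argument is
    localised by a factor \<open>\<zeta>\<close>: the integral of \<open>h \<zeta>\<close> over the
    set where \<open>h\<close> is negative is both nonnegative and nonpositive.\<close>
  have *: "AE x in borel_on \<Omega>. x \<in> B \<longrightarrow> \<zeta> x = 0"
    if \<zeta>: "\<zeta> \<in> test_functions \<Omega>" "\<And>x. \<zeta> x \<ge> 0" for \<zeta>
  proof -
    have [measurable]: "\<zeta> \<in> borel_measurable (borel_on \<Omega>)" "\<phi> n \<in> borel_measurable (borel_on \<Omega>)"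
        "(\<lambda>x. tanh (\<phi> n x)) \<in> borel_measurable (borel_on \<Omega>)" for n
      using \<zeta> \<phi> by (auto intro: test_functions_measurable_on test_functions_tanh)
    let ?c = "tanh 1 * tanh (1::real)"
    have "(\<lambda>n. \<integral>x. h x * (\<zeta> x * (tanh (\<phi> (r n) x) * tanh (\<phi> (r n) x))) \<partial>borel_on \<Omega>) \<longlonglongrightarrow>
      (\<integral>x. ?c * (h x * \<zeta> x * indicator B x) \<partial>borel_on \<Omega>)"
    proof (rule integral_dominated_convergence)
      show "integrable (borel_on \<Omega>) (\<lambda>x. \<bar>h x * \<zeta> x\<bar>)" using int[OF \<zeta>(1)] by auto
      show "AE x in borel_on \<Omega>. (\<lambda>n. h x * (\<zeta> x * (tanh (\<phi> (r n) x) * tanh (\<phi> (r n) x))))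
          \<longlonglongrightarrow> ?c * (h x * \<zeta> x * indicator B x)"
        using r
      proof eventually_elim
        case (elim x)
        have "(\<lambda>n. h x * (\<zeta> x * (tanh (\<phi> (r n) x) * tanh (\<phi> (r n) x)))) \<longlonglongrightarrow>
            h x * (\<zeta> x * (tanh (indicat_real B x) * tanh (indicat_real B x)))"
          by (intro tendsto_mult tendsto_const tendsto_tanh[OF elim]) auto
        then show ?case by (cases "x \<in> B") (auto simp: mult_ac)
      qed
      show "AE x in borel_on \<Omega>. norm (h x * (\<zeta> x * (tanh (\<phi> (r n) x) * tanh (\<phi> (r n) x)))) \<le> \<bar>h x * \<zeta> x\<bar>" for n
      proof (intro AE_I2)
        fix x
        have "\<bar>tanh (\<phi> (r n) x)\<bar> \<le> 1"
          using tanh_real_abs[of "\<phi> (r n) x"] tanh_real_lt_1[of "\<bar>\<phi> (r n) x\<bar>"] by linarith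
        then have "\<bar>tanh (\<phi> (r n) x)\<bar> * \<bar>tanh (\<phi> (r n) x)\<bar> \<le> 1"
          by (intro mult_le_one) simp_all
        then show "norm (h x * (\<zeta> x * (tanh (\<phi> (r n) x) * tanh (\<phi> (r n) x)))) \<le> \<bar>h x * \<zeta> x\<bar>"
          using mult_left_mono[of "\<bar>tanh (\<phi> (r n) x)\<bar> * \<bar>tanh (\<phi> (r n) x)\<bar>" 1 "\<bar>h x * \<zeta> x\<bar>"]
          by (simp add: abs_mult mult.assoc)
      qed
    qed measurable
    moreover have "(\<integral>x. h x * (\<zeta> x * (tanh (\<phi> (r n) x) * tanh (\<phi> (r n) x))) \<partial>borel_on \<Omega>) \<ge> 0" for n
      using \<zeta> \<phi>
      by (intro nn) (auto intro!: test_functions_mult_left[of "\<lambda>x. tanh (\<phi> (r n) x) * tanh (\<phi> (r n) x)"]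
          test_functions_mult_left test_functions_tanh test_functions_smooth[of _ \<Omega>])
    ultimately have "(\<integral>x. ?c * (h x * \<zeta> x * indicator B x) \<partial>borel_on \<Omega>) \<ge> 0"
      by (intro LIMSEQ_le_const) auto
    moreover have "?c > 0" by simp
    ultimately have ge: "(\<integral>x. h x * \<zeta> x * indicator B x \<partial>borel_on \<Omega>) \<ge> 0"
      unfolding integral_mult_right_zero by (metis mult_le_cancel_left_pos mult_zero_right)
    have int': "integrable (borel_on \<Omega>) (\<lambda>x. - (h x * \<zeta> x * indicator B x))"
      using integrable_mult_indicator[OF _ int[OF \<zeta>(1)], of B] by (simp add: mult_ac)
    have pos: "0 \<le> - (h x * \<zeta> x * indicator B x)" for x
      using \<zeta>(2)[of x] by (auto simp: B_def indicator_def mult_nonpos_nonneg)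
    have "(\<integral>x. - (h x * \<zeta> x * indicator B x) \<partial>borel_on \<Omega>) = 0"
      using ge integral_nonneg_AE[where M="borel_on \<Omega>" and f="\<lambda>x. - (h x * \<zeta> x * indicator B x)"] pos
      by (simp)
    then have "AE x in borel_on \<Omega>. - (h x * \<zeta> x * indicator B x) = 0"
      using integral_nonneg_eq_0_iff_AE[OF int'] pos by simp
    then show ?thesis by eventually_elim (auto simp: B_def)
  qed
  \<comment> \<open>An exhausting sequence of cut-offs removes the localisation: at each point of
    the domain some \<open>\<zeta> n\<close> differs from 0.\<close>
  obtain \<zeta> where \<zeta>: "\<And>n. \<zeta> n \<in> test_functions \<Omega>" "\<And>n x. 0 \<le> \<zeta> n x \<and> \<zeta> n x \<le> 1"
      "\<And>x. (\<lambda>n. \<zeta> n x) \<longlonglongrightarrow> indicat_real \<Omega> x"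
    using open_cutoff[OF op] by blast
  have "AE x in borel_on \<Omega>. \<forall>n. x \<in> B \<longrightarrow> \<zeta> n x = 0"
    unfolding AE_all_countable using * \<zeta> by blast
  then show ?thesis using AE_space
  proof eventually_elim
    case (elim x)
    show ?case
    proof (rule ccontr)
      assume "\<not> h x \<ge> 0"
      then have "x \<in> B" using elim by (simp add: B_def)
      then have "(\<lambda>n. 0) \<longlonglongrightarrow> indicat_real \<Omega> x" using elim \<zeta>(3)[of x] by simp
      then show False
        using elim by (auto simp: space_restrict_space LIMSEQ_const_iff)
    qed
  qed
qed

lemma AE_eq_0_test_functions:
  fixes h :: "'a::euclidean_space \<Rightarrow> real"
  assumes "open \<Omega>" "bounded \<Omega>"
    and h: "h \<in> borel_measurable (borel_on \<Omega>)"
    and int: "\<And>\<xi>. \<xi> \<in> test_functions \<Omega> \<Longrightarrow> integrable (borel_on \<Omega>) (\<lambda>x. h x * \<xi> x)"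
    and eq: "\<And>\<xi>. \<xi> \<in> test_functions \<Omega> \<Longrightarrow> (\<integral>x. h x * \<xi> x \<partial>borel_on \<Omega>) = 0"
  shows "AE x in borel_on \<Omega>. h x = 0"
proof -
  have "AE x in borel_on \<Omega>. h x \<ge> 0"
    using assms by (intro AE_nonneg_test_functions) auto
  moreover have "AE x in borel_on \<Omega>. - h x \<ge> 0"
    using assms by (intro AE_nonneg_test_functions) auto
  ultimately show ?thesis by eventually_elim auto
qed

section \<open>Stability of the energy space under composition\<close>


lemma L2_measurable: "f \<in> L2 M \<Longrightarrow> f \<in> borel_measurable M"
  by (simp add: L2_def)

lemma L2_square_integrable: "f \<in> L2 M \<Longrightarrow> integrable M (\<lambda>x. (f x)\<^sup>2)"
  by (simp add: L2_def)

lemma L2_zero: "(\<lambda>x. 0) \<in> L2 M"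
  by (simp add: L2_def)

lemma LIMSEQ_zero_squeeze:
  fixes a b :: "nat \<Rightarrow> real"
  assumes "\<And>n. 0 \<le> a n" "\<And>n. a n \<le> b n" "b \<longlonglongrightarrow> 0"
  shows "a \<longlonglongrightarrow> 0"
  by (rule tendsto_sandwich[OF _ _ tendsto_const assms(3)]) (use assms in auto)

lemma L2_bound:
  assumes "f \<in> L2 M" "g \<in> borel_measurable M" "AE x in M. \<bar>g x\<bar> \<le> c * \<bar>f x\<bar>"
  shows "g \<in> L2 M"
  unfolding L2_def mem_Collect_eq
proof (intro conjI Bochner_Integration.integrable_bound[of M "\<lambda>x. c\<^sup>2 * (f x)\<^sup>2" "\<lambda>x. (g x)\<^sup>2"])
  show "AE x in M. norm ((g x)\<^sup>2) \<le> norm (c\<^sup>2 * (f x)\<^sup>2)"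
    using assms(3)
  proof eventually_elim
    case (elim x)
    then have "\<bar>g x\<bar>\<^sup>2 \<le> (c * \<bar>f x\<bar>)\<^sup>2" by (intro power_mono) auto
    then show ?case by (simp add: power_mult_distrib)
  qed
qed (use assms in \<open>auto simp: L2_def\<close>)

lemma L2_mult_integrable:
  assumes f: "f \<in> L2 M" and g: "g \<in> L2 M"
  shows "integrable M (\<lambda>x. f x * g x)"
proof (rule Bochner_Integration.integrable_bound)
  show "integrable M (\<lambda>x. (f x)\<^sup>2 + (g x)\<^sup>2)" using f g by (auto simp: L2_def)
  show "AE x in M. norm (f x * g x) \<le> norm ((f x)\<^sup>2 + (g x)\<^sup>2)"
  proof (intro AE_I2)
    fix x
    have "0 \<le> (\<bar>f x\<bar> - \<bar>g x\<bar>)\<^sup>2" "0 \<le> (f x)\<^sup>2" "0 \<le> (g x)\<^sup>2" by simp_all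
    then have "2 * (\<bar>f x\<bar> * \<bar>g x\<bar>) \<le> (f x)\<^sup>2 + (g x)\<^sup>2" by (simp add: power2_diff mult.assoc)
    moreover have "0 \<le> \<bar>f x\<bar> * \<bar>g x\<bar>" by simp
    ultimately have "\<bar>f x\<bar> * \<bar>g x\<bar> \<le> (f x)\<^sup>2 + (g x)\<^sup>2" by linarith
    then show "norm (f x * g x) \<le> norm ((f x)\<^sup>2 + (g x)\<^sup>2)"
      by (simp add: abs_mult)
  qed
qed (use f g in \<open>auto simp: L2_def\<close>)

lemma L2_add:
  assumes f: "f \<in> L2 M" and g: "g \<in> L2 M"
  shows "(\<lambda>x. f x + g x) \<in> L2 M"
  using f g L2_mult_integrable[OF f g] by (auto simp: L2_def power2_sum mult.assoc)

lemma L2_cmult: "f \<in> L2 M \<Longrightarrow> (\<lambda>x. c * f x) \<in> L2 M"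
  by (auto simp: L2_def power_mult_distrib)

lemma L2_diff:
  assumes f: "f \<in> L2 M" and g: "g \<in> L2 M"
  shows "(\<lambda>x. f x - g x) \<in> L2 M"
  using L2_add[OF f L2_cmult[OF g, of "-1"]] by simp

lemma L2_Cauchy_Schwarz:
  assumes f: "f \<in> L2 M" and g: "g \<in> L2 M"
  shows "(\<integral>x. f x * g x \<partial>M)\<^sup>2 \<le> (\<integral>x. (f x)\<^sup>2 \<partial>M) * (\<integral>x. (g x)\<^sup>2 \<partial>M)"
proof -
  let ?F = "\<integral>x. (f x)\<^sup>2 \<partial>M" and ?G = "\<integral>x. (g x)\<^sup>2 \<partial>M" and ?X = "\<integral>x. f x * g x \<partial>M"
  have G: "0 \<le> ?G" by (intro integral_nonneg_AE) auto
  show ?thesis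
  proof (cases "?G = 0")
    case True
    then have "AE x in M. (g x)\<^sup>2 = 0"
      using integral_nonneg_eq_0_iff_AE[OF L2_square_integrable[OF g]] by simp
    then have "AE x in M. f x * g x = 0" by eventually_elim auto
    then have "?X = 0" by (rule integral_eq_zero_AE)
    then show ?thesis using True by simp
  next
    case False
    \<comment> \<open>The minimiser of the integral of (f - t g)^2 as a function of t.\<close>
    define t where "t = ?X / ?G"
    have "0 \<le> (\<integral>x. (f x - t * g x)\<^sup>2 \<partial>M)" by (intro integral_nonneg_AE) auto
    also have "(\<integral>x. (f x - t * g x)\<^sup>2 \<partial>M) = (\<integral>x. (f x)\<^sup>2 + t\<^sup>2 * (g x)\<^sup>2 - 2 * t * (f x * g x) \<partial>M)"
      by (intro Bochner_Integration.integral_cong) (auto simp: power2_diff power_mult_distrib)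
    also have "\<dots> = ?F + t\<^sup>2 * ?G - 2 * t * ?X"
      using L2_square_integrable[OF f] L2_square_integrable[OF g] L2_mult_integrable[OF f g] by simp
    also have "\<dots> = ?F - ?X\<^sup>2 / ?G"
      using False by (simp add: t_def field_simps power2_eq_square)
    finally show ?thesis using G False by (simp add: field_simps)
  qed
qed

text \<open>Membership in \<open>L2\<close> belongs to the notion, since the integral of a
  non-integrable square is 0 and convergence would then hold for no reason. Squared distances avoid
  square roots; the next lemma relates them to \<open>l2_norm\<close>.\<close>

definition l2_tendsto :: "'a measure \<Rightarrow> (nat \<Rightarrow> 'a \<Rightarrow> real) \<Rightarrow> ('a \<Rightarrow> real) \<Rightarrow> bool" where
  "l2_tendsto M f g \<longleftrightarrow> (\<forall>n. f n \<in> L2 M) \<and> g \<in> L2 M \<and> (\<lambda>n. \<integral>x. (f n x - g x)\<^sup>2 \<partial>M) \<longlonglongrightarrow> 0"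

lemma l2_norm_tendsto_0_iff:
  "(\<lambda>n. l2_norm M (f n)) \<longlonglongrightarrow> 0 \<longleftrightarrow> (\<lambda>n. \<integral>x. (f n x)\<^sup>2 \<partial>M) \<longlonglongrightarrow> 0"
proof -
  have nn: "0 \<le> (\<integral>x. (f n x)\<^sup>2 \<partial>M)" for n by (intro integral_nonneg_AE) auto
  have eq: "l2_norm M (f n) = sqrt (\<integral>x. (f n x)\<^sup>2 \<partial>M)" for n
    by (simp add: l2_norm_def l2_inner_def power2_eq_square)
  have "(\<lambda>n. \<integral>x. (f n x)\<^sup>2 \<partial>M) \<longlonglongrightarrow> 0" if "(\<lambda>n. sqrt (\<integral>x. (f n x)\<^sup>2 \<partial>M)) \<longlonglongrightarrow> 0"
    using tendsto_power[OF that, of 2] nn by simp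
  moreover have "(\<lambda>n. sqrt (\<integral>x. (f n x)\<^sup>2 \<partial>M)) \<longlonglongrightarrow> 0" if "(\<lambda>n. \<integral>x. (f n x)\<^sup>2 \<partial>M) \<longlonglongrightarrow> 0"
    using tendsto_real_sqrt[OF that] by simp
  ultimately show ?thesis unfolding eq by blast
qed

lemma l2_tendsto_add:
  assumes f: "l2_tendsto M f f'" and g: "l2_tendsto M g g'"
  shows "l2_tendsto M (\<lambda>n x. f n x + g n x) (\<lambda>x. f' x + g' x)"
proof -
  have L: "f n \<in> L2 M" "f' \<in> L2 M" "g n \<in> L2 M" "g' \<in> L2 M" for n
    using f g by (auto simp: l2_tendsto_def)
  have int: "integrable M (\<lambda>x. (f n x - f' x)\<^sup>2)" "integrable M (\<lambda>x. (g n x - g' x)\<^sup>2)" for n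
    by (intro L2_square_integrable L2_diff L)+
  have le: "(\<integral>x. (f n x + g n x - (f' x + g' x))\<^sup>2 \<partial>M)
     \<le> 2 * (\<integral>x. (f n x - f' x)\<^sup>2 \<partial>M) + 2 * (\<integral>x. (g n x - g' x)\<^sup>2 \<partial>M)" for n
  proof -
    have "(\<integral>x. (f n x + g n x - (f' x + g' x))\<^sup>2 \<partial>M)
       \<le> (\<integral>x. 2 * (f n x - f' x)\<^sup>2 + 2 * (g n x - g' x)\<^sup>2 \<partial>M)"
    proof (rule integral_mono)
      show "integrable M (\<lambda>x. (f n x + g n x - (f' x + g' x))\<^sup>2)"
        by (intro L2_square_integrable L2_diff L2_add L)
      fix x
      have "(a + b)\<^sup>2 \<le> 2 * a\<^sup>2 + 2 * b\<^sup>2" for a b :: real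
        using zero_le_power2[of "a - b"] by (simp add: power2_sum power2_diff)
      from this[of "f n x - f' x" "g n x - g' x"]
      show "(f n x + g n x - (f' x + g' x))\<^sup>2 \<le> 2 * (f n x - f' x)\<^sup>2 + 2 * (g n x - g' x)\<^sup>2"
        by (simp add: algebra_simps)
    qed (use int in auto)
    also have "\<dots> = 2 * (\<integral>x. (f n x - f' x)\<^sup>2 \<partial>M) + 2 * (\<integral>x. (g n x - g' x)\<^sup>2 \<partial>M)"
      using int by simp
    finally show ?thesis .
  qed
  have lim: "(\<lambda>n. 2 * (\<integral>x. (f n x - f' x)\<^sup>2 \<partial>M) + 2 * (\<integral>x. (g n x - g' x)\<^sup>2 \<partial>M)) \<longlonglongrightarrow> 2 * 0 + 2 * 0"
    using f g unfolding l2_tendsto_def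
    by (intro tendsto_add tendsto_mult tendsto_const) auto
  have "(\<lambda>n. \<integral>x. (f n x + g n x - (f' x + g' x))\<^sup>2 \<partial>M) \<longlonglongrightarrow> 0"
    by (rule tendsto_sandwich[OF _ _ tendsto_const])
      (use lim le in \<open>auto intro!: always_eventually integral_nonneg_AE\<close>)
  then show ?thesis using L by (auto simp: l2_tendsto_def intro: L2_add)
qed

lemma l2_tendsto_dominated:
  assumes [measurable]: "\<And>n. f n \<in> borel_measurable M" and g: "g \<in> borel_measurable M"
    and lim: "AE x in M. (\<lambda>n. f n x) \<longlonglongrightarrow> g x"
    and h: "h \<in> L2 M" "\<And>n. AE x in M. \<bar>f n x\<bar> \<le> \<bar>h x\<bar>"
  shows "l2_tendsto M f g"
proof -
  have [measurable]: "g \<in> borel_measurable M" by fact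
  have "AE x in M. \<forall>n. \<bar>f n x\<bar> \<le> \<bar>h x\<bar>" using h by (simp add: AE_all_countable)
  then have g_le: "AE x in M. \<bar>g x\<bar> \<le> \<bar>h x\<bar>"
    using lim
  proof eventually_elim
    case (elim x)
    then show ?case by (intro LIMSEQ_le_const2[OF tendsto_rabs[OF elim(2)]]) auto
  qed
  have L: "f n \<in> L2 M" "g \<in> L2 M" for n
    using h(2)[of n] g_le L2_bound[OF h(1), of "f n" 1] L2_bound[OF h(1), of g 1] g by simp_all
  have "(\<lambda>n. \<integral>x. (f n x - g x)\<^sup>2 \<partial>M) \<longlonglongrightarrow> (\<integral>x. 0 \<partial>M)"
  proof (rule integral_dominated_convergence)
    show "integrable M (\<lambda>x. 4 * (h x)\<^sup>2)" using h by (auto simp: L2_def)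
    show "AE x in M. (\<lambda>n. (f n x - g x)\<^sup>2) \<longlonglongrightarrow> 0"
      using lim
    proof eventually_elim
      case (elim x)
      from tendsto_power[OF LIM_zero[OF elim], of 2] show ?case by simp
    qed
    show "AE x in M. norm ((f n x - g x)\<^sup>2) \<le> 4 * (h x)\<^sup>2" for n
      using h(2)[of n] g_le
    proof eventually_elim
      case (elim x)
      then have "\<bar>f n x - g x\<bar>\<^sup>2 \<le> (2 * \<bar>h x\<bar>)\<^sup>2" by (intro power_mono) auto
      then show ?case by (simp add: power_mult_distrib)
    qed
  qed auto
  then show ?thesis using L by (simp add: l2_tendsto_def)
qed

text \<open>Write the product as b_n (f_n - f') + b_n f'. The uniform bound on b_n makes the first
  term small in L^2, and the second converges by domination with \<open>B * f'\<close>. This is the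
  form in which both the chain rule and the product rule pass to the limit.\<close>

lemma l2_tendsto_mult_bounded:
  assumes f: "l2_tendsto M f f'" and [measurable]: "\<And>n. b n \<in> borel_measurable M"
    and b': "b' \<in> borel_measurable M" and B: "\<And>n. AE x in M. \<bar>b n x\<bar> \<le> B"
    and lim: "AE x in M. (\<lambda>n. b n x) \<longlonglongrightarrow> b' x"
  shows "l2_tendsto M (\<lambda>n x. b n x * f n x) (\<lambda>x. b' x * f' x)"
proof -
  have [measurable]: "b' \<in> borel_measurable M" by fact
  have L: "f n \<in> L2 M" "f' \<in> L2 M" for n using f by (auto simp: l2_tendsto_def)
  have [measurable]: "f n \<in> borel_measurable M" "f' \<in> borel_measurable M" for n
    using L by (auto intro: L2_measurable)
  have 1: "l2_tendsto M (\<lambda>n x. b n x * (f n x - f' x)) (\<lambda>x. 0)"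
    unfolding l2_tendsto_def
  proof (intro conjI allI)
    show L': "(\<lambda>x. b n x * (f n x - f' x)) \<in> L2 M" for n
      by (rule L2_bound[OF L2_diff[OF L(1)[of n] L(2)], of _ B])
        (use B[of n] in \<open>auto simp: abs_mult intro: mult_right_mono elim!: eventually_mono\<close>)
    have le: "(\<integral>x. (b n x * (f n x - f' x) - 0)\<^sup>2 \<partial>M) \<le> B\<^sup>2 * (\<integral>x. (f n x - f' x)\<^sup>2 \<partial>M)" for n
    proof -
      have "(\<integral>x. (b n x * (f n x - f' x) - 0)\<^sup>2 \<partial>M) \<le> (\<integral>x. B\<^sup>2 * (f n x - f' x)\<^sup>2 \<partial>M)"
      proof (rule integral_mono_AE)
        show "integrable M (\<lambda>x. (b n x * (f n x - f' x) - 0)\<^sup>2)"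
          using L2_square_integrable[OF L'] by simp
        show "integrable M (\<lambda>x. B\<^sup>2 * (f n x - f' x)\<^sup>2)"
          using L2_square_integrable[OF L2_diff[OF L(1)[of n] L(2)]] by simp
        show "AE x in M. (b n x * (f n x - f' x) - 0)\<^sup>2 \<le> B\<^sup>2 * (f n x - f' x)\<^sup>2"
          using B[of n]
        proof eventually_elim
          case (elim x)
          then have "\<bar>b n x\<bar>\<^sup>2 \<le> B\<^sup>2" by (intro power_mono) auto
          then show ?case by (auto simp: power_mult_distrib intro: mult_right_mono)
        qed
      qed
      then show ?thesis by simp
    qed
    have "(\<lambda>n. B\<^sup>2 * (\<integral>x. (f n x - f' x)\<^sup>2 \<partial>M)) \<longlonglongrightarrow> B\<^sup>2 * 0"
      using f unfolding l2_tendsto_def by (intro tendsto_mult tendsto_const) auto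
    then show "(\<lambda>n. \<integral>x. (b n x * (f n x - f' x) - 0)\<^sup>2 \<partial>M) \<longlonglongrightarrow> 0"
      using le by (intro LIMSEQ_zero_squeeze[of "\<lambda>n. \<integral>x. (b n x * (f n x - f' x) - 0)\<^sup>2 \<partial>M" "\<lambda>n. B\<^sup>2 * (\<integral>x. (f n x - f' x)\<^sup>2 \<partial>M)"])
        simp_all
  qed (auto simp: L2_def)
  have 2: "l2_tendsto M (\<lambda>n x. b n x * f' x) (\<lambda>x. b' x * f' x)"
  proof (rule l2_tendsto_dominated)
    show "(\<lambda>x. B * f' x) \<in> L2 M" by (intro L2_cmult L)
    show "AE x in M. (\<lambda>n. b n x * f' x) \<longlonglongrightarrow> b' x * f' x"
      using lim by eventually_elim (rule tendsto_mult[OF _ tendsto_const])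
    show "AE x in M. \<bar>b n x * f' x\<bar> \<le> \<bar>B * f' x\<bar>" for n
      using B[of n] by eventually_elim (auto simp: abs_mult intro!: mult_right_mono)
  qed measurable
  from l2_tendsto_add[OF 1 2] show ?thesis by (simp add: algebra_simps)
qed

lemma l2_tendsto_const: "f \<in> L2 M \<Longrightarrow> l2_tendsto M (\<lambda>n. f) f"
  by (simp add: l2_tendsto_def)

lemma l2_tendsto_subseq: "l2_tendsto M f g \<Longrightarrow> strict_mono r \<Longrightarrow> l2_tendsto M (\<lambda>n. f (r n)) g"
  unfolding l2_tendsto_def using LIMSEQ_subseq_LIMSEQ[of "\<lambda>n. \<integral>x. (f n x - g x)\<^sup>2 \<partial>M" 0 r]
  by (simp add: o_def)

lemma l2_tendsto_AE_subseq:
  assumes "l2_tendsto M f g"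
  shows "\<exists>r::nat \<Rightarrow> nat. strict_mono r \<and> (AE x in M. (\<lambda>n. f (r n) x) \<longlonglongrightarrow> g x)"
proof -
  have "integrable M (\<lambda>x. (f n x - g x)\<^sup>2)" for n
    using assms by (intro L2_square_integrable L2_diff) (auto simp: l2_tendsto_def)
  moreover have "(\<lambda>n. \<integral>x. norm ((f n x - g x)\<^sup>2) \<partial>M) \<longlonglongrightarrow> 0"
    using assms by (simp add: l2_tendsto_def)
  ultimately obtain r :: "nat \<Rightarrow> nat" where r: "strict_mono r" "AE x in M. (\<lambda>n. (f (r n) x - g x)\<^sup>2) \<longlonglongrightarrow> 0"
    using tendsto_L1_AE_subseq[of M "\<lambda>n x. (f n x - g x)\<^sup>2"] by auto
  from r(2) have "AE x in M. (\<lambda>n. f (r n) x) \<longlonglongrightarrow> g x"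
  proof eventually_elim
    case (elim x)
    have "(\<lambda>n. \<bar>f (r n) x - g x\<bar>) \<longlonglongrightarrow> 0" using tendsto_real_sqrt[OF elim] by simp
    then show ?case by (rule LIM_zero_cancel[OF tendsto_rabs_zero_cancel])
  qed
  then show ?thesis using r by blast
qed

lemma l2_tendsto_integral_mult:
  assumes f: "l2_tendsto M f g" and h: "h \<in> L2 M"
  shows "(\<lambda>n. \<integral>x. f n x * h x \<partial>M) \<longlonglongrightarrow> (\<integral>x. g x * h x \<partial>M)"
proof -
  have L: "f n \<in> L2 M" "g \<in> L2 M" for n using f by (auto simp: l2_tendsto_def)
  have eq: "(\<integral>x. (f n x - g x) * h x \<partial>M) = (\<integral>x. f n x * h x \<partial>M) - (\<integral>x. g x * h x \<partial>M)" for n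
    using L2_mult_integrable[OF L(1)[of n] h] L2_mult_integrable[OF L(2) h] by (simp add: left_diff_distrib)
  have "(\<lambda>n. (\<integral>x. (f n x - g x)\<^sup>2 \<partial>M) * (\<integral>x. (h x)\<^sup>2 \<partial>M)) \<longlonglongrightarrow> 0 * (\<integral>x. (h x)\<^sup>2 \<partial>M)"
    using f unfolding l2_tendsto_def by (intro tendsto_mult tendsto_const) auto
  then have "(\<lambda>n. (\<integral>x. (f n x - g x) * h x \<partial>M)\<^sup>2) \<longlonglongrightarrow> 0"
    using L2_Cauchy_Schwarz[OF L2_diff[OF L] h]
    by (intro LIMSEQ_zero_squeeze[of "\<lambda>n. (\<integral>x. (f n x - g x) * h x \<partial>M)\<^sup>2"
        "\<lambda>n. (\<integral>x. (f n x - g x)\<^sup>2 \<partial>M) * (\<integral>x. (h x)\<^sup>2 \<partial>M)"]) simp_all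
  from tendsto_real_sqrt[OF this] have "(\<lambda>n. \<bar>\<integral>x. (f n x - g x) * h x \<partial>M\<bar>) \<longlonglongrightarrow> 0" by simp
  then show ?thesis unfolding eq by (rule LIM_zero_cancel[OF tendsto_rabs_zero_cancel])
qed

section \<open>Test functions in L^2 and the space H^1_0\<close>

lemma test_functions_L2:
  assumes "open \<Omega>" "bounded \<Omega>" "\<phi> \<in> test_functions \<Omega>"
  shows "\<phi> \<in> L2 (borel_on \<Omega>)"
proof -
  have "(\<lambda>x. \<phi> x * \<phi> x) \<in> test_functions \<Omega>"
    using assms by (intro test_functions_mult_left) (auto intro: test_functions_smooth)
  from test_functions_integrable[OF finite_measure_borel_on[OF assms(1,2)] refl this]
  show ?thesis using test_functions_measurable_on[OF assms(3)] by (simp add: L2_def power2_eq_square)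
qed

text \<open>The integral of phi(x + h v) is independent of h by translation invariance, so every
  difference quotient integrates to 0; dominated convergence carries this to the derivative. Applied
  to products it yields integration by parts.\<close>

lemma integral_frechet_derivative_test_function:
  fixes \<phi> :: "'a::euclidean_space \<Rightarrow> real"
  assumes "\<phi> \<in> test_functions \<Omega>" and "open \<Omega>"
  shows "(\<integral>x. frechet_derivative \<phi> (at x) v \<partial>borel_on \<Omega>) = 0"
proof -
  let ?D = "\<lambda>x. frechet_derivative \<phi> (at x) v"
  have D: "?D \<in> test_functions \<Omega>" by (rule test_functions_frechet_derivative[OF assms(1)])
  obtain K where K: "compact K" "K \<subseteq> \<Omega>" "\<And>x. x \<notin> K \<Longrightarrow> \<phi> x = 0"
    using assms(1) unfolding test_functions_iff by blast
  obtain R where R: "\<And>x. x \<in> K \<Longrightarrow> norm x \<le> R" using compact_imp_bounded[OF K(1)] by (auto simp: bounded_iff)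
  obtain B where B: "B > 0" "\<And>x. \<bar>?D x\<bar> \<le> B" using test_functions_bounded[OF D] by blast
  have [measurable]: "\<phi> \<in> borel_measurable borel" "?D \<in> borel_measurable borel"
    using assms(1) D by (auto intro: test_functions_measurable)
  have line: "((\<lambda>t. \<phi> (x + t *\<^sub>R v)) has_real_derivative ?D (x + t *\<^sub>R v)) (at t)" for x t
  proof -
    have d: "(\<phi> has_derivative frechet_derivative \<phi> (at (x + t *\<^sub>R v))) (at (x + t *\<^sub>R v))"
      using smooth_imp_differentiable[OF test_functions_smooth[OF assms(1)]]
      by (simp add: frechet_derivative_works)
    have "((\<lambda>t. x + t *\<^sub>R v) has_derivative (\<lambda>t. t *\<^sub>R v)) (at t)"
      by (auto intro!: derivative_eq_intros)
    from has_derivative_compose[OF this d]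
    have "((\<lambda>t. \<phi> (x + t *\<^sub>R v)) has_derivative (\<lambda>s. frechet_derivative \<phi> (at (x + t *\<^sub>R v)) (s *\<^sub>R v))) (at t)" .
    moreover have "linear (frechet_derivative \<phi> (at (x + t *\<^sub>R v)))"
      using d by (rule has_derivative_linear)
    ultimately show ?thesis
      by (simp add: has_field_derivative_def linear_cmul mult.commute[of _ "?D (x + t *\<^sub>R v)"] linear_scale)
  qed
  define h where "h = (\<lambda>n. inverse (real (Suc n)))"
  have h: "0 < h n" "h n \<le> 1" for n by (auto simp: h_def field_simps)
  have h_lim: "h \<longlonglongrightarrow> 0" unfolding h_def by (rule LIMSEQ_inverse_real_of_nat)
  have int_\<phi>: "integrable lborel \<phi>"
  proof -
    have "integrable lborel (\<lambda>x. indicator K x *\<^sub>R \<phi> x)"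
      by (rule borel_integrable_compact[OF K(1) smooth_imp_continuous_on[OF test_functions_smooth[OF assms(1)]]])
    moreover have "(\<lambda>x. indicator K x *\<^sub>R \<phi> x) = \<phi>" using K(3) unfolding fun_eq_iff indicator_def by fastforce
    ultimately show ?thesis by simp
  qed
  have shift: "integrable lborel (\<lambda>x. \<phi> (x + c))" "(\<integral>x. \<phi> (x + c) \<partial>lborel) = (\<integral>x. \<phi> x \<partial>lborel)" for c
  proof -
    have eq: "distr lborel borel ((+) c) = (lborel :: 'a measure)" by (rule lborel_distr_plus)
    show "integrable lborel (\<lambda>x. \<phi> (x + c))"
      using int_\<phi> integrable_distr_eq[of "(+) c" lborel borel \<phi>] by (simp add: eq add.commute)
    show "(\<integral>x. \<phi> (x + c) \<partial>lborel) = (\<integral>x. \<phi> x \<partial>lborel)"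
      using integral_distr[of "(+) c" lborel borel \<phi>] by (simp add: eq add.commute)
  qed
  have "(\<lambda>n. \<integral>x. (\<phi> (x + h n *\<^sub>R v) - \<phi> x) / h n \<partial>lborel) \<longlonglongrightarrow> (\<integral>x. ?D x \<partial>lborel)"
  proof (rule integral_dominated_convergence)
    \<comment> \<open>As \<open>h n \<le> 1\<close>, for x outside the ball of radius
      \<open>R + norm v\<close> both x and its translate miss the support; inside, the mean value
      theorem bounds the quotient by \<open>B\<close>.\<close>
    show "integrable lborel (\<lambda>x. indicator (cball 0 (R + norm v)) x *\<^sub>R B)"
      by (rule borel_integrable_compact) auto
    show "AE x in lborel. (\<lambda>n. (\<phi> (x + h n *\<^sub>R v) - \<phi> x) / h n) \<longlonglongrightarrow> ?D x"
    proof (intro AE_I2)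
      fix x
      have "((\<lambda>t. (\<phi> (x + t *\<^sub>R v) - \<phi> x) / t) \<longlongrightarrow> ?D x) (at 0)"
        using line[of x 0] by (simp add: DERIV_def)
      moreover have "filterlim h (at 0) sequentially"
        using h_lim h by (auto simp: filterlim_at intro!: always_eventually) (metis less_irrefl)
      ultimately show "(\<lambda>n. (\<phi> (x + h n *\<^sub>R v) - \<phi> x) / h n) \<longlonglongrightarrow> ?D x"
        by (rule filterlim_compose)
    qed
    show "AE x in lborel. norm ((\<phi> (x + h n *\<^sub>R v) - \<phi> x) / h n) \<le> indicator (cball 0 (R + norm v)) x *\<^sub>R B" for n
    proof (intro AE_I2)
      fix x
      show "norm ((\<phi> (x + h n *\<^sub>R v) - \<phi> x) / h n) \<le> indicator (cball 0 (R + norm v)) x *\<^sub>R B"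
      proof (cases "x \<in> cball 0 (R + norm v)")
        case True
        have "norm (\<phi> (x + h n *\<^sub>R v) - \<phi> (x + 0 *\<^sub>R v)) \<le> B * norm (h n - 0)"
          by (rule field_differentiable_bound[of UNIV "\<lambda>t. \<phi> (x + t *\<^sub>R v)" "\<lambda>t. ?D (x + t *\<^sub>R v)"])
            (use B line in auto)
        then show ?thesis using True h[of n] by (simp add: field_simps)
      next
        case False
        then have x: "norm x > R + norm v" by simp
        have "norm x \<le> norm (x + h n *\<^sub>R v) + norm (h n *\<^sub>R v)"
          using norm_triangle_ineq4[of "x + h n *\<^sub>R v" "h n *\<^sub>R v"] by simp
        moreover have "norm (h n *\<^sub>R v) \<le> norm v"
          using h[of n] mult_right_mono[of "h n" 1 "norm v"] by simp
        ultimately have "x + h n *\<^sub>R v \<notin> K" "x \<notin> K"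
          using x R[of x] R[of "x + h n *\<^sub>R v"] norm_ge_zero[of v] by auto
        then show ?thesis using K(3) False by simp
      qed
    qed
  qed (auto intro!: measurable_compose[where g=\<phi>])
  moreover have "(\<integral>x. (\<phi> (x + h n *\<^sub>R v) - \<phi> x) / h n \<partial>lborel) = 0" for n
    using shift int_\<phi> by simp
  ultimately have "(\<lambda>n. 0) \<longlonglongrightarrow> (\<integral>x. ?D x \<partial>lborel)" by (simp only:)
  then have "(\<integral>x. ?D x \<partial>lborel) = 0" by (simp add: LIMSEQ_const_iff)
  moreover have "(\<integral>x. ?D x \<partial>borel_on \<Omega>) = (\<integral>x. indicator \<Omega> x *\<^sub>R ?D x \<partial>lborel)"
    using \<open>open \<Omega>\<close> by (intro integral_restrict_space) auto
  moreover have "(\<lambda>x. indicator \<Omega> x *\<^sub>R ?D x) = ?D"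
    using test_functions_outside[OF D] unfolding fun_eq_iff indicator_def by fastforce
  ultimately show ?thesis by simp
qed

text \<open>The limit gradient \<open>g\<close> and the approximating sequence are made explicit, so
  that chain and product rules can be stated as operations on values, gradients and approximants
  together.\<close>

definition H10_limit :: "'a::euclidean_space set \<Rightarrow> ('a \<Rightarrow> real) \<Rightarrow> ('a \<Rightarrow> 'a \<Rightarrow> real) \<Rightarrow> (nat \<Rightarrow> 'a \<Rightarrow> real) \<Rightarrow> bool" where
  "H10_limit \<Omega> u g us \<longleftrightarrow> (\<forall>n. us n \<in> test_functions \<Omega>) \<and> l2_tendsto (borel_on \<Omega>) us u \<and>
     (\<forall>i\<in>Basis. l2_tendsto (borel_on \<Omega>) (\<lambda>n x. frechet_derivative (us n) (at x) i) (g i))"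

lemma H10_limit_subseq:
  "H10_limit \<Omega> u g us \<Longrightarrow> strict_mono r \<Longrightarrow> H10_limit \<Omega> u g (\<lambda>n. us (r n))"
  unfolding H10_limit_def
  using l2_tendsto_subseq[of "borel_on \<Omega>" us u r]
    l2_tendsto_subseq[of "borel_on \<Omega>" "\<lambda>n x. frechet_derivative (us n) (at x) i" "g i" r for i]
  by blast

lemma H10_limit_AE:
  assumes "H10_limit \<Omega> u g us"
  shows "\<exists>r::nat \<Rightarrow> nat. strict_mono r \<and> H10_limit \<Omega> u g (\<lambda>n. us (r n)) \<and>
    (AE x in borel_on \<Omega>. (\<lambda>n. us (r n) x) \<longlonglongrightarrow> u x)"
  using l2_tendsto_AE_subseq[of "borel_on \<Omega>" us u] H10_limit_subseq[OF assms] assms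
  unfolding H10_limit_def by blast

text \<open>Integration by parts is exact for the approximants, and both of its sides are continuous
  in L^2.\<close>

lemma H10_limit_weak_partial:
  assumes op: "open \<Omega>" "bounded \<Omega>" and us: "H10_limit \<Omega> u g us" and i: "i \<in> Basis"
  shows "weak_partial \<Omega> i u (g i)"
  unfolding weak_partial_def
proof
  fix \<phi> assume \<phi>: "\<phi> \<in> test_functions \<Omega>"
  have test: "us n \<in> test_functions \<Omega>" for n using us by (simp add: H10_limit_def)
  have \<phi>L: "\<phi> \<in> L2 (borel_on \<Omega>)" "(\<lambda>x. frechet_derivative \<phi> (at x) i) \<in> L2 (borel_on \<Omega>)"
    by (intro test_functions_L2 op \<phi> test_functions_frechet_derivative)+
  have usL: "us n \<in> L2 (borel_on \<Omega>)" "(\<lambda>x. frechet_derivative (us n) (at x) i) \<in> L2 (borel_on \<Omega>)" for n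
    by (intro test_functions_L2 op test test_functions_frechet_derivative)+
  have parts: "(\<integral>x. us n x * frechet_derivative \<phi> (at x) i \<partial>borel_on \<Omega>)
      = - (\<integral>x. frechet_derivative (us n) (at x) i * \<phi> x \<partial>borel_on \<Omega>)" for n
  proof -
    have d: "((\<lambda>x. us n x * \<phi> x) has_derivative
        (\<lambda>v. us n x * frechet_derivative \<phi> (at x) v + frechet_derivative (us n) (at x) v * \<phi> x)) (at x)" for x
      using smooth_imp_differentiable[OF test_functions_smooth[OF test]]
        smooth_imp_differentiable[OF test_functions_smooth[OF \<phi>]]
      by (intro has_derivative_mult) (auto simp: frechet_derivative_works[symmetric])
    have "(\<lambda>x. us n x * \<phi> x) \<in> test_functions \<Omega>"
      by (intro test_functions_mult_left \<phi> test_functions_smooth[OF test])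
    from integral_frechet_derivative_test_function[OF this op(1), of i]
    have "(\<integral>x. us n x * frechet_derivative \<phi> (at x) i + frechet_derivative (us n) (at x) i * \<phi> x \<partial>borel_on \<Omega>) = 0"
      by (simp add: frechet_derivative_eqI[OF d])
    then show ?thesis
      using L2_mult_integrable[OF usL(1) \<phi>L(2)] L2_mult_integrable[OF usL(2) \<phi>L(1)] by simp
  qed
  have "(\<lambda>n. \<integral>x. us n x * frechet_derivative \<phi> (at x) i \<partial>borel_on \<Omega>) \<longlonglongrightarrow>
      (\<integral>x. u x * frechet_derivative \<phi> (at x) i \<partial>borel_on \<Omega>)"
    using us \<phi>L by (intro l2_tendsto_integral_mult) (auto simp: H10_limit_def)
  moreover have "(\<lambda>n. - (\<integral>x. frechet_derivative (us n) (at x) i * \<phi> x \<partial>borel_on \<Omega>)) \<longlonglongrightarrow>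
      - (\<integral>x. g i x * \<phi> x \<partial>borel_on \<Omega>)"
    using us \<phi>L i by (intro tendsto_minus l2_tendsto_integral_mult) (auto simp: H10_limit_def)
  ultimately show "(\<integral>x. u x * frechet_derivative \<phi> (at x) i \<partial>borel_on \<Omega>) = - (\<integral>x. g i x * \<phi> x \<partial>borel_on \<Omega>)"
    unfolding parts by (rule LIMSEQ_unique)
qed

lemma weak_partial_unique:
  assumes op: "open \<Omega>" "bounded \<Omega>" and g: "g \<in> L2 (borel_on \<Omega>)" "weak_partial \<Omega> i u g"
    and h: "h \<in> L2 (borel_on \<Omega>)" "weak_partial \<Omega> i u h"
  shows "AE x in borel_on \<Omega>. g x = h x"
proof -
  have "AE x in borel_on \<Omega>. g x - h x = 0"
  proof (rule AE_eq_0_test_functions[OF op])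
    show "(\<lambda>x. g x - h x) \<in> borel_measurable (borel_on \<Omega>)" by (intro L2_measurable L2_diff g h)
    fix \<xi> assume \<xi>: "\<xi> \<in> test_functions \<Omega>"
    have L: "\<xi> \<in> L2 (borel_on \<Omega>)" by (intro test_functions_L2 op \<xi>)
    show "integrable (borel_on \<Omega>) (\<lambda>x. (g x - h x) * \<xi> x)"
      by (intro L2_mult_integrable L2_diff g h L)
    show "(\<integral>x. (g x - h x) * \<xi> x \<partial>borel_on \<Omega>) = 0"
      using g(2) h(2) \<xi> L2_mult_integrable[OF g(1) L] L2_mult_integrable[OF h(1) L]
      by (simp add: weak_partial_def left_diff_distrib)
  qed
  then show ?thesis by simp
qed

text \<open>The definition of \<open>Sobolev_H10\<close> demands convergence to every weak partial
  derivative. These agree almost everywhere by \<open>weak_partial_unique\<close>, so that it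
  suffices to exhibit one limit of the gradients.\<close>

lemma Sobolev_H10_iff:
  assumes op: "open \<Omega>" "bounded \<Omega>"
  shows "u \<in> Sobolev_H10 \<Omega> \<longleftrightarrow> (\<exists>g us. H10_limit \<Omega> u g us)"
proof
  assume "u \<in> Sobolev_H10 \<Omega>"
  then obtain us where u: "u \<in> L2 (borel_on \<Omega>)" "\<forall>i\<in>Basis. \<exists>g\<in>L2 (borel_on \<Omega>). weak_partial \<Omega> i u g"
    and us: "\<forall>n. us n \<in> test_functions \<Omega>" "(\<lambda>n. l2_norm (borel_on \<Omega>) (\<lambda>x. us n x - u x)) \<longlonglongrightarrow> 0"
      "\<forall>i\<in>Basis. \<forall>g\<in>L2 (borel_on \<Omega>). weak_partial \<Omega> i u g \<longrightarrow>
        (\<lambda>n. l2_norm (borel_on \<Omega>) (\<lambda>x. frechet_derivative (us n) (at x) i - g x)) \<longlonglongrightarrow> 0"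
    unfolding Sobolev_H10_def Sobolev_H1_def by blast
  obtain g where g: "\<And>i. i \<in> Basis \<Longrightarrow> g i \<in> L2 (borel_on \<Omega>)" "\<And>i. i \<in> Basis \<Longrightarrow> weak_partial \<Omega> i u (g i)"
  proof -
    have "\<forall>i\<in>Basis. \<exists>g. g \<in> L2 (borel_on \<Omega>) \<and> weak_partial \<Omega> i u g" using u(2) by blast
    from bchoice[OF this] show ?thesis using that by blast
  qed
  have "H10_limit \<Omega> u g us"
    unfolding H10_limit_def l2_tendsto_def l2_norm_tendsto_0_iff[symmetric]
    using us u g op by (auto intro!: test_functions_L2 test_functions_frechet_derivative)
  then show "\<exists>g us. H10_limit \<Omega> u g us" by blast
next
  assume "\<exists>g us. H10_limit \<Omega> u g us"
  then obtain g us where lim: "H10_limit \<Omega> u g us" by blast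
  have L: "u \<in> L2 (borel_on \<Omega>)" "\<And>i. i \<in> Basis \<Longrightarrow> g i \<in> L2 (borel_on \<Omega>)"
    using lim by (auto simp: H10_limit_def l2_tendsto_def)
  have wp: "weak_partial \<Omega> i u (g i)" if "i \<in> Basis" for i
    by (rule H10_limit_weak_partial[OF op lim that])
  have "(\<lambda>n. l2_norm (borel_on \<Omega>) (\<lambda>x. frechet_derivative (us n) (at x) i - h x)) \<longlonglongrightarrow> 0"
    if i: "i \<in> Basis" and h: "h \<in> L2 (borel_on \<Omega>)" "weak_partial \<Omega> i u h" for i h
  proof -
    have ae: "AE x in borel_on \<Omega>. g i x = h x"
      by (rule weak_partial_unique[OF op L(2)[OF i] wp[OF i] h])
    have [measurable]: "g i \<in> borel_measurable (borel_on \<Omega>)" "h \<in> borel_measurable (borel_on \<Omega>)"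
        "(\<lambda>x. frechet_derivative (us n) (at x) i) \<in> borel_measurable (borel_on \<Omega>)" for n
      using lim i h L(2)[OF i] by (auto simp: H10_limit_def l2_tendsto_def intro: L2_measurable)
    have "(\<integral>x. (frechet_derivative (us n) (at x) i - h x)\<^sup>2 \<partial>borel_on \<Omega>)
        = (\<integral>x. (frechet_derivative (us n) (at x) i - g i x)\<^sup>2 \<partial>borel_on \<Omega>)" for n
      by (intro integral_cong_AE) (use ae in \<open>auto elim!: eventually_mono\<close>)
    then show ?thesis
      unfolding l2_norm_tendsto_0_iff using lim i by (simp add: H10_limit_def l2_tendsto_def)
  qed
  moreover have "\<forall>i\<in>Basis. \<exists>g\<in>L2 (borel_on \<Omega>). weak_partial \<Omega> i u g" using L wp by blast
  ultimately show "u \<in> Sobolev_H10 \<Omega>"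
    using L lim unfolding Sobolev_H10_def Sobolev_H1_def mem_Collect_eq
    by (intro conjI exI[of _ us]) (auto simp: H10_limit_def l2_tendsto_def l2_norm_tendsto_0_iff)
qed

text \<open>A diagonal sequence: from the approximants of \<open>u n\<close> one is taken whose
  squared L^2 errors, in value and in all partial derivatives, are below 1 / (n + 1). This is needed
  because truncated functions only approach the function of interest.\<close>

lemma H10_limit_closed:
  assumes us: "\<And>n. \<exists>us. H10_limit \<Omega> (u n) (g n) us"
    and v: "l2_tendsto (borel_on \<Omega>) u v"
    and h: "\<And>i. i \<in> Basis \<Longrightarrow> l2_tendsto (borel_on \<Omega>) (\<lambda>n. g n i) (h i)"
  shows "\<exists>us. H10_limit \<Omega> v h us"
proof -
  obtain us where us: "\<And>n. H10_limit \<Omega> (u n) (g n) (us n)" using us by metis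
  let ?e = "\<lambda>n. inverse (real (Suc n))"
  have "\<exists>m. (\<integral>x. (us n m x - u n x)\<^sup>2 \<partial>borel_on \<Omega>) < ?e n \<and>
     (\<forall>i\<in>Basis. (\<integral>x. (frechet_derivative (us n m) (at x) i - g n i x)\<^sup>2 \<partial>borel_on \<Omega>) < ?e n)" for n
  proof -
    have e: "0 < ?e n" by simp
    have 1: "\<forall>\<^sub>F m in sequentially. (\<integral>x. (us n m x - u n x)\<^sup>2 \<partial>borel_on \<Omega>) < ?e n"
      using us[of n] e by (intro order_tendstoD(2)[of _ 0]) (auto simp: H10_limit_def l2_tendsto_def)
    have 2: "\<forall>\<^sub>F m in sequentially. \<forall>i\<in>Basis. (\<integral>x. (frechet_derivative (us n m) (at x) i - g n i x)\<^sup>2 \<partial>borel_on \<Omega>) < ?e n"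
      using us[of n] e
      by (intro eventually_ball_finite ballI order_tendstoD(2)[of _ 0]) (auto simp: H10_limit_def l2_tendsto_def)
    show ?thesis using eventually_conj[OF 1 2] by (auto simp: eventually_sequentially)
  qed
  from choice[OF allI, OF this] obtain m where
    m': "\<forall>n. (\<integral>x. (us n (m n) x - u n x)\<^sup>2 \<partial>borel_on \<Omega>) < ?e n \<and>
     (\<forall>i\<in>Basis. (\<integral>x. (frechet_derivative (us n (m n)) (at x) i - g n i x)\<^sup>2 \<partial>borel_on \<Omega>) < ?e n)" ..
  have m: "(\<integral>x. (us n (m n) x - u n x)\<^sup>2 \<partial>borel_on \<Omega>) < ?e n"
     "i \<in> Basis \<Longrightarrow> (\<integral>x. (frechet_derivative (us n (m n)) (at x) i - g n i x)\<^sup>2 \<partial>borel_on \<Omega>) < ?e n" for n i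
    using m' by simp_all
  have *: "l2_tendsto (borel_on \<Omega>) f k"
    if f: "\<And>n. f n \<in> L2 (borel_on \<Omega>)" and a: "\<And>n. (\<integral>x. (f n x - a n x)\<^sup>2 \<partial>borel_on \<Omega>) < ?e n"
      and k: "l2_tendsto (borel_on \<Omega>) a k" for f a k
  proof -
    have "(\<lambda>n. \<integral>x. (f n x - a n x)\<^sup>2 \<partial>borel_on \<Omega>) \<longlonglongrightarrow> 0"
      by (rule tendsto_sandwich[OF _ _ tendsto_const LIMSEQ_inverse_real_of_nat])
        (use a in \<open>auto intro!: always_eventually less_imp_le integral_nonneg_AE\<close>)
    then have "l2_tendsto (borel_on \<Omega>) (\<lambda>n x. f n x - a n x) (\<lambda>x. 0)"
      using f k by (simp add: l2_tendsto_def L2_diff L2_zero)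
    from l2_tendsto_add[OF this k] show ?thesis by simp
  qed
  have "H10_limit \<Omega> v h (\<lambda>n. us n (m n))"
    unfolding H10_limit_def
  proof (intro conjI allI ballI)
    show "us n (m n) \<in> test_functions \<Omega>" for n using us by (simp add: H10_limit_def)
    show "l2_tendsto (borel_on \<Omega>) (\<lambda>n. us n (m n)) v"
      by (rule *[OF _ m(1) v]) (use us in \<open>auto simp: H10_limit_def l2_tendsto_def\<close>)
    show "l2_tendsto (borel_on \<Omega>) (\<lambda>n x. frechet_derivative (us n (m n)) (at x) i) (h i)" if "i \<in> Basis" for i
      by (rule *[OF _ m(2)[OF that] h[OF that]]) (use us that in \<open>auto simp: H10_limit_def l2_tendsto_def\<close>)
  qed
  then show ?thesis by blast
qed

text \<open>\<open>p\<close> is applied to a subsequence of approximants that converges almost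
  everywhere. Values converge because \<open>p\<close> is Lipschitz, gradients because
  \<open>p'\<close> is bounded and continuous. The last clause of the conclusion, that the new
  approximants take values in the range of \<open>p\<close>, hands on a uniform bound when
  \<open>p\<close> is bounded, as \<open>H10_limit_product\<close> requires.\<close>

lemma H10_limit_chain:
  fixes \<Omega> :: "'a::euclidean_space set"
  assumes op: "open \<Omega>" "bounded \<Omega>" and lim: "H10_limit \<Omega> u g us"
    and smooth: "\<And>\<phi> :: 'a \<Rightarrow> real. smooth \<phi> \<Longrightarrow> smooth (\<lambda>x. p (\<phi> x))" and p0: "p 0 = 0"
    and p': "\<And>t. (p has_real_derivative p' t) (at t)" "continuous_on UNIV p'" "\<And>t. \<bar>p' t\<bar> \<le> B"
  shows "\<exists>vs. H10_limit \<Omega> (\<lambda>x. p (u x)) (\<lambda>i x. p' (u x) * g i x) vs \<and> (\<forall>n x. \<exists>t. vs n x = p t)"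
proof -
  obtain r :: "nat \<Rightarrow> nat" where r: "H10_limit \<Omega> u g (\<lambda>n. us (r n))"
      "AE x in borel_on \<Omega>. (\<lambda>n. us (r n) x) \<longlonglongrightarrow> u x"
    using H10_limit_AE[OF lim] by blast
  define ws where "ws = (\<lambda>n. us (r n))"
  have ws: "H10_limit \<Omega> u g ws" "AE x in borel_on \<Omega>. (\<lambda>n. ws n x) \<longlonglongrightarrow> u x"
    using r by (auto simp: ws_def)
  have test: "ws n \<in> test_functions \<Omega>" for n using ws by (simp add: H10_limit_def)
  have [measurable]: "ws n \<in> borel_measurable (borel_on \<Omega>)" "u \<in> borel_measurable (borel_on \<Omega>)" for n
    using ws test by (auto simp: H10_limit_def l2_tendsto_def intro: L2_measurable)
  have [measurable]: "p \<in> borel_measurable borel" "p' \<in> borel_measurable borel"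
    using borel_measurable_continuous_onI[OF DERIV_continuous_on[OF has_field_derivative_at_within[OF p'(1)]]]
      borel_measurable_continuous_onI[OF p'(2)] by simp_all
  have lip: "\<bar>p s - p t\<bar> \<le> B * \<bar>s - t\<bar>" for s t
    using field_differentiable_bound[of UNIV p p' B s t] p' by (simp add: has_field_derivative_at_within)
  have vtest: "(\<lambda>x. p (ws n x)) \<in> test_functions \<Omega>" for n
    by (rule test_functions_supp[OF test[of n] smooth[OF test_functions_smooth[OF test[of n]]]]) (simp add: p0)
  have fd: "frechet_derivative (\<lambda>x. p (ws n x)) (at x) = (\<lambda>v. p' (ws n x) * frechet_derivative (ws n) (at x) v)" for n x
  proof (rule frechet_derivative_eqI)
    have "(ws n has_derivative frechet_derivative (ws n) (at x)) (at x)"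
      using smooth_imp_differentiable[OF test_functions_smooth[OF test]] by (simp add: frechet_derivative_works)
    from has_derivative_compose[OF this p'(1)[unfolded has_field_derivative_def]]
    show "((\<lambda>x. p (ws n x)) has_derivative (\<lambda>v. p' (ws n x) * frechet_derivative (ws n) (at x) v)) (at x)" .
  qed
  have "H10_limit \<Omega> (\<lambda>x. p (u x)) (\<lambda>i x. p' (u x) * g i x) (\<lambda>n x. p (ws n x))"
    unfolding H10_limit_def fd
  proof (intro conjI allI ballI vtest)
    have L: "l2_tendsto (borel_on \<Omega>) ws u" using ws by (simp add: H10_limit_def)
    have pL: "(\<lambda>x. p (ws n x)) \<in> L2 (borel_on \<Omega>)" "(\<lambda>x. p (u x)) \<in> L2 (borel_on \<Omega>)" for n
      using L lip[of _ 0] p0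
      by (auto simp: l2_tendsto_def intro!: L2_bound[of u "borel_on \<Omega>" "\<lambda>x. p (u x)" B] L2_bound[of "ws n" "borel_on \<Omega>" "\<lambda>x. p (ws n x)" B])
    have le: "(\<integral>x. (p (ws n x) - p (u x))\<^sup>2 \<partial>borel_on \<Omega>) \<le> B\<^sup>2 * (\<integral>x. (ws n x - u x)\<^sup>2 \<partial>borel_on \<Omega>)" for n
    proof -
      have "(\<integral>x. (p (ws n x) - p (u x))\<^sup>2 \<partial>borel_on \<Omega>) \<le> (\<integral>x. B\<^sup>2 * (ws n x - u x)\<^sup>2 \<partial>borel_on \<Omega>)"
      proof (rule integral_mono)
        show "integrable (borel_on \<Omega>) (\<lambda>x. (p (ws n x) - p (u x))\<^sup>2)"
          by (intro L2_square_integrable L2_diff pL)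
        have "integrable (borel_on \<Omega>) (\<lambda>x. (ws n x - u x)\<^sup>2)"
          using L by (intro L2_square_integrable L2_diff) (auto simp: l2_tendsto_def)
        then show "integrable (borel_on \<Omega>) (\<lambda>x. B\<^sup>2 * (ws n x - u x)\<^sup>2)" by simp
        fix x
        have "\<bar>p (ws n x) - p (u x)\<bar>\<^sup>2 \<le> (B * \<bar>ws n x - u x\<bar>)\<^sup>2" by (intro power_mono lip) auto
        then show "(p (ws n x) - p (u x))\<^sup>2 \<le> B\<^sup>2 * (ws n x - u x)\<^sup>2" by (simp add: power_mult_distrib)
      qed
      then show ?thesis by simp
    qed
    have "(\<lambda>n. B\<^sup>2 * (\<integral>x. (ws n x - u x)\<^sup>2 \<partial>borel_on \<Omega>)) \<longlonglongrightarrow> B\<^sup>2 * 0"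
      using L unfolding l2_tendsto_def by (intro tendsto_mult tendsto_const) auto
    then have "(\<lambda>n. \<integral>x. (p (ws n x) - p (u x))\<^sup>2 \<partial>borel_on \<Omega>) \<longlonglongrightarrow> 0"
      using le by (intro LIMSEQ_zero_squeeze[of "\<lambda>n. \<integral>x. (p (ws n x) - p (u x))\<^sup>2 \<partial>borel_on \<Omega>"
            "\<lambda>n. B\<^sup>2 * (\<integral>x. (ws n x - u x)\<^sup>2 \<partial>borel_on \<Omega>)"]) simp_all
    then show "l2_tendsto (borel_on \<Omega>) (\<lambda>n x. p (ws n x)) (\<lambda>x. p (u x))"
      using pL by (simp add: l2_tendsto_def)
    fix i :: 'a assume i: "i \<in> Basis"
    show "l2_tendsto (borel_on \<Omega>) (\<lambda>n x. p' (ws n x) * frechet_derivative (ws n) (at x) i) (\<lambda>x. p' (u x) * g i x)"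
    proof (rule l2_tendsto_mult_bounded)
      show "l2_tendsto (borel_on \<Omega>) (\<lambda>n x. frechet_derivative (ws n) (at x) i) (g i)"
        using ws i by (simp add: H10_limit_def)
      show "AE x in borel_on \<Omega>. (\<lambda>n. p' (ws n x)) \<longlonglongrightarrow> p' (u x)"
        using ws(2)
      proof eventually_elim
        case (elim x)
        then show ?case
          using continuous_on_tendsto_compose[OF p'(2) elim] by simp
      qed
      show "AE x in borel_on \<Omega>. \<bar>p' (ws n x)\<bar> \<le> B" for n using p'(3) by simp
    qed measurable
  qed
  then show ?thesis by (intro exI[of _ "\<lambda>n x. p (ws n x)"]) auto
qed

text \<open>In each term of the product rule one factor converges in L^2, while the other must stay
  bounded and converge almost everywhere. Hence the bound \<open>R\<close> concerns the approximants
  themselves, and two successive subsequences secure the convergence almost everywhere of both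
  factors.\<close>

lemma H10_limit_product:
  assumes op: "open \<Omega>" "bounded \<Omega>"
    and a: "H10_limit \<Omega> a g as" "\<And>n x. \<bar>as n x\<bar> \<le> R" and b: "H10_limit \<Omega> b h bs" "\<And>n x. \<bar>bs n x\<bar> \<le> R"
  shows "\<exists>cs. H10_limit \<Omega> (\<lambda>x. a x * b x) (\<lambda>i x. b x * g i x + a x * h i x) cs"
proof -
  obtain r1 :: "nat \<Rightarrow> nat" where r1: "strict_mono r1" "H10_limit \<Omega> a g (\<lambda>n. as (r1 n))"
      "AE x in borel_on \<Omega>. (\<lambda>n. as (r1 n) x) \<longlonglongrightarrow> a x"
    using H10_limit_AE[OF a(1)] by blast
  obtain r2 :: "nat \<Rightarrow> nat" where r2: "strict_mono r2" "H10_limit \<Omega> b h (\<lambda>n. bs (r1 (r2 n)))"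
      "AE x in borel_on \<Omega>. (\<lambda>n. bs (r1 (r2 n)) x) \<longlonglongrightarrow> b x"
    using H10_limit_AE[OF H10_limit_subseq[OF b(1) r1(1)]] by blast
  define A where "A = (\<lambda>n. as (r1 (r2 n)))"
  define D where "D = (\<lambda>n. bs (r1 (r2 n)))"
  have A: "H10_limit \<Omega> a g A" using H10_limit_subseq[OF r1(2) r2(1)] by (simp add: A_def)
  have A_AE: "AE x in borel_on \<Omega>. (\<lambda>n. A n x) \<longlonglongrightarrow> a x"
    using r1(3)
  proof eventually_elim
    case (elim x)
    show ?case using LIMSEQ_subseq_LIMSEQ[OF elim r2(1)] by (simp add: o_def A_def)
  qed
  have D: "H10_limit \<Omega> b h D" "AE x in borel_on \<Omega>. (\<lambda>n. D n x) \<longlonglongrightarrow> b x" using r2 by (auto simp: D_def)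
  have bd: "\<bar>A n x\<bar> \<le> R" "\<bar>D n x\<bar> \<le> R" for n x using a b by (auto simp: A_def D_def)
  have test: "A n \<in> test_functions \<Omega>" "D n \<in> test_functions \<Omega>" for n using A D by (auto simp: H10_limit_def)
  have [measurable]: "A n \<in> borel_measurable (borel_on \<Omega>)" "D n \<in> borel_measurable (borel_on \<Omega>)"
    "a \<in> borel_measurable (borel_on \<Omega>)" "b \<in> borel_measurable (borel_on \<Omega>)" for n
    using A D by (auto simp: H10_limit_def l2_tendsto_def intro: L2_measurable)
  have fd: "frechet_derivative (\<lambda>x. A n x * D n x) (at x) =
      (\<lambda>v. A n x * frechet_derivative (D n) (at x) v + frechet_derivative (A n) (at x) v * D n x)" for n x
    using smooth_imp_differentiable[OF test_functions_smooth[OF test(1)]]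
      smooth_imp_differentiable[OF test_functions_smooth[OF test(2)]]
    by (intro frechet_derivative_eqI has_derivative_mult) (auto simp: frechet_derivative_works[symmetric])
  have "H10_limit \<Omega> (\<lambda>x. a x * b x) (\<lambda>i x. b x * g i x + a x * h i x) (\<lambda>n x. A n x * D n x)"
    unfolding H10_limit_def fd
  proof (intro conjI allI ballI)
    show "(\<lambda>x. A n x * D n x) \<in> test_functions \<Omega>" for n
      by (intro test_functions_mult_left test test_functions_smooth[OF test(1)])
    show "l2_tendsto (borel_on \<Omega>) (\<lambda>n x. A n x * D n x) (\<lambda>x. a x * b x)"
      using D(1) bd A_AE by (intro l2_tendsto_mult_bounded[where B=R]) (auto simp: H10_limit_def)
    fix i :: 'a assume i: "i \<in> Basis"
    have 1: "l2_tendsto (borel_on \<Omega>) (\<lambda>n x. A n x * frechet_derivative (D n) (at x) i) (\<lambda>x. a x * h i x)"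
      using D(1) bd A_AE i by (intro l2_tendsto_mult_bounded[where B=R]) (auto simp: H10_limit_def)
    have 2: "l2_tendsto (borel_on \<Omega>) (\<lambda>n x. D n x * frechet_derivative (A n) (at x) i) (\<lambda>x. b x * g i x)"
      using A bd D(2) i by (intro l2_tendsto_mult_bounded[where B=R]) (auto simp: H10_limit_def)
    from l2_tendsto_add[OF 1 2]
    show "l2_tendsto (borel_on \<Omega>) (\<lambda>n x. A n x * frechet_derivative (D n) (at x) i + frechet_derivative (A n) (at x) i * D n x)
       (\<lambda>x. b x * g i x + a x * h i x)" by (simp add: mult.commute add.commute)
  qed
  then show ?thesis by blast
qed

section \<open>Scaled tanh and the smoothed modulus\<close>

lemma DERIV_tanh_scaled:
  "((\<lambda>t. tanh (k * t)) has_real_derivative k * (1 - (tanh (k * t))\<^sup>2)) (at t)" for k t :: real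
  by (auto intro!: derivative_eq_intros)

lemma tanh_square_le_1: "(tanh t)\<^sup>2 \<le> 1" for t :: real
  using tanh_real_lt_1[of t] tanh_real_gt_neg1[of t] by (simp add: abs_square_le_1)

lemma abs_tanh_le_1: "\<bar>tanh t\<bar> \<le> 1" for t :: real
  using tanh_real_lt_1[of t] tanh_real_gt_neg1[of t] by simp

lemma tanh_measurable [measurable]: "tanh \<in> borel_measurable (borel :: real measure)"
  by (intro borel_measurable_continuous_onI continuous_intros) auto

lemma tanh_lipschitz: "\<bar>tanh s - tanh t\<bar> \<le> \<bar>s - t\<bar>" for s t :: real
proof -
  have "norm (tanh s - tanh t) \<le> 1 * norm (s - t)"
    using DERIV_tanh_scaled[of 1] tanh_square_le_1
    by (intro field_differentiable_bound[of UNIV tanh "\<lambda>t. 1 - (tanh t)\<^sup>2"]) auto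
  then show ?thesis by simp
qed

lemma DERIV_ln_cosh_scaled:
  "k \<noteq> 0 \<Longrightarrow> ((\<lambda>t. ln (cosh (k * t)) / k) has_real_derivative tanh (k * t)) (at t)" for k t :: real
proof -
  assume k: "k \<noteq> 0"
  have "((\<lambda>t. ln (cosh (k * t))) has_real_derivative tanh (k * t) * k) (at t)"
    by (rule DERIV_chain2[OF DERIV_ln_cosh]) (auto intro!: derivative_eq_intros)
  from DERIV_cdivide[OF this, of k] show ?thesis using k by simp
qed

text \<open>The derivative is tanh (k t), of modulus at most 1. With \<open>t = 0\<close> this says
  that the smoothed modulus lies below the modulus, uniformly in \<open>k\<close>; it is used mostly
  in this form, for domination.\<close>

lemma ln_cosh_lipschitz:
  "k > 0 \<Longrightarrow> \<bar>ln (cosh (k * s)) / k - ln (cosh (k * t)) / k\<bar> \<le> \<bar>s - t\<bar>" for k s t :: real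
proof -
  assume k: "k > 0"
  have "norm (ln (cosh (k * s)) / k - ln (cosh (k * t)) / k) \<le> 1 * norm (s - t)"
    using DERIV_ln_cosh_scaled[of k] k abs_tanh_le_1
    by (intro field_differentiable_bound[of UNIV "\<lambda>t. ln (cosh (k * t)) / k" "\<lambda>t. tanh (k * t)"]) auto
  then show ?thesis by simp
qed

lemma ln_cosh_measurable: "k > 0 \<Longrightarrow> (\<lambda>t::real. ln (cosh (k * t)) / k) \<in> borel_measurable borel"
  using DERIV_ln_cosh_scaled[of k]
  by (intro borel_measurable_continuous_onI DERIV_continuous_on) (auto intro: has_field_derivative_at_within)

lemma Sobolev_H10_ln_cosh:
  assumes op: "open \<Omega>" "bounded \<Omega>" and w: "w \<in> Sobolev_H10 \<Omega>" and k: "k > 0"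
  shows "(\<lambda>x. ln (cosh (k * w x)) / k) \<in> Sobolev_H10 \<Omega>"
proof -
  obtain g ws where "H10_limit \<Omega> w g ws" using w Sobolev_H10_iff[OF op] by blast
  from H10_limit_chain[OF op this, of "\<lambda>t. ln (cosh (k * t)) / k" "\<lambda>t. tanh (k * t)" 1]
  have "\<exists>vs. H10_limit \<Omega> (\<lambda>x. ln (cosh (k * w x)) / k) (\<lambda>i x. tanh (k * w x) * g i x) vs"
    using k DERIV_ln_cosh_scaled[of k] abs_tanh_le_1
      smooth_mult[OF smooth_const[of "1 / k"] smooth_ln_cosh[OF smooth_mult[OF smooth_const[of k]]]]
    by (fastforce intro!: continuous_intros)
  then show ?thesis using Sobolev_H10_iff[OF op] by blast
qed

text \<open>The bounded factor \<open>v\<close> is reached as the limit of \<open>R tanh (v / R)\<close>, since the approximants of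
  \<open>v\<close> itself need not be bounded.\<close>

lemma Sobolev_H10_tanh_mult:
  fixes \<Omega> :: "'a::euclidean_space set"
  assumes op: "open \<Omega>" "bounded \<Omega>" and w: "w \<in> Sobolev_H10 \<Omega>" and v: "v \<in> Sobolev_H10 \<Omega>"
    and V: "\<And>x. x \<in> \<Omega> \<Longrightarrow> \<bar>v x\<bar> \<le> V"
  shows "(\<lambda>x. tanh (k * w x) * v x) \<in> Sobolev_H10 \<Omega>"
proof -
  obtain g ws where ws: "H10_limit \<Omega> w g ws" using w Sobolev_H10_iff[OF op] by blast
  obtain h vs where vs: "H10_limit \<Omega> v h vs" using v Sobolev_H10_iff[OF op] by blast
  have meas [measurable]: "w \<in> borel_measurable (borel_on \<Omega>)" "v \<in> borel_measurable (borel_on \<Omega>)"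
    using ws vs by (auto simp: H10_limit_def l2_tendsto_def intro: L2_measurable)
  have L: "w \<in> L2 (borel_on \<Omega>)" "v \<in> L2 (borel_on \<Omega>)"
      "\<And>i. i \<in> Basis \<Longrightarrow> g i \<in> L2 (borel_on \<Omega>)" "\<And>i. i \<in> Basis \<Longrightarrow> h i \<in> L2 (borel_on \<Omega>)"
    using ws vs by (auto simp: H10_limit_def l2_tendsto_def)
  let ?R = "\<lambda>n. real (Suc n)"
  let ?a = "\<lambda>x. tanh (k * w x)" and ?a' = "\<lambda>x. k * (1 - (tanh (k * w x))\<^sup>2)"
  let ?b = "\<lambda>n x. ?R n * tanh (inverse (?R n) * v x)" and ?b' = "\<lambda>n x. 1 - (tanh (inverse (?R n) * v x))\<^sup>2"
  have abs1: "\<bar>1 - (tanh t)\<^sup>2\<bar> \<le> 1" for t :: real using tanh_square_le_1[of t] by simp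
  have "\<exists>as. H10_limit \<Omega> ?a (\<lambda>i x. ?a' x * g i x) as \<and> (\<forall>n x. \<exists>t. as n x = tanh (k * t))"
  proof (rule H10_limit_chain[OF op ws, where B="\<bar>k\<bar>"])
    show "smooth (\<lambda>x. tanh (k * \<phi> x))" if "smooth \<phi>" for \<phi> :: "'a \<Rightarrow> real"
      by (intro smooth_tanh smooth_mult smooth_const that)
    show "\<bar>k * (1 - (tanh (k * t))\<^sup>2)\<bar> \<le> \<bar>k\<bar>" for t
      using mult_left_mono[OF abs1, of "\<bar>k\<bar>"] by (simp add: abs_mult)
    show "continuous_on UNIV (\<lambda>t. k * (1 - (tanh (k * t))\<^sup>2))" by (intro continuous_intros) auto
  qed (use DERIV_tanh_scaled in auto)
  then obtain as where as: "H10_limit \<Omega> ?a (\<lambda>i x. ?a' x * g i x) as" "\<And>n x. \<exists>t. as n x = tanh (k * t)"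
    by blast
  have b_lip: "\<bar>?b n x\<bar> \<le> \<bar>v x\<bar>" for n x
  proof -
    have "\<bar>?b n x\<bar> = ?R n * \<bar>tanh (inverse (?R n) * v x)\<bar>" by (simp only: abs_mult abs_of_nat)
    also have "\<dots> \<le> ?R n * \<bar>inverse (?R n) * v x\<bar>"
      using tanh_lipschitz[of "inverse (?R n) * v x" 0] by (intro mult_left_mono) simp_all
    also have "\<dots> = \<bar>v x\<bar>" by (simp add: abs_mult)
    finally show ?thesis .
  qed
  \<comment> \<open>For fixed \<open>n\<close> both factors have uniformly bounded approximants,
    tanh being bounded, and the product rule applies. Closedness then lets \<open>n\<close> tend to
    infinity.\<close>
  have prod: "\<exists>us. H10_limit \<Omega> (\<lambda>x. ?a x * ?b n x) (\<lambda>i x. ?b n x * (?a' x * g i x) + ?a x * (?b' n x * h i x)) us" for n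
  proof -
    have "\<exists>bs. H10_limit \<Omega> (?b n) (\<lambda>i x. ?b' n x * h i x) bs \<and>
        (\<forall>m x. \<exists>t. bs m x = ?R n * tanh (inverse (?R n) * t))"
    proof (rule H10_limit_chain[OF op vs, where B=1])
      show "smooth (\<lambda>x. ?R n * tanh (inverse (?R n) * \<phi> x))" if "smooth \<phi>" for \<phi> :: "'a \<Rightarrow> real"
        by (intro smooth_tanh smooth_mult smooth_const that)
      show "((\<lambda>t. ?R n * tanh (inverse (?R n) * t)) has_real_derivative 1 - (tanh (inverse (?R n) * t))\<^sup>2) (at t)" for t
      proof -
        have "?R n * (inverse (?R n) * c) = c" for c by (simp add: mult.assoc[symmetric] del: of_nat_Suc)
        then show ?thesis using DERIV_cmult[OF DERIV_tanh_scaled[of "inverse (?R n)"], of "?R n"] by (simp only:)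
      qed
      show "continuous_on UNIV (\<lambda>t. 1 - (tanh (inverse (?R n) * t))\<^sup>2)" by (intro continuous_intros) auto
    qed (use abs1 in auto)
    then obtain bs where bs: "H10_limit \<Omega> (?b n) (\<lambda>i x. ?b' n x * h i x) bs"
        "\<And>m x. \<exists>t. bs m x = ?R n * tanh (inverse (?R n) * t)"
      by blast
    show ?thesis
    proof (rule H10_limit_product[OF op as(1) _ bs(1)])
      fix m x
      show "\<bar>as m x\<bar> \<le> ?R n"
      proof -
        have "\<bar>as m x\<bar> \<le> 1" using as(2)[of m x] abs_tanh_le_1 by auto
        then show ?thesis by simp
      qed
      show "\<bar>bs m x\<bar> \<le> ?R n" using bs(2)[of m x] abs_tanh_le_1 by (auto simp: abs_mult intro: mult_left_le)
    qed
  qed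
  have b_lim: "(\<lambda>n. ?b n x) \<longlonglongrightarrow> v x" for x
  proof -
    have "((\<lambda>t. tanh (v x * t)) has_real_derivative v x) (at 0)"
      using DERIV_tanh_scaled[of "v x" 0] by simp
    then have "((\<lambda>t. tanh (v x * t) / t) \<longlongrightarrow> v x) (at 0)" by (simp add: DERIV_def)
    moreover have "filterlim (\<lambda>n. inverse (?R n)) (at 0) sequentially"
      using LIMSEQ_inverse_real_of_nat by (auto simp: filterlim_at)
    ultimately have "(\<lambda>n. tanh (v x * inverse (?R n)) / inverse (?R n)) \<longlonglongrightarrow> v x"
      by (rule filterlim_compose)
    then show ?thesis by (simp add: field_simps)
  qed
  have bV: "\<bar>?b n x\<bar> \<le> V" if "x \<in> \<Omega>" for n x using order_trans[OF b_lip V[OF that]] .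
  have AE\<Omega>: "AE x in borel_on \<Omega>. P x" if "\<And>x. x \<in> \<Omega> \<Longrightarrow> P x" for P
    using that by (intro AE_I2) (simp add: space_restrict_space)
  have lim: "l2_tendsto (borel_on \<Omega>) (\<lambda>n x. ?a x * ?b n x) (\<lambda>x. ?a x * v x)"
  proof (rule l2_tendsto_dominated[OF _ _ _ L(2)])
    show "AE x in borel_on \<Omega>. (\<lambda>n. ?a x * ?b n x) \<longlonglongrightarrow> ?a x * v x"
      by (intro AE_I2 tendsto_mult tendsto_const b_lim)
    show "AE x in borel_on \<Omega>. \<bar>?a x * ?b n x\<bar> \<le> \<bar>v x\<bar>" for n
    proof (intro AE_I2)
      fix x show "\<bar>?a x * ?b n x\<bar> \<le> \<bar>v x\<bar>"
        using mult_mono[OF abs_tanh_le_1[of "k * w x"] b_lip[of n x]] by (simp add: abs_mult)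
    qed
  qed measurable
  \<comment> \<open>Boundedness of \<open>v\<close> enters here: the truncation \<open>?b n\<close>
    multiplies the gradient of \<open>w\<close>, which is merely in L^2, so a bound on it uniform in
    \<open>n\<close> is required. The factor \<open>?b' n\<close> tends boundedly to 1.\<close>
  have lim': "l2_tendsto (borel_on \<Omega>) (\<lambda>n x. ?b n x * (?a' x * g i x) + ?a x * (?b' n x * h i x))
      (\<lambda>x. v x * (?a' x * g i x) + ?a x * h i x)" if i: "i \<in> Basis" for i
  proof (rule l2_tendsto_add)
    have [measurable]: "g i \<in> borel_measurable (borel_on \<Omega>)" "h i \<in> borel_measurable (borel_on \<Omega>)"
      using L i by (auto intro: L2_measurable)
    have "(\<lambda>x. ?a' x * g i x) \<in> L2 (borel_on \<Omega>)"
      using mult_right_mono[OF mult_left_mono[OF abs1, of "\<bar>k\<bar>"]]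
      by (intro L2_bound[OF L(3)[OF i], of _ "\<bar>k\<bar>"]) (auto simp: abs_mult)
    then show "l2_tendsto (borel_on \<Omega>) (\<lambda>n x. ?b n x * (?a' x * g i x)) (\<lambda>x. v x * (?a' x * g i x))"
      using bV b_lim by (intro l2_tendsto_mult_bounded[where B=V] l2_tendsto_const AE\<Omega>) auto
    have "l2_tendsto (borel_on \<Omega>) (\<lambda>n x. (?a x * ?b' n x) * h i x) (\<lambda>x. ?a x * h i x)"
    proof (rule l2_tendsto_mult_bounded[where B=1 and f="\<lambda>n. h i"])
      show "AE x in borel_on \<Omega>. \<bar>?a x * ?b' n x\<bar> \<le> 1" for n
        using abs_tanh_le_1 abs1 by (intro AE_I2) (auto simp: abs_mult intro!: mult_le_one)
      show "AE x in borel_on \<Omega>. (\<lambda>n. ?a x * ?b' n x) \<longlonglongrightarrow> ?a x"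
      proof (intro AE_I2)
        fix x
        have "(\<lambda>n. inverse (?R n) * v x) \<longlonglongrightarrow> 0 * v x"
          by (intro tendsto_mult tendsto_const LIMSEQ_inverse_real_of_nat)
        then have "(\<lambda>n. tanh (inverse (?R n) * v x)) \<longlonglongrightarrow> 0" using tendsto_tanh[of _ 0] by fastforce
        from tendsto_mult[OF tendsto_const tendsto_diff[OF tendsto_const tendsto_power[OF this, of 2]], of "?a x" 1]
        show "(\<lambda>n. ?a x * ?b' n x) \<longlonglongrightarrow> ?a x" by simp
      qed
    qed (use L i in \<open>auto intro: l2_tendsto_const\<close>)
    then show "l2_tendsto (borel_on \<Omega>) (\<lambda>n x. ?a x * (?b' n x * h i x)) (\<lambda>x. ?a x * h i x)"
      by (simp add: mult.assoc)
  qed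
  have "\<exists>us. H10_limit \<Omega> (\<lambda>x. ?a x * v x) (\<lambda>i x. v x * (?a' x * g i x) + ?a x * h i x) us"
    by (rule H10_limit_closed[OF prod lim lim'])
  then show ?thesis using Sobolev_H10_iff[OF op] by blast
qed

section \<open>Fractional spaces and the compositions that (L4) calls for\<close>

lemma continuous_on_bdist: "continuous_on S (bdist \<Omega>)"
  unfolding bdist_def[abs_def] by (intro continuous_intros)

lemma bdist_measurable [measurable]: "bdist \<Omega> \<in> borel_measurable borel"
  by (intro borel_measurable_continuous_onI continuous_on_bdist)

lemma bdist_measurable_on [measurable]: "bdist \<Omega> \<in> borel_measurable (borel_on S)"
  by (intro measurable_restrict_space1) simp

text \<open>Squaring the Lipschitz-type bound puts the Gagliardo integrand of \<open>f\<close> below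
  those of \<open>u\<close> and \<open>v\<close>, while |f| <= |v| controls both the L^2 norm and
  the quotient by the power of the distance. The smoothed modulus and the product with tanh are both
  of this kind.\<close>

lemma H00_fractional_dominated:
  fixes \<Omega> :: "'a::euclidean_space set"
  assumes op: "open \<Omega>" and s: "s < 1" and u: "u \<in> H00 \<Omega> s" and v: "v \<in> H00 \<Omega> s"
    and f [measurable]: "f \<in> borel_measurable (borel_on \<Omega>)"
    and le: "\<And>x. x \<in> \<Omega> \<Longrightarrow> \<bar>f x\<bar> \<le> \<bar>v x\<bar>"
    and lip: "\<And>x y. x \<in> \<Omega> \<Longrightarrow> y \<in> \<Omega> \<Longrightarrow> \<bar>f x - f y\<bar> \<le> A * \<bar>u x - u y\<bar> + \<bar>v x - v y\<bar>"
  shows "f \<in> H00 \<Omega> s"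
proof -
  let ?M = "borel_on \<Omega>" and ?d = "\<lambda>x y. norm (x - y) powr (real DIM('a) + 2 * s)"
  have u': "u \<in> frac_Sobolev \<Omega> s" and v': "v \<in> frac_Sobolev \<Omega> s" "(\<lambda>x. v x / bdist \<Omega> x powr s) \<in> L2 ?M"
    using u v s by (auto simp: H00_def)
  have id [measurable]: "(\<lambda>x. x) \<in> borel_measurable ?M" by (intro measurable_restrict_space1) simp
  have "f \<in> L2 ?M"
    using v' le by (intro L2_bound[of v ?M f 1] AE_I2) (auto simp: frac_Sobolev_def space_restrict_space)
  moreover have "(\<lambda>x. f x / bdist \<Omega> x powr s) \<in> L2 ?M"
    using le by (intro L2_bound[OF v'(2), of _ 1] AE_I2) (auto simp: space_restrict_space divide_right_mono)
  moreover have "integrable (?M \<Otimes>\<^sub>M ?M) (\<lambda>(x, y). (f x - f y)\<^sup>2 / ?d x y)"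
  proof (rule Bochner_Integration.integrable_bound)
    show "integrable (?M \<Otimes>\<^sub>M ?M) (\<lambda>z. 2 * A\<^sup>2 * (case z of (x, y) \<Rightarrow> (u x - u y)\<^sup>2 / ?d x y)
        + 2 * (case z of (x, y) \<Rightarrow> (v x - v y)\<^sup>2 / ?d x y))"
      using u' v' by (intro Bochner_Integration.integrable_add integrable_mult_right) (auto simp: frac_Sobolev_def)
    show "AE z in ?M \<Otimes>\<^sub>M ?M. norm (case z of (x, y) \<Rightarrow> (f x - f y)\<^sup>2 / ?d x y) \<le>
       norm (2 * A\<^sup>2 * (case z of (x, y) \<Rightarrow> (u x - u y)\<^sup>2 / ?d x y)
        + 2 * (case z of (x, y) \<Rightarrow> (v x - v y)\<^sup>2 / ?d x y))"
    proof (intro AE_I2)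
      fix z assume "z \<in> space (?M \<Otimes>\<^sub>M ?M)"
      then obtain x y where z: "z = (x, y)" "x \<in> \<Omega>" "y \<in> \<Omega>"
        by (auto simp: space_pair_measure space_restrict_space)
      have "\<bar>f x - f y\<bar>\<^sup>2 \<le> (A * \<bar>u x - u y\<bar> + \<bar>v x - v y\<bar>)\<^sup>2" by (intro power_mono lip z) auto
      also have "\<dots> \<le> 2 * (A * \<bar>u x - u y\<bar>)\<^sup>2 + 2 * \<bar>v x - v y\<bar>\<^sup>2"
        using zero_le_power2[of "A * \<bar>u x - u y\<bar> - \<bar>v x - v y\<bar>"] unfolding power2_sum power2_diff by linarith
      also have "\<dots> = 2 * A\<^sup>2 * (u x - u y)\<^sup>2 + 2 * (v x - v y)\<^sup>2" by (simp add: power_mult_distrib)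
      finally have "(f x - f y)\<^sup>2 / ?d x y \<le> (2 * A\<^sup>2 * (u x - u y)\<^sup>2 + 2 * (v x - v y)\<^sup>2) / ?d x y"
        by (intro divide_right_mono) auto
      then show "norm (case z of (x, y) \<Rightarrow> (f x - f y)\<^sup>2 / ?d x y) \<le>
       norm (2 * A\<^sup>2 * (case z of (x, y) \<Rightarrow> (u x - u y)\<^sup>2 / ?d x y)
        + 2 * (case z of (x, y) \<Rightarrow> (v x - v y)\<^sup>2 / ?d x y))"
        by (simp add: z add_divide_distrib)
    qed
  qed measurable
  ultimately show ?thesis using s by (simp add: H00_def frac_Sobolev_def)
qed

lemma H00_measurable: "open \<Omega> \<Longrightarrow> u \<in> H00 \<Omega> s \<Longrightarrow> u \<in> borel_measurable (borel_on \<Omega>)"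
  by (auto simp: H00_def frac_Sobolev_def Sobolev_H10_def Sobolev_H1_def L2_def split: if_splits)

lemma H00_ln_cosh:
  assumes op: "open \<Omega>" "bounded \<Omega>" and w: "w \<in> H00 \<Omega> s" and k: "k > 0"
  shows "(\<lambda>x. ln (cosh (k * w x)) / k) \<in> H00 \<Omega> s"
proof (cases "s < 1")
  case True
  have [measurable]: "w \<in> borel_measurable (borel_on \<Omega>)" by (rule H00_measurable[OF op(1) w])
  from measurable_compose[OF _ ln_cosh_measurable[OF k], of w "borel_on \<Omega>"]
  have "(\<lambda>x. ln (cosh (k * w x)) / k) \<in> borel_measurable (borel_on \<Omega>)" by simp
  then show ?thesis
    using ln_cosh_lipschitz[OF k] ln_cosh_lipschitz[OF k, of _ 0]
    by (intro H00_fractional_dominated[OF op(1) True w w, where A=0]) auto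
next
  case False
  then show ?thesis using Sobolev_H10_ln_cosh[OF op _ k, of w] w by (simp add: H00_def)
qed

text \<open>With w = G[f] and v = G[xi] this is the function p'(u) v of (L4), as the preceding lemma
  treats p(u). A difference of the product is split so that a difference of tanh is multiplied by
  the bounded \<open>v\<close>, and a difference of \<open>v\<close> by tanh.\<close>

lemma H00_tanh_mult:
  assumes op: "open \<Omega>" "bounded \<Omega>" and w: "w \<in> H00 \<Omega> s" and v: "v \<in> H00 \<Omega> s"
    and V: "\<And>x. x \<in> \<Omega> \<Longrightarrow> \<bar>v x\<bar> \<le> V" and k: "k > 0"
  shows "(\<lambda>x. tanh (k * w x) * v x) \<in> H00 \<Omega> s"
proof (cases "s < 1")
  case True
  have [measurable]: "w \<in> borel_measurable (borel_on \<Omega>)" "v \<in> borel_measurable (borel_on \<Omega>)"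
    using H00_measurable[OF op(1)] w v by auto
  show ?thesis
  proof (rule H00_fractional_dominated[OF op(1) True w v, where A="k * V"])
    show "\<bar>tanh (k * w x) * v x\<bar> \<le> \<bar>v x\<bar>" for x
      using mult_right_mono[OF abs_tanh_le_1, of "\<bar>v x\<bar>" "k * w x"] by (simp add: abs_mult)
    fix x y assume x: "x \<in> \<Omega>" "y \<in> \<Omega>"
    have eq: "tanh (k * w x) * v x - tanh (k * w y) * v y =
       (tanh (k * w x) - tanh (k * w y)) * v x + tanh (k * w y) * (v x - v y)" by (simp add: algebra_simps)
    have "\<bar>(tanh (k * w x) - tanh (k * w y)) * v x\<bar> \<le> \<bar>k * w x - k * w y\<bar> * V"
      unfolding abs_mult by (intro mult_mono tanh_lipschitz V x) auto
    also have "\<dots> = k * V * \<bar>w x - w y\<bar>"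
      using k by (simp add: right_diff_distrib[symmetric] abs_mult)
    finally have 1: "\<bar>(tanh (k * w x) - tanh (k * w y)) * v x\<bar> \<le> k * V * \<bar>w x - w y\<bar>" .
    have 2: "\<bar>tanh (k * w y) * (v x - v y)\<bar> \<le> \<bar>v x - v y\<bar>"
      using mult_right_mono[OF abs_tanh_le_1, of "\<bar>v x - v y\<bar>" "k * w y"] by (simp add: abs_mult)
    show "\<bar>tanh (k * w x) * v x - tanh (k * w y) * v y\<bar> \<le> k * V * \<bar>w x - w y\<bar> + \<bar>v x - v y\<bar>"
      unfolding eq using 1 2 by linarith
  qed measurable
next
  case False
  then show ?thesis using Sobolev_H10_tanh_mult[OF op, of w v V k] w v V by (simp add: H00_def)
qed

section \<open>Symmetric kernels and the Kato inequality\<close>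


lemma ennreal_abs_integral_le:
  fixes f :: "'a \<Rightarrow> real"
  shows "ennreal \<bar>\<integral>x. f x \<partial>M\<bar> \<le> (\<integral>\<^sup>+x. ennreal (norm (f x)) \<partial>M)"
  using integral_norm_bound_ennreal[of M f]
  by (cases "integrable M f") (auto simp: not_integrable_integral_eq)

text \<open>The weight plays the part of d^gamma. A pointwise bound K w <= C w together with
  symmetry is a Schur test: it bounds the operator on L^1(w) with norm at most \<open>C\<close>, and
  on functions dominated by multiples of \<open>w\<close>.\<close>

locale weighted_kernel = sigma_finite_measure M for M :: "'a measure" +
  fixes K :: "'a \<Rightarrow> 'a \<Rightarrow> real" and w :: "'a \<Rightarrow> real" and C :: real
  assumes K_measurable: "(\<lambda>(x, y). K x y) \<in> borel_measurable (M \<Otimes>\<^sub>M M)"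
    and K_nonneg: "K x y \<ge> 0"
    and K_sym: "K x y = K y x"
    and w_measurable [measurable]: "w \<in> borel_measurable M"
    and w_pos: "x \<in> space M \<Longrightarrow> 0 < w x"
    and w_integrable: "integrable M w"
    and C_pos: "C > 0"
    and K_w: "x \<in> space M \<Longrightarrow> (\<integral>\<^sup>+y. ennreal (K x y * w y) \<partial>M) \<le> ennreal (C * w x)"
begin

definition opK :: "('a \<Rightarrow> real) \<Rightarrow> 'a \<Rightarrow> real" where
  "opK f x = (\<integral>y. K x y * f y \<partial>M)"

definition L1w :: "('a \<Rightarrow> real) \<Rightarrow> bool" where
  "L1w f \<longleftrightarrow> f \<in> borel_measurable M \<and> integrable M (\<lambda>x. w x * f x)"

lemma K_comp [measurable (raw)]:
  assumes "f \<in> measurable N M" "g \<in> measurable N M"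
  shows "(\<lambda>x. K (f x) (g x)) \<in> borel_measurable N"
  using measurable_compose[OF measurable_Pair[OF assms] K_measurable] by simp

lemma K_meas1 [measurable]: "x \<in> space M \<Longrightarrow> K x \<in> borel_measurable M"
  by measurable

lemma L1w_measurable: "L1w f \<Longrightarrow> f \<in> borel_measurable M"
  by (simp add: L1w_def)

lemma opK_measurable [measurable]:
  assumes [measurable]: "f \<in> borel_measurable M"
  shows "opK f \<in> borel_measurable M"
  unfolding opK_def by measurable

lemma opK_cong_AE:
  assumes "f \<in> borel_measurable M" "g \<in> borel_measurable M" "AE y in M. f y = g y" "x \<in> space M"
  shows "opK f x = opK g x"
  unfolding opK_def using assms
  by (intro integral_cong_AE) (auto elim!: eventually_mono)

text \<open>Tonelli and the symmetry of the kernel move it from \<open>f\<close> to the weight,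
  where \<open>K_w\<close> applies. The integrals are extended ones, so that finiteness can be
  concluded and need not be assumed.\<close>

lemma nn_integral_opK:
  assumes [measurable]: "f \<in> borel_measurable M"
  shows "(\<integral>\<^sup>+x. ennreal (w x) * (\<integral>\<^sup>+y. ennreal (K x y * \<bar>f y\<bar>) \<partial>M) \<partial>M)
     \<le> ennreal C * (\<integral>\<^sup>+y. ennreal (w y * \<bar>f y\<bar>) \<partial>M)"
proof -
  interpret pair_sigma_finite M M ..
  have "(\<integral>\<^sup>+x. ennreal (w x) * (\<integral>\<^sup>+y. ennreal (K x y * \<bar>f y\<bar>) \<partial>M) \<partial>M)
      = (\<integral>\<^sup>+x. \<integral>\<^sup>+y. ennreal (w x) * ennreal (K x y * \<bar>f y\<bar>) \<partial>M \<partial>M)"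
    by (intro nn_integral_cong nn_integral_cmult[symmetric]) measurable
  also have "\<dots> = (\<integral>\<^sup>+y. \<integral>\<^sup>+x. ennreal (w x) * ennreal (K x y * \<bar>f y\<bar>) \<partial>M \<partial>M)"
    by (rule Fubini'[symmetric]) measurable
  also have "\<dots> = (\<integral>\<^sup>+y. ennreal \<bar>f y\<bar> * (\<integral>\<^sup>+x. ennreal (K y x * w x) \<partial>M) \<partial>M)"
  proof (intro nn_integral_cong)
    fix y assume [measurable]: "y \<in> space M"
    have "(\<integral>\<^sup>+x. ennreal (w x) * ennreal (K x y * \<bar>f y\<bar>) \<partial>M) =
       (\<integral>\<^sup>+x. ennreal \<bar>f y\<bar> * ennreal (K y x * w x) \<partial>M)"
      using w_pos K_nonneg
      by (intro nn_integral_cong) (simp add: ennreal_mult'[symmetric] less_imp_le mult_ac K_sym[of y])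
    also have "\<dots> = ennreal \<bar>f y\<bar> * (\<integral>\<^sup>+x. ennreal (K y x * w x) \<partial>M)"
      by (intro nn_integral_cmult) measurable
    finally show "(\<integral>\<^sup>+x. ennreal (w x) * ennreal (K x y * \<bar>f y\<bar>) \<partial>M)
      = ennreal \<bar>f y\<bar> * (\<integral>\<^sup>+x. ennreal (K y x * w x) \<partial>M)" .
  qed
  also have "\<dots> \<le> (\<integral>\<^sup>+y. ennreal \<bar>f y\<bar> * ennreal (C * w y) \<partial>M)"
    by (intro nn_integral_mono mult_left_mono K_w) auto
  also have "\<dots> = (\<integral>\<^sup>+y. ennreal C * ennreal (w y * \<bar>f y\<bar>) \<partial>M)"
    using w_pos C_pos
    by (intro nn_integral_cong) (simp add: ennreal_mult'[symmetric] less_imp_le mult_ac)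
  also have "\<dots> = ennreal C * (\<integral>\<^sup>+y. ennreal (w y * \<bar>f y\<bar>) \<partial>M)"
    by (intro nn_integral_cmult) measurable
  finally show ?thesis .
qed

lemma nn_integral_L1w:
  assumes "L1w f"
  shows "(\<integral>\<^sup>+y. ennreal (w y * \<bar>f y\<bar>) \<partial>M) = ennreal (\<integral>y. w y * \<bar>f y\<bar> \<partial>M)"
    and "integrable M (\<lambda>y. w y * \<bar>f y\<bar>)"
proof -
  have "integrable M (\<lambda>y. \<bar>w y * f y\<bar>)" using assms by (auto simp: L1w_def)
  moreover have "AE y in M. \<bar>w y * f y\<bar> = w y * \<bar>f y\<bar>"
    using w_pos by (intro AE_I2) (simp add: abs_mult less_imp_le)
  ultimately show *: "integrable M (\<lambda>y. w y * \<bar>f y\<bar>)"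
    using assms by (subst integrable_cong_AE[symmetric]) (auto simp: L1w_def)
  show "(\<integral>\<^sup>+y. ennreal (w y * \<bar>f y\<bar>) \<partial>M) = ennreal (\<integral>y. w y * \<bar>f y\<bar> \<partial>M)"
    using w_pos by (intro nn_integral_eq_integral * AE_I2) (simp add: less_imp_le)
qed

text \<open>At a point where the integrand is not integrable, \<open>opK f\<close> is 0 by
  convention. The weighted double integral being finite, such points form a null set; for this
  reason linearity and monotonicity of \<open>opK\<close> are statements almost everywhere.\<close>

lemma L1w_AE_integrable:
  assumes "L1w f"
  shows "AE x in M. integrable M (\<lambda>y. K x y * f y)"
proof -
  have [measurable]: "f \<in> borel_measurable M" using assms by (rule L1w_measurable)
  have "(\<integral>\<^sup>+x. ennreal (w x) * (\<integral>\<^sup>+y. ennreal (K x y * \<bar>f y\<bar>) \<partial>M) \<partial>M) < \<infinity>"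
    by (rule le_less_trans[OF nn_integral_opK]) (simp_all add: nn_integral_L1w(1)[OF assms] ennreal_mult_less_top)
  then have "AE x in M. ennreal (w x) * (\<integral>\<^sup>+y. ennreal (K x y * \<bar>f y\<bar>) \<partial>M) \<noteq> \<infinity>"
    by (intro nn_integral_PInf_AE) (auto simp: less_top[symmetric])
  then show ?thesis using AE_space
  proof eventually_elim
    case (elim x)
    have [measurable]: "x \<in> space M" by fact
    have "(\<integral>\<^sup>+y. ennreal (K x y * \<bar>f y\<bar>) \<partial>M) < \<infinity>"
      using elim w_pos[of x] by (auto simp: ennreal_mult_eq_top_iff less_top[symmetric])
    then show ?case
      using K_nonneg by (intro integrableI_bounded) (auto simp: abs_mult)
  qed
qed

lemma L1w_opK:
  assumes "L1w f"
  shows "L1w (opK f)" "(\<integral>x. w x * \<bar>opK f x\<bar> \<partial>M) \<le> C * (\<integral>x. w x * \<bar>f x\<bar> \<partial>M)"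
proof -
  have [measurable]: "f \<in> borel_measurable M" using assms by (rule L1w_measurable)
  have nonneg: "0 \<le> (\<integral>x. w x * \<bar>f x\<bar> \<partial>M)"
    using w_pos by (intro integral_nonneg_AE AE_I2) (simp add: less_imp_le)
  have "(\<integral>\<^sup>+x. ennreal (w x * \<bar>opK f x\<bar>) \<partial>M)
     \<le> (\<integral>\<^sup>+x. ennreal (w x) * (\<integral>\<^sup>+y. ennreal (K x y * \<bar>f y\<bar>) \<partial>M) \<partial>M)"
  proof (intro nn_integral_mono)
    fix x assume x [measurable]: "x \<in> space M"
    have "ennreal \<bar>opK f x\<bar> \<le> (\<integral>\<^sup>+y. ennreal (norm (K x y * f y)) \<partial>M)"
      unfolding opK_def by (rule ennreal_abs_integral_le)
    then show "ennreal (w x * \<bar>opK f x\<bar>) \<le> ennreal (w x) * (\<integral>\<^sup>+y. ennreal (K x y * \<bar>f y\<bar>) \<partial>M)"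
      using K_nonneg w_pos[OF x] by (auto simp: ennreal_mult' less_imp_le abs_mult intro!: mult_left_mono)
  qed
  also have "\<dots> \<le> ennreal C * (\<integral>\<^sup>+y. ennreal (w y * \<bar>f y\<bar>) \<partial>M)"
    by (rule nn_integral_opK) measurable
  also have "\<dots> = ennreal (C * (\<integral>x. w x * \<bar>f x\<bar> \<partial>M))"
    using C_pos nonneg by (simp add: nn_integral_L1w[OF assms] ennreal_mult')
  finally have le: "(\<integral>\<^sup>+x. ennreal (w x * \<bar>opK f x\<bar>) \<partial>M) \<le> ennreal (C * (\<integral>x. w x * \<bar>f x\<bar> \<partial>M))" .
  have "(\<integral>\<^sup>+x. ennreal (norm (w x * opK f x)) \<partial>M) = (\<integral>\<^sup>+x. ennreal (w x * \<bar>opK f x\<bar>) \<partial>M)"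
    using w_pos by (intro nn_integral_cong) (simp add: abs_mult less_imp_le)
  also have "\<dots> < \<infinity>" using le by (simp add: le_less_trans)
  finally show *: "L1w (opK f)"
    unfolding L1w_def by (auto intro!: integrableI_bounded)
  show "(\<integral>x. w x * \<bar>opK f x\<bar> \<partial>M) \<le> C * (\<integral>x. w x * \<bar>f x\<bar> \<partial>M)"
    using le C_pos nonneg by (simp add: nn_integral_L1w[OF *])
qed

lemma L1w_add: "L1w f \<Longrightarrow> L1w g \<Longrightarrow> L1w (\<lambda>x. f x + g x)"
  by (auto simp: L1w_def distrib_left)

lemma L1w_diff: "L1w f \<Longrightarrow> L1w g \<Longrightarrow> L1w (\<lambda>x. f x - g x)"
  by (auto simp: L1w_def right_diff_distrib)

lemma L1w_bound:
  assumes "L1w f" "g \<in> borel_measurable M" "AE x in M. \<bar>g x\<bar> \<le> \<bar>f x\<bar>"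
  shows "L1w g"
  unfolding L1w_def
proof (intro conjI Bochner_Integration.integrable_bound[of M "\<lambda>x. w x * f x" "\<lambda>x. w x * g x"])
  show "AE x in M. norm (w x * g x) \<le> norm (w x * f x)"
    using assms(3) by eventually_elim (auto simp: abs_mult intro: mult_left_mono)
qed (use assms in \<open>auto simp: L1w_def\<close>)

lemma L1w_bounded:
  assumes "g \<in> borel_measurable M" "\<And>x. \<bar>g x\<bar> \<le> B"
  shows "L1w g"
proof (rule L1w_bound)
  show "L1w (\<lambda>x. B)" using w_integrable by (auto simp: L1w_def)
  show "AE x in M. \<bar>g x\<bar> \<le> \<bar>B\<bar>" using assms(2) by (intro AE_I2) (meson abs_ge_self order_trans)
qed fact

lemma opK_add_AE:
  assumes "L1w f" "L1w g"
  shows "AE x in M. opK (\<lambda>y. f y + g y) x = opK f x + opK g x"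
  using L1w_AE_integrable[OF assms(1)] L1w_AE_integrable[OF assms(2)]
  by eventually_elim (simp add: opK_def distrib_left)

lemma opK_diff_AE:
  assumes "L1w f" "L1w g"
  shows "AE x in M. opK (\<lambda>y. f y - g y) x = opK f x - opK g x"
  using L1w_AE_integrable[OF assms(1)] L1w_AE_integrable[OF assms(2)]
  by eventually_elim (simp add: opK_def right_diff_distrib)

lemma opK_mono_AE:
  assumes "L1w f" "L1w g" "AE x in M. f x \<le> g x"
  shows "AE x in M. opK f x \<le> opK g x"
  using L1w_AE_integrable[OF assms(1)] L1w_AE_integrable[OF assms(2)]
proof eventually_elim
  case (elim x)
  show ?case
    unfolding opK_def using assms(3) K_nonneg
    by (intro integral_mono_AE elim) (auto elim!: eventually_mono intro: mult_left_mono)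
qed

lemma opK_nonneg: "(\<And>x. x \<in> space M \<Longrightarrow> 0 \<le> f x) \<Longrightarrow> 0 \<le> opK f x"
  unfolding opK_def using K_nonneg by (intro integral_nonneg_AE AE_I2) auto

lemma integrable_mult_weight:
  assumes f: "L1w f" and [measurable]: "\<xi> \<in> borel_measurable M" and B: "\<And>x. x \<in> space M \<Longrightarrow> \<bar>\<xi> x\<bar> \<le> B * w x"
  shows "integrable M (\<lambda>x. f x * \<xi> x)"
proof (rule Bochner_Integration.integrable_bound)
  show "integrable M (\<lambda>x. B * (w x * f x))" using f by (auto simp: L1w_def)
  show "AE x in M. norm (f x * \<xi> x) \<le> norm (B * (w x * f x))"
  proof (intro AE_I2)
    fix x assume "x \<in> space M"
    then have "\<bar>f x\<bar> * \<bar>\<xi> x\<bar> \<le> \<bar>f x\<bar> * \<bar>B * w x\<bar>"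
      using B[of x] by (intro mult_left_mono) auto
    then show "norm (f x * \<xi> x) \<le> norm (B * (w x * f x))" by (simp add: abs_mult mult_ac)
  qed
qed (use f in \<open>auto simp: L1w_def\<close>)

text \<open>The dual counterpart of the bound on L^1(w). It holds at every point of the space and
  makes the pairing of an L^1(w) function with \<open>opK \<xi>\<close> integrable.\<close>

lemma opK_weight_bound:
  assumes [measurable]: "\<xi> \<in> borel_measurable M" and B: "\<And>x. x \<in> space M \<Longrightarrow> \<bar>\<xi> x\<bar> \<le> B * w x"
    and x: "x \<in> space M" and "B \<ge> 0"
  shows "\<bar>opK \<xi> x\<bar> \<le> B * C * w x"
proof -
  have [measurable]: "K x \<in> borel_measurable M" using x by measurable
  have "ennreal \<bar>opK \<xi> x\<bar> \<le> (\<integral>\<^sup>+y. ennreal (norm (K x y * \<xi> y)) \<partial>M)"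
    unfolding opK_def by (rule ennreal_abs_integral_le)
  also have "\<dots> \<le> (\<integral>\<^sup>+y. ennreal B * ennreal (K x y * w y) \<partial>M)"
  proof (intro nn_integral_mono)
    fix y assume y: "y \<in> space M"
    have "K x y * \<bar>\<xi> y\<bar> \<le> K x y * (B * w y)" using K_nonneg B[OF y] by (intro mult_left_mono)
    then show "ennreal (norm (K x y * \<xi> y)) \<le> ennreal B * ennreal (K x y * w y)"
      using K_nonneg[of x y] \<open>B \<ge> 0\<close> by (auto simp: abs_mult ennreal_mult'[symmetric] mult_ac intro!: ennreal_leI)
  qed
  also have "\<dots> = ennreal B * (\<integral>\<^sup>+y. ennreal (K x y * w y) \<partial>M)"
    by (intro nn_integral_cmult) measurable
  also have "\<dots> \<le> ennreal B * ennreal (C * w x)"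
    by (intro mult_left_mono K_w x) auto
  also have "\<dots> = ennreal (B * C * w x)"
    using \<open>B \<ge> 0\<close> by (simp add: ennreal_mult'[symmetric] mult_ac)
  finally show ?thesis
    using \<open>B \<ge> 0\<close> C_pos w_pos[OF x] by (subst (asm) ennreal_le_iff) auto
qed

text \<open>Fubini and symmetry. The double integral converges absolutely since |xi| is at most a
  multiple of \<open>w\<close> and \<open>nn_integral_opK\<close> bounds what remains.\<close>

lemma opK_dual:
  assumes f: "L1w f" and \<xi> [measurable]: "\<xi> \<in> borel_measurable M"
    and B: "\<And>x. x \<in> space M \<Longrightarrow> \<bar>\<xi> x\<bar> \<le> B * w x"
  shows "(\<integral>x. opK f x * \<xi> x \<partial>M) = (\<integral>x. f x * opK \<xi> x \<partial>M)"
proof -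
  note sf = sigma_finite_measure_axioms
  interpret pair_sigma_finite M M ..
  have [measurable]: "f \<in> borel_measurable M" using f by (rule L1w_measurable)
  have int: "integrable (M \<Otimes>\<^sub>M M) (\<lambda>(x, y). \<xi> x * K x y * f y)"
  proof (rule integrableI_bounded)
    have "(\<integral>\<^sup>+z. ennreal (norm (case z of (x, y) \<Rightarrow> \<xi> x * K x y * f y)) \<partial>(M \<Otimes>\<^sub>M M))
       = (\<integral>\<^sup>+x. \<integral>\<^sup>+y. ennreal \<bar>\<xi> x * K x y * f y\<bar> \<partial>M \<partial>M)"
      by (subst sigma_finite_measure.nn_integral_fst[OF sf, where f="\<lambda>z. ennreal (norm (case z of (x, y) \<Rightarrow> \<xi> x * K x y * f y))", symmetric]) auto
    also have "\<dots> \<le> (\<integral>\<^sup>+x. ennreal \<bar>B\<bar> * (ennreal (w x) * (\<integral>\<^sup>+y. ennreal (K x y * \<bar>f y\<bar>) \<partial>M)) \<partial>M)"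
    proof (intro nn_integral_mono)
      fix x assume x [measurable]: "x \<in> space M"
      have "(\<integral>\<^sup>+y. ennreal \<bar>\<xi> x * K x y * f y\<bar> \<partial>M) = (\<integral>\<^sup>+y. ennreal \<bar>\<xi> x\<bar> * ennreal (K x y * \<bar>f y\<bar>) \<partial>M)"
        using K_nonneg by (intro nn_integral_cong) (simp add: abs_mult ennreal_mult'[symmetric] mult_ac)
      also have "\<dots> = ennreal \<bar>\<xi> x\<bar> * (\<integral>\<^sup>+y. ennreal (K x y * \<bar>f y\<bar>) \<partial>M)"
        by (intro nn_integral_cmult) measurable
      also have "\<dots> \<le> ennreal (\<bar>B\<bar> * w x) * (\<integral>\<^sup>+y. ennreal (K x y * \<bar>f y\<bar>) \<partial>M)"
        using B[OF x] w_pos[OF x]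
        by (intro mult_right_mono ennreal_leI) (auto intro: order_trans mult_right_mono)
      finally show "(\<integral>\<^sup>+y. ennreal \<bar>\<xi> x * K x y * f y\<bar> \<partial>M)
         \<le> ennreal \<bar>B\<bar> * (ennreal (w x) * (\<integral>\<^sup>+y. ennreal (K x y * \<bar>f y\<bar>) \<partial>M))"
        using w_pos[OF x] by (simp add: ennreal_mult' mult.assoc)
    qed
    also have "\<dots> = ennreal \<bar>B\<bar> * (\<integral>\<^sup>+x. ennreal (w x) * (\<integral>\<^sup>+y. ennreal (K x y * \<bar>f y\<bar>) \<partial>M) \<partial>M)"
      by (intro nn_integral_cmult) measurable
    also have "\<dots> \<le> ennreal \<bar>B\<bar> * (ennreal C * (\<integral>\<^sup>+y. ennreal (w y * \<bar>f y\<bar>) \<partial>M))"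
      by (intro mult_left_mono nn_integral_opK) auto
    also have "\<dots> < \<infinity>"
      by (simp add: nn_integral_L1w[OF f] ennreal_mult_less_top)
    finally show "(\<integral>\<^sup>+z. ennreal (norm (case z of (x, y) \<Rightarrow> \<xi> x * K x y * f y)) \<partial>(M \<Otimes>\<^sub>M M)) < \<infinity>" .
  qed measurable
  have "(\<integral>x. opK f x * \<xi> x \<partial>M) = (\<integral>x. \<integral>y. \<xi> x * K x y * f y \<partial>M \<partial>M)"
    unfolding opK_def by (subst mult.commute, subst integral_mult_right_zero[symmetric]) (simp add: mult.assoc)
  also have "\<dots> = (\<integral>y. \<integral>x. \<xi> x * K x y * f y \<partial>M \<partial>M)"
    by (rule Fubini_integral[symmetric, OF int])
  also have "\<dots> = (\<integral>x. f x * opK \<xi> x \<partial>M)"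
    unfolding opK_def integral_mult_right_zero[symmetric]
    by (intro Bochner_Integration.integral_cong refl) (simp add: K_sym mult_ac)
  finally show ?thesis .
qed

text \<open>Testing with w sgn (u - K f), which is admissible as it is bounded by \<open>w\<close>,
  turns the difference of the two sides into the weighted norm of u - K f.\<close>

lemma AE_eq_opK_if_dual:
  assumes u: "L1w u" and f: "L1w f"
    and dual: "\<And>\<xi>. \<xi> \<in> borel_measurable M \<Longrightarrow> (\<And>x. x \<in> space M \<Longrightarrow> \<bar>\<xi> x\<bar> \<le> w x) \<Longrightarrow>
      (\<integral>x. u x * \<xi> x \<partial>M) = (\<integral>x. f x * opK \<xi> x \<partial>M)"
  shows "AE x in M. u x = opK f x"
proof -
  have [measurable]: "f \<in> borel_measurable M" "u \<in> borel_measurable M"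
    using u f by (auto intro: L1w_measurable)
  define \<xi> where "\<xi> = (\<lambda>x. w x * sgn (u x - opK f x))"
  have [measurable]: "\<xi> \<in> borel_measurable M" unfolding \<xi>_def by measurable
  have le: "\<bar>\<xi> x\<bar> \<le> 1 * w x" if "x \<in> space M" for x
    using w_pos[OF that] by (simp add: \<xi>_def abs_mult sgn_real_def)
  have "(\<integral>x. (u x - opK f x) * \<xi> x \<partial>M) = (\<integral>x. u x * \<xi> x \<partial>M) - (\<integral>x. opK f x * \<xi> x \<partial>M)"
    by (simp add: left_diff_distrib integrable_mult_weight[OF u _ le] integrable_mult_weight[OF L1w_opK(1)[OF f] _ le])
  also have "\<dots> = 0"
    using dual[of \<xi>] le opK_dual[OF f _ le] by simp
  finally have 0: "(\<integral>x. (u x - opK f x) * \<xi> x \<partial>M) = 0" .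
  have eq: "(u x - opK f x) * \<xi> x = w x * \<bar>u x - opK f x\<bar>" for x
    by (simp add: \<xi>_def sgn_real_def)
  have int: "integrable M (\<lambda>x. (u x - opK f x) * \<xi> x)"
    by (rule integrable_mult_weight[OF L1w_diff[OF u L1w_opK(1)[OF f]] _ le]) auto
  have "AE x in M. (u x - opK f x) * \<xi> x = 0"
    using 0 w_pos by (subst integral_nonneg_eq_0_iff_AE[OF int, symmetric]) (auto simp: eq less_imp_le)
  then show ?thesis using AE_space
    by eventually_elim (use w_pos in \<open>force simp: eq\<close>)
qed

text \<open>Completeness of L^1(w) for sequences with geometrically small increments. The increments
  multiplied by \<open>w\<close> form a series that converges absolutely almost everywhere; its sum,
  divided by the positive weight and added to \<open>u 0\<close>, is the limit, and the series of
  absolute values is the majorant.\<close>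

lemma L1w_Cauchy_limit:
  assumes u: "\<And>n. L1w (u n)"
    and cauchy: "\<And>n. (\<integral>x. w x * \<bar>u (Suc n) x - u n x\<bar> \<partial>M) \<le> c * (1/2) ^ n"
  shows "\<exists>v. L1w v \<and> (\<lambda>n. \<integral>x. w x * \<bar>u n x - v x\<bar> \<partial>M) \<longlonglongrightarrow> 0"
proof -
  have [measurable]: "u n \<in> borel_measurable M" for n using u by (rule L1w_measurable)
  define d where "d = (\<lambda>n x. w x * (u (Suc n) x - u n x))"
  have d_int: "integrable M (d n)" for n
    using u by (auto simp: d_def L1w_def right_diff_distrib)
  have norm_d: "(\<integral>x. norm (d n x) \<partial>M) = (\<integral>x. w x * \<bar>u (Suc n) x - u n x\<bar> \<partial>M)" for n
    using w_pos by (intro Bochner_Integration.integral_cong) (auto simp: d_def abs_mult less_imp_le)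
  have c_summable: "summable (\<lambda>n. c * (1/2::real) ^ n)" by (intro summable_mult summable_geometric) auto
  have summ: "summable (\<lambda>n. \<integral>x. norm (d n x) \<partial>M)"
  proof (rule summable_comparison_test'[OF c_summable, of 0])
    show "norm (\<integral>x. norm (d n x) \<partial>M) \<le> c * (1/2) ^ n" for n
      using cauchy[of n] integral_nonneg_AE[of "\<lambda>x. norm (d n x)" M] unfolding norm_d[symmetric] by simp
  qed
  have "(\<integral>\<^sup>+x. (\<Sum>n. ennreal (norm (d n x))) \<partial>M) = (\<Sum>n. \<integral>\<^sup>+x. ennreal (norm (d n x)) \<partial>M)"
    using d_int by (intro nn_integral_suminf) (auto simp: d_def)
  also have "\<dots> = (\<Sum>n. ennreal (\<integral>x. norm (d n x) \<partial>M))"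
    using d_int by (simp add: nn_integral_eq_integral)
  also have "\<dots> < \<infinity>"
    by (subst suminf_ennreal2[OF _ summ]) (auto simp: less_top[symmetric])
  finally have "AE x in M. (\<Sum>n. ennreal (norm (d n x))) \<noteq> \<infinity>"
    by (intro nn_integral_PInf_AE) (auto simp: d_def less_top[symmetric])
  then have AE_summ: "AE x in M. summable (\<lambda>n. norm (d n x))"
    by eventually_elim (auto intro!: summable_suminf_not_top)
  have int_sum: "integrable M (\<lambda>x. \<Sum>n. d n x)" "integrable M (\<lambda>x. \<Sum>n. norm (d n x))"
    using integrable_suminf[OF d_int AE_summ summ]
      integrable_suminf[of M "\<lambda>n x. norm (d n x)"] d_int AE_summ summ by auto
  define v where "v = (\<lambda>x. u 0 x + (\<Sum>n. d n x) / w x)"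
  have [measurable]: "(\<lambda>x. \<Sum>n. d n x) \<in> borel_measurable M" "(\<lambda>x. \<Sum>n. norm (d n x)) \<in> borel_measurable M"
    using int_sum by auto
  have [measurable]: "v \<in> borel_measurable M" unfolding v_def by measurable
  have partial: "(\<Sum>i<n. d i x) = w x * (u n x - u 0 x)" for n x
    by (induction n) (auto simp: d_def algebra_simps)
  have "integrable M (\<lambda>x. w x * u 0 x + (\<Sum>n. d n x))"
    using int_sum u[of 0] by (auto simp: L1w_def)
  moreover have "AE x in M. w x * u 0 x + (\<Sum>n. d n x) = w x * v x"
    using w_pos by (intro AE_I2) (force simp: v_def field_simps)
  ultimately have "integrable M (\<lambda>x. w x * v x)"
    by (subst (asm) integrable_cong_AE) auto
  then have v: "L1w v" by (simp add: L1w_def)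
  moreover have "(\<lambda>n. \<integral>x. w x * \<bar>u n x - v x\<bar> \<partial>M) \<longlonglongrightarrow> (\<integral>x. 0 \<partial>M)"
  proof (rule integral_dominated_convergence)
    show "integrable M (\<lambda>x. 2 * (\<Sum>n. norm (d n x)))" using int_sum by auto
    have key: "w x * \<bar>u n x - v x\<bar> = \<bar>(\<Sum>i<n. d i x) - (\<Sum>i. d i x)\<bar>" if "x \<in> space M" for x n
    proof -
      have "(\<Sum>i<n. d i x) - (\<Sum>i. d i x) = w x * (u n x - v x)"
        using w_pos[OF that] by (simp add: partial v_def field_simps)
      then show ?thesis using w_pos[OF that] by (simp add: abs_mult)
    qed
    show "AE x in M. (\<lambda>n. w x * \<bar>u n x - v x\<bar>) \<longlonglongrightarrow> 0"
      using AE_summ AE_space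
    proof eventually_elim
      case (elim x)
      have "(\<lambda>n. \<Sum>i<n. d i x) \<longlonglongrightarrow> (\<Sum>i. d i x)"
        by (rule summable_LIMSEQ[OF summable_norm_cancel[OF elim(1)]])
      then show ?case using key[OF elim(2)] by (simp add: tendsto_rabs_zero LIM_zero)
    qed
    show "AE x in M. norm (w x * \<bar>u n x - v x\<bar>) \<le> 2 * (\<Sum>n. norm (d n x))" for n
      using AE_summ AE_space
    proof eventually_elim
      case (elim x)
      have "\<bar>\<Sum>i<n. d i x\<bar> \<le> (\<Sum>i<n. norm (d i x))" by (simp add: sum_abs)
      also have "\<dots> \<le> (\<Sum>i. norm (d i x))" using elim by (intro sum_le_suminf) auto
      finally have "\<bar>\<Sum>i<n. d i x\<bar> \<le> (\<Sum>i. norm (d i x))" .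
      moreover have "\<bar>\<Sum>i. d i x\<bar> \<le> (\<Sum>i. norm (d i x))" using summable_norm[OF elim(1)] by simp
      ultimately show ?case unfolding key[OF elim(2)] by simp
    qed
  qed auto
  ultimately show ?thesis by (auto intro!: exI[of _ v])
qed

end

section \<open>Comparison, stability and existence from the Kato inequality\<close>

locale kato_kernel = weighted_kernel +
  assumes kato: "L1w f \<Longrightarrow> AE x in M. \<bar>opK f x\<bar> \<le> opK (\<lambda>y. f y * sgn (opK f y)) x"
begin

text \<open>Put g = f sgn u. The Kato inequality gives |u| <= K g, hence |u| + u <= K[g + f]. Now g
  + f is 2 f where u > 0, f where u = 0 and 0 where u < 0, so it is never positive and |u| + u <=
  0.\<close>

lemma comparison:
  assumes f: "L1w f" and u: "AE x in M. u x = opK f x" and le: "AE x in M. u x \<ge> 0 \<longrightarrow> f x \<le> 0"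
  shows "AE x in M. u x \<le> 0"
proof -
  have [measurable]: "f \<in> borel_measurable M" using f by (rule L1w_measurable)
  define g where "g = (\<lambda>y. f y * sgn (opK f y))"
  have g: "L1w g"
    by (rule L1w_bound[OF f]) (auto simp: g_def abs_mult sgn_real_def)
  have "AE x in M. g x + f x \<le> 0"
    using u le by eventually_elim (auto simp: g_def sgn_real_def)
  then have "AE x in M. opK (\<lambda>y. g y + f y) x \<le> opK (\<lambda>y. 0) x"
    by (intro opK_mono_AE L1w_add g f) (auto simp: L1w_def)
  then show ?thesis
    using opK_add_AE[OF g f] kato[OF f] u
    by eventually_elim (auto simp: opK_def[of "\<lambda>y. 0"] g_def[symmetric])
qed

text \<open>Since \<open>g\<close> is decreasing, (g(u1) - g(u2)) sgn (u1 - u2) <= 0, and the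
  nonlinear term drops out of the right-hand side of the Kato inequality: |u1 - u2| <= K |r1 - r2|.
  The resulting constant \<open>C\<close> does not depend on \<open>g\<close>, which is what keeps
  the steps of the continuity method from shrinking.\<close>

lemma stability:
  assumes r: "L1w r1" "L1w r2" and g: "antimono g" "L1w (\<lambda>x. g (u1 x))" "L1w (\<lambda>x. g (u2 x))"
    and u: "AE x in M. u1 x = opK (\<lambda>y. r1 y + g (u1 y)) x" "AE x in M. u2 x = opK (\<lambda>y. r2 y + g (u2 y)) x"
    and u_meas [measurable]: "u1 \<in> borel_measurable M" "u2 \<in> borel_measurable M"
  shows "(\<integral>x. w x * \<bar>u1 x - u2 x\<bar> \<partial>M) \<le> C * (\<integral>x. w x * \<bar>r1 x - r2 x\<bar> \<partial>M)"
proof -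
  define f where "f = (\<lambda>y. (r1 y + g (u1 y)) - (r2 y + g (u2 y)))"
  have f: "L1w f" unfolding f_def by (intro L1w_diff L1w_add r g)
  have [measurable]: "f \<in> borel_measurable M" "r1 \<in> borel_measurable M" "r2 \<in> borel_measurable M"
    using f r by (auto intro: L1w_measurable)
  have diff: "AE x in M. opK f x = u1 x - u2 x"
    using opK_diff_AE[OF L1w_add[OF r(1) g(2)] L1w_add[OF r(2) g(3)]] u
    by eventually_elim (simp add: f_def)
  have fs: "L1w (\<lambda>y. f y * sgn (opK f y))"
    by (rule L1w_bound[OF f]) (auto simp: abs_mult sgn_real_def)
  have r12: "L1w (\<lambda>y. \<bar>r1 y - r2 y\<bar>)"
    by (rule L1w_bound[OF L1w_diff[OF r]]) auto
  have "AE x in M. f x * sgn (opK f x) \<le> \<bar>r1 x - r2 x\<bar>"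
    using diff
  proof eventually_elim
    case (elim x)
    have "u1 x \<le> u2 x \<Longrightarrow> g (u2 x) \<le> g (u1 x)" "u2 x \<le> u1 x \<Longrightarrow> g (u1 x) \<le> g (u2 x)"
      using g(1) by (auto simp: antimono_def)
    then show ?case using elim by (auto simp: f_def sgn_real_def)
  qed
  then have "AE x in M. opK (\<lambda>y. f y * sgn (opK f y)) x \<le> opK (\<lambda>y. \<bar>r1 y - r2 y\<bar>) x"
    by (intro opK_mono_AE fs r12)
  then have le: "AE x in M. \<bar>u1 x - u2 x\<bar> \<le> \<bar>opK (\<lambda>y. \<bar>r1 y - r2 y\<bar>) x\<bar>"
    using kato[OF f] diff by eventually_elim linarith
  have "L1w (\<lambda>x. u1 x - u2 x)"
    by (rule L1w_bound[OF L1w_opK(1)[OF r12]]) (use le in auto)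
  then have "(\<integral>x. w x * \<bar>u1 x - u2 x\<bar> \<partial>M) \<le> (\<integral>x. w x * \<bar>opK (\<lambda>y. \<bar>r1 y - r2 y\<bar>) x\<bar> \<partial>M)"
  proof (intro integral_mono_AE nn_integral_L1w(2) L1w_opK r12)
    show "AE x in M. w x * \<bar>u1 x - u2 x\<bar> \<le> w x * \<bar>opK (\<lambda>y. \<bar>r1 y - r2 y\<bar>) x\<bar>"
      using le AE_space by eventually_elim (use w_pos in \<open>auto intro: mult_left_mono less_imp_le\<close>)
  qed
  also have "\<dots> \<le> C * (\<integral>x. w x * \<bar>r1 x - r2 x\<bar> \<partial>M)"
    using L1w_opK(2)[OF r12] by simp
  finally show ?thesis .
qed

definition solvable :: "(real \<Rightarrow> real) \<Rightarrow> bool" where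
  "solvable g \<longleftrightarrow> (\<forall>r. L1w r \<longrightarrow> (\<exists>u. L1w u \<and> (AE x in M. u x = opK (\<lambda>y. r y + g (u y)) x)))"

text \<open>By stability the map sending \<open>u\<close> to the solution \<open>v\<close> of \<open>v = K[r + g\<^sub>1(u) + g\<^sub>0(v)]\<close> is a contraction.\<close>

lemma solvable_step:
  assumes g0: "solvable g0" "antimono g0" "g0 \<in> borel_measurable borel" "\<And>t. \<bar>g0 t\<bar> \<le> B0"
    and g1: "g1 \<in> borel_measurable borel" "\<And>t. \<bar>g1 t\<bar> \<le> B1"
    and lip: "\<And>s t. C * \<bar>g1 s - g1 t\<bar> \<le> \<bar>s - t\<bar> / 2"
  shows "solvable (\<lambda>t. g1 t + g0 t)"
  unfolding solvable_def
proof (intro allI impI)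
  fix r assume r: "L1w r"
  have g0_L1w: "L1w (\<lambda>x. g0 (u x))" if "L1w u" for u
    using g0(4) measurable_compose[OF L1w_measurable[OF that] g0(3)] by (rule L1w_bounded[rotated])
  have g1_L1w: "L1w (\<lambda>x. g1 (u x))" if "L1w u" for u
    using g1(2) measurable_compose[OF L1w_measurable[OF that] g1(1)] by (rule L1w_bounded[rotated])
  obtain S where S: "\<And>r. L1w r \<Longrightarrow> L1w (S r)"
      "\<And>r. L1w r \<Longrightarrow> AE x in M. S r x = opK (\<lambda>y. r y + g0 (S r y)) x"
    using g0(1) unfolding solvable_def by metis
  define \<Phi> where "\<Phi> = (\<lambda>u. S (\<lambda>y. r y + g1 (u y)))"
  have \<Phi>_L1w: "L1w (\<Phi> u)" if "L1w u" for u
    unfolding \<Phi>_def by (intro S L1w_add r g1_L1w that)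
  have contr: "(\<integral>x. w x * \<bar>\<Phi> u x - \<Phi> v x\<bar> \<partial>M) \<le> (\<integral>x. w x * \<bar>u x - v x\<bar> \<partial>M) / 2"
    if uv: "L1w u" "L1w v" for u v
  proof -
    have "(\<integral>x. w x * \<bar>\<Phi> u x - \<Phi> v x\<bar> \<partial>M)
        \<le> C * (\<integral>x. w x * \<bar>(r x + g1 (u x)) - (r x + g1 (v x))\<bar> \<partial>M)"
      using uv unfolding \<Phi>_def
      by (intro stability[OF _ _ g0(2)] S L1w_add r g1_L1w g0_L1w L1w_measurable)
    also have "\<dots> = (\<integral>x. w x * (C * \<bar>g1 (u x) - g1 (v x)\<bar>) \<partial>M)"
      by (simp add: mult.left_commute)
    also have "\<dots> \<le> (\<integral>x. w x * \<bar>u x - v x\<bar> / 2 \<partial>M)"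
    proof (intro integral_mono)
      have "integrable M (\<lambda>x. C * (w x * \<bar>g1 (u x) - g1 (v x)\<bar>))"
        using nn_integral_L1w(2)[OF L1w_diff[OF g1_L1w[OF uv(1)] g1_L1w[OF uv(2)]]] by auto
      then show "integrable M (\<lambda>x. w x * (C * \<bar>g1 (u x) - g1 (v x)\<bar>))"
        by (simp add: mult.left_commute)
      show "integrable M (\<lambda>x. w x * \<bar>u x - v x\<bar> / 2)"
        using nn_integral_L1w(2)[OF L1w_diff[OF uv]] by auto
      show "w x * (C * \<bar>g1 (u x) - g1 (v x)\<bar>) \<le> w x * \<bar>u x - v x\<bar> / 2" if "x \<in> space M" for x
        using mult_left_mono[OF lip[of "u x" "v x"], of "w x"] w_pos[OF that] by simp
    qed
    finally show ?thesis by simp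
  qed
  define u where "u = (\<lambda>n. (\<Phi> ^^ n) (\<lambda>_. 0))"
  have u_Suc: "u (Suc n) = \<Phi> (u n)" for n by (simp add: u_def)
  have u_L1w: "L1w (u n)" for n
    by (induction n) (auto simp: u_def L1w_def[of "\<lambda>_. 0"] intro: \<Phi>_L1w)
  have "(\<integral>x. w x * \<bar>u (Suc n) x - u n x\<bar> \<partial>M) \<le> (\<integral>x. w x * \<bar>u 1 x - u 0 x\<bar> \<partial>M) * (1/2) ^ n" for n
  proof (induction n)
    case (Suc n)
    then show ?case using contr[OF u_L1w[of "Suc n"] u_L1w[of n]] by (simp add: u_Suc)
  qed simp
  from L1w_Cauchy_limit[of u, OF u_L1w this]
  obtain v where v: "L1w v" and lim: "(\<lambda>n. \<integral>x. w x * \<bar>u n x - v x\<bar> \<partial>M) \<longlonglongrightarrow> 0"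
    by blast
  \<comment> \<open>The term \<Phi> (u n) = u (Suc n) is inserted between \<Phi> v and v:
    contraction bounds the one distance, convergence the other. Hence the limit \<open>v\<close> is
    a fixed point up to a null set.\<close>
  have le: "(\<integral>x. w x * \<bar>\<Phi> v x - v x\<bar> \<partial>M)
      \<le> (\<integral>x. w x * \<bar>u n x - v x\<bar> \<partial>M) / 2 + (\<integral>x. w x * \<bar>u (Suc n) x - v x\<bar> \<partial>M)" for n
  proof -
    have int: "integrable M (\<lambda>x. w x * \<bar>\<Phi> (u n) x - \<Phi> v x\<bar>)" "integrable M (\<lambda>x. w x * \<bar>\<Phi> (u n) x - v x\<bar>)"
        "integrable M (\<lambda>x. w x * \<bar>\<Phi> v x - v x\<bar>)"
      by (intro nn_integral_L1w(2) L1w_diff \<Phi>_L1w u_L1w v)+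
    have "(\<integral>x. w x * \<bar>\<Phi> v x - v x\<bar> \<partial>M) \<le> (\<integral>x. w x * \<bar>\<Phi> (u n) x - \<Phi> v x\<bar> + w x * \<bar>\<Phi> (u n) x - v x\<bar> \<partial>M)"
    proof (intro integral_mono int Bochner_Integration.integrable_add)
      fix x assume "x \<in> space M"
      then show "w x * \<bar>\<Phi> v x - v x\<bar> \<le> w x * \<bar>\<Phi> (u n) x - \<Phi> v x\<bar> + w x * \<bar>\<Phi> (u n) x - v x\<bar>"
        unfolding distrib_left[symmetric] using w_pos[of x] by (intro mult_left_mono) auto
    qed
    also have "\<dots> = (\<integral>x. w x * \<bar>\<Phi> (u n) x - \<Phi> v x\<bar> \<partial>M) + (\<integral>x. w x * \<bar>\<Phi> (u n) x - v x\<bar> \<partial>M)"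
      by (intro Bochner_Integration.integral_add int)
    finally show ?thesis using contr[OF u_L1w[of n] v] by (simp add: u_Suc)
  qed
  have "(\<lambda>n. (\<integral>x. w x * \<bar>u n x - v x\<bar> \<partial>M) / 2 + (\<integral>x. w x * \<bar>u (Suc n) x - v x\<bar> \<partial>M)) \<longlonglongrightarrow> 0 / 2 + 0"
    by (rule tendsto_add[OF tendsto_divide[OF lim tendsto_const] LIMSEQ_Suc[OF lim]]) simp
  then have "(\<integral>x. w x * \<bar>\<Phi> v x - v x\<bar> \<partial>M) \<le> 0"
    using le by (intro LIMSEQ_le_const[of _ 0]) auto
  moreover have int: "integrable M (\<lambda>x. w x * \<bar>\<Phi> v x - v x\<bar>)"
    by (intro nn_integral_L1w(2) L1w_diff \<Phi>_L1w v)
  moreover have nn: "AE x in M. 0 \<le> w x * \<bar>\<Phi> v x - v x\<bar>"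
    using w_pos by (intro AE_I2) (simp add: less_imp_le)
  ultimately have "(\<integral>x. w x * \<bar>\<Phi> v x - v x\<bar> \<partial>M) = 0"
    using integral_nonneg_AE[OF nn] by linarith
  then have "AE x in M. w x * \<bar>\<Phi> v x - v x\<bar> = 0"
    using integral_nonneg_eq_0_iff_AE[OF int nn] by simp
  then have eq: "AE x in M. \<Phi> v x = v x"
    using AE_space by eventually_elim (use w_pos in force)
  have meas: "(\<lambda>y. r y + g1 (v y) + g0 (\<Phi> v y)) \<in> borel_measurable M"
      "(\<lambda>y. r y + (g1 (v y) + g0 (v y))) \<in> borel_measurable M"
    by (intro L1w_measurable L1w_add r g1_L1w g0_L1w \<Phi>_L1w v)+
  have "AE x in M. v x = opK (\<lambda>y. r y + (g1 (v y) + g0 (v y))) x"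
    using S(2)[OF L1w_add[OF r g1_L1w[OF v]]] eq AE_space
  proof eventually_elim
    case (elim x)
    have "opK (\<lambda>y. r y + g1 (v y) + g0 (\<Phi> v y)) x = opK (\<lambda>y. r y + (g1 (v y) + g0 (v y))) x"
      using eq by (intro opK_cong_AE meas elim) (auto elim!: eventually_mono)
    then show ?case using elim by (simp add: \<Phi>_def)
  qed
  then show "\<exists>u. L1w u \<and> (AE x in M. u x = opK (\<lambda>y. r y + (g1 (u y) + g0 (u y))) x)"
    using v by blast
qed

text \<open>\<open>g\<close> is added in \<open>m\<close> equal portions with m > 2 C \<Lambda>, so
  that C times the Lipschitz constant of a portion is at most 1/2. Every stage has the same
  stability constant, and finitely many portions suffice.\<close>

lemma solvable_antimono_lipschitz:
  assumes g: "antimono g" "g \<in> borel_measurable borel" "\<And>t. \<bar>g t\<bar> \<le> B"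
    and lip: "\<And>s t. \<bar>g s - g t\<bar> \<le> \<Lambda> * \<bar>s - t\<bar>"
  shows "solvable g"
proof -
  have [measurable]: "g \<in> borel_measurable borel" by fact
  obtain m :: nat where m: "2 * C * \<Lambda> < real m" "m > 0"
    using reals_Archimedean2[of "max 0 (2 * C * \<Lambda>)"] by auto
  have "solvable (\<lambda>t. real k / real m * g t)" for k
  proof (induction k)
    case 0
    have "\<exists>u. L1w u \<and> (AE x in M. u x = opK r x)" if "L1w r" for r
      using L1w_opK(1)[OF that] by blast
    then show ?case by (simp add: solvable_def)
  next
    case (Suc k)
    have "solvable (\<lambda>t. g t / real m + real k / real m * g t)"
    proof (rule solvable_step[OF Suc])
      show "antimono (\<lambda>t. real k / real m * g t)"
        using g(1) by (auto simp: antimono_def intro!: mult_left_mono divide_right_mono)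
      show "\<bar>real k / real m * g t\<bar> \<le> real k / real m * B" for t
        using g(3)[of t] by (auto simp: abs_mult intro!: mult_left_mono divide_right_mono)
      show "\<bar>g t / real m\<bar> \<le> B / real m" for t
        using g(3)[of t] by (auto intro!: divide_right_mono)
      show "C * \<bar>g s / real m - g t / real m\<bar> \<le> \<bar>s - t\<bar> / 2" for s t
      proof -
        have "C * \<bar>g s / real m - g t / real m\<bar> = C * \<bar>g s - g t\<bar> / real m"
          by (simp add: diff_divide_distrib[symmetric])
        also have "\<dots> \<le> C * (\<Lambda> * \<bar>s - t\<bar>) / real m"
          using lip[of s t] C_pos by (intro divide_right_mono mult_left_mono) auto
        also have "\<dots> = (2 * C * \<Lambda>) * \<bar>s - t\<bar> / (2 * real m)" by simp
        also have "\<dots> \<le> real m * \<bar>s - t\<bar> / (2 * real m)"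
          using m by (intro divide_right_mono mult_right_mono) auto
        finally show ?thesis using m by simp
      qed
    qed auto
    moreover have "(\<lambda>t. g t / real m + real k / real m * g t) = (\<lambda>t. real (Suc k) / real m * g t)"
      by (auto simp: algebra_simps add_divide_distrib)
    ultimately show ?case by simp
  qed
  from this[of m] show ?thesis using m by simp
qed

text \<open>The nonlinearity (max t 0 + \<epsilon>) powr - q is decreasing, bounded by its value at
  0 and Lipschitz with the constant that its derivative has at 0. The truncation at 0 makes it total
  and is harmless because \<open>opK\<close> of a nonnegative function is nonnegative.\<close>

lemma regularised_solution:
  assumes "q > 0" "\<epsilon> > 0"
  shows "\<exists>u. L1w u \<and> (\<forall>x. u x \<ge> 0) \<and> (AE x in M. u x = opK (\<lambda>y. (u y + \<epsilon>) powr - q) x)"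
proof -
  define g where "g = (\<lambda>t::real. (max t 0 + \<epsilon>) powr - q)"
  have g_nonneg: "g t \<ge> 0" for t by (simp add: g_def)
  have mono: "(t + \<epsilon>) powr - q \<le> (s + \<epsilon>) powr - q" if "0 \<le> s" "s \<le> t" for s t
    using that assms by (intro powr_mono2') auto
  have bound: "\<bar>g t\<bar> \<le> \<epsilon> powr - q" for t
    using mono[of 0 "max t 0"] by (simp add: g_def)
  have lip: "\<bar>(s + \<epsilon>) powr - q - (t + \<epsilon>) powr - q\<bar> \<le> q * \<epsilon> powr (- q - 1) * \<bar>s - t\<bar>"
    if "0 \<le> s" "0 \<le> t" for s t
  proof -
    have "norm ((s + \<epsilon>) powr - q - (t + \<epsilon>) powr - q) \<le> (q * \<epsilon> powr (- q - 1)) * norm (s - t)"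
    proof (rule field_differentiable_bound[of "{0..}"])
      show "((\<lambda>t. (t + \<epsilon>) powr - q) has_field_derivative (- q * (z + \<epsilon>) powr (- q - 1))) (at z within {0..})"
        if "z \<in> {0..}" for z
        using that assms by (auto intro!: derivative_eq_intros simp: powr_diff field_simps)
      show "norm (- q * (z + \<epsilon>) powr (- q - 1)) \<le> q * \<epsilon> powr (- q - 1)" if "z \<in> {0..}" for z
        using that assms by (auto simp: abs_mult intro!: mult_left_mono powr_mono2')
    qed (use that in auto)
    then show ?thesis by simp
  qed
  have "solvable g"
  proof (rule solvable_antimono_lipschitz)
    show "antimono g" using mono by (auto simp: antimono_def g_def)
    show "g \<in> borel_measurable borel" unfolding g_def by measurable
    show "\<bar>g s - g t\<bar> \<le> q * \<epsilon> powr (- q - 1) * \<bar>s - t\<bar>" for s t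
    proof -
      have "\<bar>g s - g t\<bar> \<le> q * \<epsilon> powr (- q - 1) * \<bar>max s 0 - max t 0\<bar>"
        unfolding g_def by (rule lip) auto
      also have "\<dots> \<le> q * \<epsilon> powr (- q - 1) * \<bar>s - t\<bar>"
        using assms by (intro mult_left_mono) auto
      finally show ?thesis .
    qed
  qed (rule bound)
  then obtain u where u: "L1w u" "AE x in M. u x = opK (\<lambda>y. g (u y)) x"
    unfolding solvable_def by (auto simp: L1w_def[of "\<lambda>_. 0"] dest!: spec[of _ "\<lambda>_. 0"])
  have [measurable]: "u \<in> borel_measurable M" using u(1) by (rule L1w_measurable)
  have g_meas [measurable]: "g \<in> borel_measurable borel" unfolding g_def by measurable
  \<comment> \<open>This representative of \<open>u\<close> is nonnegative everywhere, so that max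
    disappears from the equation.\<close>
  define v where "v = opK (\<lambda>y. g (u y))"
  have v_nonneg: "v x \<ge> 0" for x unfolding v_def by (intro opK_nonneg g_nonneg)
  have [measurable]: "v \<in> borel_measurable M" unfolding v_def by measurable
  have eq: "AE x in M. u x = v x" using u by (simp add: v_def)
  have "AE x in M. v x = opK (\<lambda>y. (v y + \<epsilon>) powr - q) x"
    using AE_space
  proof eventually_elim
    case (elim x)
    have "opK (\<lambda>y. g (u y)) x = opK (\<lambda>y. (v y + \<epsilon>) powr - q) x"
      using eq v_nonneg by (intro opK_cong_AE elim) (auto elim!: eventually_mono simp: g_def max_absorb1)
    then show ?case by (simp add: v_def)
  qed
  moreover have "L1w v"
    by (rule L1w_bound[OF u(1)]) (use eq in auto)
  ultimately show ?thesis using v_nonneg by blast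
qed

lemma L1w_regularised:
  assumes "q > 0" "\<epsilon> > 0" "u \<in> borel_measurable M" "\<And>x. u x \<ge> 0"
  shows "L1w (\<lambda>y. (u y + \<epsilon>) powr - q)"
proof (rule L1w_bounded)
  show "\<bar>(u x + \<epsilon>) powr - q\<bar> \<le> \<epsilon> powr - q" for x
    using powr_mono2'[of "-q" \<epsilon> "u x + \<epsilon>"] assms by auto
qed (use assms in measurable)

text \<open>Where u' >= u one also has u' + \<epsilon>' >= u + \<epsilon>, so the difference of the
  right-hand sides is nonpositive there, as \<open>comparison\<close> requires.\<close>

lemma regularised_mono:
  assumes q: "q > 0" and \<epsilon>: "0 < \<epsilon>" "\<epsilon> \<le> \<epsilon>'"
    and u: "u \<in> borel_measurable M" "\<And>x. u x \<ge> 0" "AE x in M. u x = opK (\<lambda>y. (u y + \<epsilon>) powr - q) x"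
    and u': "u' \<in> borel_measurable M" "\<And>x. u' x \<ge> 0" "AE x in M. u' x = opK (\<lambda>y. (u' y + \<epsilon>') powr - q) x"
  shows "AE x in M. u' x \<le> u x"
proof -
  have L: "L1w (\<lambda>y. (u y + \<epsilon>) powr - q)" "L1w (\<lambda>y. (u' y + \<epsilon>') powr - q)"
    using assms by (auto intro!: L1w_regularised)
  have "AE x in M. u' x - u x \<le> 0"
  proof (rule comparison[OF L1w_diff[OF L(2,1)]])
    show "AE x in M. u' x - u x = opK (\<lambda>y. (u' y + \<epsilon>') powr - q - (u y + \<epsilon>) powr - q) x"
      using opK_diff_AE[OF L(2,1)] u(3) u'(3) by eventually_elim simp
    show "AE x in M. 0 \<le> u' x - u x \<longrightarrow> (u' x + \<epsilon>') powr - q - (u x + \<epsilon>) powr - q \<le> 0"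
    proof (intro AE_I2 impI)
      fix x assume "0 \<le> u' x - u x"
      then show "(u' x + \<epsilon>') powr - q - (u x + \<epsilon>) powr - q \<le> 0"
        using powr_mono2'[of "-q" "u x + \<epsilon>" "u' x + \<epsilon>'"] u(2)[of x] assms by auto
    qed
  qed
  then show ?thesis by simp
qed

text \<open>With c0 = min 1 (1 / C1) the function c0 K[(b + \<epsilon>)^-q] stays below
  \<open>b\<close>. Where it is at least \<open>u\<close>, therefore, u <= b and c0 (b +
  \<epsilon>)^-q <= (u + \<epsilon>)^-q, so comparison puts it below \<open>u\<close> everywhere up
  to a null set. The lower estimate \<open>low\<close> is asked for where \<epsilon> <= b, where b +
  \<epsilon> and b are comparable; where b < \<epsilon> the conclusion is immediate because of the
  summand \<epsilon>.\<close>

lemma regularised_barrier: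
  assumes q: "q > 0" and \<epsilon>: "0 < \<epsilon>" and b [measurable]: "b \<in> borel_measurable M"
    and b_pos: "\<And>x. x \<in> space M \<Longrightarrow> b x > 0" and C1: "C1 > 0" and c1: "c1 > 0"
    and up: "AE x in M. opK (\<lambda>y. (b y + \<epsilon>) powr - q) x \<le> C1 * b x"
    and low: "AE x in M. \<epsilon> \<le> b x \<longrightarrow> c1 * b x \<le> opK (\<lambda>y. (b y + \<epsilon>) powr - q) x"
    and u [measurable]: "u \<in> borel_measurable M" and u_nonneg: "\<And>x. u x \<ge> 0"
    and u_eq: "AE x in M. u x = opK (\<lambda>y. (u y + \<epsilon>) powr - q) x"
  shows "AE x in M. min 1 (min 1 (1 / C1) * c1) * b x \<le> u x + \<epsilon>"
proof -
  define c0 where "c0 = min 1 (1 / C1)"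
  have c0: "c0 > 0" "c0 \<le> 1" "c0 * C1 \<le> 1" using C1 by (auto simp: c0_def min_def field_simps)
  let ?g = "\<lambda>y. (b y + \<epsilon>) powr - q" and ?h = "\<lambda>y. (u y + \<epsilon>) powr - q"
  have g: "L1w ?g"
  proof (rule L1w_bound)
    show "L1w (\<lambda>_. \<epsilon> powr - q)" by (rule L1w_bounded[of _ "\<epsilon> powr - q"]) auto
    show "AE x in M. \<bar>?g x\<bar> \<le> \<bar>\<epsilon> powr - q\<bar>"
    proof (intro AE_I2)
      fix x assume "x \<in> space M"
      then show "\<bar>?g x\<bar> \<le> \<bar>\<epsilon> powr - q\<bar>"
        using powr_mono2'[of "-q" \<epsilon> "b x + \<epsilon>"] b_pos[of x] q \<epsilon> by simp
    qed
  qed measurable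
  have h: "L1w ?h" by (rule L1w_regularised[OF q \<epsilon> u u_nonneg])
  have cg: "L1w (\<lambda>y. c0 * ?g y)" using c0 by (intro L1w_bound[OF g] AE_I2) (auto simp: abs_mult intro: mult_left_le_one_le)
  have c_opK: "opK (\<lambda>y. c0 * ?g y) x = c0 * opK ?g x" for x
    unfolding opK_def by (simp add: mult.left_commute)
  have "AE x in M. c0 * opK ?g x - u x \<le> 0"
  proof (rule comparison[OF L1w_diff[OF cg h]])
    show "AE x in M. c0 * opK ?g x - u x = opK (\<lambda>y. c0 * ?g y - ?h y) x"
      using opK_diff_AE[OF cg h] u_eq by eventually_elim (simp add: c_opK)
    show "AE x in M. 0 \<le> c0 * opK ?g x - u x \<longrightarrow> c0 * ?g x - ?h x \<le> 0"
      using up AE_space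
    proof eventually_elim
      case (elim x)
      show ?case
      proof
        assume le: "0 \<le> c0 * opK ?g x - u x"
        have "c0 * opK ?g x \<le> c0 * (C1 * b x)" using elim c0 by (intro mult_left_mono) auto
        also have "\<dots> \<le> b x" using mult_right_mono[OF c0(3), of "b x"] b_pos[OF elim(2)] by (simp add: mult.assoc)
        finally have "u x + \<epsilon> \<le> b x + \<epsilon>" using le by simp
        then have "?g x \<le> ?h x" using q \<epsilon> u_nonneg[of x] by (intro powr_mono2') auto
        moreover have "c0 * ?g x \<le> ?g x" using c0 by (intro mult_left_le_one_le) auto
        ultimately show "c0 * ?g x - ?h x \<le> 0" by linarith
      qed
    qed
  qed
  then show ?thesis using low AE_space
  proof eventually_elim
    case (elim x)
    have b0: "b x > 0" by (rule b_pos[OF elim(3)])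
    show ?case unfolding c0_def[symmetric]
    proof (cases "\<epsilon> \<le> b x")
      case True
      have "min 1 (c0 * c1) * b x \<le> c0 * c1 * b x" using b0 by (intro mult_right_mono) auto
      also have "\<dots> \<le> c0 * opK ?g x" using elim(2) True c0 mult_left_mono[of "c1 * b x" "opK ?g x" c0] by (simp add: mult.assoc)
      finally show "min 1 (c0 * c1) * b x \<le> u x + \<epsilon>" using elim(1) \<epsilon> by linarith
    next
      case False
      have "min 1 (c0 * c1) * b x \<le> 1 * b x" using b0 by (intro mult_right_mono) auto
      then show "min 1 (c0 * c1) * b x \<le> u x + \<epsilon>" using False u_nonneg[of x] by linarith
    qed
  qed
qed

lemma singular_unique:
  assumes q: "q > 0"
    and u: "L1w (\<lambda>x. u x powr - q)" "\<And>x. x \<in> space M \<Longrightarrow> u x > 0" "AE x in M. u x = opK (\<lambda>y. u y powr - q) x"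
    and v: "L1w (\<lambda>x. v x powr - q)" "\<And>x. x \<in> space M \<Longrightarrow> v x > 0" "AE x in M. v x = opK (\<lambda>y. v y powr - q) x"
  shows "AE x in M. u x = v x"
proof -
  have le: "AE x in M. u x - v x \<le> 0"
    if u: "L1w (\<lambda>x. u x powr - q)" "AE x in M. u x = opK (\<lambda>y. u y powr - q) x"
      and v: "L1w (\<lambda>x. v x powr - q)" "\<And>x. x \<in> space M \<Longrightarrow> v x > 0" "AE x in M. v x = opK (\<lambda>y. v y powr - q) x"
    for u v
  proof (rule comparison[OF L1w_diff[OF u(1) v(1)]])
    show "AE x in M. u x - v x = opK (\<lambda>y. u y powr - q - v y powr - q) x"
      using opK_diff_AE[OF u(1) v(1)] u(2) v(3) by eventually_elim simp
    show "AE x in M. 0 \<le> u x - v x \<longrightarrow> u x powr - q - v x powr - q \<le> 0"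
    proof (intro AE_I2 impI)
      fix x assume "x \<in> space M" "0 \<le> u x - v x"
      then show "u x powr - q - v x powr - q \<le> 0"
        using powr_mono2'[of "-q" "v x" "u x"] v(2)[of x] q by auto
    qed
  qed
  have "AE x in M. u x - v x \<le> 0" by (rule le[OF u(1,3) v(1) _ v(3)]) (rule v(2))
  moreover have "AE x in M. v x - u x \<le> 0" by (rule le[OF v(1,3) u(1) _ u(3)]) (rule u(2))
  ultimately show ?thesis by eventually_elim auto
qed

lemma opK_lower_bound:
  assumes f: "L1w f" "\<And>x. x \<in> space M \<Longrightarrow> f x \<ge> 0"
    and low: "\<And>x. x \<in> space M \<Longrightarrow> AE y in M. c * w x * w y \<le> K x y"
  shows "AE x in M. c * w x * (\<integral>y. w y * f y \<partial>M) \<le> opK f x"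
  using L1w_AE_integrable[OF f(1)] AE_space
proof eventually_elim
  case (elim x)
  have "c * w x * (\<integral>y. w y * f y \<partial>M) = (\<integral>y. c * w x * (w y * f y) \<partial>M)" by simp
  also have "\<dots> \<le> opK f x"
    unfolding opK_def
  proof (rule integral_mono_AE)
    show "integrable M (\<lambda>y. c * w x * (w y * f y))" using f(1) by (auto simp: L1w_def)
    show "AE y in M. c * w x * (w y * f y) \<le> K x y * f y"
      using low[OF elim(2)] AE_space
      by eventually_elim (use f(2) in \<open>auto simp: mult.assoc[symmetric] intro: mult_right_mono\<close>)
  qed fact
  finally show ?case .
qed

text \<open>A quantitative Hopf principle: a kernel above c w(x) w(y) gives K f >= c w times the
  weighted integral of \<open>f\<close>, and that integral is positive because \<open>f\<close> and
  \<open>w\<close> are, on a space of nonzero measure.\<close>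

lemma opK_lower_bound_pos:
  assumes f: "L1w f" "\<And>x. x \<in> space M \<Longrightarrow> f x > 0"
    and c: "c > 0" and low: "\<And>x. x \<in> space M \<Longrightarrow> AE y in M. c * w x * w y \<le> K x y"
    and M: "emeasure M (space M) \<noteq> 0"
  shows "\<exists>c'>0. AE x in M. c' * w x \<le> opK f x"
proof -
  have int: "integrable M (\<lambda>x. w x * f x)" and nn: "AE x in M. 0 \<le> w x * f x"
    using f w_pos by (auto simp: L1w_def less_imp_le intro!: AE_I2)
  have "(\<integral>y. w y * f y \<partial>M) \<noteq> 0"
  proof
    assume "(\<integral>y. w y * f y \<partial>M) = 0"
    then have "AE x in M. w x * f x = 0"
      using integral_nonneg_eq_0_iff_AE[OF int nn] by simp
    then have "AE x in M. False" using AE_space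
      by eventually_elim (use f w_pos in force)
    then show False using M by (simp add: AE_iff_measurable[OF _ refl])
  qed
  then have "(\<integral>y. w y * f y \<partial>M) > 0" using integral_nonneg_AE[OF nn] by simp
  then show ?thesis
    using opK_lower_bound[of f c] f c low
    by (intro exI[of _ "c * (\<integral>y. w y * f y \<partial>M)"]) (auto simp: mult_ac less_imp_le)
qed

text \<open>The majorant \<open>D\<close> acts twice: it keeps the increasing sequence
  \<open>U n\<close> below K D, so that the limit is finite, and it dominates the integrands in the
  equation, so that the limit can be taken under the kernel. Positivity of the limit comes from the
  Hopf bound for \<open>U 0\<close> and monotonicity.\<close>

lemma singular_solution:
  assumes q: "q > 0" and D: "L1w D"
    and dominated: "\<And>\<epsilon> u. 0 < \<epsilon> \<Longrightarrow> \<epsilon> \<le> 1 \<Longrightarrow> u \<in> borel_measurable M \<Longrightarrow> (\<And>x. u x \<ge> 0) \<Longrightarrow>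
      AE x in M. u x = opK (\<lambda>y. (u y + \<epsilon>) powr - q) x \<Longrightarrow> AE x in M. (u x + \<epsilon>) powr - q \<le> D x"
    and c: "c > 0" and low: "\<And>x. x \<in> space M \<Longrightarrow> AE y in M. c * w x * w y \<le> K x y"
    and M: "emeasure M (space M) \<noteq> 0"
  shows "\<exists>v. (\<forall>x. v x > 0) \<and> L1w v \<and> L1w (\<lambda>x. v x powr - q) \<and> (AE x in M. v x = opK (\<lambda>y. v y powr - q) x)"
proof -
  define \<epsilon> where "\<epsilon> = (\<lambda>n. inverse (real (Suc n)))"
  have \<epsilon>: "0 < \<epsilon> n" "\<epsilon> n \<le> 1" "\<epsilon> (Suc n) \<le> \<epsilon> n" for n
    by (auto simp: \<epsilon>_def field_simps)
  have \<epsilon>_lim: "\<epsilon> \<longlonglongrightarrow> 0" unfolding \<epsilon>_def by (rule LIMSEQ_inverse_real_of_nat)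
  obtain U where U: "\<And>n. L1w (U n)" "\<And>n x. U n x \<ge> 0"
      "\<And>n. AE x in M. U n x = opK (\<lambda>y. (U n y + \<epsilon> n) powr - q) x"
    using regularised_solution[OF q \<epsilon>(1)] by metis
  have [measurable]: "U n \<in> borel_measurable M" for n using U(1) by (rule L1w_measurable)
  have [measurable]: "D \<in> borel_measurable M" using D by (rule L1w_measurable)
  have reg: "L1w (\<lambda>y. (U n y + \<epsilon> n) powr - q)" for n
    using U q \<epsilon> by (intro L1w_regularised) auto
  have mono: "AE x in M. U n x \<le> U (Suc n) x" for n
    using U q \<epsilon> by (intro regularised_mono[OF q \<epsilon>(1) \<epsilon>(3)]) auto
  have dom: "AE x in M. (U n x + \<epsilon> n) powr - q \<le> D x" for n
    using U \<epsilon> by (intro dominated) auto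
  have U_le: "AE x in M. U n x \<le> opK D x" for n
    using opK_mono_AE[OF reg D dom, of n] U(3)[of n] by eventually_elim simp
  have "\<exists>c'>0. AE x in M. c' * w x \<le> opK (\<lambda>y. (U 0 y + \<epsilon> 0) powr - q) x"
    using U(2) \<epsilon> by (intro opK_lower_bound_pos[OF reg _ c low M]) (auto simp: add_nonneg_pos less_imp_neq[symmetric])
  then obtain c' where c': "c' > 0" "AE x in M. c' * w x \<le> opK (\<lambda>y. (U 0 y + \<epsilon> 0) powr - q) x" by blast
  have U0: "AE x in M. U 0 x > 0"
    using c'(2) U(3)[of 0] AE_space
  proof eventually_elim
    case (elim x)
    then have "0 < c' * w x" using c'(1) w_pos by simp
    then show ?case using elim by simp
  qed
  \<comment> \<open>The value 1 is a default on a null set; it makes \<open>v\<close> positive at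
    every point.\<close>
  define v where "v = (\<lambda>x. if lim (\<lambda>n. U n x) > 0 then lim (\<lambda>n. U n x) else 1)"
  have v_pos: "v x > 0" for x by (simp add: v_def)
  have [measurable]: "v \<in> borel_measurable M" unfolding v_def by measurable
  have all: "AE x in M. (\<forall>n. U n x \<le> U (Suc n) x) \<and> (\<forall>n. U n x \<le> opK D x) \<and> (\<forall>n. (U n x + \<epsilon> n) powr - q \<le> D x)
      \<and> (\<forall>n. U n x = opK (\<lambda>y. (U n y + \<epsilon> n) powr - q) x)"
    using mono U_le dom U(3) by (auto simp: AE_all_countable)
  have lim: "AE x in M. (\<lambda>n. U n x) \<longlonglongrightarrow> v x"
    using all U0
  proof eventually_elim
    case (elim x)
    have inc: "incseq (\<lambda>n. U n x)" using elim by (intro incseq_SucI) auto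
    then obtain l where l: "(\<lambda>n. U n x) \<longlonglongrightarrow> l"
      using elim by (meson incseq_convergent)
    have "U 0 x \<le> l" using incseq_le[OF inc l] .
    then show ?case using l elim limI[OF l] by (simp add: v_def)
  qed
  have lim_powr: "AE x in M. (\<lambda>n. (U n x + \<epsilon> n) powr - q) \<longlonglongrightarrow> v x powr - q"
    using lim
  proof eventually_elim
    case (elim x)
    have "(\<lambda>n. (U n x + \<epsilon> n) powr - q) \<longlonglongrightarrow> (v x + 0) powr - q"
      using v_pos[of x] by (intro tendsto_powr tendsto_add elim \<epsilon>_lim tendsto_const) auto
    then show ?case by simp
  qed
  have v_le: "AE x in M. v x powr - q \<le> D x"
    using all lim_powr
  proof eventually_elim
    case (elim x) then show ?case by (intro LIMSEQ_le_const2) auto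
  qed
  have v_powr: "L1w (\<lambda>x. v x powr - q)"
    by (rule L1w_bound[OF D]) (use v_le in \<open>auto elim!: eventually_mono\<close>)
  have eq: "AE x in M. v x = opK (\<lambda>y. v y powr - q) x"
    using L1w_AE_integrable[OF D] all lim AE_space
  proof eventually_elim
    case (elim x)
    have [measurable]: "x \<in> space M" by fact
    have "(\<lambda>n. opK (\<lambda>y. (U n y + \<epsilon> n) powr - q) x) \<longlonglongrightarrow> opK (\<lambda>y. v y powr - q) x"
      unfolding opK_def
    proof (rule integral_dominated_convergence)
      show "integrable M (\<lambda>y. K x y * D y)" by fact
      show "AE y in M. (\<lambda>n. K x y * (U n y + \<epsilon> n) powr - q) \<longlonglongrightarrow> K x y * v y powr - q"
        using lim_powr by eventually_elim (rule tendsto_mult[OF tendsto_const])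
      show "AE y in M. norm (K x y * (U n y + \<epsilon> n) powr - q) \<le> K x y * D y" for n
        using dom[of n] by eventually_elim (use K_nonneg in \<open>auto simp: abs_mult intro: mult_left_mono\<close>)
    qed measurable
    moreover have "(\<lambda>n. opK (\<lambda>y. (U n y + \<epsilon> n) powr - q) x) = (\<lambda>n. U n x)" using elim(2) by auto
    ultimately show ?case using elim(3) LIMSEQ_unique by metis
  qed
  have "L1w v"
    by (rule L1w_bound[OF L1w_opK(1)[OF v_powr]]) (use eq in auto)
  then show ?thesis using v_pos v_powr eq by blast
qed

end

section \<open>Boundary strips and Green function estimates\<close>


text \<open>The integrand is at most \<open>a j\<close> on \<open>S j\<close>, and the products
  \<open>a j * b j\<close> decay geometrically. The sets may overlap: in the applications they are
  nested sublevel sets, whose measure is known, instead of the shells between them.\<close>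

lemma nn_integral_shells:
  fixes g :: "'b \<Rightarrow> ennreal" and a b :: "nat \<Rightarrow> real"
  assumes cover: "\<And>x. x \<in> space M \<Longrightarrow> g x = 0 \<or> (\<exists>j. x \<in> S j \<and> g x \<le> ennreal (a j))"
    and [measurable]: "\<And>j. S j \<in> sets M"
    and S: "\<And>j. emeasure M (S j) \<le> ennreal (b j)"
    and ab: "\<And>j. 0 \<le> a j" "\<And>j. 0 \<le> b j" "\<And>j. a j * b j \<le> c * \<rho> ^ j" and \<rho>: "0 \<le> \<rho>" "\<rho> < 1"
  shows "(\<integral>\<^sup>+x. g x \<partial>M) \<le> ennreal (c / (1 - \<rho>))"
proof -
  have "0 \<le> a 0 * b 0" using ab by simp
  then have c: "0 \<le> c" using ab(3)[of 0] by simp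
  have "(\<integral>\<^sup>+x. g x \<partial>M) \<le> (\<integral>\<^sup>+x. (\<Sum>j. ennreal (a j) * indicator (S j) x) \<partial>M)"
  proof (rule nn_integral_mono)
    fix x assume "x \<in> space M"
    from cover[OF this] show "g x \<le> (\<Sum>j. ennreal (a j) * indicator (S j) x)"
    proof
      assume "\<exists>j. x \<in> S j \<and> g x \<le> ennreal (a j)"
      then obtain j where j: "x \<in> S j" "g x \<le> ennreal (a j)" by blast
      have "(\<Sum>i\<in>{j}. ennreal (a i) * indicator (S i) x) \<le> (\<Sum>j. ennreal (a j) * indicator (S j) x)"
        by (rule sum_le_suminf) auto
      then show ?thesis using j by (auto intro: order_trans)
    qed simp
  qed
  also have "\<dots> = (\<Sum>j. \<integral>\<^sup>+x. ennreal (a j) * indicator (S j) x \<partial>M)"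
    by (intro nn_integral_suminf) auto
  also have "\<dots> = (\<Sum>j. ennreal (a j) * emeasure M (S j))"
    by (intro arg_cong[where f=suminf] ext nn_integral_cmult_indicator) auto
  also have "\<dots> \<le> (\<Sum>j. ennreal (c * \<rho> ^ j))"
  proof (intro suminf_le summableI)
    fix j
    have "ennreal (a j) * emeasure M (S j) \<le> ennreal (a j) * ennreal (b j)"
      by (intro mult_left_mono S) auto
    also have "\<dots> = ennreal (a j * b j)" using ab by (simp add: ennreal_mult)
    also have "\<dots> \<le> ennreal (c * \<rho> ^ j)" by (intro ennreal_leI ab)
    finally show "ennreal (a j) * emeasure M (S j) \<le> ennreal (c * \<rho> ^ j)" .
  qed
  also have "\<dots> = ennreal (\<Sum>j. c * \<rho> ^ j)"
    using c \<rho> by (intro suminf_ennreal2 summable_mult summable_geometric) auto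
  also have "(\<Sum>j. c * \<rho> ^ j) = c / (1 - \<rho>)"
    using \<rho> by (subst suminf_mult) (auto simp: suminf_geometric summable_geometric)
  finally show ?thesis .
qed

text \<open>Dyadic decomposition towards 0. Where f lies between R / 2^(j+1) and R / 2^j, the
  integrand is at most the power of the lower level, while the measure is that of the upper sublevel
  set; this mismatch by one is the factor \<open>2 powr m\<close>, and the ratio of the series is
  2^(m - \<kappa>). It is used for f the distance to a point and for f the distance to the
  boundary.\<close>

lemma nn_integral_powr_near:
  fixes f :: "'b \<Rightarrow> real"
  assumes [measurable]: "f \<in> borel_measurable M" and R: "R > 0" and m: "0 \<le> m" "m < \<kappa>" and A: "0 \<le> A"
    and S: "\<And>t. 0 < t \<Longrightarrow> emeasure M {x\<in>space M. 0 < f x \<and> f x < t} \<le> ennreal (A * t powr \<kappa>)"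
  shows "(\<integral>\<^sup>+x. ennreal (f x powr - m) * indicator {x. 0 < f x \<and> f x < R} x \<partial>M)
     \<le> ennreal (A * R powr (\<kappa> - m) * 2 powr m / (1 - 2 powr (m - \<kappa>)))"
proof (rule nn_integral_shells)
  let ?S = "\<lambda>j::nat. {x\<in>space M. 0 < f x \<and> f x < R * 2 powr - real j}"
  show "?S j \<in> sets M" for j by measurable
  show "emeasure M (?S j) \<le> ennreal (A * (R * 2 powr - real j) powr \<kappa>)" for j
    using R by (intro S) auto
  show "ennreal (f x powr - m) * indicator {x. 0 < f x \<and> f x < R} x = 0 \<or>
     (\<exists>j. x \<in> ?S j \<and> ennreal (f x powr - m) * indicator {x. 0 < f x \<and> f x < R} x \<le>
        ennreal ((R * 2 powr - real (Suc j)) powr - m))" if x: "x \<in> space M" for x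
  proof (cases "0 < f x \<and> f x < R")
    case True
    have ex: "\<exists>n. R * 2 powr - real n \<le> f x"
    proof -
      obtain n where "(1/2::real) ^ n < f x / R" using real_arch_pow_inv[of "f x / R" "1/2"] True R by auto
      then have "R * 2 powr - real n \<le> f x"
        using R by (simp add: powr_minus powr_realpow field_simps power_one_over)
      then show ?thesis ..
    qed
    \<comment> \<open>The least \<open>n\<close> locates \<open>f x\<close> between two consecutive
      dyadic levels; it is not 0 because f x < R.\<close>
    define n where "n = (LEAST n. R * 2 powr - real n \<le> f x)"
    have n: "R * 2 powr - real n \<le> f x" unfolding n_def by (rule LeastI_ex[OF ex])
    have "n \<noteq> 0" using n True by (auto intro!: Nat.gr0I)
    then obtain j where j: "n = Suc j" by (cases n) auto
    have "\<not> R * 2 powr - real j \<le> f x"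
      using not_less_Least[of j "\<lambda>n. R * 2 powr - real n \<le> f x"] j by (simp add: n_def)
    moreover have "f x powr - m \<le> (R * 2 powr - real (Suc j)) powr - m"
      using n m R by (intro powr_mono2') (auto simp: j)
    ultimately show ?thesis using True x by (intro disjI2 exI[of _ j]) (auto intro: ennreal_leI)
  qed auto
  show "(R * 2 powr - real (Suc j)) powr - m * (A * (R * 2 powr - real j) powr \<kappa>) \<le>
     A * R powr (\<kappa> - m) * 2 powr m * (2 powr (m - \<kappa>)) ^ j" (is "?lhs \<le> ?rhs") for j
  proof -
    have "(R * 2 powr - real (Suc j)) powr - m * (A * (R * 2 powr - real j) powr \<kappa>) =
        A * (R powr - m * R powr \<kappa>) * (2 powr (real (Suc j) * m) * 2 powr (- real j * \<kappa>))"
      using R by (simp add: powr_mult powr_powr algebra_simps)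
    also have "\<dots> = A * R powr (\<kappa> - m) * (2 powr m * (2 powr (m - \<kappa>)) ^ j)"
      by (simp add: powr_add[symmetric] powr_realpow[symmetric] powr_powr algebra_simps)
    finally have eq: "?lhs = A * R powr (\<kappa> - m) * (2 powr m * (2 powr (m - \<kappa>)) ^ j)" .
    show "?lhs \<le> ?rhs" unfolding eq by (simp only: mult.assoc order_refl)
  qed
  show "2 powr (m - \<kappa>) < 1" using m powr_less_mono[of "m - \<kappa>" 0 2] by simp
qed (use A in auto)

text \<open>The decomposition outwards, with levels R 2^j. Now m > \<kappa> makes the series
  converge, and the mismatch of levels costs \<open>2 powr \<kappa>\<close>.\<close>

lemma nn_integral_powr_far:
  fixes f :: "'b \<Rightarrow> real"
  assumes [measurable]: "f \<in> borel_measurable M" and R: "R > 0" and m: "0 \<le> \<kappa>" "\<kappa> < m" and A: "0 \<le> A"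
    and S: "\<And>t. 0 < t \<Longrightarrow> emeasure M {x\<in>space M. f x < t} \<le> ennreal (A * t powr \<kappa>)"
  shows "(\<integral>\<^sup>+x. ennreal (f x powr - m) * indicator {x. R \<le> f x} x \<partial>M)
     \<le> ennreal (A * R powr (\<kappa> - m) * 2 powr \<kappa> / (1 - 2 powr (\<kappa> - m)))"
proof (rule nn_integral_shells)
  let ?S = "\<lambda>j::nat. {x\<in>space M. f x < R * 2 powr real (Suc j)}"
  show "?S j \<in> sets M" for j by measurable
  show "emeasure M (?S j) \<le> ennreal (A * (R * 2 powr real (Suc j)) powr \<kappa>)" for j
    using R by (intro S) auto
  show "ennreal (f x powr - m) * indicator {x. R \<le> f x} x = 0 \<or>
     (\<exists>j. x \<in> ?S j \<and> ennreal (f x powr - m) * indicator {x. R \<le> f x} x \<le>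
        ennreal ((R * 2 powr real j) powr - m))" if x: "x \<in> space M" for x
  proof (cases "R \<le> f x")
    case True
    have ex: "\<exists>n. f x < R * 2 powr real n"
    proof -
      obtain n where "f x / R < (2::real) ^ n" using real_arch_pow[of 2 "f x / R"] by auto
      then have "f x < R * 2 powr real n"
        using R by (simp add: powr_realpow field_simps)
      then show ?thesis ..
    qed
    define n where "n = (LEAST n. f x < R * 2 powr real n)"
    have n: "f x < R * 2 powr real n" unfolding n_def by (rule LeastI_ex[OF ex])
    have "n \<noteq> 0" using n True by (auto intro!: Nat.gr0I)
    then obtain j where j: "n = Suc j" by (cases n) auto
    have "\<not> f x < R * 2 powr real j"
      using not_less_Least[of j "\<lambda>n. f x < R * 2 powr real n"] j by (simp add: n_def)
    then have "f x powr - m \<le> (R * 2 powr real j) powr - m"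
      using m R by (intro powr_mono2') auto
    then show ?thesis using True x n j by (intro disjI2 exI[of _ j]) (auto intro: ennreal_leI)
  qed auto
  show "(R * 2 powr real j) powr - m * (A * (R * 2 powr real (Suc j)) powr \<kappa>) \<le>
     A * R powr (\<kappa> - m) * 2 powr \<kappa> * (2 powr (\<kappa> - m)) ^ j" (is "?lhs \<le> ?rhs") for j
  proof -
    have "(R * 2 powr real j) powr - m * (A * (R * 2 powr real (Suc j)) powr \<kappa>) =
        A * (R powr - m * R powr \<kappa>) * (2 powr (- real j * m) * 2 powr (real (Suc j) * \<kappa>))"
      using R by (simp add: powr_mult powr_powr algebra_simps)
    also have "\<dots> = A * R powr (\<kappa> - m) * (2 powr \<kappa> * (2 powr (\<kappa> - m)) ^ j)"
      by (simp add: powr_add[symmetric] powr_realpow[symmetric] powr_powr algebra_simps)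
    finally have eq: "?lhs = A * R powr (\<kappa> - m) * (2 powr \<kappa> * (2 powr (\<kappa> - m)) ^ j)" .
    show "?lhs \<le> ?rhs" unfolding eq by (simp only: mult.assoc order_refl)
  qed
  show "2 powr (\<kappa> - m) < 1" using m powr_less_mono[of "\<kappa> - m" 0 2] by simp
qed (use A in auto)

text \<open>The translates of the strip \<open>0 < F < \<eta>\<close> by multiples of \<open>\<eta> e\<close> are disjoint.\<close>

lemma emeasure_strip:
  fixes F :: "'a::euclidean_space \<Rightarrow> real"
  assumes F [measurable]: "F \<in> borel_measurable borel" and e: "norm e = 1"
    and shift: "\<And>y \<tau>. F (y + \<tau> *\<^sub>R e) = F y + \<tau>" and \<rho>: "\<rho> > 0" and \<eta>: "\<eta> > 0"
  shows "emeasure lborel {y\<in>ball x \<rho>. 0 < F y \<and> F y < \<eta>}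
     \<le> ennreal (unit_ball_vol (real DIM('a)) * 3 ^ DIM('a) * (\<eta> * \<rho> powr (real DIM('a) - 1)))"
proof -
  let ?N = "DIM('a)" let ?\<omega> = "unit_ball_vol (real ?N)"
  define S where "S = {y\<in>ball x \<rho>. 0 < F y \<and> F y < \<eta>}"
  have [measurable]: "S \<in> sets borel" unfolding S_def by measurable
  have \<omega>: "?\<omega> \<ge> 0" by simp
  have \<rho>N: "\<rho> ^ ?N = \<rho> * \<rho> powr (real ?N - 1)"
    using \<rho> by (simp add: powr_diff powr_realpow)
  have Sball: "emeasure lborel S \<le> ennreal (?\<omega> * \<rho> ^ ?N)"
  proof -
    have "emeasure lborel S \<le> emeasure lborel (ball x \<rho>)" by (intro emeasure_mono) (auto simp: S_def)
    then show ?thesis using \<rho> by (simp add: emeasure_ball)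
  qed
  show ?thesis
  proof (cases "\<rho> \<le> \<eta>")
    case True
    have "?\<omega> * \<rho> ^ ?N \<le> ?\<omega> * (3 ^ ?N * (\<eta> * \<rho> powr (real ?N - 1)))"
    proof (intro mult_left_mono \<omega>)
      have "\<rho> * \<rho> powr (real ?N - 1) \<le> 1 * (\<eta> * \<rho> powr (real ?N - 1))" using True by (simp add: mult_right_mono)
      also have "\<dots> \<le> 3 ^ ?N * (\<eta> * \<rho> powr (real ?N - 1))" using \<eta> by (intro mult_right_mono) auto
      finally show "\<rho> ^ ?N \<le> 3 ^ ?N * (\<eta> * \<rho> powr (real ?N - 1))" by (simp add: \<rho>N)
    qed
    then have "ennreal (?\<omega> * \<rho> ^ ?N) \<le> ennreal (?\<omega> * 3 ^ ?N * (\<eta> * \<rho> powr (real ?N - 1)))"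
      by (intro ennreal_leI) (simp add: mult.assoc)
    then show ?thesis using Sball unfolding S_def by (rule order_trans[rotated])
  next
    case False
    \<comment> \<open>With m at least \<rho> / \<eta>, rounded up, the shifts k \<eta> for k < m do
      not exceed \<rho>. All \<open>m\<close> disjoint translates therefore lie in the ball of
      radius 3 \<rho>, and each has at most the fraction \<eta> / \<rho> of its volume.\<close>
    define m where "m = nat \<lceil>\<rho> / \<eta>\<rceil>"
    have "\<rho> / \<eta> > 0" using \<rho> \<eta> by simp
    then have m: "\<rho> / \<eta> \<le> real m" "real m \<le> \<rho> / \<eta> + 1" "real m > 0" unfolding m_def by linarith+
    define T where "T = (\<lambda>k::nat. (+) (- (real k * \<eta>) *\<^sub>R e) -` S)"
    have T_meas: "T k \<in> sets borel" for k unfolding T_def by (rule measurable_sets_borel[OF _ \<open>S \<in> sets borel\<close>]) measurable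
    have T_emeasure: "emeasure lborel (T k) = emeasure lborel S" for k
    proof -
      have "emeasure lborel S = emeasure (distr lborel borel ((+) (- (real k * \<eta>) *\<^sub>R e))) S"
        by (simp only: lborel_distr_plus)
      also have "\<dots> = emeasure lborel (T k)" by (subst emeasure_distr) (auto simp: T_def)
      finally show ?thesis ..
    qed
    have T_F: "real k * \<eta> < F y \<and> F y < (real k + 1) * \<eta>" if "y \<in> T k" for k y
    proof -
      have "F (- (real k * \<eta>) *\<^sub>R e + y) = F y - real k * \<eta>"
        using shift[of y "- (real k * \<eta>)"] by (simp add: add.commute)
      then show ?thesis using that by (auto simp: T_def S_def algebra_simps)
    qed
    have disj: "disjoint_family_on T {..<m}"
      unfolding disjoint_family_on_def
    proof (intro ballI impI)
      fix i j :: nat assume ij: "i \<noteq> j"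
      have False if y: "y \<in> T i" "y \<in> T j" for y
      proof -
        have "real i * \<eta> < (real j + 1) * \<eta>" "real j * \<eta> < (real i + 1) * \<eta>"
          using T_F[OF y(1)] T_F[OF y(2)] by linarith+
        then have "real i < real j + 1" "real j < real i + 1" using \<eta> by auto
        then show False using ij by linarith
      qed
      then show "T i \<inter> T j = {}" by blast
    qed
    have sub: "(\<Union>k<m. T k) \<subseteq> ball x (3 * \<rho>)"
    proof
      fix y assume "y \<in> (\<Union>k<m. T k)"
      then obtain k where k: "k < m" "- (real k * \<eta>) *\<^sub>R e + y \<in> ball x \<rho>" by (auto simp: T_def S_def)
      have "dist x y \<le> dist x (- (real k * \<eta>) *\<^sub>R e + y) + dist (- (real k * \<eta>) *\<^sub>R e + y) y" by (rule dist_triangle)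
      moreover have "dist (- (real k * \<eta>) *\<^sub>R e + y) y = real k * \<eta>" using e \<eta> by (simp add: dist_norm)
      moreover have "real k * \<eta> \<le> \<rho>"
      proof -
        have "real k * \<eta> \<le> (real m - 1) * \<eta>" using k \<eta> by (intro mult_right_mono) auto
        also have "\<dots> \<le> (\<rho> / \<eta>) * \<eta>" using m \<eta> by (intro mult_right_mono) auto
        finally show ?thesis using \<eta> by simp
      qed
      moreover have "dist x (- (real k * \<eta>) *\<^sub>R e + y) < \<rho>" using k(2) by (simp only: mem_ball)
      ultimately have "dist x y < 3 * \<rho>" using \<rho> by linarith
      then show "y \<in> ball x (3 * \<rho>)" by simp
    qed
    have fin: "emeasure lborel S = ennreal (measure lborel S)"
      using Sball by (intro emeasure_eq_ennreal_measure) (auto simp: top_unique)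
    have "ennreal (real m * measure lborel S) = (\<Sum>k<m. emeasure lborel (T k))"
      by (simp add: T_emeasure fin ennreal_mult ennreal_of_nat_eq_real_of_nat)
    also have "\<dots> = emeasure lborel (\<Union>k<m. T k)"
      using T_meas disj by (intro sum_emeasure) auto
    also have "\<dots> \<le> emeasure lborel (ball x (3 * \<rho>))" by (intro emeasure_mono sub) auto
    also have "\<dots> = ennreal (?\<omega> * (3 * \<rho>) ^ ?N)" using \<rho> by (simp add: emeasure_ball)
    finally have "real m * measure lborel S \<le> ?\<omega> * (3 * \<rho>) ^ ?N"
      using \<rho> by (subst (asm) ennreal_le_iff) auto
    moreover have "\<rho> / \<eta> * measure lborel S \<le> real m * measure lborel S" using m by (intro mult_right_mono) auto
    ultimately have "\<rho> / \<eta> * measure lborel S \<le> ?\<omega> * (3 * \<rho>) ^ ?N" by linarith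
    then have "measure lborel S \<le> \<eta> / \<rho> * (?\<omega> * (3 * \<rho>) ^ ?N)" using \<rho> \<eta> by (simp add: field_simps)
    also have "\<dots> = ?\<omega> * 3 ^ ?N * (\<eta> * \<rho> powr (real ?N - 1))"
      using \<rho> by (simp add: power_mult_distrib \<rho>N)
    finally show ?thesis unfolding S_def[symmetric] fin by (rule ennreal_leI)
  qed
qed

section \<open>Volume of boundary strips of a C^2 domain\<close>

lemma C2_lipschitz_on_cball:
  fixes \<phi> :: "'a::euclidean_space \<Rightarrow> real"
  assumes "C_k 2 \<phi>"
  shows "\<exists>\<Lambda>\<ge>0. \<forall>x\<in>cball c R. \<forall>y\<in>cball c R. \<bar>\<phi> x - \<phi> y\<bar> \<le> \<Lambda> * norm (x - y)"
proof -
  have diff: "\<phi> differentiable at x" and C1: "C_k (Suc 0) (\<lambda>x. frechet_derivative \<phi> (at x) v)" for x v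
    using assms by (simp_all add: numeral_2_eq_2)
  have cont: "continuous_on UNIV (\<lambda>x. frechet_derivative \<phi> (at x) v)" for v
    using C1[of v] by (auto intro!: continuous_at_imp_continuous_on differentiable_imp_continuous_within)
  have "\<exists>B. \<forall>x\<in>cball c R. \<bar>frechet_derivative \<phi> (at x) v\<bar> \<le> B" for v
  proof -
    have "compact ((\<lambda>x. frechet_derivative \<phi> (at x) v) ` cball c R)"
      by (intro compact_continuous_image continuous_on_subset[OF cont]) auto
    then show ?thesis using compact_imp_bounded by (fastforce simp: bounded_iff)
  qed
  then obtain B where B: "\<And>v x. x \<in> cball c R \<Longrightarrow> \<bar>frechet_derivative \<phi> (at x) v\<bar> \<le> B v" by metis
  define \<Lambda> where "\<Lambda> = (\<Sum>b\<in>Basis. \<bar>B b\<bar>)"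
  have on: "onorm (frechet_derivative \<phi> (at x)) \<le> \<Lambda>" if x: "x \<in> cball c R" for x
  proof (rule onorm_le)
    fix v
    have lin: "linear (frechet_derivative \<phi> (at x))"
      using diff frechet_derivative_works has_derivative_linear by blast
    have "frechet_derivative \<phi> (at x) v = frechet_derivative \<phi> (at x) (\<Sum>b\<in>Basis. (v \<bullet> b) *\<^sub>R b)"
      by (simp add: euclidean_representation)
    also have "\<dots> = (\<Sum>b\<in>Basis. (v \<bullet> b) * frechet_derivative \<phi> (at x) b)"
      using lin by (simp add: linear_sum linear_scale)
    finally have "norm (frechet_derivative \<phi> (at x) v) \<le> (\<Sum>b\<in>Basis. \<bar>v \<bullet> b\<bar> * \<bar>frechet_derivative \<phi> (at x) b\<bar>)"
      using sum_abs[of "\<lambda>b. (v \<bullet> b) * frechet_derivative \<phi> (at x) b" Basis] by (simp add: abs_mult)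
    also have "\<dots> \<le> (\<Sum>b\<in>Basis. norm v * \<bar>B b\<bar>)"
      using B[OF x] by (intro sum_mono mult_mono Basis_le_norm) (auto intro: order_trans[OF _ abs_ge_self])
    finally show "norm (frechet_derivative \<phi> (at x) v) \<le> \<Lambda> * norm v"
      by (simp add: \<Lambda>_def sum_distrib_left mult.commute)
  qed
  have "\<bar>\<phi> x - \<phi> y\<bar> \<le> \<Lambda> * norm (x - y)" if "x \<in> cball c R" "y \<in> cball c R" for x y
    using differentiable_bound[of "cball c R" \<phi> "\<lambda>x. frechet_derivative \<phi> (at x)" \<Lambda> x y] on that diff
    by (auto simp: frechet_derivative_works intro: has_derivative_at_withinI)
  moreover have "\<Lambda> \<ge> 0" unfolding \<Lambda>_def by (intro sum_nonneg) auto
  ultimately show ?thesis by blast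
qed

lemma bdist_triangle: "bdist \<Omega> x \<le> bdist \<Omega> y + norm (x - y)"
  unfolding bdist_def using infdist_triangle[of x "- \<Omega>" y] by (simp add: dist_norm)

lemma bdist_nonneg: "bdist \<Omega> x \<ge> 0"
  by (simp add: bdist_def infdist_nonneg)

lemma Compl_bounded_nonempty: "bounded \<Omega> \<Longrightarrow> - \<Omega> \<noteq> ({} :: 'a::euclidean_space set)"
  using not_bounded_UNIV by (metis Compl_empty_eq double_complement)

lemma bdist_pos:
  fixes \<Omega> :: "'a::euclidean_space set"
  assumes "open \<Omega>" "bounded \<Omega>" "x \<in> \<Omega>" shows "bdist \<Omega> x > 0"
  unfolding bdist_def using assms Compl_bounded_nonempty
  by (intro infdist_pos_not_in_closed) auto

lemma bdist_ge_ball: "bounded (\<Omega> :: 'a::euclidean_space set) \<Longrightarrow> ball z r \<subseteq> \<Omega> \<Longrightarrow> y \<in> ball z (r / 2) \<Longrightarrow> r / 2 \<le> bdist \<Omega> y"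
proof -
  assume b: "bounded \<Omega>" and r: "ball z r \<subseteq> \<Omega>" and y: "y \<in> ball z (r / 2)"
  show "r / 2 \<le> bdist \<Omega> y"
    unfolding bdist_def infdist_notempty[OF Compl_bounded_nonempty[OF b]]
  proof (rule cINF_greatest[OF Compl_bounded_nonempty[OF b]])
    fix a assume "a \<in> - \<Omega>"
    then have "a \<notin> ball z r" using r by auto
    then show "r / 2 \<le> dist y a" using y dist_triangle[of z a y] by simp
  qed
qed

abbreviation strip :: "'a::euclidean_space set \<Rightarrow> 'a \<Rightarrow> real \<Rightarrow> real \<Rightarrow> 'a set" where
  "strip \<Omega> x \<rho> t \<equiv> {y\<in>\<Omega> \<inter> ball x \<rho>. bdist \<Omega> y < t}"

lemma strip_measurable: "open \<Omega> \<Longrightarrow> strip \<Omega> x \<rho> t \<in> sets borel"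
  by measurable

text \<open>Around an interior point the boundary distance is bounded below, so the strip is empty
  for small \<open>t\<close>, and for larger \<open>t\<close> the whole ball is a good enough bound.
  Around a boundary point, let F be the height above the graph in the direction e: it grows at unit
  speed along e and satisfies 0 < F <= (1 + \<Lambda>) d in the domain, so the strip lies in a slab
  of F to which \<open>emeasure_strip\<close> applies.\<close>

lemma emeasure_strip_local:
  fixes \<Omega> :: "'a::euclidean_space set"
  assumes \<Omega>: "C2_bounded_domain \<Omega>" and z: "z \<in> closure \<Omega>"
  shows "\<exists>r>0. \<exists>C\<ge>0. \<forall>x \<rho> t. 0 < \<rho> \<longrightarrow> 0 < t \<longrightarrow> ball x \<rho> \<subseteq> ball z r \<longrightarrow>
     emeasure lborel (strip \<Omega> x \<rho> t) \<le> ennreal (C * (t * \<rho> powr (real DIM('a) - 1)))"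
proof -
  have op: "open \<Omega>" and bd: "bounded \<Omega>" using \<Omega> by (auto simp: C2_bounded_domain_def)
  let ?\<omega> = "unit_ball_vol (real DIM('a))"
  show ?thesis
  proof (cases "z \<in> \<Omega>")
    case True
    then obtain r where r: "r > 0" "ball z r \<subseteq> \<Omega>" using op by (meson open_contains_ball)
    have "emeasure lborel (strip \<Omega> x \<rho> t) \<le> ennreal (?\<omega> * (t * \<rho> powr (real DIM('a) - 1)))"
      if \<rho>: "0 < \<rho>" and t: "0 < t" and sub: "ball x \<rho> \<subseteq> ball z (r / 2)" for x \<rho> t
    proof (cases "t \<le> r / 2")
      case True
      then have "strip \<Omega> x \<rho> t = {}" using bdist_ge_ball[OF bd r(2)] sub by force
      then show ?thesis by (simp only: emeasure_empty) simp
    next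
      case False
      have "dist x z + \<rho> \<le> r / 2" using sub \<rho> r by (simp add: ball_subset_ball_iff)
      then have "\<rho> \<le> r / 2" using zero_le_dist[of x z] by linarith
      then have "\<rho> \<le> t" using False by simp
      have "emeasure lborel (strip \<Omega> x \<rho> t) \<le> emeasure lborel (ball x \<rho>)" by (intro emeasure_mono) auto
      also have "\<dots> = ennreal (?\<omega> * (\<rho> * \<rho> powr (real DIM('a) - 1)))"
        using \<rho> by (simp add: emeasure_ball powr_diff powr_realpow)
      also have "\<dots> \<le> ennreal (?\<omega> * (t * \<rho> powr (real DIM('a) - 1)))"
        using \<open>\<rho> \<le> t\<close> by (intro ennreal_leI mult_left_mono mult_right_mono) auto
      finally show ?thesis .
    qed
    then show ?thesis using r by (intro exI[of _ "r / 2"] conjI exI[of _ ?\<omega>]) auto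
  next
    case False
    then have "z \<in> frontier \<Omega>" using z op by (simp add: frontier_def interior_open)
    then have "\<exists>r>0. \<exists>e \<phi>. norm e = 1 \<and> C_k 2 \<phi> \<and>
        \<Omega> \<inter> ball z r = {x \<in> ball z r. x \<bullet> e > \<phi> (x - (x \<bullet> e) *\<^sub>R e)}"
      using \<Omega> unfolding C2_bounded_domain_def by (elim conjE) (rule bspec)
    then obtain r e \<phi> where r: "r > 0" and e: "norm e = 1" and \<phi>: "C_k 2 \<phi>"
      and chart: "\<Omega> \<inter> ball z r = {x \<in> ball z r. x \<bullet> e > \<phi> (x - (x \<bullet> e) *\<^sub>R e)}"
      by (elim exE conjE) (rule that)
    define P where "P = (\<lambda>y. y - (y \<bullet> e) *\<^sub>R e)"
    define F where "F = (\<lambda>y. y \<bullet> e - \<phi> (P y))"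
    have "norm (v - (v \<bullet> e) *\<^sub>R e) \<le> norm v" for v
    proof (rule power2_le_imp_le)
      have "e \<bullet> e = 1" using e by (simp add: norm_eq_1)
      then have "(norm (v - (v \<bullet> e) *\<^sub>R e))\<^sup>2 = (norm v)\<^sup>2 - (v \<bullet> e)\<^sup>2"
        unfolding power2_norm_eq_inner
        by (simp add: inner_diff_left inner_diff_right inner_commute[of e v] power2_eq_square)
      then show "(norm (v - (v \<bullet> e) *\<^sub>R e))\<^sup>2 \<le> (norm v)\<^sup>2" by simp
    qed simp
    moreover have "P y - P y' = (y - y') - ((y - y') \<bullet> e) *\<^sub>R e" for y y'
      by (simp add: P_def inner_diff_left scaleR_diff_left)
    ultimately have P_norm: "norm (P y - P y') \<le> norm (y - y')" for y y' by simp
    have ee: "e \<bullet> e = 1" using e by (simp add: norm_eq_1)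
    have P_shift: "P (y + \<tau> *\<^sub>R e) = P y" for y \<tau>
      by (simp add: P_def inner_add_left ee scaleR_add_left)
    have F_shift: "F (y + \<tau> *\<^sub>R e) = F y + \<tau>" for y \<tau>
      by (simp add: F_def P_shift inner_add_left ee)
    have "continuous_on UNIV \<phi>"
      using \<phi> by (auto simp: numeral_2_eq_2 intro!: continuous_at_imp_continuous_on differentiable_imp_continuous_within)
    moreover have "continuous_on UNIV P" unfolding P_def by (intro continuous_intros)
    ultimately have "continuous_on UNIV (\<lambda>y. \<phi> (P y))" by (rule continuous_on_compose2) simp
    then have "continuous_on UNIV F" unfolding F_def by (intro continuous_on_diff continuous_intros)
    then have [measurable]: "F \<in> borel_measurable borel" by (rule borel_measurable_continuous_onI)
    obtain \<Lambda> where \<Lambda>: "\<Lambda> \<ge> 0" "\<And>x y. x \<in> cball (P z) r \<Longrightarrow> y \<in> cball (P z) r \<Longrightarrow> \<bar>\<phi> x - \<phi> y\<bar> \<le> \<Lambda> * norm (x - y)"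
      using C2_lipschitz_on_cball[OF \<phi>, of "P z" r] by blast
    have F_lip: "F y - F y' \<le> (1 + \<Lambda>) * norm (y - y')" if y: "y \<in> ball z r" "y' \<in> ball z r" for y y'
    proof -
      have "P y \<in> cball (P z) r" "P y' \<in> cball (P z) r"
        using y P_norm[of z y] P_norm[of z y'] by (auto simp: dist_norm)
      from \<Lambda>(2)[OF this] have "\<bar>\<phi> (P y) - \<phi> (P y')\<bar> \<le> \<Lambda> * norm (y - y')"
        using mult_left_mono[OF P_norm \<Lambda>(1)] by (rule order_trans)
      moreover have "(y - y') \<bullet> e \<le> norm (y - y')" using norm_cauchy_schwarz[of "y - y'" e] e by simp
      ultimately show ?thesis by (simp add: F_def inner_diff_left algebra_simps)
    qed
    \<comment> \<open>A nearest point y' of the complement stays in the chart, because d(y) <= |y -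
      z| < r / 4. There F(y') <= 0, and the Lipschitz bound for F turns the distance from y to y'
      into a bound for F(y).\<close>
    have F_le: "0 < F y \<and> F y \<le> (1 + \<Lambda>) * bdist \<Omega> y" if y: "y \<in> \<Omega>" "y \<in> ball z (r / 4)" for y
    proof -
      have "closed (- \<Omega>)" using op by auto
      then obtain y' where y': "y' \<in> - \<Omega>" "bdist \<Omega> y = dist y y'"
        unfolding bdist_def using infdist_attains_inf[of "- \<Omega>" y] Compl_bounded_nonempty[OF bd] by metis
      have "bdist \<Omega> y \<le> dist y z" unfolding bdist_def using False by (intro infdist_le) auto
      moreover have zy: "dist z y < r / 4" using y(2) by (simp only: mem_ball)
      moreover have "dist z y' \<le> dist z y + dist y y'" by (rule dist_triangle)
      moreover have "dist y z = dist z y" by (rule dist_commute)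
      ultimately have "dist z y' < r" using y'(2) r by linarith
      then have yb: "y' \<in> ball z r" "y \<in> ball z r" using zy r unfolding mem_ball by linarith+
      have "y \<in> \<Omega> \<inter> ball z r" using y(1) yb(2) by blast
      then have "0 < F y" unfolding chart F_def P_def by simp
      moreover have "y' \<notin> \<Omega> \<inter> ball z r" using y'(1) by blast
      then have "F y' \<le> 0" using yb(1) unfolding chart F_def P_def by simp
      ultimately show ?thesis using F_lip[OF yb(2,1)] y' by (simp add: dist_norm)
    qed
    let ?C = "?\<omega> * 3 ^ DIM('a) * (1 + \<Lambda>)"
    have "emeasure lborel (strip \<Omega> x \<rho> t) \<le> ennreal (?C * (t * \<rho> powr (real DIM('a) - 1)))"
      if \<rho>: "0 < \<rho>" and t: "0 < t" and sub: "ball x \<rho> \<subseteq> ball z (r / 4)" for x \<rho> t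
    proof -
      have "strip \<Omega> x \<rho> t \<subseteq> {y\<in>ball x \<rho>. 0 < F y \<and> F y < (1 + \<Lambda>) * t}"
      proof
        fix y assume y: "y \<in> strip \<Omega> x \<rho> t"
        then have "0 < F y \<and> F y \<le> (1 + \<Lambda>) * bdist \<Omega> y" using sub by (intro F_le) auto
        moreover have "(1 + \<Lambda>) * bdist \<Omega> y < (1 + \<Lambda>) * t" using y \<Lambda>(1) by simp
        ultimately show "y \<in> {y\<in>ball x \<rho>. 0 < F y \<and> F y < (1 + \<Lambda>) * t}" using y by auto
      qed
      then have "emeasure lborel (strip \<Omega> x \<rho> t) \<le> emeasure lborel {y\<in>ball x \<rho>. 0 < F y \<and> F y < (1 + \<Lambda>) * t}"
        by (intro emeasure_mono) auto
      also have "\<dots> \<le> ennreal (?\<omega> * 3 ^ DIM('a) * ((1 + \<Lambda>) * t * \<rho> powr (real DIM('a) - 1)))"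
        using \<Lambda>(1) t by (intro emeasure_strip[OF _ e F_shift \<rho>]) auto
      finally show ?thesis by (simp add: mult.assoc)
    qed
    then show ?thesis using r \<Lambda>(1) by (intro exI[of _ "r / 4"] conjI exI[of _ ?C]) auto
  qed
qed

text \<open>For radii up to a Lebesgue number \<open>\<rho>0\<close> of a cover of the closure by
  local neighbourhoods, the local estimate holds with the sum of finitely many constants. A larger
  ball meets the domain within finitely many balls of radius \<open>\<rho>0\<close>, and
  \<rho>0^(N-1) <= \<rho>^(N-1). Linear growth in \<open>t\<close>, uniform in the centre, is what
  makes d^-\<theta> integrable for \<theta> < 1 with the correct scaling in \<rho>.\<close>

lemma emeasure_strip_bound:
  fixes \<Omega> :: "'a::euclidean_space set"
  assumes \<Omega>: "C2_bounded_domain \<Omega>"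
  shows "\<exists>C>0. \<forall>x\<in>\<Omega>. \<forall>\<rho>>0. \<forall>t>0.
     emeasure lborel (strip \<Omega> x \<rho> t) \<le> ennreal (C * (t * \<rho> powr (real DIM('a) - 1)))"
proof -
  have op: "open \<Omega>" and bd: "bounded \<Omega>" using \<Omega> by (auto simp: C2_bounded_domain_def)
  have cpt: "compact (closure \<Omega>)" using bd by simp
  have N: "real DIM('a) - 1 \<ge> 0" using DIM_positive[where 'a='a] by linarith
  have "\<forall>z\<in>closure \<Omega>. \<exists>r C. r > 0 \<and> C \<ge> 0 \<and> (\<forall>x \<rho> t. 0 < \<rho> \<longrightarrow> 0 < t \<longrightarrow> ball x \<rho> \<subseteq> ball z r \<longrightarrow>
     emeasure lborel (strip \<Omega> x \<rho> t) \<le> ennreal (C * (t * \<rho> powr (real DIM('a) - 1))))"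
    using emeasure_strip_local[OF \<Omega>] by blast
  then obtain r C where rC: "\<forall>z\<in>closure \<Omega>. r z > 0 \<and> C z \<ge> 0 \<and> (\<forall>x \<rho> t. 0 < \<rho> \<longrightarrow> 0 < t \<longrightarrow> ball x \<rho> \<subseteq> ball z (r z) \<longrightarrow>
     emeasure lborel (strip \<Omega> x \<rho> t) \<le> ennreal (C z * (t * \<rho> powr (real DIM('a) - 1))))"
    by (elim bchoice[THEN exE]) (rule that)
  have "closure \<Omega> \<subseteq> (\<Union>z\<in>closure \<Omega>. ball z (r z))" using rC by fastforce
  then obtain D where D: "D \<subseteq> closure \<Omega>" "finite D" "closure \<Omega> \<subseteq> (\<Union>z\<in>D. ball z (r z))"
    using compactE_image[OF cpt, of "closure \<Omega>" "\<lambda>z. ball z (r z)"] by auto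
  obtain \<rho>0 where \<rho>0: "\<rho>0 > 0" "\<And>x. x \<in> closure \<Omega> \<Longrightarrow> \<exists>G\<in>(\<lambda>z. ball z (r z)) ` D. ball x \<rho>0 \<subseteq> G"
    using Heine_Borel_lemma[OF cpt D(3)] by auto
  define C0 where "C0 = (\<Sum>z\<in>D. C z)"
  have C0: "C z \<le> C0" "0 \<le> C z" if "z \<in> D" for z
    unfolding C0_def using that D rC by (auto intro!: member_le_sum)
  have C0_nn: "0 \<le> C0" unfolding C0_def using D rC by (intro sum_nonneg) auto
  have small: "emeasure lborel (strip \<Omega> x \<rho> t) \<le> ennreal (C0 * (t * \<rho> powr (real DIM('a) - 1)))"
    if x: "x \<in> closure \<Omega>" and \<rho>: "0 < \<rho>" "\<rho> \<le> \<rho>0" and t: "0 < t" for x \<rho> t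
  proof -
    obtain z where z: "z \<in> D" "ball x \<rho>0 \<subseteq> ball z (r z)" using \<rho>0(2)[OF x] by auto
    then have sub: "ball x \<rho> \<subseteq> ball z (r z)" using \<rho> by (meson subset_ball subset_trans)
    have "emeasure lborel (strip \<Omega> x \<rho> t) \<le> ennreal (C z * (t * \<rho> powr (real DIM('a) - 1)))"
      using rC z D sub \<rho> t by blast
    also have "\<dots> \<le> ennreal (C0 * (t * \<rho> powr (real DIM('a) - 1)))"
      using C0[OF z(1)] t by (intro ennreal_leI mult_right_mono) auto
    finally show ?thesis .
  qed
  have "closure \<Omega> \<subseteq> (\<Union>z\<in>closure \<Omega>. ball z \<rho>0)" using \<rho>0 by fastforce
  then obtain E where E: "E \<subseteq> closure \<Omega>" "finite E" "closure \<Omega> \<subseteq> (\<Union>z\<in>E. ball z \<rho>0)"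
    using compactE_image[OF cpt, of "closure \<Omega>" "\<lambda>z. ball z \<rho>0"] by auto
  let ?C = "(1 + real (card E)) * C0 + 1"
  have "emeasure lborel (strip \<Omega> x \<rho> t) \<le> ennreal (?C * (t * \<rho> powr (real DIM('a) - 1)))"
    if x: "x \<in> \<Omega>" and \<rho>: "0 < \<rho>" and t: "0 < t" for x \<rho> t
  proof (cases "\<rho> \<le> \<rho>0")
    case True
    have "emeasure lborel (strip \<Omega> x \<rho> t) \<le> ennreal (C0 * (t * \<rho> powr (real DIM('a) - 1)))"
      using x closure_subset True \<rho> t by (intro small) auto
    also have "\<dots> \<le> ennreal (?C * (t * \<rho> powr (real DIM('a) - 1)))"
      using C0_nn t by (intro ennreal_leI mult_right_mono) (auto simp: algebra_simps)
    finally show ?thesis .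
  next
    case False
    have "strip \<Omega> x \<rho> t \<subseteq> (\<Union>z\<in>E. strip \<Omega> z \<rho>0 t)"
      using E(3) closure_subset[of \<Omega>] by fastforce
    then have "emeasure lborel (strip \<Omega> x \<rho> t) \<le> emeasure lborel (\<Union>z\<in>E. strip \<Omega> z \<rho>0 t)"
      using E(2) strip_measurable[OF op] by (intro emeasure_mono) auto
    also have "\<dots> \<le> (\<Sum>z\<in>E. emeasure lborel (strip \<Omega> z \<rho>0 t))"
      using E(2) strip_measurable[OF op] by (intro emeasure_subadditive_finite) auto
    also have "\<dots> \<le> (\<Sum>z\<in>E. ennreal (C0 * (t * \<rho>0 powr (real DIM('a) - 1))))"
      using E(1) \<rho>0 t by (intro sum_mono small) auto
    also have "\<dots> = ennreal (real (card E) * (C0 * (t * \<rho>0 powr (real DIM('a) - 1))))"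
      using C0_nn t by (simp add: ennreal_mult' ennreal_of_nat_eq_real_of_nat)
    also have "\<dots> \<le> ennreal (?C * (t * \<rho> powr (real DIM('a) - 1)))"
    proof (rule ennreal_leI)
      have "t * \<rho>0 powr (real DIM('a) - 1) \<le> t * \<rho> powr (real DIM('a) - 1)"
        using False \<rho>0 t N by (intro mult_left_mono powr_mono2) auto
      then have "real (card E) * C0 * (t * \<rho>0 powr (real DIM('a) - 1)) \<le> ?C * (t * \<rho> powr (real DIM('a) - 1))"
        using C0_nn t by (intro mult_mono) (auto simp: algebra_simps)
      then show "real (card E) * (C0 * (t * \<rho>0 powr (real DIM('a) - 1))) \<le> ?C * (t * \<rho> powr (real DIM('a) - 1))"
        by (simp add: mult.assoc)
    qed
    finally show ?thesis .
  qed
  moreover have "?C > 0" using C0_nn by (simp add: add_nonneg_pos)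
  ultimately show ?thesis by blast
qed

section \<open>Integrals of powers of the distance to a point and to the boundary\<close>

lemma space_borel_on [simp]: "space (borel_on \<Omega>) = \<Omega>"
  by (simp add: space_restrict_space)

lemma norm_measurable_on [measurable]: "(\<lambda>y. norm (x - y)) \<in> borel_measurable (borel_on S)"
  for x :: "'a::euclidean_space"
  by (intro measurable_restrict_space1) measurable

lemma emeasure_borel_on_ball:
  fixes x :: "'a::euclidean_space"
  assumes "open \<Omega>" "t > 0"
  shows "emeasure (borel_on \<Omega>) {y\<in>\<Omega>. norm (x - y) < t} \<le> ennreal (unit_ball_vol (real DIM('a)) * t powr real DIM('a))"
proof -
  have "emeasure (borel_on \<Omega>) {y\<in>\<Omega>. norm (x - y) < t} = emeasure lborel {y\<in>\<Omega>. norm (x - y) < t}"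
    using assms by (intro emeasure_restrict_space) auto
  also have "\<dots> \<le> emeasure lborel (ball x t)" by (intro emeasure_mono) (auto simp: dist_norm)
  also have "\<dots> = ennreal (unit_ball_vol (real DIM('a)) * t powr real DIM('a))"
    using assms by (simp add: emeasure_ball powr_realpow)
  finally show ?thesis .
qed

lemma riesz_near:
  fixes \<Omega> :: "'a::euclidean_space set"
  assumes op: "open \<Omega>" and \<sigma>: "0 < \<sigma>" "\<sigma> < real DIM('a)"
  shows "\<exists>C>0. \<forall>x. \<forall>R>0. (\<integral>\<^sup>+y. ennreal (norm (x - y) powr (\<sigma> - real DIM('a))) * indicator {y. norm (x - y) < R} y \<partial>borel_on \<Omega>)
      \<le> ennreal (C * R powr \<sigma>)"
proof -
  let ?N = "real DIM('a)" and ?\<omega> = "unit_ball_vol (real DIM('a))"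
  let ?C = "?\<omega> * 2 powr (?N - \<sigma>) / (1 - 2 powr (- \<sigma>))"
  have "2 powr (- \<sigma>) < 1" using \<sigma> powr_less_mono[of "- \<sigma>" 0 2] by simp
  then have "?C > 0" by (intro divide_pos_pos mult_pos_pos) auto
  moreover have "(\<integral>\<^sup>+y. ennreal (norm (x - y) powr (\<sigma> - ?N)) * indicator {y. norm (x - y) < R} y \<partial>borel_on \<Omega>)
      \<le> ennreal (?C * R powr \<sigma>)" if R: "R > 0" for x R
  proof -
    have "(\<integral>\<^sup>+y. ennreal (norm (x - y) powr (\<sigma> - ?N)) * indicator {y. norm (x - y) < R} y \<partial>borel_on \<Omega>)
      \<le> (\<integral>\<^sup>+y. ennreal (norm (x - y) powr - (?N - \<sigma>)) * indicator {y. 0 < norm (x - y) \<and> norm (x - y) < R} y \<partial>borel_on \<Omega>)"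
      by (intro nn_integral_mono) (auto simp: indicator_def)
    also have "\<dots> \<le> ennreal (?\<omega> * R powr (?N - (?N - \<sigma>)) * 2 powr (?N - \<sigma>) / (1 - 2 powr (?N - \<sigma> - ?N)))"
    proof (rule nn_integral_powr_near[OF _ R])
      show "emeasure (borel_on \<Omega>) {y \<in> space (borel_on \<Omega>). 0 < norm (x - y) \<and> norm (x - y) < t}
          \<le> ennreal (?\<omega> * t powr ?N)" if "0 < t" for t
        by (rule order_trans[OF emeasure_mono emeasure_borel_on_ball[OF op that, of x]])
          (use op in \<open>auto simp: sets_restrict_space_iff\<close>)
    qed (use \<sigma> in auto)
    finally show ?thesis by (simp add: mult_ac)
  qed
  ultimately show ?thesis by blast
qed

text \<open>Where d < \<rho> the dyadic estimate is used with exponent 1 and constant C \<rho>^(N-1)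
  from the strips; where d >= \<rho> the integrand is at most \<rho>^-\<theta> and the volume of the
  ball suffices. Both parts are of order \<rho>^(N-\<theta>).\<close>

lemma bdist_powr_ball:
  fixes \<Omega> :: "'a::euclidean_space set"
  assumes \<Omega>: "C2_bounded_domain \<Omega>" and \<theta>: "0 \<le> \<theta>" "\<theta> < 1"
  shows "\<exists>C>0. \<forall>x\<in>\<Omega>. \<forall>\<rho>>0. (\<integral>\<^sup>+y. ennreal (bdist \<Omega> y powr - \<theta>) * indicator {y. norm (x - y) < \<rho>} y \<partial>borel_on \<Omega>)
      \<le> ennreal (C * \<rho> powr (real DIM('a) - \<theta>))"
proof -
  let ?N = "real DIM('a)" and ?\<omega> = "unit_ball_vol (real DIM('a))"
  have op: "open \<Omega>" and bd: "bounded \<Omega>" using \<Omega> by (auto simp: C2_bounded_domain_def)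
  obtain C where C: "C > 0" "\<And>x \<rho> t. x \<in> \<Omega> \<Longrightarrow> \<rho> > 0 \<Longrightarrow> t > 0 \<Longrightarrow>
     emeasure lborel (strip \<Omega> x \<rho> t) \<le> ennreal (C * (t * \<rho> powr (?N - 1)))"
    using emeasure_strip_bound[OF \<Omega>] by blast
  have lt1: "2 powr (\<theta> - 1) < 1" using \<theta> powr_less_mono[of "\<theta> - 1" 0 2] by simp
  let ?C = "C * 2 powr \<theta> / (1 - 2 powr (\<theta> - 1)) + ?\<omega>"
  have pos: "C * 2 powr \<theta> / (1 - 2 powr (\<theta> - 1)) > 0"
    using C lt1 by (intro divide_pos_pos mult_pos_pos) auto
  moreover have "(\<integral>\<^sup>+y. ennreal (bdist \<Omega> y powr - \<theta>) * indicator {y. norm (x - y) < \<rho>} y \<partial>borel_on \<Omega>)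
      \<le> ennreal (?C * \<rho> powr (?N - \<theta>))" if x: "x \<in> \<Omega>" and \<rho>: "\<rho> > 0" for x \<rho>
  proof -
    let ?B = "{y\<in>\<Omega>. norm (x - y) < \<rho>}"
    have B_borel: "?B \<in> sets borel" using op by measurable
    then have B [measurable]: "?B \<in> sets (borel_on \<Omega>)" using op by (auto simp: sets_restrict_space_iff)
    have BI: "?B \<inter> \<Omega> = ?B" by blast
    have near: "(\<integral>\<^sup>+y. ennreal (bdist \<Omega> y powr - \<theta>) * indicator {y. 0 < bdist \<Omega> y \<and> bdist \<Omega> y < \<rho>} y \<partial>restrict_space (borel_on \<Omega>) ?B)
        \<le> ennreal ((C * \<rho> powr (?N - 1)) * \<rho> powr (1 - \<theta>) * 2 powr \<theta> / (1 - 2 powr (\<theta> - 1)))"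
    proof (rule nn_integral_powr_near[OF _ \<rho>])
      show "bdist \<Omega> \<in> borel_measurable (restrict_space (borel_on \<Omega>) ?B)"
        by (intro measurable_restrict_space1) measurable
      show "emeasure (restrict_space (borel_on \<Omega>) ?B) {y \<in> space (restrict_space (borel_on \<Omega>) ?B). 0 < bdist \<Omega> y \<and> bdist \<Omega> y < t}
          \<le> ennreal (C * \<rho> powr (?N - 1) * t powr 1)" if t: "0 < t" for t
      proof -
        have eq: "{y \<in> space (restrict_space (borel_on \<Omega>) ?B). 0 < bdist \<Omega> y \<and> bdist \<Omega> y < t} = strip \<Omega> x \<rho> t"
          using bdist_pos[OF op bd] by (auto simp: space_restrict_space dist_norm)
        have "emeasure (restrict_space (borel_on \<Omega>) ?B) (strip \<Omega> x \<rho> t) = emeasure (borel_on \<Omega>) (strip \<Omega> x \<rho> t)"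
        proof (rule emeasure_restrict_space)
          show "?B \<inter> space (borel_on \<Omega>) \<in> sets (borel_on \<Omega>)" by (simp only: space_borel_on BI B)
        qed (auto simp: dist_norm)
        also have "\<dots> = emeasure lborel (strip \<Omega> x \<rho> t)"
          using op by (intro emeasure_restrict_space) auto
        also have "\<dots> \<le> ennreal (C * (t * \<rho> powr (?N - 1)))" by (rule C(2)[OF x \<rho> t])
        finally show ?thesis unfolding eq using t by (simp add: mult_ac)
      qed
    qed (use \<theta> C in auto)
    have "(\<integral>\<^sup>+y. ennreal (bdist \<Omega> y powr - \<theta>) * indicator {y. norm (x - y) < \<rho>} y \<partial>borel_on \<Omega>)
       \<le> (\<integral>\<^sup>+y. ennreal (bdist \<Omega> y powr - \<theta>) * indicator {y. 0 < bdist \<Omega> y \<and> bdist \<Omega> y < \<rho>} y * indicator ?B y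
          + ennreal (\<rho> powr - \<theta>) * indicator ?B y \<partial>borel_on \<Omega>)"
    proof (intro nn_integral_mono)
      fix y assume y: "y \<in> space (borel_on \<Omega>)"
      have "bdist \<Omega> y powr - \<theta> \<le> \<rho> powr - \<theta>" if "\<rho> \<le> bdist \<Omega> y"
        using that \<rho> \<theta> by (intro powr_mono2') auto
      then show "ennreal (bdist \<Omega> y powr - \<theta>) * indicator {y. norm (x - y) < \<rho>} y
         \<le> ennreal (bdist \<Omega> y powr - \<theta>) * indicator {y. 0 < bdist \<Omega> y \<and> bdist \<Omega> y < \<rho>} y * indicator ?B y
          + ennreal (\<rho> powr - \<theta>) * indicator ?B y"
        using y bdist_pos[OF op bd, of y] by (auto simp: indicator_def not_less intro: ennreal_leI)
    qed
    also have "\<dots> = (\<integral>\<^sup>+y. ennreal (bdist \<Omega> y powr - \<theta>) * indicator {y. 0 < bdist \<Omega> y \<and> bdist \<Omega> y < \<rho>} y * indicator ?B y \<partial>borel_on \<Omega>)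
          + (\<integral>\<^sup>+y. ennreal (\<rho> powr - \<theta>) * indicator ?B y \<partial>borel_on \<Omega>)"
      by (intro nn_integral_add) measurable
    also have "(\<integral>\<^sup>+y. ennreal (bdist \<Omega> y powr - \<theta>) * indicator {y. 0 < bdist \<Omega> y \<and> bdist \<Omega> y < \<rho>} y * indicator ?B y \<partial>borel_on \<Omega>)
       = (\<integral>\<^sup>+y. ennreal (bdist \<Omega> y powr - \<theta>) * indicator {y. 0 < bdist \<Omega> y \<and> bdist \<Omega> y < \<rho>} y \<partial>restrict_space (borel_on \<Omega>) ?B)"
      by (intro nn_integral_restrict_space[symmetric]) (simp only: space_borel_on BI B)
    also have "(\<integral>\<^sup>+y. ennreal (\<rho> powr - \<theta>) * indicator ?B y \<partial>borel_on \<Omega>) = ennreal (\<rho> powr - \<theta>) * emeasure (borel_on \<Omega>) ?B"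
      by (intro nn_integral_cmult_indicator) measurable
    also have "\<dots> \<le> ennreal (\<rho> powr - \<theta>) * ennreal (?\<omega> * \<rho> powr ?N)"
      by (intro mult_left_mono emeasure_borel_on_ball op \<rho>) auto
    also note near
    also have "ennreal ((C * \<rho> powr (?N - 1)) * \<rho> powr (1 - \<theta>) * 2 powr \<theta> / (1 - 2 powr (\<theta> - 1))) + ennreal (\<rho> powr - \<theta>) * ennreal (?\<omega> * \<rho> powr ?N)
       = ennreal (?C * \<rho> powr (?N - \<theta>))"
    proof -
      have "(C * \<rho> powr (?N - 1)) * \<rho> powr (1 - \<theta>) * 2 powr \<theta> / (1 - 2 powr (\<theta> - 1)) =
          (C * 2 powr \<theta> / (1 - 2 powr (\<theta> - 1))) * (\<rho> powr (?N - 1) * \<rho> powr (1 - \<theta>))" by simp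
      also have "\<rho> powr (?N - 1) * \<rho> powr (1 - \<theta>) = \<rho> powr (?N - \<theta>)" by (simp add: powr_add[symmetric])
      finally have 1: "(C * \<rho> powr (?N - 1)) * \<rho> powr (1 - \<theta>) * 2 powr \<theta> / (1 - 2 powr (\<theta> - 1)) =
          (C * 2 powr \<theta> / (1 - 2 powr (\<theta> - 1))) * \<rho> powr (?N - \<theta>)" .
      have "\<rho> powr - \<theta> * (?\<omega> * \<rho> powr ?N) = ?\<omega> * (\<rho> powr - \<theta> * \<rho> powr ?N)" by simp
      also have "\<rho> powr - \<theta> * \<rho> powr ?N = \<rho> powr (?N - \<theta>)" by (simp add: powr_add[symmetric])
      finally have 2: "\<rho> powr - \<theta> * (?\<omega> * \<rho> powr ?N) = ?\<omega> * \<rho> powr (?N - \<theta>)" .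
      define a where "a = C * 2 powr \<theta> / (1 - 2 powr (\<theta> - 1))"
      have "a > 0" using pos by (simp add: a_def)
      have "ennreal (\<rho> powr - \<theta>) * ennreal (?\<omega> * \<rho> powr ?N) = ennreal (?\<omega> * \<rho> powr (?N - \<theta>))"
        by (simp only: ennreal_mult'[symmetric] powr_ge_zero 2)
      then show ?thesis
        unfolding 1 a_def[symmetric] distrib_right using \<open>a > 0\<close> by (simp add: ennreal_plus[symmetric] del: ennreal_plus)
    qed
    finally show ?thesis by (simp add: add_mono)
  qed
  ultimately show ?thesis by (intro exI[of _ ?C]) (auto simp: add_pos_nonneg)
qed

text \<open>A negative exponent is treated by \<open>bdist_powr_ball\<close> on a ball that contains
  the domain; for a nonnegative one the power is bounded. Setting \<theta> = max 0 (- \<alpha>)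
  treats both at once.\<close>

lemma bdist_powr_integrable:
  fixes \<Omega> :: "'a::euclidean_space set"
  assumes \<Omega>: "C2_bounded_domain \<Omega>" and \<alpha>: "\<alpha> > - 1"
  shows "integrable (borel_on \<Omega>) (\<lambda>y. bdist \<Omega> y powr \<alpha>)"
proof -
  have op: "open \<Omega>" and bd: "bounded \<Omega>" and ne: "\<Omega> \<noteq> {}" using \<Omega> by (auto simp: C2_bounded_domain_def)
  obtain D where D: "\<And>x y. x \<in> \<Omega> \<Longrightarrow> y \<in> \<Omega> \<Longrightarrow> norm (x - y) \<le> D"
    using diameter_bounded_bound[OF bd] by (auto simp: dist_norm)
  obtain x0 where x0: "x0 \<in> \<Omega>" using ne by blast
  have D0: "D \<ge> 0" using D[OF x0 x0] by simp
  define E where "E = bdist \<Omega> x0 + D"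
  have E: "bdist \<Omega> y \<le> E" if "y \<in> \<Omega>" for y
    using bdist_triangle[of \<Omega> y x0] D[OF that x0] by (simp add: E_def)
  let ?\<theta> = "max 0 (- \<alpha>)"
  obtain C where C: "C > 0" "\<And>x \<rho>. x \<in> \<Omega> \<Longrightarrow> \<rho> > 0 \<Longrightarrow>
      (\<integral>\<^sup>+y. ennreal (bdist \<Omega> y powr - ?\<theta>) * indicator {y. norm (x - y) < \<rho>} y \<partial>borel_on \<Omega>)
      \<le> ennreal (C * \<rho> powr (real DIM('a) - ?\<theta>))"
    using bdist_powr_ball[OF \<Omega>, of ?\<theta>] \<alpha> by auto
  let ?b = "max 1 (E powr \<alpha>)"
  have "(\<integral>\<^sup>+y. ennreal (norm (bdist \<Omega> y powr \<alpha>)) \<partial>borel_on \<Omega>) \<le>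
     (\<integral>\<^sup>+y. ennreal ?b * (ennreal (bdist \<Omega> y powr - ?\<theta>) * indicator {y. norm (x0 - y) < D + 1} y) \<partial>borel_on \<Omega>)"
  proof (intro nn_integral_mono)
    fix y assume "y \<in> space (borel_on \<Omega>)"
    then have y: "y \<in> \<Omega>" by simp
    have "bdist \<Omega> y powr \<alpha> \<le> ?b * bdist \<Omega> y powr - ?\<theta>"
    proof (cases "\<alpha> \<ge> 0")
      case True
      then have "bdist \<Omega> y powr \<alpha> \<le> E powr \<alpha>" using E[OF y] bdist_nonneg by (intro powr_mono2) auto
      then show ?thesis using True bdist_pos[OF op bd y] by (simp add: max_absorb1 max_def)
    next
      case False
      then have "?\<theta> = - \<alpha>" by simp
      then show ?thesis using mult_right_mono[of 1 ?b "bdist \<Omega> y powr \<alpha>"] by simp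
    qed
    moreover have "norm (x0 - y) < D + 1" using D[OF x0 y] by simp
    ultimately show "ennreal (norm (bdist \<Omega> y powr \<alpha>)) \<le>
      ennreal ?b * (ennreal (bdist \<Omega> y powr - ?\<theta>) * indicator {y. norm (x0 - y) < D + 1} y)"
      by (simp add: ennreal_mult[symmetric] ennreal_leI)
  qed
  also have "\<dots> = ennreal ?b * (\<integral>\<^sup>+y. ennreal (bdist \<Omega> y powr - ?\<theta>) * indicator {y. norm (x0 - y) < D + 1} y \<partial>borel_on \<Omega>)"
    by (intro nn_integral_cmult) measurable
  also have "\<dots> \<le> ennreal ?b * ennreal (C * (D + 1) powr (real DIM('a) - ?\<theta>))"
    using D0 by (intro mult_left_mono C x0) auto
  also have "\<dots> < \<infinity>" by (simp add: ennreal_mult_less_top)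
  finally show ?thesis by (intro integrableI_bounded) auto
qed

text \<open>The measure with density d^-\<theta> gives a ball of radius \<rho> centred in the domain
  a mass of order \<rho>^(N-\<theta>), so the outward dyadic estimate applies to it with that
  exponent.\<close>

lemma riesz_far_bdist:
  fixes \<Omega> :: "'a::euclidean_space set"
  assumes \<Omega>: "C2_bounded_domain \<Omega>" and \<theta>: "0 \<le> \<theta>" "\<theta> < 1" and m: "real DIM('a) - \<theta> < m"
  shows "\<exists>C>0. \<forall>x\<in>\<Omega>. \<forall>R>0. (\<integral>\<^sup>+y. ennreal (norm (x - y) powr - m * bdist \<Omega> y powr - \<theta>) * indicator {y. R \<le> norm (x - y)} y \<partial>borel_on \<Omega>)
      \<le> ennreal (C * R powr (real DIM('a) - \<theta> - m))"
proof -
  let ?\<kappa> = "real DIM('a) - \<theta>"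
  obtain C where C: "C > 0" "\<And>x \<rho>. x \<in> \<Omega> \<Longrightarrow> \<rho> > 0 \<Longrightarrow>
      (\<integral>\<^sup>+y. ennreal (bdist \<Omega> y powr - \<theta>) * indicator {y. norm (x - y) < \<rho>} y \<partial>borel_on \<Omega>)
      \<le> ennreal (C * \<rho> powr ?\<kappa>)"
    using bdist_powr_ball[OF \<Omega> \<theta>] by blast
  have \<kappa>: "0 \<le> ?\<kappa>" using \<theta> DIM_positive[where 'a='a] by linarith
  have "2 powr (?\<kappa> - m) < 1" using m powr_less_mono[of "?\<kappa> - m" 0 2] by simp
  then have pos: "C * 2 powr ?\<kappa> / (1 - 2 powr (?\<kappa> - m)) > 0" using C by (intro divide_pos_pos mult_pos_pos) auto
  have "(\<integral>\<^sup>+y. ennreal (norm (x - y) powr - m * bdist \<Omega> y powr - \<theta>) * indicator {y. R \<le> norm (x - y)} y \<partial>borel_on \<Omega>)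
      \<le> ennreal (C * 2 powr ?\<kappa> / (1 - 2 powr (?\<kappa> - m)) * R powr (?\<kappa> - m))" if x: "x \<in> \<Omega>" and R: "R > 0" for x R
  proof -
    let ?\<nu> = "density (borel_on \<Omega>) (\<lambda>y. ennreal (bdist \<Omega> y powr - \<theta>))"
    have "(\<integral>\<^sup>+y. ennreal (norm (x - y) powr - m) * indicator {y. R \<le> norm (x - y)} y \<partial>?\<nu>)
       \<le> ennreal (C * R powr (?\<kappa> - m) * 2 powr ?\<kappa> / (1 - 2 powr (?\<kappa> - m)))"
    proof (rule nn_integral_powr_far[OF _ R \<kappa> m])
      show "emeasure ?\<nu> {y\<in>space ?\<nu>. norm (x - y) < t} \<le> ennreal (C * t powr ?\<kappa>)" if t: "0 < t" for t
      proof -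
        have [measurable]: "{y\<in>\<Omega>. norm (x - y) < t} \<in> sets (borel_on \<Omega>)"
          using measurable_sets[OF norm_measurable_on[of x \<Omega>], of "{..<t}"] by (simp add: vimage_def Int_def conj_commute)
        have "emeasure ?\<nu> {y\<in>space ?\<nu>. norm (x - y) < t} =
            (\<integral>\<^sup>+y. ennreal (bdist \<Omega> y powr - \<theta>) * indicator {y\<in>\<Omega>. norm (x - y) < t} y \<partial>borel_on \<Omega>)"
          by (subst emeasure_density) auto
        also have "\<dots> = (\<integral>\<^sup>+y. ennreal (bdist \<Omega> y powr - \<theta>) * indicator {y. norm (x - y) < t} y \<partial>borel_on \<Omega>)"
          by (intro nn_integral_cong) (auto simp: indicator_def)
        finally show ?thesis using C(2)[OF x t] by simp
      qed
    qed (use C in auto)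
    also have "(\<integral>\<^sup>+y. ennreal (norm (x - y) powr - m) * indicator {y. R \<le> norm (x - y)} y \<partial>?\<nu>)
       = (\<integral>\<^sup>+y. ennreal (bdist \<Omega> y powr - \<theta>) * (ennreal (norm (x - y) powr - m) * indicator {y. R \<le> norm (x - y)} y) \<partial>borel_on \<Omega>)"
      by (intro nn_integral_density) auto
    finally show ?thesis by (simp add: ennreal_mult mult_ac)
  qed
  then show ?thesis using pos by blast
qed

section \<open>Estimates of the Green function profile\<close>

lemma green_profile_offdiag_measurable:
  fixes \<Omega> :: "'a::euclidean_space set"
  assumes "open \<Omega>"
  shows "(\<lambda>y. ennreal (green_profile \<Omega> s \<gamma> x y * bdist \<Omega> y powr a) * indicator (- {x}) y) \<in> borel_measurable (borel_on \<Omega>)"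
proof -
  have "- {x} \<inter> \<Omega> \<in> sets (borel_on \<Omega>)" using assms by (auto simp: sets_restrict_space_iff)
  then have [measurable]: "(indicator (- {x}) :: 'a \<Rightarrow> ennreal) \<in> borel_measurable (borel_on \<Omega>)"
    by (subst borel_measurable_indicator_iff) auto
  show ?thesis unfolding green_profile_def by measurable
qed

lemma green_profile_le_riesz:
  assumes \<gamma>: "0 < \<gamma>" and xy: "x \<noteq> (y :: 'a::euclidean_space)"
  shows "green_profile \<Omega> s \<gamma> x y \<le> norm (x - y) powr (2 * s - real DIM('a))"
proof -
  have le: "(min (bdist \<Omega> z / norm (x - y)) 1) powr \<gamma> \<le> 1" for z
    using \<gamma> bdist_nonneg[of \<Omega> z] powr_mono2[of \<gamma> "min (bdist \<Omega> z / norm (x - y)) 1" 1] by simp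
  have "1 / norm (x - y) powr (real DIM('a) - 2 * s) = norm (x - y) powr (2 * s - real DIM('a))"
    by (simp add: powr_minus_divide[symmetric])
  then have "green_profile \<Omega> s \<gamma> x y \<le> norm (x - y) powr (2 * s - real DIM('a)) * 1 * 1"
    unfolding green_profile_def by (intro mult_mono le) auto
  then show ?thesis by simp
qed

text \<open>With r = |x - y|, min (d(x) / r) 1 times d(y) is at most 2 d(x): if r <= d(x) then d(y)
  <= 2 d(x), and otherwise d(y) <= 2 r. So the boundary factor of x converts the weight at y into
  the weight at x, while the factor of y is bounded by 1.\<close>

lemma green_profile_bdist_le:
  assumes \<gamma>: "0 < \<gamma>" and xy: "x \<noteq> (y :: 'a::euclidean_space)"
  shows "green_profile \<Omega> s \<gamma> x y * bdist \<Omega> y powr \<gamma>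
     \<le> 2 powr \<gamma> * bdist \<Omega> x powr \<gamma> * norm (x - y) powr (2 * s - real DIM('a))"
proof -
  let ?r = "norm (x - y)" and ?d = "bdist \<Omega> x" and ?e = "bdist \<Omega> y"
  have r: "?r > 0" using xy by simp
  have nn: "?d \<ge> 0" "?e \<ge> 0" by (simp_all add: bdist_nonneg)
  have e: "?e \<le> ?d + ?r" using bdist_triangle[of \<Omega> y x] by (simp add: norm_minus_commute)
  have key: "min (?d / ?r) 1 * ?e \<le> 2 * ?d"
  proof (cases "?r \<le> ?d")
    case True
    have "min (?d / ?r) 1 * ?e \<le> 1 * ?e" using nn by (intro mult_right_mono) auto
    then show ?thesis using True e by linarith
  next
    case False
    have "min (?d / ?r) 1 * ?e \<le> ?d / ?r * (2 * ?r)" using e False nn r by (intro mult_mono) auto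
    also have "\<dots> = 2 * ?d" using r by simp
    finally show ?thesis .
  qed
  have "(min (?d / ?r) 1) powr \<gamma> * (min (?e / ?r) 1) powr \<gamma> * ?e powr \<gamma> \<le> (min (?d / ?r) 1) powr \<gamma> * 1 * ?e powr \<gamma>"
    using \<gamma> nn r powr_mono2[of \<gamma> "min (?e / ?r) 1" 1] by (intro mult_mono) auto
  also have "\<dots> = (min (?d / ?r) 1 * ?e) powr \<gamma>" using nn r by (simp add: powr_mult)
  also have "\<dots> \<le> (2 * ?d) powr \<gamma>" using key \<gamma> nn r by (intro powr_mono2) auto
  also have "\<dots> = 2 powr \<gamma> * ?d powr \<gamma>" using nn by (simp add: powr_mult)
  finally have "(1 / ?r powr (real DIM('a) - 2 * s)) * ((min (?d / ?r) 1) powr \<gamma> * (min (?e / ?r) 1) powr \<gamma> * ?e powr \<gamma>)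
      \<le> (1 / ?r powr (real DIM('a) - 2 * s)) * (2 powr \<gamma> * ?d powr \<gamma>)"
    by (intro mult_left_mono) auto
  also have "1 / ?r powr (real DIM('a) - 2 * s) = ?r powr (2 * s - real DIM('a))"
    by (simp add: powr_minus_divide[symmetric])
  finally show ?thesis by (simp add: green_profile_def mult_ac powr_minus_divide[symmetric])
qed

text \<open>Within half the boundary distance of x both boundary factors equal 1, and the profile is
  the Riesz kernel, which decreases with |x - y|.\<close>

lemma green_profile_ge_local:
  fixes x :: "'a::euclidean_space"
  assumes xy: "x \<noteq> y" and close: "norm (x - y) \<le> bdist \<Omega> x / 2" and N: "2 * s < real DIM('a)"
  shows "(bdist \<Omega> x / 2) powr (2 * s - real DIM('a)) \<le> green_profile \<Omega> s \<gamma> x y"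
proof -
  have r: "norm (x - y) > 0" using xy by simp
  have "bdist \<Omega> x \<le> bdist \<Omega> y + norm (x - y)" by (rule bdist_triangle)
  then have "norm (x - y) \<le> bdist \<Omega> y" "norm (x - y) \<le> bdist \<Omega> x" using close r by linarith+
  then have "green_profile \<Omega> s \<gamma> x y = norm (x - y) powr (2 * s - real DIM('a))"
    using r by (simp add: green_profile_def min_absorb2 powr_minus_divide[symmetric])
  moreover have "(bdist \<Omega> x / 2) powr (2 * s - real DIM('a)) \<le> norm (x - y) powr (2 * s - real DIM('a))"
    using r close N by (intro powr_mono2') auto
  ultimately show ?thesis by simp
qed

lemma green_profile_ge_global:
  fixes \<Omega> :: "'a::euclidean_space set"
  assumes bd: "bounded \<Omega>" and \<gamma>: "0 < \<gamma>" and N: "2 * s < real DIM('a)"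
  shows "\<exists>c>0. \<forall>x\<in>\<Omega>. \<forall>y\<in>\<Omega>. x \<noteq> y \<longrightarrow> c * bdist \<Omega> x powr \<gamma> * bdist \<Omega> y powr \<gamma> \<le> green_profile \<Omega> s \<gamma> x y"
proof (cases "\<Omega> = {}")
  case False
  then obtain x0 where x0: "x0 \<in> \<Omega>" by blast
  obtain D0 where D0: "\<And>x y. x \<in> \<Omega> \<Longrightarrow> y \<in> \<Omega> \<Longrightarrow> norm (x - y) \<le> D0"
    using diameter_bounded_bound[OF bd] by (auto simp: dist_norm)
  \<comment> \<open>\<open>D\<close> bounds the diameter and also the boundary distance, so that d /
    D is below both d / |x - y| and 1.\<close>
  define D where "D = D0 + bdist \<Omega> x0 + 1"
  have D: "D > 0" "\<And>x y. x \<in> \<Omega> \<Longrightarrow> y \<in> \<Omega> \<Longrightarrow> norm (x - y) \<le> D" "\<And>x. x \<in> \<Omega> \<Longrightarrow> bdist \<Omega> x \<le> D"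
  proof -
    show "D > 0" using D0[OF x0 x0] bdist_nonneg[of \<Omega> x0] by (simp add: D_def)
    show "norm (x - y) \<le> D" if "x \<in> \<Omega>" "y \<in> \<Omega>" for x y
      using D0[OF that] bdist_nonneg[of \<Omega> x0] by (simp add: D_def)
    show "bdist \<Omega> x \<le> D" if "x \<in> \<Omega>" for x
      using D0[OF that x0] bdist_triangle[of \<Omega> x x0] by (simp add: D_def)
  qed
  let ?c = "D powr (2 * s - real DIM('a)) * (1 / D) powr \<gamma> * (1 / D) powr \<gamma>"
  have "?c * bdist \<Omega> x powr \<gamma> * bdist \<Omega> y powr \<gamma> \<le> green_profile \<Omega> s \<gamma> x y"
    if xy: "x \<in> \<Omega>" "y \<in> \<Omega>" "x \<noteq> y" for x y
  proof -
    have r: "norm (x - y) > 0" using xy by simp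
    have fac: "(1 / D) powr \<gamma> * bdist \<Omega> z powr \<gamma> \<le> (min (bdist \<Omega> z / norm (x - y)) 1) powr \<gamma>" if z: "z \<in> \<Omega>" for z
    proof -
      have "(1 / D) powr \<gamma> * bdist \<Omega> z powr \<gamma> = (bdist \<Omega> z / D) powr \<gamma>"
        using D bdist_nonneg[of \<Omega> z] by (simp add: powr_mult[symmetric])
      also have "\<dots> \<le> (min (bdist \<Omega> z / norm (x - y)) 1) powr \<gamma>"
        using D z xy r \<gamma> bdist_nonneg[of \<Omega> z] by (intro powr_mono2) (auto intro!: divide_left_mono)
      finally show ?thesis .
    qed
    have "D powr (2 * s - real DIM('a)) \<le> norm (x - y) powr (2 * s - real DIM('a))"
      using r D xy N by (intro powr_mono2') auto
    also have "\<dots> = 1 / norm (x - y) powr (real DIM('a) - 2 * s)" by (simp add: powr_minus_divide[symmetric])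
    finally have "D powr (2 * s - real DIM('a)) * ((1 / D) powr \<gamma> * bdist \<Omega> x powr \<gamma>) * ((1 / D) powr \<gamma> * bdist \<Omega> y powr \<gamma>)
       \<le> green_profile \<Omega> s \<gamma> x y"
      unfolding green_profile_def by (intro mult_mono fac xy) auto
    then show ?thesis by (simp add: mult_ac)
  qed
  moreover have "?c > 0" using D by simp
  ultimately show ?thesis by blast
qed (auto intro: exI[of _ 1])

text \<open>This is the estimate G[d^gamma] <= C d^gamma behind \<open>K_w\<close>: after
  \<open>green_profile_bdist_le\<close> only |x - y|^(2s-N) is left, whose integral over a bounded
  domain is bounded uniformly in x.\<close>

lemma green_profile_bdist_integral:
  fixes \<Omega> :: "'a::euclidean_space set"
  assumes \<Omega>: "C2_bounded_domain \<Omega>" and s: "0 < s" "2 * s < real DIM('a)" and \<gamma>: "0 < \<gamma>"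
  shows "\<exists>C>0. \<forall>x\<in>\<Omega>. (\<integral>\<^sup>+y. ennreal (green_profile \<Omega> s \<gamma> x y * bdist \<Omega> y powr \<gamma>) * indicator (- {x}) y \<partial>borel_on \<Omega>)
     \<le> ennreal (C * bdist \<Omega> x powr \<gamma>)"
proof -
  have op: "open \<Omega>" and bd: "bounded \<Omega>" using \<Omega> by (auto simp: C2_bounded_domain_def)
  obtain D where D: "\<And>x y. x \<in> \<Omega> \<Longrightarrow> y \<in> \<Omega> \<Longrightarrow> norm (x - y) \<le> D"
    using diameter_bounded_bound[OF bd] by (auto simp: dist_norm)
  obtain C where C: "C > 0" "\<And>x R. R > 0 \<Longrightarrow>
      (\<integral>\<^sup>+y. ennreal (norm (x - y) powr (2 * s - real DIM('a))) * indicator {y. norm (x - y) < R} y \<partial>borel_on \<Omega>) \<le> ennreal (C * R powr (2 * s))"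
    using riesz_near[OF op, of "2 * s"] s by auto
  let ?D = "\<bar>D\<bar> + 1"
  let ?C = "2 powr \<gamma> * (C * ?D powr (2 * s))"
  have "(\<integral>\<^sup>+y. ennreal (green_profile \<Omega> s \<gamma> x y * bdist \<Omega> y powr \<gamma>) * indicator (- {x}) y \<partial>borel_on \<Omega>)
     \<le> ennreal (?C * bdist \<Omega> x powr \<gamma>)" if x: "x \<in> \<Omega>" for x
  proof -
    let ?c = "2 powr \<gamma> * bdist \<Omega> x powr \<gamma>"
    have "(\<integral>\<^sup>+y. ennreal (green_profile \<Omega> s \<gamma> x y * bdist \<Omega> y powr \<gamma>) * indicator (- {x}) y \<partial>borel_on \<Omega>)
      \<le> (\<integral>\<^sup>+y. ennreal ?c * (ennreal (norm (x - y) powr (2 * s - real DIM('a))) * indicator {y. norm (x - y) < ?D} y) \<partial>borel_on \<Omega>)"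
    proof (intro nn_integral_mono)
      fix y assume "y \<in> space (borel_on \<Omega>)"
      then have "norm (x - y) < ?D" using D[OF x, of y] by simp
      then show "ennreal (green_profile \<Omega> s \<gamma> x y * bdist \<Omega> y powr \<gamma>) * indicator (- {x}) y
        \<le> ennreal ?c * (ennreal (norm (x - y) powr (2 * s - real DIM('a))) * indicator {y. norm (x - y) < ?D} y)"
        using green_profile_bdist_le[OF \<gamma>, of x y \<Omega> s]
        by (cases "x = y") (auto simp: ennreal_mult[symmetric] mult.assoc intro!: ennreal_leI)
    qed
    also have "\<dots> = ennreal ?c * (\<integral>\<^sup>+y. ennreal (norm (x - y) powr (2 * s - real DIM('a))) * indicator {y. norm (x - y) < ?D} y \<partial>borel_on \<Omega>)"
      by (intro nn_integral_cmult) measurable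
    also have "\<dots> \<le> ennreal ?c * ennreal (C * ?D powr (2 * s))" by (intro mult_left_mono C) auto
    also have "\<dots> = ennreal (?C * bdist \<Omega> x powr \<gamma>)" using C by (simp add: ennreal_mult[symmetric] mult_ac)
    finally show ?thesis .
  qed
  moreover have "?C > 0" using C by simp
  ultimately show ?thesis by blast
qed

text \<open>For |x - y| < d(x) / 2 one has d(y) >= d(x) / 2, and the Riesz kernel contributes
  d(x)^(2s-\<beta>). Farther away the factor of x gives (d(x) / |x - y|)^gamma, and of the factor of
  y the power \<gamma>' = min \<gamma> \<beta> is used to cancel as much of d(y)^-\<beta> as
  possible. What is left is d(y)^-\<theta> with \<theta> = \<beta> - \<gamma>', and \<theta> < 1 by
  \<beta> < \<gamma> + 1. The remaining kernel |x - y|^-m decays fast enough when N - \<theta> < m,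
  which is exactly 2 s - \<gamma> < \<beta>.\<close>

lemma green_profile_singular_integral:
  fixes \<Omega> :: "'a::euclidean_space set"
  assumes \<Omega>: "C2_bounded_domain \<Omega>" and s: "0 < s" "2 * s < real DIM('a)" and \<gamma>: "0 < \<gamma>"
    and \<beta>: "0 < \<beta>" "2 * s - \<gamma> < \<beta>" "\<beta> < \<gamma> + 1"
  shows "\<exists>C>0. \<forall>x\<in>\<Omega>. (\<integral>\<^sup>+y. ennreal (green_profile \<Omega> s \<gamma> x y * bdist \<Omega> y powr - \<beta>) * indicator (- {x}) y \<partial>borel_on \<Omega>)
     \<le> ennreal (C * bdist \<Omega> x powr (2 * s - \<beta>))"
proof -
  let ?N = "real DIM('a)"
  have op: "open \<Omega>" and bd: "bounded \<Omega>" using \<Omega> by (auto simp: C2_bounded_domain_def)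
  define \<gamma>' where "\<gamma>' = min \<gamma> \<beta>"
  define \<theta> where "\<theta> = \<beta> - \<gamma>'"
  define m where "m = ?N - 2 * s + \<gamma> + \<gamma>'"
  have \<theta>: "0 \<le> \<theta>" "\<theta> < 1" and \<gamma>': "0 < \<gamma>'" "\<gamma>' \<le> \<gamma>" using \<gamma> \<beta> by (auto simp: \<theta>_def \<gamma>'_def)
  have m: "?N - \<theta> < m" using \<beta> by (simp add: m_def \<theta>_def)
  obtain C where C: "C > 0" "\<And>x R. R > 0 \<Longrightarrow>
      (\<integral>\<^sup>+y. ennreal (norm (x - y) powr (2 * s - ?N)) * indicator {y. norm (x - y) < R} y \<partial>borel_on \<Omega>) \<le> ennreal (C * R powr (2 * s))"
    using riesz_near[OF op, of "2 * s"] s by auto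
  obtain C' where C': "C' > 0" "\<And>x R. x \<in> \<Omega> \<Longrightarrow> R > 0 \<Longrightarrow>
      (\<integral>\<^sup>+y. ennreal (norm (x - y) powr - m * bdist \<Omega> y powr - \<theta>) * indicator {y. R \<le> norm (x - y)} y \<partial>borel_on \<Omega>)
      \<le> ennreal (C' * R powr (?N - \<theta> - m))"
    using riesz_far_bdist[OF \<Omega> \<theta> m] by blast
  let ?C = "C * (1/2) powr (2 * s - \<beta>) + C' * (1/2) powr (2 * s - \<gamma> - \<beta>)"
  have "(\<integral>\<^sup>+y. ennreal (green_profile \<Omega> s \<gamma> x y * bdist \<Omega> y powr - \<beta>) * indicator (- {x}) y \<partial>borel_on \<Omega>)
     \<le> ennreal (?C * bdist \<Omega> x powr (2 * s - \<beta>))" if x: "x \<in> \<Omega>" for x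
  proof -
    let ?d = "bdist \<Omega> x"
    let ?A = "\<lambda>y. ennreal (norm (x - y) powr (2 * s - ?N)) * indicator {y. norm (x - y) < ?d / 2} y"
    let ?B = "\<lambda>y. ennreal (norm (x - y) powr - m * bdist \<Omega> y powr - \<theta>) * indicator {y. ?d / 2 \<le> norm (x - y)} y"
    have d: "?d > 0" by (rule bdist_pos[OF op bd x])
    have pw: "ennreal (green_profile \<Omega> s \<gamma> x y * bdist \<Omega> y powr - \<beta>) * indicator (- {x}) y
      \<le> ennreal ((?d / 2) powr - \<beta>) * ?A y + ennreal (?d powr \<gamma>) * ?B y" if y: "y \<in> \<Omega>" for y
    proof (cases "x = y")
      case False
      let ?r = "norm (x - y)" and ?e = "bdist \<Omega> y"
      have r: "?r > 0" using False by simp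
      have e: "?e > 0" by (rule bdist_pos[OF op bd y])
      show ?thesis
      proof (cases "?r < ?d / 2")
        case True
        have "?d \<le> ?e + ?r" by (rule bdist_triangle)
        then have "?e powr - \<beta> \<le> (?d / 2) powr - \<beta>" using True d \<beta> by (intro powr_mono2') auto
        then have "green_profile \<Omega> s \<gamma> x y * ?e powr - \<beta> \<le> ?r powr (2 * s - ?N) * (?d / 2) powr - \<beta>"
          using green_profile_le_riesz[OF \<gamma> False, of \<Omega> s] by (intro mult_mono) auto
        then show ?thesis using True False
          by (auto simp: ennreal_mult[symmetric] mult_ac intro!: ennreal_leI)
      next
        case far: False
        have 1: "(min (?d / ?r) 1) powr \<gamma> \<le> (?d / ?r) powr \<gamma>" using \<gamma> d r by (intro powr_mono2) auto
        \<comment> \<open>The base is at most 1, so lowering the exponent from \<gamma> to \<gamma>'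
          enlarges the power.\<close>
        have "(min (?e / ?r) 1) powr \<gamma> \<le> (min (?e / ?r) 1) powr \<gamma>'" using \<gamma>' e r by (intro powr_mono') auto
        also have "\<dots> \<le> (?e / ?r) powr \<gamma>'" using \<gamma>' e r by (intro powr_mono2) auto
        finally have 2: "(min (?e / ?r) 1) powr \<gamma> \<le> (?e / ?r) powr \<gamma>'" .
        have "green_profile \<Omega> s \<gamma> x y * ?e powr - \<beta> \<le> 1 / ?r powr (?N - 2 * s) * (?d / ?r) powr \<gamma> * (?e / ?r) powr \<gamma>' * ?e powr - \<beta>"
          unfolding green_profile_def by (intro mult_mono 1 2) auto
        also have "\<dots> = ?d powr \<gamma> * ((?r powr - (?N - 2 * s) * ?r powr - \<gamma> * ?r powr - \<gamma>') * (?e powr \<gamma>' * ?e powr - \<beta>))"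
        proof -
          have "1 / ?r powr (?N - 2 * s) = ?r powr - (?N - 2 * s)" by (simp only: powr_minus_divide)
          moreover have "(?d / ?r) powr \<gamma> = ?d powr \<gamma> * ?r powr - \<gamma>"
            using d r by (simp add: powr_divide powr_minus_divide)
          moreover have "(?e / ?r) powr \<gamma>' = ?e powr \<gamma>' * ?r powr - \<gamma>'"
            using e r by (simp add: powr_divide powr_minus_divide)
          ultimately show ?thesis by (simp only: mult_ac)
        qed
        also have "\<dots> = ?d powr \<gamma> * (?r powr - m * ?e powr - \<theta>)"
          by (simp add: powr_add[symmetric] m_def \<theta>_def algebra_simps)
        finally show ?thesis using far False
          by (auto simp: ennreal_mult[symmetric] intro!: ennreal_leI)
      qed
    qed simp
    have "(\<integral>\<^sup>+y. ennreal (green_profile \<Omega> s \<gamma> x y * bdist \<Omega> y powr - \<beta>) * indicator (- {x}) y \<partial>borel_on \<Omega>)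
       \<le> (\<integral>\<^sup>+y. ennreal ((?d / 2) powr - \<beta>) * ?A y + ennreal (?d powr \<gamma>) * ?B y \<partial>borel_on \<Omega>)"
      by (intro nn_integral_mono pw) simp
    also have "\<dots> = ennreal ((?d / 2) powr - \<beta>) * (\<integral>\<^sup>+y. ?A y \<partial>borel_on \<Omega>) + ennreal (?d powr \<gamma>) * (\<integral>\<^sup>+y. ?B y \<partial>borel_on \<Omega>)"
      by (subst nn_integral_add) (auto simp: nn_integral_cmult)
    also have "\<dots> \<le> ennreal ((?d / 2) powr - \<beta>) * ennreal (C * (?d / 2) powr (2 * s))
        + ennreal (?d powr \<gamma>) * ennreal (C' * (?d / 2) powr (?N - \<theta> - m))"
      using d by (intro add_mono mult_left_mono C C' x) auto
    also have "\<dots> = ennreal ((?d / 2) powr - \<beta> * (C * (?d / 2) powr (2 * s)) + ?d powr \<gamma> * (C' * (?d / 2) powr (?N - \<theta> - m)))"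
      using C C' by (simp add: ennreal_mult[symmetric] ennreal_plus[symmetric] del: ennreal_plus)
    also have "(?d / 2) powr - \<beta> * (C * (?d / 2) powr (2 * s)) + ?d powr \<gamma> * (C' * (?d / 2) powr (?N - \<theta> - m)) = ?C * ?d powr (2 * s - \<beta>)"
    proof -
      have h: "(?d / 2) powr a = ?d powr a * (1/2) powr a" for a using d powr_mult[of ?d "1/2" a] by simp
      have e: "?N - \<theta> - m = 2 * s - \<gamma> - \<beta>" by (simp add: m_def \<theta>_def)
      have "(?d / 2) powr - \<beta> * (C * (?d / 2) powr (2 * s)) = C * ((?d / 2) powr - \<beta> * (?d / 2) powr (2 * s))"
        by (simp only: mult_ac)
      also have "(?d / 2) powr - \<beta> * (?d / 2) powr (2 * s) = (?d / 2) powr (2 * s - \<beta>)"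
        by (simp add: powr_add[symmetric])
      finally have 1: "(?d / 2) powr - \<beta> * (C * (?d / 2) powr (2 * s)) = C * (?d powr (2 * s - \<beta>) * (1/2) powr (2 * s - \<beta>))"
        by (simp only: h)
      have "?d powr \<gamma> * (C' * (?d powr (2 * s - \<gamma> - \<beta>) * (1/2) powr (2 * s - \<gamma> - \<beta>)))
          = C' * (1/2) powr (2 * s - \<gamma> - \<beta>) * (?d powr \<gamma> * ?d powr (2 * s - \<gamma> - \<beta>))"
        by (simp only: mult_ac)
      also have "?d powr \<gamma> * ?d powr (2 * s - \<gamma> - \<beta>) = ?d powr (2 * s - \<beta>)"
        by (simp add: powr_add[symmetric])
      finally show ?thesis unfolding 1 e h[of "2 * s - \<gamma> - \<beta>"] by (simp only: distrib_right distrib_left mult_ac)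
    qed
    finally show ?thesis .
  qed
  moreover have "?C > 0" using C C' by (intro add_pos_pos mult_pos_pos) auto
  ultimately show ?thesis by blast
qed

section \<open>From the form inequality to the Kato inequality\<close>


lemma self_adjoint_in_L2:
  assumes "self_adjoint M T" "(u, f) \<in> T" shows "u \<in> L2 M" "f \<in> L2 M"
  using assms unfolding self_adjoint_def adjoint_graph_def by blast+

lemma self_adjoint_inner:
  assumes T: "self_adjoint M T" and uf: "(u, f) \<in> T" and vg: "(v, g) \<in> T"
  shows "l2_inner M f v = l2_inner M u g"
proof -
  have "(v, g) \<in> adjoint_graph M T" using T vg by (simp add: self_adjoint_def)
  then show ?thesis using uf unfolding adjoint_graph_def by blast
qed

text \<open>The difference \<open>h\<close> of two images of \<open>v\<close> is orthogonal to the
  domain, which is dense. For \<open>u\<close> in the domain close to \<open>h\<close>, the square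
  integral of \<open>h\<close> equals the integral of h (h - u), and Cauchy-Schwarz makes it
  arbitrarily small.\<close>

lemma self_adjoint_functional:
  assumes T: "self_adjoint M T" and g: "(v, g) \<in> T" and g': "(v, g') \<in> T"
  shows "AE x in M. g x = g' x"
proof -
  define h where "h = (\<lambda>x. g x - g' x)"
  have L: "g \<in> L2 M" "g' \<in> L2 M" using self_adjoint_in_L2[OF T] g g' by auto
  then have h: "h \<in> L2 M" unfolding h_def by (intro L2_diff)
  have orth: "(\<integral>x. u x * h x \<partial>M) = 0" if uD: "u \<in> Domain T" for u
  proof -
    obtain f where f: "(u, f) \<in> T" using uD by blast
    then have u: "u \<in> L2 M" using self_adjoint_in_L2[OF T] by blast
    have "l2_inner M u g = l2_inner M u g'"
      using self_adjoint_inner[OF T f g] self_adjoint_inner[OF T f g'] by simp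
    then show ?thesis
      using L2_mult_integrable[OF u L(1)] L2_mult_integrable[OF u L(2)]
      by (simp add: l2_inner_def h_def right_diff_distrib)
  qed
  let ?H = "\<integral>x. (h x)\<^sup>2 \<partial>M"
  have "?H \<le> e\<^sup>2" if e: "e > 0" for e
  proof -
    obtain u where u: "u \<in> Domain T" "l2_norm M (\<lambda>x. h x - u x) < e"
      using T h e unfolding self_adjoint_def by blast
    have uL: "u \<in> L2 M" using u self_adjoint_in_L2[OF T] by blast
    have nn: "0 \<le> (\<integral>x. (h x - u x)\<^sup>2 \<partial>M)" by (intro integral_nonneg_AE) auto
    have le: "(\<integral>x. (h x - u x)\<^sup>2 \<partial>M) \<le> e\<^sup>2"
      using u(2) nn e real_sqrt_less_iff[of "\<integral>x. (h x - u x)\<^sup>2 \<partial>M" "e\<^sup>2"]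
      by (simp add: l2_norm_def l2_inner_def power2_eq_square[symmetric])
    have eq: "(\<integral>x. h x * (h x - u x) \<partial>M) = ?H"
      using L2_mult_integrable[OF h h] L2_mult_integrable[OF uL h] orth[OF u(1)]
      by (simp add: right_diff_distrib power2_eq_square mult.commute)
    have "?H\<^sup>2 \<le> ?H * (\<integral>x. (h x - u x)\<^sup>2 \<partial>M)"
      using L2_Cauchy_Schwarz[OF h L2_diff[OF h uL]] eq by simp
    then have "?H * ?H \<le> ?H * e\<^sup>2"
      using mult_left_mono[OF le, of ?H] by (simp add: power2_eq_square)
    then show ?thesis
      by (cases "?H = 0") (auto simp: mult_le_cancel_left zero_less_iff_neq_zero less_le)
  qed
  then have "?H \<le> 0 + e" if "e > 0" for e
    using that real_sqrt_gt_zero[OF that] by (metis add_0 real_sqrt_pow2 less_imp_le)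
  then have "?H \<le> 0" by (rule field_le_epsilon)
  moreover have "0 \<le> ?H" by (intro integral_nonneg_AE) auto
  ultimately have "?H = 0" by linarith
  then have "AE x in M. (h x)\<^sup>2 = 0"
    using integral_nonneg_eq_0_iff_AE[OF L2_square_integrable[OF h]] by simp
  then show ?thesis by eventually_elim (simp add: h_def)
qed

lemma op_apply_in: "u \<in> Domain T \<Longrightarrow> (u, op_apply T u) \<in> T"
proof -
  assume "u \<in> Domain T"
  then have "\<exists>f. (u, f) \<in> T" by blast
  from someI_ex[OF this] show "(u, op_apply T u) \<in> T" unfolding op_apply_def .
qed

lemma energy_inner_commute: "energy_inner M T u v = energy_inner M T v u"
  by (simp add: energy_inner_def l2_inner_def mult.commute)

text \<open><T u, T v> = <u, T T v>, which needs \<open>u\<close> to lie in the domain of the square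
  root alone. \<open>op_apply\<close> selects some image of \<open>v\<close>; passing to the image
  \<open>g\<close> that has an image itself is legitimate because images are unique almost
  everywhere.\<close>

lemma energy_inner_eq:
  assumes T: "self_adjoint M T" and u: "u \<in> Domain T" and vh: "(v, h) \<in> T O T"
  shows "energy_inner M T u v = (\<integral>x. u x * h x \<partial>M)"
proof -
  obtain g where g: "(v, g) \<in> T" "(g, h) \<in> T" using vh by blast
  have u': "(u, op_apply T u) \<in> T" by (rule op_apply_in[OF u])
  have v': "(v, op_apply T v) \<in> T" using g by (intro op_apply_in) blast
  have [measurable]: "op_apply T u \<in> borel_measurable M" "op_apply T v \<in> borel_measurable M" "g \<in> borel_measurable M"
    using self_adjoint_in_L2[OF T u'] self_adjoint_in_L2[OF T v'] self_adjoint_in_L2[OF T g(1)] by (auto intro: L2_measurable)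
  have "energy_inner M T u v = (\<integral>x. op_apply T u x * g x \<partial>M)"
    unfolding energy_inner_def l2_inner_def
    using self_adjoint_functional[OF T v' g(1)] by (intro integral_cong_AE) auto
  then show ?thesis using self_adjoint_inner[OF T u' g(2)] by (simp add: l2_inner_def)
qed

text \<open>The inequality that assumption (L4) provides for the smooth approximation \<open>ln (cosh (k t)) / k\<close>
  of the modulus.\<close>

locale smooth_kato_kernel = weighted_kernel "borel_on \<Omega>" K w C
  for \<Omega> :: "'a::euclidean_space set" and K w C +
  assumes open_\<Omega>: "open \<Omega>" and bounded_\<Omega>: "bounded \<Omega>"
    and w_continuous: "continuous_on \<Omega> w"
    and kato_smooth: "\<And>f \<xi> k. f \<in> test_functions \<Omega> \<Longrightarrow> \<xi> \<in> test_functions \<Omega> \<Longrightarrow> (\<And>x. \<xi> x \<ge> 0) \<Longrightarrow> k > 0 \<Longrightarrow>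
      (\<integral>x. ln (cosh (k * opK f x)) / k * \<xi> x \<partial>borel_on \<Omega>)
        \<le> (\<integral>x. f x * tanh (k * opK f x) * opK \<xi> x \<partial>borel_on \<Omega>)"
begin

section \<open>From test functions to L^1 data and from tanh to sgn\<close>

lemma L1w_test: "\<phi> \<in> test_functions \<Omega> \<Longrightarrow> L1w \<phi>"
proof -
  assume \<phi>: "\<phi> \<in> test_functions \<Omega>"
  obtain B where "\<forall>x. \<bar>\<phi> x\<bar> \<le> B" using test_functions_bounded[OF \<phi>] by blast
  then show ?thesis using test_functions_measurable_on[OF \<phi>] by (intro L1w_bounded) auto
qed

lemma test_le_weight: "\<phi> \<in> test_functions \<Omega> \<Longrightarrow> \<exists>B>0. \<forall>x\<in>\<Omega>. \<bar>\<phi> x\<bar> \<le> B * w x"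
  using w_continuous w_pos by (intro test_functions_le_weight) auto

lemma integrable_mult_bounded:
  assumes "L1w f" "g \<in> borel_measurable (borel_on \<Omega>)" "\<And>x. \<bar>g x\<bar> \<le> 1"
    "\<xi> \<in> borel_measurable (borel_on \<Omega>)" "\<And>x. x \<in> \<Omega> \<Longrightarrow> \<bar>\<xi> x\<bar> \<le> B * w x"
  shows "integrable (borel_on \<Omega>) (\<lambda>x. f x * g x * \<xi> x)"
proof -
  have "L1w (\<lambda>x. f x * g x)"
    using assms by (intro L1w_bound[OF assms(1)] AE_I2) (auto simp: abs_mult L1w_def intro: mult_left_le)
  then show ?thesis using assms by (intro integrable_mult_weight) auto
qed

text \<open>L^1(w) is L^1 of the finite measure with density \<open>w\<close>, where test functions
  are dense. Boundedness of \<open>opK\<close> carries the convergence to the images, and a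
  subsequence of these converges almost everywhere.\<close>

lemma L1w_approx:
  assumes f: "L1w f"
  shows "\<exists>\<phi>. (\<forall>n. \<phi> n \<in> test_functions \<Omega>) \<and> (\<lambda>n. \<integral>x. w x * \<bar>\<phi> n x - f x\<bar> \<partial>borel_on \<Omega>) \<longlonglongrightarrow> 0
    \<and> (AE x in borel_on \<Omega>. (\<lambda>n. opK (\<phi> n) x) \<longlonglongrightarrow> opK f x)"
proof -
  let ?\<mu> = "density (borel_on \<Omega>) (\<lambda>x. ennreal (w x))"
  have [measurable]: "f \<in> borel_measurable (borel_on \<Omega>)" using f by (rule L1w_measurable)
  have w_nn: "AE x in borel_on \<Omega>. 0 \<le> w x" using w_pos by (intro AE_I2) (simp add: less_imp_le)
  have fin: "finite_measure ?\<mu>"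
  proof (rule finite_measureI)
    have "emeasure ?\<mu> (space ?\<mu>) = (\<integral>\<^sup>+x. ennreal (w x) \<partial>borel_on \<Omega>)"
      using sets.top[of "borel_on \<Omega>"]
      by (subst emeasure_density) (auto intro!: nn_integral_cong simp: indicator_def)
    also have "\<dots> = ennreal (\<integral>x. w x \<partial>borel_on \<Omega>)"
      using w_integrable w_nn by (rule nn_integral_eq_integral)
    finally show "emeasure ?\<mu> (space ?\<mu>) \<noteq> \<infinity>" by simp
  qed
  have "integrable ?\<mu> f"
    using f w_nn by (subst integrable_density) (auto simp: L1w_def)
  from test_functions_dense_seq[OF fin sets_density open_\<Omega> this]
  obtain \<phi> where \<phi>: "\<And>n. \<phi> n \<in> test_functions \<Omega>" "(\<lambda>n. \<integral>x. \<bar>\<phi> n x - f x\<bar> \<partial>?\<mu>) \<longlonglongrightarrow> 0"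
    by (elim exE conjE) (rule that, simp_all)
  have [measurable]: "\<phi> n \<in> borel_measurable (borel_on \<Omega>)" for n
    using \<phi> by (intro test_functions_measurable_on)
  have eq: "(\<integral>x. \<bar>\<phi> n x - f x\<bar> \<partial>?\<mu>) = (\<integral>x. w x * \<bar>\<phi> n x - f x\<bar> \<partial>borel_on \<Omega>)" for n
    using w_nn by (subst integral_density) auto
  have lim: "(\<lambda>n. \<integral>x. w x * \<bar>\<phi> n x - f x\<bar> \<partial>borel_on \<Omega>) \<longlonglongrightarrow> 0" using \<phi>(2) by (simp add: eq)
  let ?d = "\<lambda>n x. w x * (opK (\<phi> n) x - opK f x)"
  have L: "L1w (opK (\<phi> n))" "L1w (opK f)" for n by (intro L1w_opK L1w_test \<phi> f)+
  have int: "integrable (borel_on \<Omega>) (?d n)" for n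
    using L1w_diff[OF L] by (simp add: L1w_def)
  have norm_d: "(\<integral>x. norm (?d n x) \<partial>borel_on \<Omega>) \<le> C * (\<integral>x. w x * \<bar>\<phi> n x - f x\<bar> \<partial>borel_on \<Omega>)" for n
  proof -
    have "(\<integral>x. norm (?d n x) \<partial>borel_on \<Omega>) = (\<integral>x. w x * \<bar>opK (\<lambda>y. \<phi> n y - f y) x\<bar> \<partial>borel_on \<Omega>)"
      using opK_diff_AE[OF L1w_test[OF \<phi>(1)[of n]] f] w_nn
      by (intro integral_cong_AE) (auto simp: abs_mult)
    also have "\<dots> \<le> C * (\<integral>x. w x * \<bar>\<phi> n x - f x\<bar> \<partial>borel_on \<Omega>)"
      by (intro L1w_opK L1w_diff L1w_test \<phi> f)
    finally show ?thesis .
  qed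
  have "(\<lambda>n. C * (\<integral>x. w x * \<bar>\<phi> n x - f x\<bar> \<partial>borel_on \<Omega>)) \<longlonglongrightarrow> C * 0"
    by (rule tendsto_mult[OF tendsto_const lim])
  then have "(\<lambda>n. \<integral>x. norm (?d n x) \<partial>borel_on \<Omega>) \<longlonglongrightarrow> 0"
    using norm_d by (intro LIMSEQ_zero_squeeze[of "\<lambda>n. \<integral>x. norm (?d n x) \<partial>borel_on \<Omega>" "\<lambda>n. C * (\<integral>x. w x * \<bar>\<phi> n x - f x\<bar> \<partial>borel_on \<Omega>)"]) auto
  then obtain r :: "nat \<Rightarrow> nat" where r: "strict_mono r" "AE x in borel_on \<Omega>. (\<lambda>n. ?d (r n) x) \<longlonglongrightarrow> 0"
    using tendsto_L1_AE_subseq[of "borel_on \<Omega>" ?d] int by auto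
  from r(2) AE_space have "AE x in borel_on \<Omega>. (\<lambda>n. opK (\<phi> (r n)) x) \<longlonglongrightarrow> opK f x"
  proof eventually_elim
    case (elim x)
    then have w: "w x > 0" by (intro w_pos)
    have "(\<lambda>n. ?d (r n) x / w x) \<longlonglongrightarrow> 0 / w x"
      using w by (intro tendsto_divide elim tendsto_const) auto
    then have "(\<lambda>n. opK (\<phi> (r n)) x - opK f x) \<longlonglongrightarrow> 0" using w by simp
    then show ?case by (rule LIM_zero_cancel)
  qed
  moreover have "(\<lambda>n. \<integral>x. w x * \<bar>\<phi> (r n) x - f x\<bar> \<partial>borel_on \<Omega>) \<longlonglongrightarrow> 0"
    using LIMSEQ_subseq_LIMSEQ[OF lim r(1)] by (simp add: o_def)
  ultimately show ?thesis using \<phi>(1) by (intro exI[of _ "\<lambda>n. \<phi> (r n)"]) auto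
qed

text \<open>The left side is continuous in \<open>f\<close> because the smoothed modulus is
  1-Lipschitz and \<open>opK\<close> is bounded. On the right, \<phi>_n - f is paired with a
  function bounded by a multiple of the weight and hence contributes little; what remains has the
  fixed factor \<open>f\<close>, and the bounded factor tanh converges almost everywhere.\<close>

lemma kato_smooth_L1w:
  assumes f: "L1w f" and \<xi>: "\<xi> \<in> test_functions \<Omega>" "\<And>x. \<xi> x \<ge> 0" and k: "k > 0"
  shows "(\<integral>x. ln (cosh (k * opK f x)) / k * \<xi> x \<partial>borel_on \<Omega>)
        \<le> (\<integral>x. f x * tanh (k * opK f x) * opK \<xi> x \<partial>borel_on \<Omega>)"
proof -
  let ?M = "borel_on \<Omega>" and ?p = "\<lambda>t. ln (cosh (k * t)) / k"
  obtain \<phi> where \<phi>: "\<And>n. \<phi> n \<in> test_functions \<Omega>" "(\<lambda>n. \<integral>x. w x * \<bar>\<phi> n x - f x\<bar> \<partial>?M) \<longlonglongrightarrow> 0"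
      "AE x in ?M. (\<lambda>n. opK (\<phi> n) x) \<longlonglongrightarrow> opK f x"
    using L1w_approx[OF f] by blast
  obtain B where B: "B > 0" "\<And>x. x \<in> \<Omega> \<Longrightarrow> \<bar>\<xi> x\<bar> \<le> B * w x" using test_le_weight[OF \<xi>(1)] by blast
  have [measurable]: "f \<in> borel_measurable ?M" "\<xi> \<in> borel_measurable ?M" "\<phi> n \<in> borel_measurable ?M" for n
    using f \<xi> \<phi> by (auto intro: L1w_measurable test_functions_measurable_on)
  have p_meas: "(\<lambda>x. ?p (g x)) \<in> borel_measurable ?M" if "g \<in> borel_measurable ?M" for g
    using measurable_compose[OF that ln_cosh_measurable[OF k]] by simp
  have opK\<xi>: "\<bar>opK \<xi> x\<bar> \<le> B * C * w x" if "x \<in> \<Omega>" for x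
    using B that by (intro opK_weight_bound) auto
  have L: "L1w (\<phi> n)" "L1w (opK (\<phi> n))" "L1w (opK f)" for n by (intro L1w_opK L1w_test \<phi> f)+
  have p_le: "\<bar>?p t\<bar> \<le> \<bar>t\<bar>" for t using ln_cosh_lipschitz[OF k, of t 0] by simp
  have p_L1w: "L1w (\<lambda>x. ?p (g x))" if "L1w g" for g
  proof (rule L1w_bound[OF that])
    show "(\<lambda>x. ?p (g x)) \<in> borel_measurable ?M" by (rule p_meas[OF L1w_measurable[OF that]])
    show "AE x in ?M. \<bar>?p (g x)\<bar> \<le> \<bar>g x\<bar>" by (intro AE_I2 p_le)
  qed
  have lhs: "(\<lambda>n. \<integral>x. ?p (opK (\<phi> n) x) * \<xi> x \<partial>?M) \<longlonglongrightarrow> (\<integral>x. ?p (opK f x) * \<xi> x \<partial>?M)"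
  proof (rule LIM_zero_cancel, rule tendsto_rabs_zero_cancel, rule LIMSEQ_zero_squeeze)
    fix n
    have D: "L1w (\<lambda>x. opK (\<phi> n) x - opK f x)" by (rule L1w_diff[OF L(2,3)])
    have "(\<integral>x. ?p (opK (\<phi> n) x) * \<xi> x \<partial>?M) - (\<integral>x. ?p (opK f x) * \<xi> x \<partial>?M)
       = (\<integral>x. (?p (opK (\<phi> n) x) - ?p (opK f x)) * \<xi> x \<partial>?M)"
      unfolding left_diff_distrib using B
      by (intro Bochner_Integration.integral_diff[symmetric] integrable_mult_weight[where B=B] p_L1w L) auto
    also have "\<bar>\<dots>\<bar> \<le> (\<integral>x. B * (w x * \<bar>opK (\<phi> n) x - opK f x\<bar>) \<partial>?M)"
    proof (rule integral_abs_bound[THEN order_trans], rule integral_mono)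
      show "integrable ?M (\<lambda>x. \<bar>(?p (opK (\<phi> n) x) - ?p (opK f x)) * \<xi> x\<bar>)"
        using B by (intro integrable_abs integrable_mult_weight[where B=B] L1w_diff p_L1w L) auto
      show "integrable ?M (\<lambda>x. B * (w x * \<bar>opK (\<phi> n) x - opK f x\<bar>))"
        using nn_integral_L1w(2)[OF D] by simp
      fix x assume "x \<in> space ?M"
      then have "\<bar>?p (opK (\<phi> n) x) - ?p (opK f x)\<bar> * \<bar>\<xi> x\<bar> \<le> \<bar>opK (\<phi> n) x - opK f x\<bar> * (B * w x)"
        using B by (intro mult_mono ln_cosh_lipschitz k) auto
      then show "\<bar>(?p (opK (\<phi> n) x) - ?p (opK f x)) * \<xi> x\<bar> \<le> B * (w x * \<bar>opK (\<phi> n) x - opK f x\<bar>)"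
        by (simp only: abs_mult mult_ac)
    qed
    also have "\<dots> = B * (\<integral>x. w x * \<bar>opK (\<lambda>y. \<phi> n y - f y) x\<bar> \<partial>?M)"
    proof -
      have "AE x in ?M. B * (w x * \<bar>opK (\<phi> n) x - opK f x\<bar>) = B * (w x * \<bar>opK (\<lambda>y. \<phi> n y - f y) x\<bar>)"
        using opK_diff_AE[OF L(1) f, of n] by eventually_elim simp
      then have "(\<integral>x. B * (w x * \<bar>opK (\<phi> n) x - opK f x\<bar>) \<partial>?M) = (\<integral>x. B * (w x * \<bar>opK (\<lambda>y. \<phi> n y - f y) x\<bar>) \<partial>?M)"
        by (intro integral_cong_AE) measurable
      then show ?thesis by simp
    qed
    also have "\<dots> \<le> B * (C * (\<integral>x. w x * \<bar>\<phi> n x - f x\<bar> \<partial>?M))"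
      using B by (intro mult_left_mono L1w_opK L1w_diff L f) auto
    finally show "\<bar>(\<integral>x. ?p (opK (\<phi> n) x) * \<xi> x \<partial>?M) - (\<integral>x. ?p (opK f x) * \<xi> x \<partial>?M)\<bar>
        \<le> B * (C * (\<integral>x. w x * \<bar>\<phi> n x - f x\<bar> \<partial>?M))" .
  next
    have "(\<lambda>n. B * (C * (\<integral>x. w x * \<bar>\<phi> n x - f x\<bar> \<partial>?M))) \<longlonglongrightarrow> B * (C * 0)"
      by (rule tendsto_mult[OF tendsto_const tendsto_mult[OF tendsto_const \<phi>(2)]])
    then show "(\<lambda>n. B * (C * (\<integral>x. w x * \<bar>\<phi> n x - f x\<bar> \<partial>?M))) \<longlonglongrightarrow> 0" by simp
  qed simp
  have tanh_meas: "(\<lambda>x. tanh (k * g x)) \<in> borel_measurable ?M" if [measurable]: "g \<in> borel_measurable ?M" for g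
    by measurable
  have rhs1: "(\<lambda>n. \<integral>x. (\<phi> n x - f x) * tanh (k * opK (\<phi> n) x) * opK \<xi> x \<partial>?M) \<longlonglongrightarrow> 0"
  proof (rule tendsto_rabs_zero_cancel, rule LIMSEQ_zero_squeeze)
    fix n
    have D: "L1w (\<lambda>x. \<phi> n x - f x)" by (rule L1w_diff[OF L(1) f])
    have "\<bar>\<integral>x. (\<phi> n x - f x) * tanh (k * opK (\<phi> n) x) * opK \<xi> x \<partial>?M\<bar>
      \<le> (\<integral>x. B * C * (w x * \<bar>\<phi> n x - f x\<bar>) \<partial>?M)"
    proof (rule integral_abs_bound[THEN order_trans], rule integral_mono)
      show "integrable ?M (\<lambda>x. \<bar>(\<phi> n x - f x) * tanh (k * opK (\<phi> n) x) * opK \<xi> x\<bar>)"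
        using opK\<xi> abs_tanh_le_1 by (intro integrable_abs integrable_mult_bounded[OF D, where B="B * C"]) auto
      show "integrable ?M (\<lambda>x. B * C * (w x * \<bar>\<phi> n x - f x\<bar>))"
        using nn_integral_L1w(2)[OF D] by simp
      fix x assume "x \<in> space ?M"
      then have "\<bar>\<phi> n x - f x\<bar> * \<bar>tanh (k * opK (\<phi> n) x)\<bar> * \<bar>opK \<xi> x\<bar> \<le> \<bar>\<phi> n x - f x\<bar> * 1 * (B * C * w x)"
        using opK\<xi> abs_tanh_le_1 by (intro mult_mono) auto
      then show "\<bar>(\<phi> n x - f x) * tanh (k * opK (\<phi> n) x) * opK \<xi> x\<bar> \<le> B * C * (w x * \<bar>\<phi> n x - f x\<bar>)"
        by (simp add: abs_mult mult_ac)
    qed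
    then show "\<bar>\<integral>x. (\<phi> n x - f x) * tanh (k * opK (\<phi> n) x) * opK \<xi> x \<partial>?M\<bar>
      \<le> B * C * (\<integral>x. w x * \<bar>\<phi> n x - f x\<bar> \<partial>?M)" by simp
  next
    have "(\<lambda>n. B * C * (\<integral>x. w x * \<bar>\<phi> n x - f x\<bar> \<partial>?M)) \<longlonglongrightarrow> B * C * 0"
      by (rule tendsto_mult[OF tendsto_const \<phi>(2)])
    then show "(\<lambda>n. B * C * (\<integral>x. w x * \<bar>\<phi> n x - f x\<bar> \<partial>?M)) \<longlonglongrightarrow> 0" by simp
  qed simp
  have rhs2: "(\<lambda>n. \<integral>x. f x * tanh (k * opK (\<phi> n) x) * opK \<xi> x \<partial>?M) \<longlonglongrightarrow> (\<integral>x. f x * tanh (k * opK f x) * opK \<xi> x \<partial>?M)"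
  proof (rule integral_dominated_convergence)
    show "integrable ?M (\<lambda>x. \<bar>f x * opK \<xi> x\<bar>)"
      using opK\<xi> by (intro integrable_abs integrable_mult_weight[OF f, where B="B * C"]) auto
    show "AE x in ?M. (\<lambda>n. f x * tanh (k * opK (\<phi> n) x) * opK \<xi> x) \<longlonglongrightarrow> f x * tanh (k * opK f x) * opK \<xi> x"
      using \<phi>(3)
    proof eventually_elim
      case (elim x)
      have "(\<lambda>n. tanh (k * opK (\<phi> n) x)) \<longlonglongrightarrow> tanh (k * opK f x)"
        by (rule tendsto_tanh[OF tendsto_mult[OF tendsto_const elim]]) simp
      then show ?case by (intro tendsto_mult tendsto_const)
    qed
    show "AE x in ?M. norm (f x * tanh (k * opK (\<phi> n) x) * opK \<xi> x) \<le> \<bar>f x * opK \<xi> x\<bar>" for n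
    proof (intro AE_I2)
      fix x
      have "\<bar>f x\<bar> * \<bar>opK \<xi> x\<bar> * \<bar>tanh (k * opK (\<phi> n) x)\<bar> \<le> \<bar>f x\<bar> * \<bar>opK \<xi> x\<bar>"
        using abs_tanh_le_1 by (intro mult_left_le) auto
      then show "norm (f x * tanh (k * opK (\<phi> n) x) * opK \<xi> x) \<le> \<bar>f x * opK \<xi> x\<bar>"
        by (simp add: abs_mult mult_ac)
    qed
  qed measurable
  have eq: "(\<integral>x. \<phi> n x * tanh (k * opK (\<phi> n) x) * opK \<xi> x \<partial>?M) =
     (\<integral>x. (\<phi> n x - f x) * tanh (k * opK (\<phi> n) x) * opK \<xi> x \<partial>?M) + (\<integral>x. f x * tanh (k * opK (\<phi> n) x) * opK \<xi> x \<partial>?M)" for n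
  proof -
    have int: "integrable ?M (\<lambda>x. g x * tanh (k * opK (\<phi> n) x) * opK \<xi> x)" if "L1w g" for g
      using opK\<xi> abs_tanh_le_1 by (intro integrable_mult_bounded[OF that, where B="B * C"]) auto
    show ?thesis
      unfolding Bochner_Integration.integral_add[OF int[OF L1w_diff[OF L(1) f]] int[OF f], symmetric]
      by (intro Bochner_Integration.integral_cong refl) (simp add: algebra_simps)
  qed
  have "(\<lambda>n. \<integral>x. \<phi> n x * tanh (k * opK (\<phi> n) x) * opK \<xi> x \<partial>?M) \<longlonglongrightarrow> (\<integral>x. f x * tanh (k * opK f x) * opK \<xi> x \<partial>?M)"
    unfolding eq using tendsto_add[OF rhs1 rhs2] by simp
  from lhs this show ?thesis
    using kato_smooth[OF \<phi>(1) \<xi> k] by (intro LIMSEQ_le) auto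
qed

text \<open>Since cosh is at least half of exp |.|, the smoothed modulus lies between |t| - ln 2 / k
  and |t|.\<close>

lemma ln_cosh_tendsto_abs: "(\<lambda>n. ln (cosh (real (Suc n) * t)) / real (Suc n)) \<longlonglongrightarrow> \<bar>t\<bar>"
proof (rule tendsto_sandwich[of "\<lambda>n. \<bar>t\<bar> - ln 2 * inverse (real (Suc n))" _ _ "\<lambda>_. \<bar>t\<bar>"])
  have "\<bar>t\<bar> - ln 2 * inverse (real (Suc n)) \<le> ln (cosh (real (Suc n) * t)) / real (Suc n)" for n
  proof -
    let ?k = "real (Suc n)"
    have ln_half: "ln (exp a / 2) = a - ln 2" for a :: real by (simp add: ln_div)
    have "exp \<bar>?k * t\<bar> / 2 \<le> cosh \<bar>?k * t\<bar>" by (simp only: cosh_def) simp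
    then have "exp \<bar>?k * t\<bar> / 2 \<le> cosh (?k * t)" by (simp only: cosh_real_abs)
    then have "ln (exp \<bar>?k * t\<bar> / 2) \<le> ln (cosh (?k * t))" by (subst ln_le_cancel_iff) auto
    then have "\<bar>?k * t\<bar> - ln 2 \<le> ln (cosh (?k * t))" by (simp only: ln_half)
    then have "?k * \<bar>t\<bar> - ln 2 \<le> ln (cosh (?k * t))" by (simp only: abs_mult abs_of_nat)
    then have "(?k * \<bar>t\<bar> - ln 2) / ?k \<le> ln (cosh (?k * t)) / ?k" by (intro divide_right_mono) auto
    moreover have "(?k * \<bar>t\<bar> - ln 2) / ?k = \<bar>t\<bar> - ln 2 * inverse ?k" by (simp add: field_simps)
    ultimately show ?thesis by (simp only:)
  qed
  then show "\<forall>\<^sub>F n in sequentially. \<bar>t\<bar> - ln 2 * inverse (real (Suc n)) \<le> ln (cosh (real (Suc n) * t)) / real (Suc n)" by simp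
  have "ln (cosh (real (Suc n) * t)) / real (Suc n) \<le> \<bar>t\<bar>" for n
  proof -
    have "\<bar>ln (cosh (real (Suc n) * t)) / real (Suc n)\<bar> \<le> \<bar>t\<bar>"
      using ln_cosh_lipschitz[of "real (Suc n)" t 0] by (simp del: of_nat_Suc)
    then show ?thesis by (rule order_trans[OF abs_ge_self])
  qed
  then show "\<forall>\<^sub>F n in sequentially. ln (cosh (real (Suc n) * t)) / real (Suc n) \<le> \<bar>t\<bar>" by simp
  have "(\<lambda>n. \<bar>t\<bar> - ln 2 * inverse (real (Suc n))) \<longlonglongrightarrow> \<bar>t\<bar> - ln 2 * 0"
    by (intro tendsto_diff tendsto_mult tendsto_const LIMSEQ_inverse_real_of_nat)
  then show "(\<lambda>n. \<bar>t\<bar> - ln 2 * inverse (real (Suc n))) \<longlonglongrightarrow> \<bar>t\<bar>" by simp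
qed simp

lemma tanh_tendsto_sgn: "(\<lambda>n. tanh (real (Suc n) * t)) \<longlonglongrightarrow> sgn t"
proof (cases t "0::real" rule: linorder_cases)
  case less
  have "filterlim (\<lambda>n. t * real (Suc n)) at_bot sequentially"
    by (rule filterlim_tendsto_neg_mult_at_bot[OF tendsto_const less
        filterlim_compose[OF filterlim_real_sequentially filterlim_Suc]])
  then have "filterlim (\<lambda>n. real (Suc n) * t) at_bot sequentially" by (simp only: mult.commute)
  from filterlim_compose[OF tanh_real_at_bot this] show ?thesis using less by simp
next
  case greater
  have "filterlim (\<lambda>n. real (Suc n) * t) at_top sequentially"
    by (rule filterlim_at_top_mult_tendsto_pos[OF tendsto_const greater
        filterlim_compose[OF filterlim_real_sequentially filterlim_Suc]])
  from filterlim_compose[OF tanh_real_at_top this] show ?thesis using greater by simp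
qed simp

text \<open>Both limits as k grows are dominated by integrands free of k: the smoothed modulus lies
  below |t| and |tanh| below 1. The value of sgn at 0 agrees with the limit of tanh (k 0).\<close>

lemma kato_integral:
  assumes f: "L1w f" and \<xi>: "\<xi> \<in> test_functions \<Omega>" "\<And>x. \<xi> x \<ge> 0"
  shows "(\<integral>x. \<bar>opK f x\<bar> * \<xi> x \<partial>borel_on \<Omega>) \<le> (\<integral>x. f x * sgn (opK f x) * opK \<xi> x \<partial>borel_on \<Omega>)"
proof -
  let ?M = "borel_on \<Omega>" and ?k = "\<lambda>n. real (Suc n)"
  obtain B where B: "B > 0" "\<And>x. x \<in> \<Omega> \<Longrightarrow> \<bar>\<xi> x\<bar> \<le> B * w x" using test_le_weight[OF \<xi>(1)] by blast
  have [measurable]: "f \<in> borel_measurable ?M" "\<xi> \<in> borel_measurable ?M"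
    using f \<xi> by (auto intro: L1w_measurable test_functions_measurable_on)
  have opK\<xi>: "\<bar>opK \<xi> x\<bar> \<le> B * C * w x" if "x \<in> \<Omega>" for x
    using B that by (intro opK_weight_bound) auto
  have lhs: "(\<lambda>n. \<integral>x. ln (cosh (?k n * opK f x)) / ?k n * \<xi> x \<partial>?M) \<longlonglongrightarrow> (\<integral>x. \<bar>opK f x\<bar> * \<xi> x \<partial>?M)"
  proof (rule integral_dominated_convergence)
    show "integrable ?M (\<lambda>x. \<bar>opK f x * \<xi> x\<bar>)"
      using B by (intro integrable_abs integrable_mult_weight[OF L1w_opK(1)[OF f], where B=B]) auto
    show "AE x in ?M. (\<lambda>n. ln (cosh (?k n * opK f x)) / ?k n * \<xi> x) \<longlonglongrightarrow> \<bar>opK f x\<bar> * \<xi> x"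
      by (intro AE_I2 tendsto_mult tendsto_const ln_cosh_tendsto_abs)
    show "AE x in ?M. norm (ln (cosh (?k n * opK f x)) / ?k n * \<xi> x) \<le> \<bar>opK f x * \<xi> x\<bar>" for n
    proof (intro AE_I2)
      fix x
      have "\<bar>ln (cosh (?k n * opK f x)) / ?k n\<bar> * \<bar>\<xi> x\<bar> \<le> \<bar>opK f x\<bar> * \<bar>\<xi> x\<bar>"
        using ln_cosh_lipschitz[of "?k n" "opK f x" 0] by (intro mult_right_mono) auto
      then show "norm (ln (cosh (?k n * opK f x)) / ?k n * \<xi> x) \<le> \<bar>opK f x * \<xi> x\<bar>"
        by (simp only: abs_mult real_norm_def)
    qed
    show "(\<lambda>x. ln (cosh (?k n * opK f x)) / ?k n * \<xi> x) \<in> borel_measurable ?M" for n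
      using measurable_compose[OF opK_measurable[of f] ln_cosh_measurable[of "?k n"]] by measurable
  qed measurable
  have rhs: "(\<lambda>n. \<integral>x. f x * tanh (?k n * opK f x) * opK \<xi> x \<partial>?M) \<longlonglongrightarrow> (\<integral>x. f x * sgn (opK f x) * opK \<xi> x \<partial>?M)"
  proof (rule integral_dominated_convergence)
    show "integrable ?M (\<lambda>x. \<bar>f x * opK \<xi> x\<bar>)"
      using opK\<xi> by (intro integrable_abs integrable_mult_weight[OF f, where B="B * C"]) auto
    show "AE x in ?M. (\<lambda>n. f x * tanh (?k n * opK f x) * opK \<xi> x) \<longlonglongrightarrow> f x * sgn (opK f x) * opK \<xi> x"
      by (intro AE_I2 tendsto_mult tendsto_const tanh_tendsto_sgn)
    show "AE x in ?M. norm (f x * tanh (?k n * opK f x) * opK \<xi> x) \<le> \<bar>f x * opK \<xi> x\<bar>" for n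
    proof (intro AE_I2)
      fix x
      have "\<bar>f x\<bar> * \<bar>opK \<xi> x\<bar> * \<bar>tanh (?k n * opK f x)\<bar> \<le> \<bar>f x\<bar> * \<bar>opK \<xi> x\<bar>"
        by (intro mult_left_le abs_tanh_le_1) auto
      then show "norm (f x * tanh (?k n * opK f x) * opK \<xi> x) \<le> \<bar>f x * opK \<xi> x\<bar>"
        by (simp only: abs_mult real_norm_def mult_ac)
    qed
  qed measurable
  show ?thesis
    by (rule LIMSEQ_le[OF lhs rhs]) (use kato_smooth_L1w[OF f \<xi>] in auto)
qed

text \<open>Duality moves \<open>opK\<close> from \<open>\<xi>\<close> back to f sgn (K f). The
  integrated inequality is then one between two functions tested against all nonnegative test
  functions, hence holds almost everywhere.\<close>

sublocale kato_kernel "borel_on \<Omega>" K w C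
proof
  fix f assume f: "L1w f"
  let ?g = "\<lambda>y. f y * sgn (opK f y)"
  have [measurable]: "f \<in> borel_measurable (borel_on \<Omega>)" using f by (rule L1w_measurable)
  have g: "L1w ?g" by (rule L1w_bound[OF f]) (auto simp: abs_mult sgn_real_def)
  have L: "L1w (\<lambda>x. \<bar>opK f x\<bar>)" by (rule L1w_bound[OF L1w_opK(1)[OF f]]) auto
  have "AE x in borel_on \<Omega>. 0 \<le> opK ?g x - \<bar>opK f x\<bar>"
  proof (rule AE_nonneg_test_functions[OF open_\<Omega> bounded_\<Omega>])
    show "(\<lambda>x. opK ?g x - \<bar>opK f x\<bar>) \<in> borel_measurable (borel_on \<Omega>)" by measurable
    fix \<xi> assume \<xi>: "\<xi> \<in> test_functions \<Omega>"
    obtain B where B: "B > 0" "\<And>x. x \<in> \<Omega> \<Longrightarrow> \<bar>\<xi> x\<bar> \<le> B * w x" using test_le_weight[OF \<xi>] by blast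
    have [measurable]: "\<xi> \<in> borel_measurable (borel_on \<Omega>)" using \<xi> by (rule test_functions_measurable_on)
    have int: "integrable (borel_on \<Omega>) (\<lambda>x. opK ?g x * \<xi> x)" "integrable (borel_on \<Omega>) (\<lambda>x. \<bar>opK f x\<bar> * \<xi> x)"
      using B by (auto intro!: integrable_mult_weight[where B=B] L1w_opK g L)
    then show "integrable (borel_on \<Omega>) (\<lambda>x. (opK ?g x - \<bar>opK f x\<bar>) * \<xi> x)" by (simp add: left_diff_distrib)
    assume nn: "\<And>x. 0 \<le> \<xi> x"
    have "(\<integral>x. opK ?g x * \<xi> x \<partial>borel_on \<Omega>) = (\<integral>x. ?g x * opK \<xi> x \<partial>borel_on \<Omega>)"
      using B by (intro opK_dual[OF g, where B=B]) auto
    then show "0 \<le> (\<integral>x. (opK ?g x - \<bar>opK f x\<bar>) * \<xi> x \<partial>borel_on \<Omega>)"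
      using kato_integral[OF f \<xi> nn] int by (simp add: left_diff_distrib)
  qed
  then show "AE x in borel_on \<Omega>. \<bar>opK f x\<bar> \<le> opK ?g x" by eventually_elim simp
qed

end

section \<open>The singular problem\<close>


text \<open>\<open>G\<close> is meaningful only off the diagonal of the product of the domain with
  itself. Extension by 0 makes nonnegativity and symmetry hold for all pairs, as
  \<open>weighted_kernel\<close> demands.\<close>

definition offdiag_kernel :: "'a set \<Rightarrow> ('a \<Rightarrow> 'a \<Rightarrow> real) \<Rightarrow> 'a \<Rightarrow> 'a \<Rightarrow> real" where
  "offdiag_kernel \<Omega> G x y = (if x \<in> \<Omega> \<and> y \<in> \<Omega> \<and> x \<noteq> y then G x y else 0)"

lemma offdiag_kernel_measurable:
  fixes \<Omega> :: "'a::euclidean_space set"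
  assumes op: "open \<Omega>"
    and G: "(\<lambda>(x, y). G x y) \<in> borel_measurable (restrict_space borel {(x, y). x \<in> \<Omega> \<and> y \<in> \<Omega> \<and> x \<noteq> y})"
  shows "(\<lambda>(x, y). offdiag_kernel \<Omega> G x y) \<in> borel_measurable (borel_on \<Omega> \<Otimes>\<^sub>M borel_on \<Omega>)"
proof -
  let ?D = "{(x, y). x \<in> \<Omega> \<and> y \<in> \<Omega> \<and> x \<noteq> y}"
  have "?D = \<Omega> \<times> \<Omega> \<inter> {z. fst z \<noteq> snd z}" by auto
  also have "open \<dots>"
    by (intro open_Int open_Times op open_Collect_neq continuous_intros)
  finally have D: "?D \<in> sets borel" by simp
  have "(\<lambda>z. indicator ?D z *\<^sub>R (case z of (x, y) \<Rightarrow> G x y)) \<in> borel_measurable borel"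
    using G D by (subst (asm) borel_measurable_restrict_space_iff) auto
  then have 1: "(\<lambda>z. indicator ?D z *\<^sub>R (case z of (x, y) \<Rightarrow> G x y)) \<in> borel_measurable (borel \<Otimes>\<^sub>M borel)"
    by (simp add: borel_prod)
  have id: "(\<lambda>x. x) \<in> measurable (borel_on \<Omega>) borel" by (intro measurable_restrict_space1) simp
  have "(\<lambda>z. (fst z, snd z)) \<in> measurable (borel_on \<Omega> \<Otimes>\<^sub>M borel_on \<Omega>) (borel \<Otimes>\<^sub>M borel)"
    by (intro measurable_Pair measurable_compose[OF measurable_fst id] measurable_compose[OF measurable_snd id])
  from measurable_compose[OF this 1] show ?thesis
    by (rule measurable_cong[THEN iffD1, rotated]) (auto simp: offdiag_kernel_def indicator_def space_pair_measure split: if_splits)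
qed

lemma AE_borel_on_neq: "open \<Omega> \<Longrightarrow> AE y in borel_on \<Omega>. y \<noteq> (x :: 'a::euclidean_space)"
  using AE_lborel_singleton[of x] by (subst AE_restrict_space_iff) auto

text \<open>The integrands differ within the domain at the single point y = x. Although
  \<open>G x x\<close> is arbitrary, \<open>G x\<close> is measurable, being glued from a measurable
  function and a value at one point.\<close>

lemma green_op_eq_offdiag:
  fixes \<Omega> :: "'a::euclidean_space set"
  assumes op: "open \<Omega>" and x: "x \<in> \<Omega>"
    and K: "(\<lambda>(x, y). offdiag_kernel \<Omega> G x y) \<in> borel_measurable (borel_on \<Omega> \<Otimes>\<^sub>M borel_on \<Omega>)"
    and f [measurable]: "f \<in> borel_measurable (borel_on \<Omega>)"
  shows "green_op \<Omega> G f x = (\<integral>y. offdiag_kernel \<Omega> G x y * f y \<partial>borel_on \<Omega>)"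
proof -
  have K1 [measurable]: "offdiag_kernel \<Omega> G x \<in> borel_measurable (borel_on \<Omega>)"
    using measurable_compose[OF measurable_Pair1' K, of x] x by simp
  have sx: "{x} \<in> sets (borel_on \<Omega>)"
    using x op by (simp add: sets_restrict_space_iff)
  have "(\<lambda>y. if y \<in> {x} then G x x else offdiag_kernel \<Omega> G x y) \<in> borel_measurable (borel_on \<Omega>)"
    by (intro measurable_If_set) (simp_all add: sx x K1)
  then have [measurable]: "G x \<in> borel_measurable (borel_on \<Omega>)"
    by (rule measurable_cong[THEN iffD1, rotated]) (use x in \<open>auto simp: offdiag_kernel_def\<close>)
  show ?thesis
    unfolding green_op_def
  proof (rule integral_cong_AE)
    show "AE y in borel_on \<Omega>. G x y * f y = offdiag_kernel \<Omega> G x y * f y"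
      using AE_borel_on_neq[OF op, of x] AE_space
      by eventually_elim (use x in \<open>auto simp: offdiag_kernel_def\<close>)
  qed measurable
qed

text \<open>The number 2 s q / (q + 1) is the exponent \<open>\<beta>\<close> of
  \<open>green_profile_singular_integral\<close>, whose three conditions are checked. The second is
  equivalent to q > q_star; the third comes from q < q_star_star, or directly from \<gamma> >= 2 s -
  1 when that bound is infinite.\<close>

lemma admissible_supercritical:
  assumes "admissible_exponents s q \<gamma>" "q > q_star s \<gamma>" "0 < \<gamma>"
  shows "0 < 2 * s * q / (q + 1)" "2 * s - \<gamma> < 2 * s * q / (q + 1)" "2 * s * q / (q + 1) < \<gamma> + 1"
proof -
  have q: "q > 0" and s: "\<gamma> < 2 * s" and qs: "ereal q < q_star_star s \<gamma>"
    using assms by (auto simp: admissible_exponents_def)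
  show "0 < 2 * s * q / (q + 1)" using q s assms(3) by simp
  have "2 * s < \<gamma> * (q + 1)" using assms by (simp add: q_star_def field_simps)
  then show "2 * s - \<gamma> < 2 * s * q / (q + 1)" using q by (simp add: field_simps)
  show "2 * s * q / (q + 1) < \<gamma> + 1"
  proof (cases "\<gamma> \<ge> 2 * s - 1")
    case True
    have "2 * s * q < 2 * s * (q + 1)" using s assms(3) by simp
    also have "\<dots> \<le> (\<gamma> + 1) * (q + 1)" using True q by (intro mult_right_mono) auto
    finally show ?thesis using q by (simp add: field_simps)
  next
    case False
    then have "q < (\<gamma> + 1) / (2 * s - \<gamma> - 1)" using qs by (simp add: q_star_star_def)
    then show ?thesis using False q by (simp add: field_simps)
  qed
qed

text \<open>Below q_star one has \<gamma> q < 2 s - \<gamma>, and with \<gamma> >= s - 1/2 this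
  gives \<gamma> - \<gamma> q > 2 \<gamma> - 2 s >= -1. At q = q_star the first relation is an
  equality, and the strictness comes from \<gamma> > s - 1/2.\<close>

lemma admissible_subcritical:
  assumes "admissible_exponents s q \<gamma>" "q \<le> q_star s \<gamma>" "0 < \<gamma>"
  shows "\<gamma> - \<gamma> * q > - 1"
proof (cases "q < q_star s \<gamma>")
  case True
  then have "\<gamma> * q < 2 * s - \<gamma>" using assms by (simp add: q_star_def field_simps)
  moreover have "\<gamma> \<ge> s - 1 / 2" using assms True by (auto simp: admissible_exponents_def)
  ultimately show ?thesis by linarith
next
  case False
  then have "\<gamma> * q = 2 * s - \<gamma>" using assms by (simp add: q_star_def field_simps)
  moreover have "\<gamma> > s - 1 / 2" using assms False by (auto simp: admissible_exponents_def)
  ultimately show ?thesis by linarith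
qed

section \<open>Majorants for the regularised problems with a Green kernel\<close>

locale green_kernel = smooth_kato_kernel \<Omega> K "\<lambda>x. bdist \<Omega> x powr \<gamma>" C
  for \<Omega> :: "'a::euclidean_space set" and K \<gamma> C +
  fixes s C0 :: real
  assumes domain: "C2_bounded_domain \<Omega>" and s_pos: "0 < s" and dim: "2 * s < real DIM('a)"
    and \<gamma>_pos: "0 < \<gamma>" and C0: "C0 > 0"
    and K_bounds: "\<And>x y. x \<in> \<Omega> \<Longrightarrow> y \<in> \<Omega> \<Longrightarrow> x \<noteq> y \<Longrightarrow>
       inverse C0 * green_profile \<Omega> s \<gamma> x y \<le> K x y \<and> K x y \<le> C0 * green_profile \<Omega> s \<gamma> x y"
    and K_diag: "\<And>x. K x x = 0"
begin

abbreviation "\<delta> \<equiv> bdist \<Omega>"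

lemma \<delta>_pos: "x \<in> \<Omega> \<Longrightarrow> \<delta> x > 0"
  by (rule bdist_pos[OF open_\<Omega> bounded_\<Omega>])

lemma L1w_bdist_powr: "\<gamma> + \<alpha> > - 1 \<Longrightarrow> L1w (\<lambda>x. \<delta> x powr \<alpha>)"
  unfolding L1w_def using bdist_powr_integrable[OF domain, of "\<gamma> + \<alpha>"] by (simp add: powr_add)

lemma K_lower: "\<exists>c>0. \<forall>x\<in>\<Omega>. AE y in borel_on \<Omega>. c * \<delta> x powr \<gamma> * \<delta> y powr \<gamma> \<le> K x y"
proof -
  obtain c where c: "c > 0" "\<And>x y. x \<in> \<Omega> \<Longrightarrow> y \<in> \<Omega> \<Longrightarrow> x \<noteq> y \<Longrightarrow> c * \<delta> x powr \<gamma> * \<delta> y powr \<gamma> \<le> green_profile \<Omega> s \<gamma> x y"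
    using green_profile_ge_global[OF bounded_\<Omega> \<gamma>_pos dim] by blast
  have "AE y in borel_on \<Omega>. (inverse C0 * c) * \<delta> x powr \<gamma> * \<delta> y powr \<gamma> \<le> K x y" if x: "x \<in> \<Omega>" for x
    using AE_borel_on_neq[OF open_\<Omega>, of x] AE_space
  proof eventually_elim
    case (elim y)
    then have y: "y \<in> \<Omega>" "x \<noteq> y" by auto
    have "inverse C0 * (c * \<delta> x powr \<gamma> * \<delta> y powr \<gamma>) \<le> inverse C0 * green_profile \<Omega> s \<gamma> x y"
      using C0 by (intro mult_left_mono c x y) auto
    then show ?case using K_bounds[OF x y] by (simp add: mult.assoc)
  qed
  then show ?thesis using c C0 by (intro exI[of _ "inverse C0 * c"]) auto
qed

lemma emeasure_\<Omega>: "emeasure (borel_on \<Omega>) (space (borel_on \<Omega>)) \<noteq> 0"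
proof -
  obtain x where "x \<in> \<Omega>" using domain by (auto simp: C2_bounded_domain_def)
  then obtain r where r: "r > 0" "ball x r \<subseteq> \<Omega>" using open_\<Omega> by (meson open_contains_ball)
  have "0 < emeasure lborel (ball x r)" using r by (simp add: emeasure_ball)
  also have "\<dots> \<le> emeasure lborel \<Omega>" using r open_\<Omega> by (intro emeasure_mono) auto
  finally show ?thesis using open_\<Omega> by (simp add: emeasure_restrict_space)
qed

text \<open>The solution for \<epsilon> = 1 lies below those for smaller \<epsilon>, and the Hopf
  bound puts it above c' d^gamma. One constant thus serves all \<epsilon>, and the majorant is (c'
  d^gamma)^-q.\<close>

lemma dominated_subcritical:
  assumes q: "q > 0" "\<gamma> - \<gamma> * q > - 1"
  shows "\<exists>D. L1w D \<and> (\<forall>\<epsilon> u. 0 < \<epsilon> \<longrightarrow> \<epsilon> \<le> 1 \<longrightarrow> u \<in> borel_measurable (borel_on \<Omega>) \<longrightarrow> (\<forall>x. u x \<ge> 0) \<longrightarrow>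
      (AE x in borel_on \<Omega>. u x = opK (\<lambda>y. (u y + \<epsilon>) powr - q) x) \<longrightarrow> (AE x in borel_on \<Omega>. (u x + \<epsilon>) powr - q \<le> D x))"
proof -
  obtain u1 where u1: "L1w u1" "\<And>x. u1 x \<ge> 0" "AE x in borel_on \<Omega>. u1 x = opK (\<lambda>y. (u1 y + 1) powr - q) x"
    using regularised_solution[OF q(1), of 1] by auto
  have [measurable]: "u1 \<in> borel_measurable (borel_on \<Omega>)" using u1(1) by (rule L1w_measurable)
  obtain c where c: "c > 0" "\<And>x. x \<in> \<Omega> \<Longrightarrow> AE y in borel_on \<Omega>. c * \<delta> x powr \<gamma> * \<delta> y powr \<gamma> \<le> K x y"
    using K_lower by blast
  have reg: "L1w (\<lambda>y. (u1 y + 1) powr - q)" using q u1 by (intro L1w_regularised) auto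
  have pos: "(u1 x + 1) powr - q > 0" for x using u1(2)[of x] by simp
  have "\<exists>c'>0. AE x in borel_on \<Omega>. c' * \<delta> x powr \<gamma> \<le> opK (\<lambda>y. (u1 y + 1) powr - q) x"
    by (rule opK_lower_bound_pos[OF reg pos c(1)]) (use c(2) emeasure_\<Omega> in auto)
  then obtain c' where c': "c' > 0" "AE x in borel_on \<Omega>. c' * \<delta> x powr \<gamma> \<le> opK (\<lambda>y. (u1 y + 1) powr - q) x" by blast
  let ?D = "\<lambda>x. c' powr - q * \<delta> x powr (- (\<gamma> * q))"
  have "L1w (\<lambda>x. \<delta> x powr (- (\<gamma> * q)))" using q by (intro L1w_bdist_powr) auto
  then have "L1w ?D" by (auto simp: L1w_def mult.left_commute)
  moreover have "AE x in borel_on \<Omega>. (u x + \<epsilon>) powr - q \<le> ?D x"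
    if \<epsilon>: "0 < \<epsilon>" "\<epsilon> \<le> 1" and u: "u \<in> borel_measurable (borel_on \<Omega>)" "\<forall>x. u x \<ge> 0"
      "AE x in borel_on \<Omega>. u x = opK (\<lambda>y. (u y + \<epsilon>) powr - q) x" for \<epsilon> u
  proof -
    have "AE x in borel_on \<Omega>. u1 x \<le> u x"
      using u u1 by (intro regularised_mono[OF q(1) \<epsilon>]) auto
    then show ?thesis using c'(2) u1(3) AE_space
    proof eventually_elim
      case (elim x)
      then have "\<delta> x > 0" using \<delta>_pos by simp
      then have "0 < c' * \<delta> x powr \<gamma>" using c'(1) by simp
      then have "(u x + \<epsilon>) powr - q \<le> (c' * \<delta> x powr \<gamma>) powr - q" using elim \<epsilon> q by (intro powr_mono2') auto
      also have "\<dots> = ?D x" using c'(1) by (simp add: powr_mult powr_powr)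
      finally show ?case .
    qed
  qed
  ultimately show ?thesis by blast
qed

text \<open>On the ball of radius d(x) / 2 the kernel is at least a multiple of (d(x) / 2)^(2s-N),
  and the volume of the ball is a multiple of (d(x) / 2)^N; the product has the order
  d(x)^(2s).\<close>

lemma opK_local_lower:
  assumes x: "x \<in> \<Omega>" and g: "L1w g" "\<And>y. y \<in> \<Omega> \<Longrightarrow> g y \<ge> 0" and m: "m \<ge> 0"
    and int: "integrable (borel_on \<Omega>) (\<lambda>y. K x y * g y)"
    and low: "\<And>y. y \<in> \<Omega> \<Longrightarrow> norm (x - y) < \<delta> x / 2 \<Longrightarrow> m \<le> g y"
  shows "inverse C0 * unit_ball_vol (real DIM('a)) * (1/2) powr (2 * s) * m * \<delta> x powr (2 * s) \<le> opK g x"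
proof -
  let ?N = "real DIM('a)" and ?\<omega> = "unit_ball_vol (real DIM('a))" and ?B = "ball x (\<delta> x / 2)"
  have d: "\<delta> x > 0" by (rule \<delta>_pos[OF x])
  have B\<Omega>: "?B \<subseteq> \<Omega>"
  proof
    fix y assume y: "y \<in> ?B"
    have "\<delta> x \<le> \<delta> y + norm (x - y)" by (rule bdist_triangle)
    then have "\<delta> y > 0" using y d by (simp add: dist_norm)
    moreover have "\<delta> y = 0" if "y \<notin> \<Omega>" unfolding bdist_def using that by (intro infdist_zero) simp
    ultimately show "y \<in> \<Omega>" by fastforce
  qed
  have B [measurable]: "?B \<in> sets (borel_on \<Omega>)" using B\<Omega> open_\<Omega> by (simp add: sets_restrict_space_iff)
  have meas: "measure (borel_on \<Omega>) ?B = ?\<omega> * (\<delta> x / 2) powr ?N"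
  proof -
    have "emeasure (borel_on \<Omega>) ?B = ennreal (?\<omega> * (\<delta> x / 2) powr ?N)"
      using B\<Omega> open_\<Omega> d by (simp add: emeasure_restrict_space emeasure_ball powr_realpow)
    then show ?thesis by (simp add: measure_def)
  qed
  let ?c = "inverse C0 * (\<delta> x / 2) powr (2 * s - ?N) * m"
  have "inverse C0 * ?\<omega> * (1/2) powr (2 * s) * m * \<delta> x powr (2 * s) = ?c * measure (borel_on \<Omega>) ?B"
  proof -
    have "(\<delta> x / 2) powr (2 * s - ?N) * (\<delta> x / 2) powr ?N = (\<delta> x * (1/2)) powr (2 * s)"
      by (simp add: powr_add[symmetric])
    also have "\<dots> = \<delta> x powr (2 * s) * (1/2) powr (2 * s)" by (rule powr_mult)
    finally show ?thesis unfolding meas by (simp add: mult_ac)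
  qed
  also have "\<dots> = (\<integral>y. ?c * indicator ?B y \<partial>borel_on \<Omega>)"
    using B by (simp add: Int_absorb2 B\<Omega>)
  also have "\<dots> \<le> opK g x"
    unfolding opK_def
  proof (rule integral_mono_AE[OF _ int])
    have "emeasure (borel_on \<Omega>) ?B < \<infinity>"
      using B\<Omega> open_\<Omega> d by (simp add: emeasure_restrict_space emeasure_ball)
    then have "integrable (borel_on \<Omega>) (indicat_real ?B)" using B by (intro integrable_real_indicator) auto
    then show "integrable (borel_on \<Omega>) (\<lambda>y. ?c * indicator ?B y)" by simp
    show "AE y in borel_on \<Omega>. ?c * indicator ?B y \<le> K x y * g y"
      using AE_borel_on_neq[OF open_\<Omega>, of x] AE_space
    proof eventually_elim
      case (elim y)
      then have y: "y \<in> \<Omega>" "x \<noteq> y" by auto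
      show ?case
      proof (cases "y \<in> ?B")
        case True
        then have le: "norm (x - y) < \<delta> x / 2" by (simp add: dist_norm)
        have "inverse C0 * (\<delta> x / 2) powr (2 * s - ?N) \<le> inverse C0 * green_profile \<Omega> s \<gamma> x y"
          using C0 le by (intro mult_left_mono green_profile_ge_local y dim) auto
        also have "\<dots> \<le> K x y" using K_bounds[OF x y] by simp
        finally show ?thesis using True low[OF y(1) le] m K_nonneg[of x y] C0 by (simp add: mult_mono)
      next
        case False
        then show ?thesis using K_nonneg g(2)[OF y(1)] by simp
      qed
    qed
  qed
  finally show ?thesis .
qed

text \<open>The hypotheses of \<open>regularised_barrier\<close> are verified for b = d^a: the upper
  estimate from the singular integral, the lower one from the part of the kernel near the diagonal,
  where b is essentially constant. The constants are independent of \<epsilon> and u, so the single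
  majorant (c b)^-q serves all of them.\<close>

lemma dominated_supercritical:
  assumes q: "q > 0" and \<beta>: "2 * s - \<gamma> < 2 * s * q / (q + 1)" "2 * s * q / (q + 1) < \<gamma> + 1"
  shows "\<exists>D. L1w D \<and> (\<forall>\<epsilon> u. 0 < \<epsilon> \<longrightarrow> \<epsilon> \<le> 1 \<longrightarrow> u \<in> borel_measurable (borel_on \<Omega>) \<longrightarrow> (\<forall>x. u x \<ge> 0) \<longrightarrow>
      (AE x in borel_on \<Omega>. u x = opK (\<lambda>y. (u y + \<epsilon>) powr - q) x) \<longrightarrow> (AE x in borel_on \<Omega>. (u x + \<epsilon>) powr - q \<le> D x))"
proof -
  define a where "a = 2 * s / (q + 1)"
  define b where "b = (\<lambda>x. \<delta> x powr a)"
  have a: "a > 0" using q s_pos by (simp add: a_def)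
  have aq: "a * q = 2 * s * q / (q + 1)" by (simp add: a_def)
  have a2: "2 * s - a * q = a" using q by (simp add: a_def field_simps)
  have [measurable]: "b \<in> borel_measurable (borel_on \<Omega>)" unfolding b_def by measurable
  have b_pos: "b x > 0" if "x \<in> \<Omega>" for x using \<delta>_pos[OF that] by (simp add: b_def)
  have b_powr: "b x powr - q = \<delta> x powr - (a * q)" for x by (simp add: b_def powr_powr)
  have "0 < a * q" using a q by simp
  then obtain C2 where C2: "C2 > 0" "\<And>x. x \<in> \<Omega> \<Longrightarrow>
      (\<integral>\<^sup>+y. ennreal (green_profile \<Omega> s \<gamma> x y * \<delta> y powr - (a * q)) * indicator (- {x}) y \<partial>borel_on \<Omega>)
     \<le> ennreal (C2 * \<delta> x powr (2 * s - a * q))"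
    using green_profile_singular_integral[OF domain s_pos dim \<gamma>_pos, of "a * q"] \<beta> by (auto simp: aq)
  have nn: "(\<integral>\<^sup>+y. ennreal (K x y * b y powr - q) \<partial>borel_on \<Omega>) \<le> ennreal (C0 * C2 * b x)" if x: "x \<in> \<Omega>" for x
  proof -
    have "(\<integral>\<^sup>+y. ennreal (K x y * b y powr - q) \<partial>borel_on \<Omega>) \<le>
      (\<integral>\<^sup>+y. ennreal C0 * (ennreal (green_profile \<Omega> s \<gamma> x y * \<delta> y powr - (a * q)) * indicator (- {x}) y) \<partial>borel_on \<Omega>)"
    proof (intro nn_integral_mono)
      fix y assume "y \<in> space (borel_on \<Omega>)"
      then have y: "y \<in> \<Omega>" by simp
      show "ennreal (K x y * b y powr - q) \<le> ennreal C0 * (ennreal (green_profile \<Omega> s \<gamma> x y * \<delta> y powr - (a * q)) * indicator (- {x}) y)"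
      proof (cases "x = y")
        case False
        then have "K x y * \<delta> y powr - (a * q) \<le> C0 * green_profile \<Omega> s \<gamma> x y * \<delta> y powr - (a * q)"
          using K_bounds[OF x y] by (intro mult_right_mono) auto
        then show ?thesis using False C0
          by (simp add: b_powr ennreal_mult'[symmetric] mult.assoc ennreal_leI)
      qed (simp add: K_diag)
    qed
    also have "\<dots> = ennreal C0 * (\<integral>\<^sup>+y. ennreal (green_profile \<Omega> s \<gamma> x y * \<delta> y powr - (a * q)) * indicator (- {x}) y \<partial>borel_on \<Omega>)"
      by (rule nn_integral_cmult[OF green_profile_offdiag_measurable[OF open_\<Omega>]])
    also have "\<dots> \<le> ennreal C0 * ennreal (C2 * \<delta> x powr (2 * s - a * q))" by (intro mult_left_mono C2 x) auto
    also have "\<dots> = ennreal (C0 * C2 * b x)" using C0 C2 by (simp add: ennreal_mult'[symmetric] a2 b_def mult.assoc)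
    finally show ?thesis .
  qed
  \<comment> \<open>For y within d(x) / 2 of x one has d(y) <= 3/2 d(x), hence b(y) <= (3/2)^a b(x);
    the 1 absorbs \<epsilon> <= b(x). Thus b(y) + \<epsilon> <= mm b(x).\<close>
  define mm where "mm = (3/2) powr a + 1"
  have mm: "mm > 0" by (simp add: mm_def add_nonneg_pos)
  define c1 where "c1 = inverse C0 * unit_ball_vol (real DIM('a)) * (1/2) powr (2 * s) * mm powr - q"
  have c1: "c1 > 0" using C0 mm by (simp add: c1_def)
  have C1: "C0 * C2 > 0" using C0 C2 by simp
  define c where "c = min 1 (min 1 (1 / (C0 * C2)) * c1)"
  have c: "c > 0" using c1 C1 by (simp add: c_def)
  let ?D = "\<lambda>x. c powr - q * \<delta> x powr (- (a * q))"
  have "L1w (\<lambda>x. \<delta> x powr (- (a * q)))" using \<beta> by (intro L1w_bdist_powr) (auto simp: aq)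
  then have "L1w ?D" by (auto simp: L1w_def mult.left_commute)
  moreover have "AE x in borel_on \<Omega>. (u x + \<epsilon>) powr - q \<le> ?D x"
    if \<epsilon>: "0 < \<epsilon>" "\<epsilon> \<le> 1" and u: "u \<in> borel_measurable (borel_on \<Omega>)" "\<forall>x. u x \<ge> 0"
      "AE x in borel_on \<Omega>. u x = opK (\<lambda>y. (u y + \<epsilon>) powr - q) x" for \<epsilon> u
  proof -
    let ?g = "\<lambda>y. (b y + \<epsilon>) powr - q"
    have g: "L1w ?g"
    proof (rule L1w_bounded)
      show "\<bar>(b x + \<epsilon>) powr - q\<bar> \<le> \<epsilon> powr - q" for x
        using powr_mono2'[of "-q" \<epsilon> "b x + \<epsilon>"] q \<epsilon> by (simp add: b_def)
    qed measurable
    have up: "AE x in borel_on \<Omega>. opK ?g x \<le> C0 * C2 * b x"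
      using AE_space
    proof eventually_elim
      case (elim x)
      then have x: "x \<in> \<Omega>" by simp
      have "ennreal (opK ?g x) \<le> ennreal \<bar>opK ?g x\<bar>" by (intro ennreal_leI) simp
      also have "\<dots> \<le> (\<integral>\<^sup>+y. ennreal (norm (K x y * ?g y)) \<partial>borel_on \<Omega>)"
        unfolding opK_def by (rule ennreal_abs_integral_le)
      also have "\<dots> \<le> (\<integral>\<^sup>+y. ennreal (K x y * b y powr - q) \<partial>borel_on \<Omega>)"
      proof (intro nn_integral_mono ennreal_leI)
        fix y assume "y \<in> space (borel_on \<Omega>)"
        then have "?g y \<le> b y powr - q" using b_pos[of y] q \<epsilon> by (intro powr_mono2') auto
        then show "norm (K x y * ?g y) \<le> K x y * b y powr - q"
          using K_nonneg[of x y] by (simp add: abs_mult mult_left_mono)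
      qed
      also note nn[OF x]
      finally show ?case using C1 b_pos[OF x] by (subst (asm) ennreal_le_iff) auto
    qed
    have low: "AE x in borel_on \<Omega>. \<epsilon> \<le> b x \<longrightarrow> c1 * b x \<le> opK ?g x"
      using L1w_AE_integrable[OF g] AE_space
    proof eventually_elim
      case (elim x)
      then have x: "x \<in> \<Omega>" by simp
      show ?case
      proof
        assume le: "\<epsilon> \<le> b x"
        have "(mm * b x) powr - q \<le> ?g y" if y: "y \<in> \<Omega>" "norm (x - y) < \<delta> x / 2" for y
        proof (rule powr_mono2')
          have "\<delta> y \<le> \<delta> x + norm (x - y)" using bdist_triangle[of \<Omega> y x] by (simp add: norm_minus_commute)
          then have "\<delta> y \<le> 3/2 * \<delta> x" using y by linarith
          then have "b y \<le> (3/2 * \<delta> x) powr a" unfolding b_def using a bdist_nonneg by (intro powr_mono2) auto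
          also have "\<dots> = (3/2) powr a * b x" unfolding b_def by (subst powr_mult) (use \<delta>_pos[OF x] in auto)
          finally show "b y + \<epsilon> \<le> mm * b x" using le by (simp add: mm_def distrib_right)
          show "0 < b y + \<epsilon>" using b_pos[OF y(1)] \<epsilon> by simp
        qed (use q in simp)
        then have "inverse C0 * unit_ball_vol (real DIM('a)) * (1/2) powr (2 * s) * (mm * b x) powr - q * \<delta> x powr (2 * s) \<le> opK ?g x"
          by (intro opK_local_lower[OF x g _ _ elim(1)]) auto
        moreover have "(mm * b x) powr - q * \<delta> x powr (2 * s) = mm powr - q * b x"
        proof -
          have "(mm * b x) powr - q * \<delta> x powr (2 * s) = mm powr - q * (\<delta> x powr - (a * q) * \<delta> x powr (2 * s))"
            using mm b_pos[OF x] by (simp add: powr_mult b_powr)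
          also have "\<delta> x powr - (a * q) * \<delta> x powr (2 * s) = b x"
            unfolding b_def by (simp add: powr_add[symmetric] a2)
          finally show ?thesis .
        qed
        ultimately show "c1 * b x \<le> opK ?g x" by (simp add: c1_def mult.assoc)
      qed
    qed
    have bm: "b \<in> borel_measurable (borel_on \<Omega>)" by measurable
    have "AE x in borel_on \<Omega>. c * b x \<le> u x + \<epsilon>"
      unfolding c_def
      by (rule regularised_barrier[OF q \<epsilon>(1) bm _ C1 c1 up low u(1) _ u(3)]) (use b_pos u(2) in auto)
    then show ?thesis using AE_space
    proof eventually_elim
      case (elim x)
      then have bx: "b x > 0" using b_pos by simp
      have "(u x + \<epsilon>) powr - q \<le> (c * b x) powr - q" using elim c bx q by (intro powr_mono2') auto
      also have "\<dots> = ?D x" using c bx by (simp add: powr_mult b_powr)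
      finally show ?case .
    qed
  qed
  ultimately show ?thesis by blast
qed

lemma singular_solution_exists:
  assumes ex: "admissible_exponents s q \<gamma>"
  shows "\<exists>v. (\<forall>x. v x > 0) \<and> L1w v \<and> L1w (\<lambda>x. v x powr - q) \<and> (AE x in borel_on \<Omega>. v x = opK (\<lambda>y. v y powr - q) x)"
proof -
  have q: "q > 0" using ex by (simp add: admissible_exponents_def)
  have "\<exists>D. L1w D \<and> (\<forall>\<epsilon> u. 0 < \<epsilon> \<longrightarrow> \<epsilon> \<le> 1 \<longrightarrow> u \<in> borel_measurable (borel_on \<Omega>) \<longrightarrow> (\<forall>x. u x \<ge> 0) \<longrightarrow>
      (AE x in borel_on \<Omega>. u x = opK (\<lambda>y. (u y + \<epsilon>) powr - q) x) \<longrightarrow> (AE x in borel_on \<Omega>. (u x + \<epsilon>) powr - q \<le> D x))"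
  proof (cases "q \<le> q_star s \<gamma>")
    case True
    show ?thesis by (rule dominated_subcritical[OF q admissible_subcritical[OF ex True \<gamma>_pos]])
  next
    case False
    then have "q > q_star s \<gamma>" by simp
    then show ?thesis using admissible_supercritical[OF ex _ \<gamma>_pos] by (intro dominated_supercritical[OF q])
  qed
  then obtain D where D: "L1w D" and dom: "\<And>\<epsilon> u. 0 < \<epsilon> \<Longrightarrow> \<epsilon> \<le> 1 \<Longrightarrow> u \<in> borel_measurable (borel_on \<Omega>) \<Longrightarrow> (\<And>x. u x \<ge> 0) \<Longrightarrow>
      AE x in borel_on \<Omega>. u x = opK (\<lambda>y. (u y + \<epsilon>) powr - q) x \<Longrightarrow> AE x in borel_on \<Omega>. (u x + \<epsilon>) powr - q \<le> D x"
    by blast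
  obtain c where c: "c > 0" "\<And>x. x \<in> \<Omega> \<Longrightarrow> AE y in borel_on \<Omega>. c * \<delta> x powr \<gamma> * \<delta> y powr \<gamma> \<le> K x y"
    using K_lower by blast
  show ?thesis
    by (rule singular_solution[OF q D dom c(1) _ emeasure_\<Omega>]) (use c(2) in auto)
qed

section \<open>Weak-dual solutions as solutions of the kernel equation\<close>

lemma L1_weighted_iff: "f \<in> L1_weighted \<Omega> \<gamma> \<longleftrightarrow> L1w f"
proof -
  have "integrable (borel_on \<Omega>) (\<lambda>x. \<bar>f x\<bar> * \<delta> x powr \<gamma>) \<longleftrightarrow> integrable (borel_on \<Omega>) (\<lambda>x. \<delta> x powr \<gamma> * f x)"
    if [measurable]: "f \<in> borel_measurable (borel_on \<Omega>)"
  proof -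
    have "(\<lambda>x. \<bar>f x\<bar> * \<delta> x powr \<gamma>) = (\<lambda>x. \<bar>\<delta> x powr \<gamma> * f x\<bar>)" by (simp add: abs_mult mult.commute)
    then show ?thesis using integrable_abs_cancel[of "borel_on \<Omega>" "\<lambda>x. \<delta> x powr \<gamma> * f x"] by auto
  qed
  then show ?thesis by (auto simp: L1_weighted_def L1w_def)
qed

text \<open>One direction tests with the weight times a sign, which lies in
  \<open>weighted_L_infinity\<close>; the other is Fubini. In the latter, \<xi> is replaced by a
  truncation that satisfies the bound at every point and equals \<xi> almost everywhere.\<close>

lemma weak_dual_solution_iff:
  assumes G: "\<And>f x. f \<in> borel_measurable (borel_on \<Omega>) \<Longrightarrow> x \<in> \<Omega> \<Longrightarrow> green_op \<Omega> G f x = opK f x"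
  shows "weak_dual_solution \<Omega> \<gamma> G q u \<longleftrightarrow> (\<forall>x. x \<notin> \<Omega> \<longrightarrow> u x = 0) \<and> (\<forall>x\<in>\<Omega>. u x > 0) \<and> L1w u \<and>
     L1w (\<lambda>x. u x powr - q) \<and> (AE x in borel_on \<Omega>. u x = opK (\<lambda>y. u y powr - q) x)" (is "?L \<longleftrightarrow> ?R")
proof -
  let ?w = "\<lambda>x. \<delta> x powr \<gamma>" and ?f = "\<lambda>x. u x powr - q"
  have inv: "1 / u x powr q = ?f x" for x by (simp add: powr_minus_divide)
  have dual: "(\<forall>\<xi>\<in>weighted_L_infinity \<Omega> \<gamma>. (\<integral>x. u x * \<xi> x \<partial>borel_on \<Omega>) = (\<integral>x. ?f x * green_op \<Omega> G \<xi> x \<partial>borel_on \<Omega>))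
     \<longleftrightarrow> (AE x in borel_on \<Omega>. u x = opK ?f x)" if u: "L1w u" and f: "L1w ?f"
  proof
    assume dual: "\<forall>\<xi>\<in>weighted_L_infinity \<Omega> \<gamma>. (\<integral>x. u x * \<xi> x \<partial>borel_on \<Omega>) = (\<integral>x. ?f x * green_op \<Omega> G \<xi> x \<partial>borel_on \<Omega>)"
    show "AE x in borel_on \<Omega>. u x = opK ?f x"
    proof (rule AE_eq_opK_if_dual[OF u f])
      fix \<xi> assume [measurable]: "\<xi> \<in> borel_measurable (borel_on \<Omega>)" and le: "\<And>x. x \<in> space (borel_on \<Omega>) \<Longrightarrow> \<bar>\<xi> x\<bar> \<le> ?w x"
      have "\<bar>\<xi> x / ?w x\<bar> \<le> 1" if "x \<in> \<Omega>" for x using le[of x] that \<delta>_pos[OF that] by simp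
      then have "AE x in borel_on \<Omega>. \<bar>\<xi> x / ?w x\<bar> \<le> 1" by (intro AE_I2) auto
      then have "(\<lambda>x. \<xi> x / ?w x) \<in> L_infinity (borel_on \<Omega>)" by (auto simp: L_infinity_def intro!: exI[of _ 1])
      moreover have "\<forall>x\<in>\<Omega>. \<xi> x = ?w x * (\<xi> x / ?w x)" using \<delta>_pos by (auto simp: less_imp_neq[symmetric])
      ultimately have "\<xi> \<in> weighted_L_infinity \<Omega> \<gamma>"
        unfolding weighted_L_infinity_def mem_Collect_eq by - (rule bexI[where x="\<lambda>x. \<xi> x / ?w x"])
      then have "(\<integral>x. u x * \<xi> x \<partial>borel_on \<Omega>) = (\<integral>x. ?f x * green_op \<Omega> G \<xi> x \<partial>borel_on \<Omega>)" using dual by blast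
      also have "\<dots> = (\<integral>x. ?f x * opK \<xi> x \<partial>borel_on \<Omega>)"
        by (intro Bochner_Integration.integral_cong) (simp_all add: G)
      finally show "(\<integral>x. u x * \<xi> x \<partial>borel_on \<Omega>) = (\<integral>x. ?f x * opK \<xi> x \<partial>borel_on \<Omega>)" .
    qed
  next
    assume eq: "AE x in borel_on \<Omega>. u x = opK ?f x"
    show "\<forall>\<xi>\<in>weighted_L_infinity \<Omega> \<gamma>. (\<integral>x. u x * \<xi> x \<partial>borel_on \<Omega>) = (\<integral>x. ?f x * green_op \<Omega> G \<xi> x \<partial>borel_on \<Omega>)"
    proof
      fix \<xi> assume "\<xi> \<in> weighted_L_infinity \<Omega> \<gamma>"
      then obtain v B where v [measurable]: "v \<in> borel_measurable (borel_on \<Omega>)" and B: "AE x in borel_on \<Omega>. \<bar>v x\<bar> \<le> B"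
        and \<xi>: "\<And>x. x \<in> \<Omega> \<Longrightarrow> \<xi> x = ?w x * v x"
        by (auto simp: weighted_L_infinity_def L_infinity_def)
      have \<xi>m [measurable]: "\<xi> \<in> borel_measurable (borel_on \<Omega>)"
        by (rule measurable_cong[THEN iffD2, of _ _ "\<lambda>x. ?w x * v x"]) (use \<xi> in auto)
      \<comment> \<open>\<open>\<xi>\<close> is bounded by a multiple of the weight only almost everywhere\<close>
      define \<zeta> where "\<zeta> = (\<lambda>x. ?w x * max (- \<bar>B\<bar>) (min \<bar>B\<bar> (v x)))"
      have \<zeta>m [measurable]: "\<zeta> \<in> borel_measurable (borel_on \<Omega>)" unfolding \<zeta>_def by measurable
      have \<zeta>: "\<bar>\<zeta> x\<bar> \<le> \<bar>B\<bar> * ?w x" for x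
      proof -
        have "\<bar>max (- \<bar>B\<bar>) (min \<bar>B\<bar> (v x))\<bar> \<le> \<bar>B\<bar>" by auto
        from mult_left_mono[OF this, of "?w x"] show ?thesis by (simp add: \<zeta>_def abs_mult mult.commute)
      qed
      have ae: "AE x in borel_on \<Omega>. \<xi> x = \<zeta> x"
        using B AE_space by eventually_elim (auto simp: \<xi> \<zeta>_def)
      have [measurable]: "u \<in> borel_measurable (borel_on \<Omega>)" "?f \<in> borel_measurable (borel_on \<Omega>)"
        using u f by (auto intro: L1w_measurable)
      have "(\<integral>x. u x * \<xi> x \<partial>borel_on \<Omega>) = (\<integral>x. opK ?f x * \<zeta> x \<partial>borel_on \<Omega>)"
        using ae eq by (intro integral_cong_AE) auto
      also have "\<dots> = (\<integral>x. ?f x * opK \<zeta> x \<partial>borel_on \<Omega>)"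
        by (rule opK_dual[OF f \<zeta>m, of "\<bar>B\<bar>"]) (rule \<zeta>)
      also have "\<dots> = (\<integral>x. ?f x * green_op \<Omega> G \<xi> x \<partial>borel_on \<Omega>)"
        using opK_cong_AE[OF \<xi>m \<zeta>m ae] by (intro Bochner_Integration.integral_cong) (simp_all add: G[OF \<xi>m])
      finally show "(\<integral>x. u x * \<xi> x \<partial>borel_on \<Omega>) = (\<integral>x. ?f x * green_op \<Omega> G \<xi> x \<partial>borel_on \<Omega>)" .
    qed
  qed
  show ?thesis
    unfolding weak_dual_solution_def L1_weighted_0_def mem_Collect_eq inv L1_weighted_iff using dual by blast
qed

lemma weak_dual_solution_unique_exists:
  assumes G: "\<And>f x. f \<in> borel_measurable (borel_on \<Omega>) \<Longrightarrow> x \<in> \<Omega> \<Longrightarrow> green_op \<Omega> G f x = opK f x"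
    and ex: "admissible_exponents s q \<gamma>"
  shows "\<exists>u. weak_dual_solution \<Omega> \<gamma> G q u \<and> (\<forall>v. weak_dual_solution \<Omega> \<gamma> G q v \<longrightarrow> (AE x in borel_on \<Omega>. v x = u x))"
proof -
  have q: "q > 0" using ex by (simp add: admissible_exponents_def)
  obtain v where v: "\<And>x. v x > 0" "L1w v" "L1w (\<lambda>x. v x powr - q)" "AE x in borel_on \<Omega>. v x = opK (\<lambda>y. v y powr - q) x"
    using singular_solution_exists[OF ex] by blast
  \<comment> \<open>The solution of the kernel equation is positive on the whole space, whereas a
    weak-dual solution has to vanish outside the domain.\<close>
  define u where "u = (\<lambda>x. if x \<in> \<Omega> then v x else 0)"
  have iff: "weak_dual_solution \<Omega> \<gamma> G q u \<longleftrightarrow> (\<forall>x. x \<notin> \<Omega> \<longrightarrow> u x = 0) \<and> (\<forall>x\<in>\<Omega>. u x > 0) \<and> L1w u \<and>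
     L1w (\<lambda>x. u x powr - q) \<and> (AE x in borel_on \<Omega>. u x = opK (\<lambda>y. u y powr - q) x)" for u
    by (rule weak_dual_solution_iff) (rule G)
  have uv: "u x = v x" if "x \<in> space (borel_on \<Omega>)" for x using that by (simp add: u_def)
  have L1w_cong: "L1w f" if g: "L1w g" and fg: "\<And>x. x \<in> space (borel_on \<Omega>) \<Longrightarrow> f x = g x" for f g
    using g measurable_cong[of "borel_on \<Omega>" f g borel, OF fg]
      Bochner_Integration.integrable_cong[of "borel_on \<Omega>" "borel_on \<Omega>" "\<lambda>x. \<delta> x powr \<gamma> * f x" "\<lambda>x. \<delta> x powr \<gamma> * g x"] fg
    by (simp add: L1w_def)
  have opu: "opK (\<lambda>y. u y powr - q) x = opK (\<lambda>y. v y powr - q) x" for x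
    unfolding opK_def by (intro Bochner_Integration.integral_cong) (simp_all add: u_def)
  have "weak_dual_solution \<Omega> \<gamma> G q u"
    unfolding iff
  proof (intro conjI)
    show "L1w u" by (rule L1w_cong[OF v(2) uv])
    show "L1w (\<lambda>x. u x powr - q)" by (rule L1w_cong[OF v(3)]) (simp add: u_def)
    show "AE x in borel_on \<Omega>. u x = opK (\<lambda>y. u y powr - q) x"
      using v(4) AE_space by eventually_elim (simp add: opu uv)
  qed (use v(1) in \<open>auto simp: u_def\<close>)
  moreover have "AE x in borel_on \<Omega>. v' x = u x" if "weak_dual_solution \<Omega> \<gamma> G q v'" for v'
  proof (rule singular_unique[OF q])
    note v' = that[unfolded iff] and u' = calculation[unfolded iff]
    show "L1w (\<lambda>x. v' x powr - q)" "AE x in borel_on \<Omega>. v' x = opK (\<lambda>y. v' y powr - q) x"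
      using v' by blast+
    show "L1w (\<lambda>x. u x powr - q)" "AE x in borel_on \<Omega>. u x = opK (\<lambda>y. u y powr - q) x"
      using u' by blast+
    show "0 < v' x" if "x \<in> space (borel_on \<Omega>)" for x using v' that by simp
    show "0 < u x" if "x \<in> space (borel_on \<Omega>)" for x using u' that by simp
  qed
  ultimately show ?thesis by blast
qed

end

section \<open>The kernel hypotheses from the assumptions on the operator and its inverse\<close>

theorem theorem3p3:
  fixes \<Omega> :: "'a::euclidean_space set"
    and s \<gamma> q \<Lambda>\<^sub>0 :: real
    and L :: "('a \<Rightarrow> real) \<Rightarrow> ('a \<Rightarrow> real)"
    and A T :: "(('a \<Rightarrow> real) \<times> ('a \<Rightarrow> real)) set"
    and G :: "'a \<Rightarrow> 'a \<Rightarrow> real"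
  assumes dim: "DIM('a) \<ge> 2" "real DIM('a) > 2 * s"
    and domain: "C2_bounded_domain \<Omega>"
    and s: "0 < s" "s \<le> 1"
    and \<gamma>: "0 < \<gamma>" "\<gamma> \<le> 1"
    and L1: "positive_symmetric (borel_on \<Omega>) (test_functions \<Omega>) L"
    and friedrichs: "A = friedrichs_extension (borel_on \<Omega>) (test_functions \<Omega>) L"
    and sqrt_A: "is_sqrt_op (borel_on \<Omega>) T A"
    and L2: "\<Lambda>\<^sub>0 > 0"
      "\<And>u. u \<in> test_functions \<Omega> \<Longrightarrow>
         (l2_norm (borel_on \<Omega>) u)\<^sup>2 \<le> \<Lambda>\<^sub>0 * l2_inner (borel_on \<Omega>) (L u) u"
    and L3: "Domain T = H00 \<Omega> s"
    and L4: "\<And>u v p p'.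
         u \<in> Domain T \<inter> L_infinity (borel_on \<Omega>) \<Longrightarrow>
         v \<in> Domain T \<inter> L_infinity (borel_on \<Omega>) \<Longrightarrow>
         (AE x in borel_on \<Omega>. v x \<ge> 0) \<Longrightarrow>
         convex_on UNIV p \<Longrightarrow>
         (\<And>t. (p has_real_derivative p' t) (at t)) \<Longrightarrow>
         (\<exists>K. K-lipschitz_on UNIV p') \<Longrightarrow>
         p 0 = 0 \<Longrightarrow> p' 0 = 0 \<Longrightarrow>
         energy_inner (borel_on \<Omega>) T (\<lambda>x. p (u x)) v
           \<le> energy_inner (borel_on \<Omega>) T u (\<lambda>x. p' (u x) * v x)"
    and G1: "\<And>f. f \<in> test_functions \<Omega> \<Longrightarrow> (green_op \<Omega> G f, f) \<in> A"
    and G2_measurable: "(\<lambda>(x, y). G x y) \<in>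
         borel_measurable (restrict_space borel {(x, y). x \<in> \<Omega> \<and> y \<in> \<Omega> \<and> x \<noteq> y})"
    and G2_positive: "\<And>x y. x \<in> \<Omega> \<Longrightarrow> y \<in> \<Omega> \<Longrightarrow> x \<noteq> y \<Longrightarrow> G x y > 0"
    and G2_symmetric: "\<And>x y. x \<in> \<Omega> \<Longrightarrow> y \<in> \<Omega> \<Longrightarrow> x \<noteq> y \<Longrightarrow> G x y = G y x"
    and G2_bounds: "\<exists>C>0. \<forall>x\<in>\<Omega>. \<forall>y\<in>\<Omega>. x \<noteq> y \<longrightarrow>
         inverse C * green_profile \<Omega> s \<gamma> x y \<le> G x y \<and> G x y \<le> C * green_profile \<Omega> s \<gamma> x y"
    and G3: "\<And>x xs. x \<in> \<Omega> \<Longrightarrow> (\<And>n. xs n \<in> \<Omega>) \<Longrightarrow> xs \<longlonglongrightarrow> x \<Longrightarrow>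
         (AE y in borel_on \<Omega>. y \<noteq> x \<longrightarrow> (\<lambda>n. G (xs n) y) \<longlonglongrightarrow> G x y)"
    and exponents: "admissible_exponents s q \<gamma>"
  shows "\<exists>u. weak_dual_solution \<Omega> \<gamma> G q u \<and>
           (\<forall>v. weak_dual_solution \<Omega> \<gamma> G q v \<longrightarrow> (AE x in borel_on \<Omega>. v x = u x))"
proof -
  let ?M = "borel_on \<Omega>" and ?w = "\<lambda>x. bdist \<Omega> x powr \<gamma>" and ?K = "offdiag_kernel \<Omega> G"
  have op: "open \<Omega>" and bd: "bounded \<Omega>" using domain by (auto simp: C2_bounded_domain_def)
  interpret M: finite_measure ?M by (rule finite_measure_borel_on[OF op bd])
  obtain C0 where C0: "C0 > 0" "\<And>x y. x \<in> \<Omega> \<Longrightarrow> y \<in> \<Omega> \<Longrightarrow> x \<noteq> y \<Longrightarrow>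
      inverse C0 * green_profile \<Omega> s \<gamma> x y \<le> G x y \<and> G x y \<le> C0 * green_profile \<Omega> s \<gamma> x y"
    using G2_bounds by blast
  obtain C1 where C1: "C1 > 0" "\<And>x. x \<in> \<Omega> \<Longrightarrow>
      (\<integral>\<^sup>+y. ennreal (green_profile \<Omega> s \<gamma> x y * ?w y) * indicator (- {x}) y \<partial>?M) \<le> ennreal (C1 * ?w x)"
    using green_profile_bdist_integral[OF domain s(1) dim(2) \<gamma>(1)] by blast
  have K_meas: "(\<lambda>(x, y). ?K x y) \<in> borel_measurable (?M \<Otimes>\<^sub>M ?M)"
    by (rule offdiag_kernel_measurable[OF op G2_measurable])
  interpret W: weighted_kernel ?M ?K ?w "C0 * C1"
  proof unfold_locales
    show "(\<lambda>(x, y). ?K x y) \<in> borel_measurable (?M \<Otimes>\<^sub>M ?M)" by (rule K_meas)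
    show "0 \<le> ?K x y" for x y using G2_positive by (simp add: offdiag_kernel_def less_imp_le)
    show "?K x y = ?K y x" for x y using G2_symmetric by (auto simp: offdiag_kernel_def)
    show "?w \<in> borel_measurable ?M" by measurable
    show "0 < ?w x" if "x \<in> space ?M" for x using bdist_pos[OF op bd, of x] that by simp
    show "integrable ?M ?w" using \<gamma> by (intro bdist_powr_integrable[OF domain]) auto
    show "C0 * C1 > 0" using C0 C1 by simp
    fix x assume "x \<in> space ?M"
    then have x: "x \<in> \<Omega>" by simp
    have "(\<integral>\<^sup>+y. ennreal (?K x y * ?w y) \<partial>?M)
       \<le> (\<integral>\<^sup>+y. ennreal C0 * (ennreal (green_profile \<Omega> s \<gamma> x y * ?w y) * indicator (- {x}) y) \<partial>?M)"
    proof (intro nn_integral_mono)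
      fix y assume "y \<in> space ?M"
      then have y: "y \<in> \<Omega>" by simp
      show "ennreal (?K x y * ?w y) \<le> ennreal C0 * (ennreal (green_profile \<Omega> s \<gamma> x y * ?w y) * indicator (- {x}) y)"
      proof (cases "x = y")
        case False
        then have "G x y * ?w y \<le> C0 * green_profile \<Omega> s \<gamma> x y * ?w y"
          using C0(2)[OF x y] by (intro mult_right_mono) auto
        then show ?thesis using False C0 x y
          by (simp add: offdiag_kernel_def ennreal_mult'[symmetric] mult.assoc ennreal_leI)
      qed (simp add: offdiag_kernel_def)
    qed
    also have "\<dots> = ennreal C0 * (\<integral>\<^sup>+y. ennreal (green_profile \<Omega> s \<gamma> x y * ?w y) * indicator (- {x}) y \<partial>?M)"
      by (rule nn_integral_cmult[OF green_profile_offdiag_measurable[OF op]])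
    also have "\<dots> \<le> ennreal C0 * ennreal (C1 * ?w x)" by (intro mult_left_mono C1 x) auto
    also have "\<dots> = ennreal (C0 * C1 * ?w x)" using C0 C1 by (simp add: ennreal_mult'[symmetric] mult.assoc)
    finally show "(\<integral>\<^sup>+y. ennreal (?K x y * ?w y) \<partial>?M) \<le> ennreal (C0 * C1 * ?w x)" .
  qed
  have G_eq: "green_op \<Omega> G f x = W.opK f x" if "f \<in> borel_measurable ?M" "x \<in> \<Omega>" for f x
    unfolding W.opK_def by (rule green_op_eq_offdiag[OF op that(2) K_meas that(1)])
  have T: "self_adjoint ?M T" and TA: "T O T = A" using sqrt_A by (auto simp: is_sqrt_op_def)
  have test_cont: "continuous_on \<Omega> ?w"
    using bdist_pos[OF op bd] by (intro continuous_on_powr' continuous_on_bdist continuous_on_const) (auto simp: less_imp_le bdist_nonneg \<gamma>)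
  have GT: "green_op \<Omega> G f \<in> Domain T" "(green_op \<Omega> G f, f) \<in> T O T" if "f \<in> test_functions \<Omega>" for f
    using G1[OF that] TA by blast+
  \<comment> \<open>(L4) is restricted to bounded functions, and \<open>H00_tanh_mult\<close> needs
    a bound on \<open>v\<close>. A test function is below a multiple of the weight, hence so is its
    image, and the weight is bounded on a bounded domain.\<close>
  have G_bd: "\<exists>V. \<forall>x\<in>\<Omega>. \<bar>green_op \<Omega> G f x\<bar> \<le> V" if f: "f \<in> test_functions \<Omega>" for f
  proof -
    obtain B where B: "B > 0" "\<forall>x\<in>\<Omega>. \<bar>f x\<bar> \<le> B * ?w x"
      using test_functions_le_weight[OF f test_cont] W.w_pos by auto
    obtain x0 D where D: "\<And>x. x \<in> \<Omega> \<Longrightarrow> norm (x - x0) \<le> D"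
      using bd by (metis bounded_iff diff_zero)
    have "\<bar>green_op \<Omega> G f x\<bar> \<le> B * (C0 * C1) * (bdist \<Omega> x0 + D) powr \<gamma>" if x: "x \<in> \<Omega>" for x
    proof -
      have "\<bar>W.opK f x\<bar> \<le> B * (C0 * C1) * ?w x"
        using B x by (intro W.opK_weight_bound test_functions_measurable_on[OF f]) auto
      also have "\<dots> \<le> B * (C0 * C1) * (bdist \<Omega> x0 + D) powr \<gamma>"
        using B C0 C1 D[OF x] bdist_triangle[of \<Omega> x x0] \<gamma>
        by (intro mult_left_mono powr_mono2) (auto simp: bdist_nonneg)
      finally show ?thesis using G_eq[OF test_functions_measurable_on[OF f] x] by simp
    qed
    then show ?thesis by blast
  qed
  interpret green_kernel \<Omega> ?K \<gamma> "C0 * C1" s C0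
  proof unfold_locales
    show "continuous_on \<Omega> ?w" by (rule test_cont)
    fix f \<xi> :: "'a \<Rightarrow> real" and k :: real
    assume f: "f \<in> test_functions \<Omega>" and \<xi>: "\<xi> \<in> test_functions \<Omega>" "\<And>x. 0 \<le> \<xi> x" and k: "k > 0"
    let ?u = "green_op \<Omega> G f" and ?v = "green_op \<Omega> G \<xi>"
    have H: "?u \<in> H00 \<Omega> s" "?v \<in> H00 \<Omega> s" using GT(1)[OF f] GT(1)[OF \<xi>(1)] L3 by auto
    have m [measurable]: "?u \<in> borel_measurable ?M" "?v \<in> borel_measurable ?M"
      using H H00_measurable[OF op] by auto
    obtain V where V: "\<And>x. x \<in> \<Omega> \<Longrightarrow> \<bar>?v x\<bar> \<le> V" using G_bd[OF \<xi>(1)] by blast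
    obtain U where U: "\<And>x. x \<in> \<Omega> \<Longrightarrow> \<bar>?u x\<bar> \<le> U" using G_bd[OF f] by blast
    have Linf: "g \<in> L_infinity ?M" if "g \<in> borel_measurable ?M" "\<And>x. x \<in> \<Omega> \<Longrightarrow> \<bar>g x\<bar> \<le> B" for g B
      using that by (auto simp: L_infinity_def intro!: AE_I2 exI[of _ B])
    have eq: "?u x = W.opK f x" "?v x = W.opK \<xi> x" if "x \<in> \<Omega>" for x
      using G_eq[OF test_functions_measurable_on[OF f] that] G_eq[OF test_functions_measurable_on[OF \<xi>(1)] that] by auto
    let ?p = "\<lambda>t. ln (cosh (k * t)) / k" and ?p' = "\<lambda>t. tanh (k * t)"
    have pD: "(\<lambda>x. ?p (?u x)) \<in> Domain T" unfolding L3 by (rule H00_ln_cosh[OF op bd H(1) k])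
    have pvD: "(\<lambda>x. ?p' (?u x) * ?v x) \<in> Domain T" unfolding L3 by (rule H00_tanh_mult[OF op bd H V k])
    have deriv: "(?p has_real_derivative ?p' t) (at t)" for t using DERIV_ln_cosh_scaled[of k] k by simp
    \<comment> \<open>(L4) for u = G[f] and v = G[xi], where v >= 0 because the kernel and xi are
      nonnegative. Monotonicity of tanh makes p convex, and p' is Lipschitz with constant k.\<close>
    have "energy_inner ?M T (\<lambda>x. ?p (?u x)) ?v \<le> energy_inner ?M T ?u (\<lambda>x. ?p' (?u x) * ?v x)"
    proof (rule L4)
      show "AE x in ?M. 0 \<le> ?v x"
        using AE_space by eventually_elim (use \<xi>(2) in \<open>simp add: eq W.opK_nonneg\<close>)
      show "convex_on UNIV ?p"
      proof (rule convex_on_realI[where f'="?p'"])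
        show "?p' x \<le> ?p' y" if "x \<le> y" for x y using that k by simp
      qed (use deriv in auto)
      have "k-lipschitz_on UNIV ?p'"
      proof (rule lipschitz_onI)
        show "dist (?p' x) (?p' y) \<le> k * dist x y" for x y
          using tanh_lipschitz[of "k * x" "k * y"] k by (simp add: dist_real_def right_diff_distrib[symmetric] abs_mult)
      qed (use k in simp)
      then show "\<exists>K. K-lipschitz_on UNIV ?p'" by blast
    qed (use GT(1)[OF f] GT(1)[OF \<xi>(1)] Linf[OF m(1) U] Linf[OF m(2) V] deriv in auto)
    also have "energy_inner ?M T (\<lambda>x. ?p (?u x)) ?v = (\<integral>x. ?p (?u x) * \<xi> x \<partial>?M)"
      by (rule energy_inner_eq[OF T pD GT(2)[OF \<xi>(1)]])
    also have "\<dots> = (\<integral>x. ?p (W.opK f x) * \<xi> x \<partial>?M)"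
      by (intro Bochner_Integration.integral_cong) (simp_all add: eq)
    \<comment> \<open>The arguments are exchanged because here it is the first one, G[f], whose
      image under the operator is known to be f; of p'(u) v only membership in the form domain is
      available.\<close>
    also have "energy_inner ?M T ?u (\<lambda>x. ?p' (?u x) * ?v x) = (\<integral>x. ?p' (?u x) * ?v x * f x \<partial>?M)"
      by (subst energy_inner_commute) (rule energy_inner_eq[OF T pvD GT(2)[OF f]])
    also have "\<dots> = (\<integral>x. f x * ?p' (W.opK f x) * W.opK \<xi> x \<partial>?M)"
      by (intro Bochner_Integration.integral_cong) (simp_all add: eq)
    finally show "(\<integral>x. ?p (W.opK f x) * \<xi> x \<partial>?M) \<le> (\<integral>x. f x * ?p' (W.opK f x) * W.opK \<xi> x \<partial>?M)" .
  next
    fix x y assume "x \<in> \<Omega>" "y \<in> \<Omega>" "x \<noteq> y"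
    then show "inverse C0 * green_profile \<Omega> s \<gamma> x y \<le> ?K x y \<and> ?K x y \<le> C0 * green_profile \<Omega> s \<gamma> x y"
      using C0(2)[of x y] by (simp add: offdiag_kernel_def)
  qed (use op bd domain s dim \<gamma> C0 in \<open>auto simp: offdiag_kernel_def\<close>)
  show ?thesis by (rule weak_dual_solution_unique_exists[OF _ exponents]) (rule G_eq)
qed

end
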